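(* Let $p\ge4$ and $b\ge 0$. Assume that $u(t,x)$ is a solution of $$i\partial_tu+\partial_x^2u+i|u|^2\partial_xu+b|u|^pu=0,\qquad (t,x)\in\mathbb{R}\times\mathbb{R},$$ satisfying (A.1) $u\in C(\mathbb{R};H^{1,0})$, (A.2) $\|u(t)\|_{1,0}\le C(\|u(0)\|_{1,0})$ and $\|u(t)\|_{4}=O(|t|^{-\frac14})$ as $t\to\infty$. Moreover, assume that there exists $\phi_+\in H^{4,0}\cap H^{0,4}$ such that (A.3) $\|(\mathcal{G}u)(t)-U(t)\phi_+\|_{2}\to0$ as $t\to\infty$. Then $u(t,x)$ is identically zero.
   Context: Notation: $\|\cdot\|_q$ is the $L^q(\mathbb{R})$ norm. $C(\|u(0)\|_{1,0})$ denotes a constant depending only on $\|u(0)\|_{1,0}$ (not on $t$). For $m,s\in\mathbb{R}$, $$H^{m,s}=\left\{f\in\mathcal{S}'(\mathbb{R}):\ \|f\|_{m,s}=\left\|(1+|x|^2)^{s/2}(1-\partial_x^2)^{m/2}f\right\|_{L^2}<\infty\right\}.$$ Further, $$(U(t)f)(x)=\frac{1}{\sqrt{4\pi it}}\int_{\mathbb{R}}e^{i\frac{(x-y)^2}{4t}}f(y)\,dy,\qquad (\mathcal{G}u)(t,x)=\exp\left(-\frac{i}{2}\int_{-\infty}^x|u(t,y)|^2\,dy\right)u(t,x).$$ *)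

theory Defs
  imports "HOL-Analysis.Analysis" "HOL-Library.Landau_Symbols"
begin

text \<open>For \<open>f\<close> outside \<open>Lq_space q\<close> the value of \<open>Lq_norm q f\<close> carries no information, since the
  Bochner integral of a non-integrable function is 0.\<close>

definition Lq_space :: "real \<Rightarrow> (real \<Rightarrow> complex) set" where
  "Lq_space q = {f \<in> borel_measurable lborel. integrable lborel (\<lambda>x. norm (f x) powr q)}"

definition Lq_norm :: "real \<Rightarrow> (real \<Rightarrow> complex) \<Rightarrow> real" where
  "Lq_norm q f = (LINT x|lborel. norm (f x) powr q) powr (1 / q)"

definition vderiv :: "(real \<Rightarrow> complex) \<Rightarrow> real \<Rightarrow> complex" where
  "vderiv f x = vector_derivative f (at x)"

definition schwartz :: "(real \<Rightarrow> complex) \<Rightarrow> bool" where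
  "schwartz \<phi> \<longleftrightarrow>
     (\<forall>k x. (vderiv ^^ k) \<phi> differentiable (at x)) \<and>
     (\<forall>j k. bounded (range (\<lambda>x. x ^ j *\<^sub>R (vderiv ^^ k) \<phi> x)))"

definition schwartz_seminorm :: "nat \<Rightarrow> nat \<Rightarrow> (real \<Rightarrow> complex) \<Rightarrow> real" where
  "schwartz_seminorm j k \<phi> = (SUP x. norm (x ^ j *\<^sub>R (vderiv ^^ k) \<phi> x))"

text \<open>A distribution is a functional on all functions of which only the values at Schwartz
  functions matter; equality of distributions always means agreement on Schwartz functions.\<close>

type_synonym distr = "(real \<Rightarrow> complex) \<Rightarrow> complex"

definition tempered :: "distr \<Rightarrow> bool" where
  "tempered T \<longleftrightarrow>
     (\<forall>\<phi> \<psi>. schwartz \<phi> \<longrightarrow> schwartz \<psi> \<longrightarrow> T (\<lambda>x. \<phi> x + \<psi> x) = T \<phi> + T \<psi>) \<and>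
     (\<forall>c \<phi>. schwartz \<phi> \<longrightarrow> T (\<lambda>x. c * \<phi> x) = c * T \<phi>) \<and>
     (\<exists>C N. \<forall>\<phi>. schwartz \<phi> \<longrightarrow>
        norm (T \<phi>) \<le> C * (\<Sum>j\<le>N. \<Sum>k\<le>N. schwartz_seminorm j k \<phi>))"

definition distr_eq :: "distr \<Rightarrow> distr \<Rightarrow> bool" where
  "distr_eq S T \<longleftrightarrow> (\<forall>\<phi>. schwartz \<phi> \<longrightarrow> S \<phi> = T \<phi>)"

definition distr_of :: "(real \<Rightarrow> complex) \<Rightarrow> distr" where
  "distr_of f \<phi> = (LINT x|lborel. f x * \<phi> x)"

text \<open>Functions that are tempered distributions.  Measurability and integrability are required
  explicitly because \<^const>\<open>distr_of\<close> alone cannot distinguish a non-integrable product from 0.\<close>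

definition tempered_fun :: "(real \<Rightarrow> complex) \<Rightarrow> bool" where
  "tempered_fun f \<longleftrightarrow>
     f \<in> borel_measurable lborel \<and>
     (\<forall>\<phi>. schwartz \<phi> \<longrightarrow> integrable lborel (\<lambda>x. f x * \<phi> x)) \<and>
     tempered (distr_of f)"

definition distr_deriv :: "distr \<Rightarrow> distr" where
  "distr_deriv T \<phi> = - T (vderiv \<phi>)"

definition distr_mult :: "(real \<Rightarrow> complex) \<Rightarrow> distr \<Rightarrow> distr" where
  "distr_mult a T \<phi> = T (\<lambda>x. a x * \<phi> x)"

definition fourier :: "(real \<Rightarrow> complex) \<Rightarrow> real \<Rightarrow> complex" where
  "fourier \<phi> \<xi> = complex_of_real (1 / sqrt (2 * pi)) *
     (LINT x|lborel. exp (- \<i> * complex_of_real (x * \<xi>)) * \<phi> x)"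

definition inv_fourier :: "(real \<Rightarrow> complex) \<Rightarrow> real \<Rightarrow> complex" where
  "inv_fourier \<phi> x = complex_of_real (1 / sqrt (2 * pi)) *
     (LINT \<xi>|lborel. exp (\<i> * complex_of_real (x * \<xi>)) * \<phi> \<xi>)"

definition distr_fourier :: "distr \<Rightarrow> distr" where
  "distr_fourier T \<phi> = T (fourier \<phi>)"

definition distr_inv_fourier :: "distr \<Rightarrow> distr" where
  "distr_inv_fourier T \<phi> = T (inv_fourier \<phi>)"

text \<open>\<open>bessel m\<close> is $(1-\partial_x^2)^{m/2}$, the Fourier multiplier with symbol
  $(1+\xi^2)^{m/2}$.\<close>

definition weight :: "real \<Rightarrow> real \<Rightarrow> complex" where
  "weight s x = complex_of_real ((1 + \<bar>x\<bar>\<^sup>2) powr (s / 2))"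

definition bessel :: "real \<Rightarrow> distr \<Rightarrow> distr" where
  "bessel m T = distr_inv_fourier (distr_mult (weight m) (distr_fourier T))"

definition H_space :: "real \<Rightarrow> real \<Rightarrow> distr set" where
  "H_space m s = {T. tempered T \<and>
     (\<exists>g \<in> Lq_space 2. distr_eq (distr_mult (weight s) (bessel m T)) (distr_of g))}"

text \<open>The choice is immaterial: the representing function is unique up to null sets.\<close>

definition H_norm :: "real \<Rightarrow> real \<Rightarrow> distr \<Rightarrow> real" where
  "H_norm m s T = Lq_norm 2
     (SOME g. g \<in> Lq_space 2 \<and> distr_eq (distr_mult (weight s) (bessel m T)) (distr_of g))"

definition H_fun :: "real \<Rightarrow> real \<Rightarrow> (real \<Rightarrow> complex) set" where
  "H_fun m s = {f. tempered_fun f \<and> distr_of f \<in> H_space m s}"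

definition Hf_norm :: "real \<Rightarrow> real \<Rightarrow> (real \<Rightarrow> complex) \<Rightarrow> real" where
  "Hf_norm m s f = H_norm m s (distr_of f)"

definition continuous_into_H :: "real \<Rightarrow> real \<Rightarrow> (real \<Rightarrow> real \<Rightarrow> complex) \<Rightarrow> bool" where
  "continuous_into_H m s u \<longleftrightarrow>
     (\<forall>t. u t \<in> H_fun m s) \<and>
     (\<forall>t\<^sub>0. ((\<lambda>t. Hf_norm m s (\<lambda>x. u t x - u t\<^sub>0 x)) \<longlongrightarrow> 0) (at t\<^sub>0))"

text \<open>A solution of $i\partial_t u+\partial_x^2u+i|u|^2\partial_xu+b|u|^pu=0$: for every \<open>t\<close> the
  equation holds in $\mathcal{S}'(\mathbb{R})$.  Spatial derivatives are distributional, \<open>ux t\<close>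
  being a function that represents $\partial_x u(t)$, and $\partial_t$ is the derivative of
  \<open>t \<mapsto> u(t)\<close> in the weak sense of $\mathcal{S}'$.  For $u \in C(\mathbb{R};H^{1,0})$ this is the
  same as being a solution in the sense of distributions on $\mathbb{R}\times\mathbb{R}$.\<close>

definition gdnls_solution :: "real \<Rightarrow> real \<Rightarrow> (real \<Rightarrow> real \<Rightarrow> complex) \<Rightarrow> bool" where
  "gdnls_solution p b u \<longleftrightarrow>
     (\<exists>ux :: real \<Rightarrow> real \<Rightarrow> complex. \<forall>t.
        (let N = (\<lambda>x. \<i> * complex_of_real ((norm (u t x))\<^sup>2) * ux t x
                      + complex_of_real (b * norm (u t x) powr p) * u t x)
         in tempered_fun (u t) \<and> tempered_fun (ux t) \<and> tempered_fun N \<and>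
            distr_eq (distr_deriv (distr_of (u t))) (distr_of (ux t)) \<and>
            (\<forall>\<phi>. schwartz \<phi> \<longrightarrow>
               (\<lambda>s. distr_of (u s) \<phi>) differentiable (at t) \<and>
               \<i> * vector_derivative (\<lambda>s. distr_of (u s) \<phi>) (at t)
                 + distr_deriv (distr_deriv (distr_of (u t))) \<phi>
                 + distr_of N \<phi> = 0)))"

text \<open>Meaningful for \<open>t \<noteq> 0\<close> and integrable \<open>f\<close>; the square root is the principal one.\<close>

definition free_propagator :: "real \<Rightarrow> (real \<Rightarrow> complex) \<Rightarrow> real \<Rightarrow> complex" where
  "free_propagator t f x = 1 / csqrt (4 * complex_of_real pi * \<i> * complex_of_real t) *
     (LINT y|lborel. exp (\<i> * complex_of_real ((x - y)\<^sup>2 / (4 * t))) * f y)"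

definition gauge_transform :: "(real \<Rightarrow> real \<Rightarrow> complex) \<Rightarrow> real \<Rightarrow> real \<Rightarrow> complex" where
  "gauge_transform u t x =
     exp (- (\<i> / 2) * complex_of_real (LINT y:{..x}|lborel. (norm (u t y))\<^sup>2)) * u t x"

end

theory Submission
  imports Defs "HOL-Probability.Probability"
begin

text \<open>The gauge transform \<open>v = G u\<close> turns the equation into
  \<open>i v\<^sub>t + v\<^sub>x\<^sub>x + i (|v|\<^sup>2 v)\<^sub>x + b |v|\<^sup>p v = 0\<close> (lemma \<open>gauge_equation\<close>).  For a dispersing solution the cubic
  term decays exactly at the borderline rate \<open>1/t\<close>, so a nontrivial solution has to pick up a
  logarithmic phase, and this is incompatible with \<open>v\<close> being asymptotic to a free solution
  \<open>U(t) \<phi>\<close>.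

  To see this, pair \<open>v(t)\<close> with the moving profile
  \<open>t\<^bsup>-1/2\<^esup> exp (- i x\<^sup>2 / 4t) g(x / 2t)\<close>, where \<open>g\<close> is a Schwartz function.  The profile solves the
  adjoint free equation up to an error \<open>O(t\<^bsup>-2\<^esup>)\<close> (lemma \<open>wave_almost_free\<close>), so the derivative
  of the pairing comes from the nonlinearity.  Because the cubic term is in divergence form, its
  derivative can be moved to the profile, and only \<open>|v|\<^sup>2 v\<close> has to be understood.  A free solution
  looks like \<open>c t\<^bsup>-1/2\<^esup> exp (i x\<^sup>2 / 4t) F(x / 2t)\<close> for large \<open>t\<close>, where \<open>F\<close> is the Fourier transform of
  \<open>\<phi>\<close>; convergence in \<open>L\<^sup>2\<close> together with the decay of the \<open>L\<^sup>4\<close> norm allows \<open>v\<close> to be replaced by this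
  profile.  The derivative of the pairing is therefore asymptotic to \<open>L / t\<close> with
  \<open>L = 2 |c|\<^sup>2 c \<integral> |F|\<^sup>2 F (- i \<xi> g) d\<xi>\<close> (lemma \<open>leading_term\<close>).  But the pairing is bounded, hence
  \<open>L = 0\<close> (lemmas \<open>no_logarithmic_growth\<close>, \<open>leading_vanishes\<close>).  Since \<open>g\<close> is arbitrary, \<open>F\<close> vanishes
  almost everywhere, and so does \<open>\<phi>\<close>; the norm of \<open>u(t)\<close> then tends to zero, while it is
  constant by conservation of mass (lemma \<open>mass_conserved\<close>).

  A solution is only given as a distribution.  It has the regularity \<open>H\<^sup>1\<close> in space, its
  norm in \<open>H\<^sup>1\<close> being expressed by Bessel potentials, and in time it is differentiable only after
  pairing with a fixed Schwartz function.  The nonlinear manipulations above test the equation with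
  functions built from \<open>u\<close> itself.  They rest on three tools: a function that acts on Schwartz
  functions as a bounded functional for the \<open>L\<^sup>2\<close> norm is square integrable (lemma \<open>l2_by_duality\<close>);
  weak derivatives are derivatives of absolutely continuous representatives
  (lemma \<open>weak_derivative_imp_h1\<close>); and the time derivative extends to test functions that lie in
  \<open>H\<^sup>1\<close> and move continuously in time (lemma \<open>derivative_moving\<close>), because \<open>u\<close> is Lipschitz in time
  with values in \<open>H\<^bsup>-1\<^esup>\<close>.  Terms quadratic in a time increment are negligible for the same reason
  (lemma \<open>du_l2_small\<close>).\<close>

section \<open>Square integrable functions on the line\<close>

definition sqint :: "(real \<Rightarrow> complex) \<Rightarrow> bool" where
  "sqint f \<longleftrightarrow> f \<in> borel_measurable lborel \<and> integrable lborel (\<lambda>x. (norm (f x))\<^sup>2)"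

definition l2 :: "(real \<Rightarrow> complex) \<Rightarrow> real" where
  "l2 f = sqrt (LINT x|lborel. (norm (f x))\<^sup>2)"

lemma sqint_measurable [measurable_dest]: "sqint f \<Longrightarrow> f \<in> borel_measurable borel"
  by (auto simp: sqint_def)

lemma sqint_integrable: "sqint f \<Longrightarrow> integrable lborel (\<lambda>x. (norm (f x))\<^sup>2)"
  by (auto simp: sqint_def)

lemma Lq_space_2: "f \<in> Lq_space 2 \<longleftrightarrow> sqint f"
  by (simp add: Lq_space_def sqint_def)

lemma Lq_norm_2: "Lq_norm 2 f = l2 f"
  by (simp add: Lq_norm_def l2_def powr_half_sqrt)

lemma l2_nonneg [simp]: "0 \<le> l2 f"
  by (simp add: l2_def)

lemma l2_power2: "(l2 f)\<^sup>2 = (LINT x|lborel. (norm (f x))\<^sup>2)"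
  by (simp add: l2_def)

lemma l2_zero [simp]: "l2 (\<lambda>x. 0) = 0" "sqint (\<lambda>x. 0)"
  by (auto simp: l2_def sqint_def)

lemma sqint_bound:
  assumes "sqint g" "f \<in> borel_measurable borel" "AE x in lborel. norm (f x) \<le> norm (g x)"
  shows "sqint f"
  unfolding sqint_def
proof
  show "integrable lborel (\<lambda>x. (norm (f x))\<^sup>2)"
  proof (rule Bochner_Integration.integrable_bound[OF sqint_integrable[OF assms(1)]])
    show "AE x in lborel. norm ((norm (f x))\<^sup>2) \<le> norm ((norm (g x))\<^sup>2)"
      using assms(3) by eventually_elim (simp add: power_mono)
  qed (use assms(2) in measurable)
qed (use assms in auto)

lemma l2_mono:
  assumes "sqint g" "f \<in> borel_measurable borel" "AE x in lborel. norm (f x) \<le> norm (g x)"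
  shows "l2 f \<le> l2 g"
  unfolding l2_def
proof (rule real_sqrt_le_mono, rule integral_mono_AE)
  show "AE x in lborel. (norm (f x))\<^sup>2 \<le> (norm (g x))\<^sup>2"
    using assms(3) by eventually_elim (simp add: power_mono)
qed (simp_all only: sqint_integrable sqint_bound[OF assms] assms(1))

lemma l2_cong_AE:
  assumes "f \<in> borel_measurable borel" "g \<in> borel_measurable borel" "AE x in lborel. f x = g x"
  shows "l2 f = l2 g"
  unfolding l2_def using assms by (intro arg_cong[where f=sqrt] integral_cong_AE) auto

lemma sqint_cong_AE:
  assumes "sqint f" "g \<in> borel_measurable borel" "AE x in lborel. f x = g x"
  shows "sqint g"
  by (rule sqint_bound[OF assms(1,2)]) (use assms(3) in auto)

lemma cnj_measurable [measurable]: "f \<in> borel_measurable M \<Longrightarrow> (\<lambda>x. cnj (f x)) \<in> borel_measurable M"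
  by (erule measurable_compose) (intro borel_measurable_continuous_onI continuous_intros)

lemma sqint_cnj [simp]: "sqint (\<lambda>x. cnj (f x)) \<longleftrightarrow> sqint f"
  using cnj_measurable[of f borel] cnj_measurable[of "\<lambda>x. cnj (f x)" borel] unfolding sqint_def by fastforce

lemma l2_cnj [simp]: "l2 (\<lambda>x. cnj (f x)) = l2 f"
  by (auto simp: l2_def)

lemma l2_minus_commute: "l2 (\<lambda>x. f x - g x) = l2 (\<lambda>x. g x - f x)"
  by (simp add: l2_def norm_minus_commute)

lemma sqint_cmult: "sqint f \<Longrightarrow> sqint (\<lambda>x. c * f x)"
  by (auto simp: sqint_def norm_mult power_mult_distrib)

lemma l2_cmult: "l2 (\<lambda>x. c * f x) = norm c * l2 f"
  by (simp add: l2_def norm_mult power_mult_distrib real_sqrt_mult)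

lemma sqint_add:
  assumes "sqint f" "sqint g" shows "sqint (\<lambda>x. f x + g x)"
  unfolding sqint_def
proof
  note [measurable] = sqint_measurable[OF assms(1)] sqint_measurable[OF assms(2)]
  have "integrable lborel (\<lambda>x. 2 * (norm (f x))\<^sup>2 + 2 * (norm (g x))\<^sup>2)"
    using assms by (auto simp: sqint_def)
  then show "integrable lborel (\<lambda>x. (norm (f x + g x))\<^sup>2)"
  proof (rule Bochner_Integration.integrable_bound)
    show "AE x in lborel. norm ((norm (f x + g x))\<^sup>2) \<le> norm (2 * (norm (f x))\<^sup>2 + 2 * (norm (g x))\<^sup>2)"
    proof (intro AE_I2)
      fix x
      have "(norm (f x + g x))\<^sup>2 \<le> (norm (f x) + norm (g x))\<^sup>2"
        by (intro power_mono norm_triangle_ineq) auto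
      also have "\<dots> \<le> 2 * (norm (f x))\<^sup>2 + 2 * (norm (g x))\<^sup>2"
        using sum_squares_bound[of "norm (f x)" "norm (g x)"] by (simp add: power2_sum)
      finally show "norm ((norm (f x + g x))\<^sup>2) \<le> norm (2 * (norm (f x))\<^sup>2 + 2 * (norm (g x))\<^sup>2)"
        by simp
    qed
  qed measurable
qed (use assms in measurable)

lemma sqint_uminus: "sqint f \<Longrightarrow> sqint (\<lambda>x. - f x)"
  using sqint_cmult[of f "-1"] by simp

lemma sqint_diff: "sqint f \<Longrightarrow> sqint g \<Longrightarrow> sqint (\<lambda>x. f x - g x)"
  using sqint_add[of f "\<lambda>x. - g x"] sqint_uminus[of g] by simp

lemma sqint_bounded_mult:
  assumes "sqint f" "m \<in> borel_measurable borel" "\<And>x. norm (m x) \<le> B"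
  shows "sqint (\<lambda>x. m x * f x)" "l2 (\<lambda>x. m x * f x) \<le> B * l2 f"
proof -
  have B: "0 \<le> B" using assms(3)[of 0] norm_ge_zero order_trans by blast
  have *: "AE x in lborel. norm (m x * f x) \<le> norm (of_real B * f x)"
    using assms(3) B by (intro AE_I2) (auto simp: norm_mult intro: mult_right_mono)
  have m: "(\<lambda>x. m x * f x) \<in> borel_measurable borel"
    using assms by (auto simp: sqint_def)
  show "sqint (\<lambda>x. m x * f x)" by (rule sqint_bound[OF sqint_cmult[OF assms(1)] m *])
  show "l2 (\<lambda>x. m x * f x) \<le> B * l2 f"
    using l2_mono[OF sqint_cmult[OF assms(1)] m *] B by (simp add: l2_cmult)
qed

lemma sqint_prod_integrable:
  assumes "sqint f" "sqint g" shows "integrable lborel (\<lambda>x. f x * g x)"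
proof -
  note [measurable] = sqint_measurable[OF assms(1)] sqint_measurable[OF assms(2)]
  have "integrable lborel (\<lambda>x. (norm (f x))\<^sup>2 + (norm (g x))\<^sup>2)"
    using assms by (auto simp: sqint_def)
  then show ?thesis
  proof (rule Bochner_Integration.integrable_bound)
    show "AE x in lborel. norm (f x * g x) \<le> norm ((norm (f x))\<^sup>2 + (norm (g x))\<^sup>2)"
    proof (intro AE_I2)
      fix x
      have "2 * norm (f x) * norm (g x) \<le> (norm (f x))\<^sup>2 + (norm (g x))\<^sup>2"
        by (rule sum_squares_bound)
      moreover have "0 \<le> norm (f x) * norm (g x)" by simp
      ultimately have "norm (f x) * norm (g x) \<le> (norm (f x))\<^sup>2 + (norm (g x))\<^sup>2"
        by linarith
      then show "norm (f x * g x) \<le> norm ((norm (f x))\<^sup>2 + (norm (g x))\<^sup>2)"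
        by (simp add: norm_mult)
    qed
  qed measurable
qed

lemma l2_CS_norm:
  assumes "sqint f" "sqint g"
  shows "(LINT x|lborel. norm (f x) * norm (g x)) \<le> l2 f * l2 g"
proof -
  note [measurable] = sqint_measurable[OF assms(1)] sqint_measurable[OF assms(2)]
  have i: "integrable lborel (\<lambda>x. norm (f x) * norm (g x))"
    using integrable_norm[OF sqint_prod_integrable[OF assms]] by (simp add: norm_mult)
  let ?I = "LINT x|lborel. norm (f x) * norm (g x)"
  have nI: "0 \<le> ?I" by (rule Bochner_Integration.integral_nonneg) auto
  have e: "(\<integral>\<^sup>+x. ennreal (norm (f x)) * ennreal (norm (g x)) \<partial>lborel) = ennreal ?I"
    using nn_integral_eq_integral[OF i] by (simp add: ennreal_mult)
  have f: "(\<integral>\<^sup>+x. (ennreal (norm (f x)))\<^sup>2 \<partial>lborel) = ennreal ((l2 f)\<^sup>2)"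
    using nn_integral_eq_integral[OF sqint_integrable[OF assms(1)]] by (simp add: ennreal_power l2_power2)
  have g: "(\<integral>\<^sup>+x. (ennreal (norm (g x)))\<^sup>2 \<partial>lborel) = ennreal ((l2 g)\<^sup>2)"
    using nn_integral_eq_integral[OF sqint_integrable[OF assms(2)]] by (simp add: ennreal_power l2_power2)
  have "(\<integral>\<^sup>+x. ennreal (norm (f x)) * ennreal (norm (g x)) \<partial>lborel)\<^sup>2
      \<le> (\<integral>\<^sup>+x. (ennreal (norm (f x)))\<^sup>2 \<partial>lborel) * (\<integral>\<^sup>+x. (ennreal (norm (g x)))\<^sup>2 \<partial>lborel)"
    by (rule Cauchy_Schwarz_nn_integral) measurable
  then have "ennreal (?I\<^sup>2) \<le> ennreal ((l2 f)\<^sup>2 * (l2 g)\<^sup>2)"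
    unfolding e f g using nI by (simp add: ennreal_power ennreal_mult)
  then have "?I\<^sup>2 \<le> (l2 f * l2 g)\<^sup>2"
    by (simp add: ennreal_le_iff power_mult_distrib)
  then show ?thesis by (rule power2_le_imp_le) simp
qed

lemma l2_CS:
  assumes "sqint f" "sqint g"
  shows "norm (LINT x|lborel. f x * g x) \<le> l2 f * l2 g"
proof -
  have "norm (LINT x|lborel. f x * g x) \<le> (LINT x|lborel. norm (f x * g x))"
    by (rule integral_norm_bound)
  also have "\<dots> \<le> l2 f * l2 g" using l2_CS_norm[OF assms] by (simp add: norm_mult)
  finally show ?thesis .
qed

lemma l2_triangle:
  assumes "sqint f" "sqint g"
  shows "l2 (\<lambda>x. f x + g x) \<le> l2 f + l2 g"
proof -
  note [measurable] = sqint_measurable[OF assms(1)] sqint_measurable[OF assms(2)]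
  have i: "integrable lborel (\<lambda>x. norm (f x) * norm (g x))"
    using integrable_norm[OF sqint_prod_integrable[OF assms]] by (simp add: norm_mult)
  have "(l2 (\<lambda>x. f x + g x))\<^sup>2 \<le> (LINT x|lborel. ((norm (f x))\<^sup>2 + (norm (g x))\<^sup>2) + 2 * (norm (f x) * norm (g x)))"
    unfolding l2_power2
  proof (rule integral_mono)
    show "integrable lborel (\<lambda>x. (norm (f x + g x))\<^sup>2)" using sqint_add[OF assms] by (rule sqint_integrable)
    show "integrable lborel (\<lambda>x. ((norm (f x))\<^sup>2 + (norm (g x))\<^sup>2) + 2 * (norm (f x) * norm (g x)))"
      using assms i by (auto simp: sqint_def)
    fix x
    have "(norm (f x + g x))\<^sup>2 \<le> (norm (f x) + norm (g x))\<^sup>2"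
      by (intro power_mono norm_triangle_ineq) auto
    then show "(norm (f x + g x))\<^sup>2 \<le> ((norm (f x))\<^sup>2 + (norm (g x))\<^sup>2) + 2 * (norm (f x) * norm (g x))"
      by (simp add: power2_sum)
  qed
  also have "\<dots> = (l2 f)\<^sup>2 + (l2 g)\<^sup>2 + 2 * (LINT x|lborel. norm (f x) * norm (g x))"
    using assms i by (simp add: l2_power2 sqint_def)
  also have "\<dots> \<le> (l2 f + l2 g)\<^sup>2"
    using l2_CS_norm[OF assms] by (simp add: power2_sum)
  finally show ?thesis by (rule power2_le_imp_le) simp
qed

lemma l2_triangle_diff:
  assumes "sqint f" "sqint g" "sqint h"
  shows "l2 (\<lambda>x. f x - h x) \<le> l2 (\<lambda>x. f x - g x) + l2 (\<lambda>x. g x - h x)"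
  using l2_triangle[OF sqint_diff[OF assms(1,2)] sqint_diff[OF assms(2,3)]] by simp

lemma l2_le_diff:
  assumes "sqint f" "sqint g"
  shows "l2 f \<le> l2 g + l2 (\<lambda>x. f x - g x)"
  using l2_triangle[OF assms(2) sqint_diff[OF assms]] by simp

lemma l2_eq_0_AE:
  assumes "sqint f" "l2 f = 0" shows "AE x in lborel. f x = 0"
proof -
  have "(LINT x|lborel. (norm (f x))\<^sup>2) = 0" using assms(2) l2_power2[of f] by simp
  then have "AE x in lborel. (norm (f x))\<^sup>2 = 0"
    using integral_nonneg_eq_0_iff_AE[OF sqint_integrable[OF assms(1)]] by simp
  then show ?thesis by simp
qed

lemma l2_dominated_tendsto:
  assumes f: "\<And>n. f n \<in> borel_measurable borel" and g: "g \<in> borel_measurable borel"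
    and w: "integrable lborel (\<lambda>x. (w x)\<^sup>2)"
    and lim: "AE x in lborel. (\<lambda>n. f n x) \<longlonglongrightarrow> g x"
    and bd: "\<And>n. AE x in lborel. norm (f n x) \<le> (w x :: real)"
  shows "sqint g" "(\<lambda>n. l2 (\<lambda>x. f n x - g x)) \<longlonglongrightarrow> 0" "\<And>n. sqint (f n)"
proof -
  note [measurable] = f g
  have all: "AE x in lborel. \<forall>n. norm (f n x) \<le> w x" using bd by (simp add: AE_all_countable)
  have gb: "AE x in lborel. norm (g x) \<le> w x"
    using all lim
  proof eventually_elim
    case (elim x)
    show ?case by (rule LIMSEQ_le_const2[OF tendsto_norm[OF elim(2)]]) (use elim(1) in auto)
  qed
  have ig: "integrable lborel (\<lambda>x. (norm (h x))\<^sup>2)"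
    if [measurable]: "h \<in> borel_measurable borel" and "AE x in lborel. norm (h x) \<le> w x" for h :: "real \<Rightarrow> complex"
    apply (rule Bochner_Integration.integrable_bound[OF w])
     apply (use that in measurable)
    using that(2) by eventually_elim (simp add: power_mono)
  show "sqint g" unfolding sqint_def using ig[OF g gb] g by simp
  show "sqint (f n)" for n unfolding sqint_def using ig[OF f bd] f by simp
  have "(\<lambda>n. LINT x|lborel. (norm (f n x - g x))\<^sup>2) \<longlonglongrightarrow> (LINT x|(lborel::real measure). (0::real))"
  proof (rule integral_dominated_convergence)
    show "integrable lborel (\<lambda>x. 4 * (w x)\<^sup>2)" using w by simp
    show "AE x in lborel. (\<lambda>n. (norm (f n x - g x))\<^sup>2) \<longlonglongrightarrow> 0"
      using lim
    proof eventually_elim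
      case (elim x)
      have "(\<lambda>n. (norm (f n x - g x))\<^sup>2) \<longlonglongrightarrow> (norm (g x - g x))\<^sup>2"
        by (intro tendsto_intros elim)
      then show ?case by simp
    qed
    show "AE x in lborel. norm ((norm (f n x - g x))\<^sup>2) \<le> 4 * (w x)\<^sup>2" for n
      using all gb
    proof eventually_elim
      case (elim x)
      have "norm (f n x - g x) \<le> 2 * w x" using elim norm_triangle_ineq4[of "f n x" "g x"] by (smt (verit))
      then have "(norm (f n x - g x))\<^sup>2 \<le> (2 * w x)\<^sup>2" by (intro power_mono) auto
      then show ?case by (simp add: power_mult_distrib)
    qed
  qed measurable
  from tendsto_real_sqrt[OF this] show "(\<lambda>n. l2 (\<lambda>x. f n x - g x)) \<longlonglongrightarrow> 0"
    unfolding l2_def by simp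
qed

lemma l2_tendsto:
  assumes "\<And>n. sqint (f n)" "sqint g" "(\<lambda>n. l2 (\<lambda>x. f n x - g x)) \<longlonglongrightarrow> 0"
  shows "(\<lambda>n. l2 (f n)) \<longlonglongrightarrow> l2 g"
proof (rule Lim_transform2)
  show "(\<lambda>n. l2 g) \<longlonglongrightarrow> l2 g" by simp
  show "(\<lambda>n. l2 g - l2 (f n)) \<longlonglongrightarrow> 0"
  proof (rule Lim_null_comparison[OF _ assms(3)], intro always_eventually allI)
    fix n show "norm (l2 g - l2 (f n)) \<le> l2 (\<lambda>x. f n x - g x)"
      using l2_le_diff[OF assms(1)[of n] assms(2)] l2_le_diff[OF assms(2) assms(1)[of n]]
      by (simp add: l2_minus_commute[of g] abs_le_iff)
  qed
qed

lemma integral_mult_tendsto: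
  assumes "\<And>n. sqint (f n)" "sqint g" "(\<lambda>n. l2 (\<lambda>x. f n x - g x)) \<longlonglongrightarrow> 0" "sqint h"
  shows "(\<lambda>n. LINT x|lborel. h x * f n x) \<longlonglongrightarrow> (LINT x|lborel. h x * g x)"
proof -
  have "(\<lambda>n. (LINT x|lborel. h x * f n x) - (LINT x|lborel. h x * g x)) \<longlonglongrightarrow> 0"
  proof (rule Lim_null_comparison, intro always_eventually allI)
    fix n
    have "(LINT x|lborel. h x * f n x) - (LINT x|lborel. h x * g x) = (LINT x|lborel. h x * (f n x - g x))"
      using assms by (simp add: sqint_prod_integrable right_diff_distrib)
    then show "norm ((LINT x|lborel. h x * f n x) - (LINT x|lborel. h x * g x)) \<le> l2 h * l2 (\<lambda>x. f n x - g x)"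
      using l2_CS[OF assms(4) sqint_diff[OF assms(1)[of n] assms(2)]] by simp
    show "(\<lambda>n. l2 h * l2 (\<lambda>x. f n x - g x)) \<longlonglongrightarrow> 0" using tendsto_mult_right_zero[OF assms(3)] by simp
  qed
  then show ?thesis using LIM_zero_iff by blast
qed

lemma l2_affine:
  assumes "a \<noteq> 0"
  shows "sqint f \<Longrightarrow> sqint (\<lambda>x. f (t + a * x))" "l2 (\<lambda>x. f (t + a * x)) = l2 f / sqrt \<bar>a\<bar>"
proof -
  show "sqint (\<lambda>x. f (t + a * x))" if "sqint f"
  proof -
    note [measurable] = sqint_measurable[OF that]
    have "integrable lborel (\<lambda>x. (norm (f (t + a * x)))\<^sup>2)"
      using lborel_integrable_real_affine[OF sqint_integrable[OF that] assms, of t] by simp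
    then show ?thesis by (simp add: sqint_def)
  qed
  have "(LINT x|lborel. (norm (f x))\<^sup>2) = \<bar>a\<bar> * (LINT x|lborel. (norm (f (t + a * x)))\<^sup>2)"
    using lborel_integral_real_affine[OF assms, of "\<lambda>x. (norm (f x))\<^sup>2" t] by simp
  then show "l2 (\<lambda>x. f (t + a * x)) = l2 f / sqrt \<bar>a\<bar>"
    using assms by (simp add: l2_def real_sqrt_mult)
qed

lemma integrable_inv_1_sq: "integrable lborel (\<lambda>x::real. 1 / (1 + x\<^sup>2))"
  using integrable_inverse_1_plus_square
  by (simp add: set_integrable_def einterval_def inverse_eq_divide)

lemma integrable_of_decay:
  fixes f :: "real \<Rightarrow> complex"
  assumes "f \<in> borel_measurable borel" "\<And>x. norm (f x) \<le> B / (1 + x\<^sup>2)"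
  shows "integrable lborel f"
proof (rule Bochner_Integration.integrable_bound)
  show "integrable lborel (\<lambda>x::real. B * (1 / (1 + x\<^sup>2)))" by (rule integrable_mult_right[OF integrable_inv_1_sq])
  show "AE x in lborel. norm (f x) \<le> norm (B * (1 / (1 + x\<^sup>2)))"
    using order_trans[OF assms(2) abs_ge_self] by (intro AE_I2) simp
qed (use assms in simp)

lemma sqint_of_decay:
  assumes "f \<in> borel_measurable borel" "\<And>x. norm (f x) \<le> B / (1 + x\<^sup>2)"
  shows "sqint f"
  unfolding sqint_def
proof
  show "integrable lborel (\<lambda>x. (norm (f x))\<^sup>2)"
  proof (rule Bochner_Integration.integrable_bound)
    show "integrable lborel (\<lambda>x::real. B\<^sup>2 * (1 / (1 + x\<^sup>2)))" by (rule integrable_mult_right[OF integrable_inv_1_sq])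
    show "AE x in lborel. norm ((norm (f x))\<^sup>2) \<le> norm (B\<^sup>2 * (1 / (1 + x\<^sup>2)))"
    proof (intro AE_I2)
      fix x :: real
      have "(norm (f x))\<^sup>2 \<le> (B / (1 + x\<^sup>2))\<^sup>2" using assms(2) by (intro power_mono) auto
      also have "\<dots> = B\<^sup>2 * (1 / (1 + x\<^sup>2)) * (1 / (1 + x\<^sup>2))" by (simp add: power2_eq_square)
      also have "\<dots> \<le> B\<^sup>2 * (1 / (1 + x\<^sup>2)) * 1"
        by (intro mult_left_mono) (auto simp: field_simps add_pos_nonneg)
      finally show "norm ((norm (f x))\<^sup>2) \<le> norm (B\<^sup>2 * (1 / (1 + x\<^sup>2)))" by simp
    qed
  qed (use assms in measurable)
qed (use assms in simp)

text \<open>Time derivatives are handled throughout as limits of difference quotients, since the increments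
  of the flow are estimated before any derivative is known to exist.\<close>

lemma has_vector_derivative_limit:
  fixes f :: "real \<Rightarrow> 'a::real_normed_vector"
  shows "(f has_vector_derivative d) (at x) \<longleftrightarrow> ((\<lambda>k. (f (x + k) - f x) /\<^sub>R k) \<longlongrightarrow> d) (at 0)"
proof -
  have "norm (f (x + k) - f x - k *\<^sub>R d) / norm k = norm ((f (x + k) - f x) /\<^sub>R k - d)" if "k \<noteq> 0" for k :: real
  proof -
    have "(f (x + k) - f x) /\<^sub>R k - d = (f (x + k) - f x - k *\<^sub>R d) /\<^sub>R k"
      using that by (simp add: scaleR_diff_right)
    then show ?thesis by (simp add: divide_inverse mult.commute)
  qed
  then have "((\<lambda>k. norm (f (x + k) - f x - k *\<^sub>R d) / norm k) \<longlongrightarrow> 0) (at 0)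
      \<longleftrightarrow> ((\<lambda>k. norm ((f (x + k) - f x) /\<^sub>R k - d)) \<longlongrightarrow> 0) (at 0)"
    by (intro Lim_cong_within) auto
  then show ?thesis
    unfolding has_vector_derivative_def has_derivative_at tendsto_norm_zero_iff LIM_zero_iff
    using bounded_linear_scaleR_left by blast
qed

lemma vector_derivative_bound:
  fixes f :: "real \<Rightarrow> 'a::real_normed_vector"
  assumes "convex S" "\<And>x. x \<in> S \<Longrightarrow> (f has_vector_derivative f' x) (at x within S)"
    and "\<And>x. x \<in> S \<Longrightarrow> norm (f' x) \<le> B" "x \<in> S" "y \<in> S"
  shows "norm (f x - f y) \<le> B * \<bar>x - y\<bar>"
proof -
  have "norm (f x - f y) \<le> B * norm (x - y)"
  proof (rule differentiable_bound[OF assms(1) _ _ assms(4,5)])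
    show "(f has_derivative (\<lambda>h. h *\<^sub>R f' z)) (at z within S)" if "z \<in> S" for z
      using assms(2)[OF that] by (simp add: has_vector_derivative_def)
    show "onorm (\<lambda>h. h *\<^sub>R f' z) \<le> B" if "z \<in> S" for z
      using assms(3)[OF that] by (intro onorm_le) (simp add: mult.commute[of B] mult_left_mono)
  qed
  then show ?thesis by simp
qed

text \<open>Differentiation under the integral sign, by dominated convergence of the difference quotients.\<close>

lemma integral_parameter_derivative:
  fixes f :: "real \<Rightarrow> real \<Rightarrow> complex"
  assumes int: "\<And>x. integrable lborel (f x)"
    and der: "\<And>x y. ((\<lambda>x. f x y) has_vector_derivative f' x y) (at x)"
    and bd: "\<And>x y. norm (f' x y) \<le> B y" and B: "integrable lborel B"
    and [measurable]: "\<And>x. f' x \<in> borel_measurable borel"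
  shows "((\<lambda>x. LINT y|lborel. f x y) has_vector_derivative (LINT y|lborel. f' x y)) (at x)"
proof -
  note [measurable] = borel_measurable_integrable[OF int]
  have "(\<lambda>n. (LINT y|lborel. (f (x + h n) y - f x y) /\<^sub>R h n)) \<longlonglongrightarrow> (LINT y|lborel. f' x y)"
    if h: "h \<longlonglongrightarrow> 0" "\<And>n. h n \<noteq> 0" for h
  proof (rule integral_dominated_convergence[OF _ _ B])
    show "AE y in lborel. (\<lambda>n. (f (x + h n) y - f x y) /\<^sub>R h n) \<longlonglongrightarrow> f' x y"
    proof (intro AE_I2)
      fix y
      have "((\<lambda>k. (f (x + k) y - f x y) /\<^sub>R k) \<longlongrightarrow> f' x y) (at 0)"
        using der[where x=x and y=y] unfolding has_vector_derivative_limit .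
      then show "(\<lambda>n. (f (x + h n) y - f x y) /\<^sub>R h n) \<longlonglongrightarrow> f' x y"
        using h unfolding tendsto_at_iff_sequentially comp_def by blast
    qed
    show "AE y in lborel. norm ((f (x + h n) y - f x y) /\<^sub>R h n) \<le> B y" for n
    proof (intro AE_I2)
      fix y
      have "norm (f (x + h n) y - f x y) \<le> B y * norm (x + h n - x)"
        using vector_derivative_bound[of UNIV "\<lambda>x. f x y" "\<lambda>x. f' x y" "B y" "x + h n" x] der bd by simp
      then show "norm ((f (x + h n) y - f x y) /\<^sub>R h n) \<le> B y"
        using h(2)[of n] by (simp add: divide_simps mult.commute flip: divide_inverse)
    qed
  qed (use int borel_measurable_integrable[OF int] in simp_all)
  then have "((\<lambda>k. (LINT y|lborel. (f (x + k) y - f x y) /\<^sub>R k)) \<longlongrightarrow> (LINT y|lborel. f' x y)) (at 0)"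
    unfolding tendsto_at_iff_sequentially comp_def by blast
  then have "((\<lambda>k. ((LINT y|lborel. f (x + k) y) - (LINT y|lborel. f x y)) /\<^sub>R k) \<longlongrightarrow> (LINT y|lborel. f' x y)) (at 0)"
    using int by simp
  then show ?thesis unfolding has_vector_derivative_limit .
qed

section \<open>Schwartz functions\<close>

text \<open>Complex linear span of a set of functions. Being Schwartz requires bounds on all derivatives; if
  a family of functions is closed under differentiation up to linear combinations, the span is
  the class on which the induction over the order of the derivative can run.\<close>

inductive_set cspan :: "(real \<Rightarrow> complex) set \<Rightarrow> (real \<Rightarrow> complex) set" for G where
  cspan_base: "g \<in> G \<Longrightarrow> g \<in> cspan G"
| cspan_add: "f \<in> cspan G \<Longrightarrow> g \<in> cspan G \<Longrightarrow> (\<lambda>x. f x + g x) \<in> cspan G"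
| cspan_cmult: "f \<in> cspan G \<Longrightarrow> (\<lambda>x. c * f x) \<in> cspan G"

lemma vderiv_eqI: "(\<And>x. (f has_vector_derivative f' x) (at x)) \<Longrightarrow> vderiv f = f'"
  by (auto simp: vderiv_def vector_derivative_at)

text \<open>The device for all closure properties below: it is enough that the derivative of a generator is
  a combination of generators and that generators decay rapidly, because the span is then stable
  under iterated differentiation.\<close>

lemma schwartz_by_generators:
  assumes der: "\<And>g. g \<in> G \<Longrightarrow> \<exists>g'\<in>cspan G. \<forall>x. (g has_vector_derivative g' x) (at x)"
    and dec: "\<And>g j. g \<in> G \<Longrightarrow> \<exists>B. \<forall>x. \<bar>x\<bar> ^ j * norm (g x) \<le> B"
    and f: "f \<in> cspan G"
  shows "schwartz f"
proof -
  have der': "\<exists>g'\<in>cspan G. \<forall>x. (g has_vector_derivative g' x) (at x)" if "g \<in> cspan G" for g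
    using that
  proof induction
    case (cspan_base g) then show ?case by (rule der)
  next
    case (cspan_add f g)
    then obtain f' g' where "f' \<in> cspan G" "\<forall>x. (f has_vector_derivative f' x) (at x)"
      "g' \<in> cspan G" "\<forall>x. (g has_vector_derivative g' x) (at x)" by blast
    then show ?case
      by (intro bexI[of _ "\<lambda>x. f' x + g' x"]) (auto intro: has_vector_derivative_add cspan.intros)
  next
    case (cspan_cmult f c)
    then obtain f' where "f' \<in> cspan G" "\<forall>x. (f has_vector_derivative f' x) (at x)" by blast
    then show ?case
      by (intro bexI[of _ "\<lambda>x. c * f' x"]) (auto intro: has_vector_derivative_mult_right cspan.intros)
  qed
  have dec': "\<exists>B. \<forall>x. \<bar>x\<bar> ^ j * norm (g x) \<le> B" if "g \<in> cspan G" for g j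
    using that
  proof induction
    case (cspan_base g) then show ?case by (rule dec)
  next
    case (cspan_add f g)
    then obtain B C where "\<forall>x. \<bar>x\<bar> ^ j * norm (f x) \<le> B" "\<forall>x. \<bar>x\<bar> ^ j * norm (g x) \<le> C" by blast
    moreover have "\<bar>x\<bar> ^ j * norm (f x + g x) \<le> \<bar>x\<bar> ^ j * norm (f x) + \<bar>x\<bar> ^ j * norm (g x)" for x
      using mult_left_mono[OF norm_triangle_ineq[of "f x" "g x"], of "\<bar>x\<bar> ^ j"] by (simp add: distrib_left)
    ultimately show ?case by (intro exI[of _ "B + C"]) (meson add_mono order_trans)
  next
    case (cspan_cmult f c)
    then obtain B where "\<forall>x. \<bar>x\<bar> ^ j * norm (f x) \<le> B" by blast
    then have "\<forall>x. \<bar>x\<bar> ^ j * norm (c * f x) \<le> norm c * B"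
      by (simp add: norm_mult mult.left_commute[of _ "norm c"] mult_left_mono)
    then show ?case by blast
  qed
  have it: "(vderiv ^^ k) f \<in> cspan G" for k
  proof (induction k)
    case (Suc k)
    then obtain g' where "g' \<in> cspan G" "\<forall>x. ((vderiv ^^ k) f has_vector_derivative g' x) (at x)"
      using der' by blast
    then show ?case using vderiv_eqI[of "(vderiv ^^ k) f" g'] by simp
  qed (use f in simp)
  show ?thesis
    unfolding schwartz_def
  proof (intro conjI allI)
    fix k x show "(vderiv ^^ k) f differentiable at x"
      using der'[OF it[of k]] by (auto intro: differentiableI_vector)
  next
    fix j k
    obtain B where "\<forall>x. \<bar>x\<bar> ^ j * norm ((vderiv ^^ k) f x) \<le> B" using dec'[OF it] by blast
    then show "bounded (range (\<lambda>x. x ^ j *\<^sub>R (vderiv ^^ k) f x))"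
      by (auto simp: bounded_iff power_abs)
  qed
qed

lemma schwartz_has_derivative: "schwartz f \<Longrightarrow> (f has_vector_derivative vderiv f x) (at x)"
  unfolding schwartz_def vderiv_def by (metis funpow_0 vector_derivative_works)

lemma schwartz_vderiv:
  assumes "schwartz f" shows "schwartz (vderiv f)"
proof -
  have "(vderiv ^^ k) (vderiv f) = (vderiv ^^ Suc k) f" for k
    by (simp only: funpow_Suc_right comp_apply)
  then show ?thesis using assms unfolding schwartz_def by presburger
qed

lemma schwartz_moment_bound:
  assumes "schwartz f" shows "\<exists>B\<ge>0. \<forall>x. \<bar>x\<bar> ^ j * norm (f x) \<le> B"
proof -
  have "bounded (range (\<lambda>x. x ^ j *\<^sub>R (vderiv ^^ 0) f x))" using assms unfolding schwartz_def by blast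
  then obtain B where "\<And>x. norm (x ^ j *\<^sub>R f x) \<le> B" by (auto simp: bounded_iff)
  then have "\<And>x. \<bar>x\<bar> ^ j * norm (f x) \<le> B" by (simp add: power_abs)
  moreover from this[of 0] have "0 \<le> B" by (meson abs_ge_zero mult_nonneg_nonneg norm_ge_zero order_trans zero_le_power)
  ultimately show ?thesis by blast
qed

lemma poly_weight_le: "(1 + \<bar>x\<bar>) ^ n \<le> 2 ^ n * (1 + \<bar>x::real\<bar> ^ n)"
proof -
  have "(1 + \<bar>x\<bar>) ^ n \<le> (2 * max 1 \<bar>x\<bar>) ^ n" by (intro power_mono) auto
  also have "\<dots> = 2 ^ n * (max 1 \<bar>x\<bar>) ^ n" by (simp add: power_mult_distrib)
  also have "(max 1 \<bar>x\<bar>) ^ n \<le> 1 + \<bar>x\<bar> ^ n" by (auto simp: max_def)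
  finally show ?thesis by simp
qed

lemma schwartz_weight_bound:
  assumes "schwartz f" shows "\<exists>B\<ge>0. \<forall>x. (1 + \<bar>x\<bar>) ^ n * norm (f x) \<le> B"
proof -
  obtain B where B: "0 \<le> B" "\<And>x. \<bar>x\<bar> ^ 0 * norm (f x) \<le> B" using schwartz_moment_bound[OF assms, of "0"] by auto
  obtain C where C: "0 \<le> C" "\<And>x. \<bar>x\<bar> ^ n * norm (f x) \<le> C" using schwartz_moment_bound[OF assms, of "n"] by auto
  show ?thesis
  proof (intro exI[of _ "2 ^ n * (B + C)"] conjI allI)
    show "0 \<le> 2 ^ n * (B + C)" using B C by simp
    fix x
    have "(1 + \<bar>x\<bar>) ^ n * norm (f x) \<le> (2 ^ n * (1 + \<bar>x\<bar> ^ n)) * norm (f x)"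
      by (intro mult_right_mono poly_weight_le) auto
    also have "\<dots> = 2 ^ n * (norm (f x) + \<bar>x\<bar> ^ n * norm (f x))" by (simp add: algebra_simps)
    also have "\<dots> \<le> 2 ^ n * (B + C)" using B(2)[of x] C(2)[of x] by (intro mult_left_mono add_mono) auto
    finally show "(1 + \<bar>x\<bar>) ^ n * norm (f x) \<le> 2 ^ n * (B + C)" .
  qed
qed

lemma schwartz_continuous: "schwartz f \<Longrightarrow> continuous_on UNIV f"
  by (meson continuous_at_imp_continuous_on has_vector_derivative_continuous schwartz_has_derivative)

lemma schwartz_measurable: "schwartz f \<Longrightarrow> f \<in> borel_measurable borel"
  using borel_measurable_continuous_onI schwartz_continuous by blast

lemma schwartz_decay:
  assumes "schwartz f" shows "\<exists>B\<ge>0. \<forall>x. norm (f x) \<le> B / (1 + x\<^sup>2)"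
proof -
  obtain B where B: "0 \<le> B" "\<And>x. (1 + \<bar>x\<bar>) ^ 2 * norm (f x) \<le> B" using schwartz_weight_bound[OF assms, of "2"] by auto
  show ?thesis
  proof (intro exI[of _ B] conjI allI)
    fix x :: real
    have "1 + x\<^sup>2 \<le> (1 + \<bar>x\<bar>) ^ 2" unfolding power2_sum by simp
    then have "(1 + x\<^sup>2) * norm (f x) \<le> B" using B(2)[of x] by (meson mult_right_mono norm_ge_zero order_trans)
    then show "norm (f x) \<le> B / (1 + x\<^sup>2)" by (simp add: field_simps add_pos_nonneg)
  qed (rule B)
qed

lemma schwartz_bounded:
  assumes "schwartz f" shows "\<exists>B\<ge>0. \<forall>x. norm (f x) \<le> B"
proof -
  obtain B where "0 \<le> B" "\<And>x. \<bar>x\<bar> ^ 0 * norm (f x) \<le> B" using schwartz_moment_bound[OF assms, of "0"] by auto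
  then show ?thesis by (intro exI[of _ B]) simp
qed

lemma schwartz_integrable: assumes "schwartz f" shows "integrable lborel f"
proof -
  obtain B where "0 \<le> B" and B: "\<And>x. norm (f x) \<le> B / (1 + x\<^sup>2)" using schwartz_decay[OF assms] by auto
  show ?thesis by (rule integrable_of_decay[OF schwartz_measurable[OF assms] B])
qed

lemma schwartz_sqint: assumes "schwartz f" shows "sqint f"
proof -
  obtain B where "0 \<le> B" and B: "\<And>x. norm (f x) \<le> B / (1 + x\<^sup>2)" using schwartz_decay[OF assms] by auto
  show ?thesis by (rule sqint_of_decay[OF schwartz_measurable[OF assms] B])
qed

lemma schwartz_cspan:
  assumes "f \<in> cspan {f. schwartz f}" shows "schwartz f"
proof (rule schwartz_by_generators[OF _ _ assms])
  fix g assume "g \<in> {f. schwartz f}"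
  then have g: "schwartz g" by simp
  show "\<exists>g'\<in>cspan {f. schwartz f}. \<forall>x. (g has_vector_derivative g' x) (at x)"
    by (intro bexI[of _ "vderiv g"] allI schwartz_has_derivative cspan_base)
      (simp_all add: g schwartz_vderiv)
  fix j
  obtain B where "0 \<le> B" "\<And>x. \<bar>x\<bar> ^ j * norm (g x) \<le> B" using schwartz_moment_bound[OF g, of "j"] by auto
  then show "\<exists>B. \<forall>x. \<bar>x\<bar> ^ j * norm (g x) \<le> B" by blast
qed

lemma schwartz_add: "schwartz f \<Longrightarrow> schwartz g \<Longrightarrow> schwartz (\<lambda>x. f x + g x)"
  by (rule schwartz_cspan, intro cspan_add cspan_base) simp_all

lemma schwartz_cmult: "schwartz f \<Longrightarrow> schwartz (\<lambda>x. c * f x)"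
  by (rule schwartz_cspan, intro cspan_cmult cspan_base) simp

lemma has_vector_derivative_cnj:
  "(f has_vector_derivative f') (at x) \<Longrightarrow> ((\<lambda>x. cnj (f x)) has_vector_derivative cnj f') (at x)"
  using bounded_linear.has_vector_derivative[OF bounded_linear_cnj] by blast

lemma schwartz_cnj: assumes "schwartz f" shows "schwartz (\<lambda>x. cnj (f x))"
proof (rule schwartz_by_generators[of "{\<lambda>x. cnj (f x) |f. schwartz f}"])
  fix g assume "g \<in> {\<lambda>x. cnj (f x) |f. schwartz f}"
  then obtain f where f: "schwartz f" "g = (\<lambda>x. cnj (f x))" by blast
  show "\<exists>g'\<in>cspan {\<lambda>x. cnj (f x) |f. schwartz f}. \<forall>x. (g has_vector_derivative g' x) (at x)"
    using f schwartz_vderiv[OF f(1)] has_vector_derivative_cnj[OF schwartz_has_derivative[OF f(1)]]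
    by (intro bexI[of _ "\<lambda>x. cnj (vderiv f x)"]) (auto intro!: cspan_base)
  show "\<exists>B. \<forall>x. \<bar>x\<bar> ^ j * norm (g x) \<le> B" for j
  proof -
    obtain B where "0 \<le> B" "\<And>x. \<bar>x\<bar> ^ j * norm (f x) \<le> B" using schwartz_moment_bound[OF f(1), of "j"] by auto
    then show ?thesis by (auto simp: f(2))
  qed
qed (rule cspan_base, use assms in blast)

lemma of_real_power_has_vector_derivative:
  "((\<lambda>x. of_real x ^ i :: complex) has_vector_derivative of_nat i * of_real x ^ (i - 1)) (at x)"
proof -
  have "((\<lambda>x. x ^ i) has_real_derivative real i * x ^ (i - 1)) (at x)"
    by (auto intro!: derivative_eq_intros)
  from has_vector_derivative_of_real[OF this]
  show ?thesis by simp
qed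

text \<open>Multipliers whose logarithmic derivative is an affine function of \<open>x\<close> cover the
  modulations, Gaussians and quadratic phases that are needed. The powers of \<open>x\<close>
  are part of the statement because differentiating the multiplier produces them; the products
  \<open>x\<^sup>i m f\<close> are the generators.\<close>

lemma schwartz_mult_exp:
  fixes m :: "real \<Rightarrow> complex"
  assumes f: "schwartz f"
    and m: "\<And>x. (m has_vector_derivative (a + c * of_real x) * m x) (at x)"
    and bd: "\<And>x. norm (m x) \<le> M"
  shows "schwartz (\<lambda>x. of_real x ^ i * m x * f x)"
proof (rule schwartz_by_generators[of "{\<lambda>x. of_real x ^ i * m x * f x |i f. schwartz f}"])
  let ?G = "{\<lambda>x. of_real x ^ i * m x * f x |i f. schwartz f}"
  fix g assume "g \<in> ?G"
  then obtain i f where f: "schwartz f" "g = (\<lambda>x. of_real x ^ i * m x * f x)" by blast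
  have G: "(\<lambda>x. of_real x ^ i * m x * f x) \<in> cspan ?G" if "schwartz f" for i f
    using that by (auto intro!: cspan_base)
  show "\<exists>g'\<in>cspan ?G. \<forall>x. (g has_vector_derivative g' x) (at x)"
  proof (intro bexI allI)
    let ?g' = "\<lambda>x. (of_nat i * (of_real x ^ (i - 1) * m x * f x) + (a * (of_real x ^ i * m x * f x)
        + c * (of_real x ^ (i + 1) * m x * f x))) + of_real x ^ i * m x * vderiv f x"
    show "?g' \<in> cspan ?G"
      using f schwartz_vderiv[OF f(1)] by (intro cspan_add cspan_cmult G) auto
    fix x show "(g has_vector_derivative ?g' x) (at x)"
      unfolding f(2)
      by (rule has_vector_derivative_eq_rhs)
        (rule has_vector_derivative_mult of_real_power_has_vector_derivative m schwartz_has_derivative[OF f(1)]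
          | simp add: algebra_simps)+
  qed
  fix j
  obtain B where B: "0 \<le> B" "\<And>x. \<bar>x\<bar> ^ (j + i) * norm (f x) \<le> B" using schwartz_moment_bound[OF f(1), of "j + i"] by auto
  have "\<bar>x\<bar> ^ j * norm (g x) \<le> M * B" for x
  proof -
    have "\<bar>x\<bar> ^ j * norm (g x) = norm (m x) * (\<bar>x\<bar> ^ (j + i) * norm (f x))"
      by (simp add: f norm_mult norm_power power_add)
    also have "\<dots> \<le> M * B" using B bd[of x] by (intro mult_mono) (auto intro: order_trans[OF norm_ge_zero])
    finally show ?thesis .
  qed
  then show "\<exists>B. \<forall>x. \<bar>x\<bar> ^ j * norm (g x) \<le> B" by blast
qed (rule cspan_base, use f in blast)

lemma schwartz_times_x: "schwartz f \<Longrightarrow> schwartz (\<lambda>x. of_real x ^ i * f x)"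
  using schwartz_mult_exp[of f "\<lambda>_. 1" 0 0 1 i] by simp

lemma exp_quadratic_derivative:
  fixes c d :: complex
  shows "((\<lambda>x. exp (c * of_real x ^ 2 + d * of_real x)) has_vector_derivative
    (d + (2 * c) * of_real x) * exp (c * of_real x ^ 2 + d * of_real x)) (at (x::real))"
proof -
  have "((\<lambda>z. exp (c * z ^ 2 + d * z)) has_field_derivative
    (d + (2 * c) * of_real x) * exp (c * of_real x ^ 2 + d * of_real x)) (at (of_real x :: complex))"
    by (auto intro!: derivative_eq_intros simp: algebra_simps)
  from has_vector_derivative_real_field[OF this] show ?thesis .
qed

lemma schwartz_mult_quadratic_phase:
  assumes "schwartz f" "Re c \<le> 0" "Re d = 0"
  shows "schwartz (\<lambda>x. exp (c * of_real x ^ 2 + d * of_real x) * f x)"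
proof -
  have "norm (exp (c * of_real x ^ 2 + d * of_real x)) \<le> 1" for x :: real
    using assms by (simp add: norm_exp_eq_Re mult_nonpos_nonneg flip: of_real_power)
  from schwartz_mult_exp[OF assms(1) exp_quadratic_derivative this, of 0] show ?thesis by simp
qed

lemma exp_power_term_le:
  assumes "0 \<le> (y::real)" shows "y ^ k / fact k \<le> exp y"
proof -
  have "(\<Sum>i\<in>{k}. inverse (fact i) *\<^sub>R y ^ i) \<le> (\<Sum>i. inverse (fact i) *\<^sub>R y ^ i)"
    using assms by (intro sum_le_suminf summable_exp_generic) auto
  then show ?thesis by (simp add: exp_def divide_inverse mult.commute)
qed

lemma poly_times_gauss_bound: "\<exists>B. \<forall>x::real. \<bar>x\<bar> ^ j * exp (- (x\<^sup>2) / 2) \<le> B"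
proof -
  define k where "k = Suc j"
  have "\<bar>x\<bar> ^ j * exp (- (x\<^sup>2) / 2) \<le> 1 + 2 ^ k * fact k" for x :: real
  proof (cases "\<bar>x\<bar> \<le> 1")
    case True
    then have "\<bar>x\<bar> ^ j * exp (- (x\<^sup>2) / 2) \<le> 1 * 1" by (intro mult_mono power_le_one) auto
    then show ?thesis by (smt (verit) fact_ge_zero mult_nonneg_nonneg zero_le_power)
  next
    case False
    \<comment> \<open>one term of the exponential series dominates the power\<close>
    have "(x\<^sup>2 / 2) ^ k / fact k \<le> exp (x\<^sup>2 / 2)"
      by (intro exp_power_term_le) simp
    then have "(x\<^sup>2 / 2) ^ k * exp (- (x\<^sup>2) / 2) \<le> fact k"
      by (simp add: exp_minus field_simps)
    then have "\<bar>x\<bar> ^ (2 * k) * exp (- (x\<^sup>2) / 2) \<le> 2 ^ k * fact k"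
      unfolding power_mult power2_abs by (simp add: power_divide field_simps)
    moreover have "\<bar>x\<bar> ^ j \<le> \<bar>x\<bar> ^ (2 * k)"
      using False by (intro power_increasing) (auto simp: k_def)
    ultimately show ?thesis
      by (smt (verit) exp_ge_zero mult_right_mono)
  qed
  then show ?thesis by blast
qed

text \<open>The generators here are the products of powers of \<open>x\<close> with the Gaussian.\<close>

lemma schwartz_gauss: "schwartz (\<lambda>x. exp (- (of_real x ^ 2) / 2))"
proof -
  let ?e = "\<lambda>x::real. exp (- (of_real x ^ 2) / 2) :: complex"
  let ?G = "{\<lambda>x. of_real x ^ i * ?e x |i. True}"
  have e: "(?e has_vector_derivative (- of_real x) * ?e x) (at x)" for x
    using exp_quadratic_derivative[of "-1/2" 0 x] by simp
  have G: "(\<lambda>x. of_real x ^ i * ?e x) \<in> cspan ?G" for i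
    by (auto intro!: cspan_base)
  have "schwartz (\<lambda>x. of_real x ^ 0 * ?e x)"
  proof (rule schwartz_by_generators[of ?G])
    fix g assume "g \<in> ?G"
    then obtain i where g: "g = (\<lambda>x. of_real x ^ i * ?e x)" by blast
    show "\<exists>g'\<in>cspan ?G. \<forall>x. (g has_vector_derivative g' x) (at x)"
    proof (intro bexI allI)
      let ?g' = "\<lambda>x. of_nat i * (of_real x ^ (i - 1) * ?e x) + (-1) * (of_real x ^ (i + 1) * ?e x)"
      show "?g' \<in> cspan ?G" by (intro cspan_add cspan_cmult G)
      fix x show "(g has_vector_derivative ?g' x) (at x)"
        unfolding g
        by (rule has_vector_derivative_eq_rhs)
          (rule has_vector_derivative_mult of_real_power_has_vector_derivative e
          | simp add: algebra_simps)+
    qed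
    fix j
    obtain B where "\<forall>x::real. \<bar>x\<bar> ^ (j + i) * exp (- (x\<^sup>2) / 2) \<le> B" using poly_times_gauss_bound by blast
    moreover have "\<bar>x\<bar> ^ j * norm (g x) = \<bar>x\<bar> ^ (j + i) * exp (- (x\<^sup>2) / 2)" for x
      by (simp add: g norm_mult norm_power power_add norm_exp_eq_Re power_abs flip: of_real_power)
    ultimately show "\<exists>B. \<forall>x. \<bar>x\<bar> ^ j * norm (g x) \<le> B" by auto
  qed (rule G)
  then show ?thesis by simp
qed

lemma schwartz_affine:
  assumes f: "schwartz f" and a: "a \<noteq> 0"
  shows "schwartz (\<lambda>x. f (t + a * x))"
proof (rule schwartz_by_generators[of "{\<lambda>x. f (t + a * x) |f. schwartz f}"])
  let ?G = "{\<lambda>x. f (t + a * x) |f. schwartz f}"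
  fix g assume "g \<in> ?G"
  then obtain f where f: "schwartz f" "g = (\<lambda>x. f (t + a * x))" by blast
  have "((\<lambda>x. f (t + a * x)) has_vector_derivative of_real a * vderiv f (t + a * x)) (at x)" for x
  proof -
    have "((\<lambda>x. t + a * x) has_vector_derivative a) (at x)"
      unfolding has_real_derivative_iff_has_vector_derivative[symmetric] by (auto intro!: derivative_eq_intros)
    from vector_diff_chain_at[OF this schwartz_has_derivative[OF f(1)]]
    show ?thesis by (simp add: comp_def scaleR_conv_of_real)
  qed
  then show "\<exists>g'\<in>cspan ?G. \<forall>x. (g has_vector_derivative g' x) (at x)"
    using f schwartz_vderiv[OF f(1)]
    by (intro bexI[of _ "\<lambda>x. of_real a * vderiv f (t + a * x)"]) (auto intro!: cspan_cmult, intro cspan_base, auto)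
  fix j
  obtain B where B: "0 \<le> B" "\<And>x. (1 + \<bar>x\<bar>) ^ j * norm (f x) \<le> B" using schwartz_weight_bound[OF f(1), of "j"] by auto
  define C where "C = (1 + \<bar>t\<bar>) / \<bar>a\<bar>"
  have "\<bar>x\<bar> \<le> C * (1 + \<bar>t + a * x\<bar>)" for x
  proof -
    have "\<bar>a\<bar> * \<bar>x\<bar> \<le> \<bar>t\<bar> + \<bar>t + a * x\<bar>" by (simp flip: abs_mult)
    also have "\<dots> \<le> (1 + \<bar>t\<bar>) * (1 + \<bar>t + a * x\<bar>)" by (simp add: algebra_simps)
    finally show ?thesis using a by (simp add: C_def field_simps)
  qed
  then have "\<bar>x\<bar> ^ j * norm (g x) \<le> C ^ j * B" for x
  proof -
    have "\<bar>x\<bar> ^ j * norm (g x) \<le> (C * (1 + \<bar>t + a * x\<bar>)) ^ j * norm (g x)"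
      using \<open>\<And>x. \<bar>x\<bar> \<le> C * (1 + \<bar>t + a * x\<bar>)\<close> by (intro mult_right_mono power_mono) auto
    also have "\<dots> = C ^ j * ((1 + \<bar>t + a * x\<bar>) ^ j * norm (f (t + a * x)))"
      by (simp add: f power_mult_distrib)
    also have "\<dots> \<le> C ^ j * B" using B by (intro mult_left_mono) (auto simp: C_def)
    finally show ?thesis .
  qed
  then show "\<exists>B. \<forall>x. \<bar>x\<bar> ^ j * norm (g x) \<le> B" by blast
qed (rule cspan_base, use f in blast)

text \<open>A derivative of \<open>(1 + x\<^sup>2)\<^bsup>s/2\<^esup>\<close> is \<open>s x\<close> times
  the weight of order \<open>s - 2\<close>, so the generators are the products with all orders
  \<open>s\<close> at once.\<close>

lemma schwartz_weight:
  assumes f: "schwartz f"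
  shows "schwartz (\<lambda>x. weight s x * f x)"
proof -
  let ?w = "\<lambda>s (x::real). of_real ((1 + x\<^sup>2) powr s) :: complex"
  let ?G = "{\<lambda>x. ?w s x * f x |s f. schwartz f}"
  have G: "(\<lambda>x. ?w s x * f x) \<in> cspan ?G" if "schwartz f" for s f
    using that by (auto intro!: cspan_base)
  have w: "(?w s has_vector_derivative ?w (s - 1) x * (2 * of_real s * of_real x)) (at x)" for s x
  proof -
    have p: "1 + x\<^sup>2 > 0" by (simp add: add_pos_nonneg)
    have "((\<lambda>x. (1 + x\<^sup>2) powr s) has_real_derivative (1 + x\<^sup>2) powr (s - 1) * (2 * s * x)) (at x)"
      using p by (auto intro!: derivative_eq_intros simp: powr_diff field_simps)
    from has_vector_derivative_of_real[OF this]
    show ?thesis by simp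
  qed
  have "schwartz (\<lambda>x. ?w (s/2) x * f x)"
  proof (rule schwartz_by_generators[of ?G])
    fix g assume "g \<in> ?G"
    then obtain s f where f: "schwartz f" "g = (\<lambda>x. ?w s x * f x)" by blast
    show "\<exists>g'\<in>cspan ?G. \<forall>x. (g has_vector_derivative g' x) (at x)"
    proof (intro bexI allI)
      let ?g' = "\<lambda>x. (2 * of_real s) * (?w (s - 1) x * (of_real x ^ 1 * f x)) + ?w s x * vderiv f x"
      show "?g' \<in> cspan ?G"
        using f schwartz_vderiv[OF f(1)] by (intro cspan_add cspan_cmult G schwartz_times_x)
      fix x show "(g has_vector_derivative ?g' x) (at x)"
        unfolding f(2)
        by (rule has_vector_derivative_eq_rhs)
          (rule has_vector_derivative_mult w schwartz_has_derivative[OF f(1)]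
          | simp add: algebra_simps)+
    qed
    fix j
    obtain n where n: "s \<le> real n" using real_arch_simple by blast
    obtain B where B: "0 \<le> B" "\<And>x. (1 + \<bar>x\<bar>) ^ (j + 2 * n) * norm (f x) \<le> B" using schwartz_weight_bound[OF f(1), of "j + 2 * n"] by auto
    have "\<bar>x\<bar> ^ j * norm (g x) \<le> B" for x
    proof -
      have "(1 + x\<^sup>2) powr s \<le> (1 + x\<^sup>2) powr real n" using n by (intro powr_mono) auto
      also have "\<dots> = (1 + x\<^sup>2) ^ n" by (simp add: powr_realpow add_pos_nonneg)
      also have "\<dots> \<le> ((1 + \<bar>x\<bar>)\<^sup>2) ^ n" unfolding power2_sum by (intro power_mono) auto
      finally have w: "(1 + x\<^sup>2) powr s \<le> (1 + \<bar>x\<bar>) ^ (2 * n)" by (simp add: power_mult)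
      have "\<bar>x\<bar> ^ j * norm (g x) = \<bar>x\<bar> ^ j * (1 + x\<^sup>2) powr s * norm (f x)"
        by (simp add: f norm_mult)
      also have "\<dots> \<le> (1 + \<bar>x\<bar>) ^ j * (1 + \<bar>x\<bar>) ^ (2 * n) * norm (f x)"
        using w by (intro mult_right_mono mult_mono power_mono) auto
      also have "\<dots> \<le> B" using B(2)[of x] by (simp add: power_add)
      finally show ?thesis .
    qed
    then show "\<exists>B. \<forall>x. \<bar>x\<bar> ^ j * norm (g x) \<le> B" by blast
  qed (rule G[OF f])
  then show ?thesis by (simp add: weight_def)
qed

section \<open>The Fourier transform on Schwartz functions\<close>

lemma integrable_prod_bound:
  fixes f g :: "real \<Rightarrow> complex" and h :: "real \<times> real \<Rightarrow> complex"
  assumes f: "integrable lborel f" and g: "integrable lborel g"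
    and h [measurable]: "h \<in> borel_measurable (lborel \<Otimes>\<^sub>M lborel)"
    and bd: "\<And>x y. norm (h (x, y)) \<le> norm (f x) * norm (g y)"
  shows "integrable (lborel \<Otimes>\<^sub>M lborel) h"
proof (rule lborel_pair.Fubini_integrable[OF h])
  have i: "integrable lborel (\<lambda>y. h (x, y))" for x
  proof (rule Bochner_Integration.integrable_bound)
    show "integrable lborel (\<lambda>y. norm (f x) * norm (g y))" using g by simp
    show "AE y in lborel. norm (h (x, y)) \<le> norm (norm (f x) * norm (g y))"
      using bd by (simp add: abs_mult)
  qed measurable
  then show "AE x in lborel. integrable lborel (\<lambda>y. h (x, y))" by simp
  show "integrable lborel (\<lambda>x. LINT y|lborel. norm (h (x, y)))"
  proof (rule Bochner_Integration.integrable_bound)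
    show "integrable lborel (\<lambda>x. norm (f x) * (LINT y|lborel. norm (g y)))" using f by simp
    show "AE x in lborel. norm (LINT y|lborel. norm (h (x, y))) \<le> norm (norm (f x) * (LINT y|lborel. norm (g y)))"
    proof (intro AE_I2)
      fix x
      have "(LINT y|lborel. norm (h (x, y))) \<le> (LINT y|lborel. norm (f x) * norm (g y))"
        using bd i g by (intro integral_mono) auto
      then show "norm (LINT y|lborel. norm (h (x, y))) \<le> norm (norm (f x) * (LINT y|lborel. norm (g y)))"
        by (simp add: abs_mult)
    qed
  qed measurable
qed

lemma fourier_exp_norm [simp]: "norm (exp (- \<i> * complex_of_real r)) = 1" "norm (exp (\<i> * complex_of_real r)) = 1"
  by (simp_all add: norm_exp_eq_Re)

lemma fourier_integrand_integrable:
  assumes "integrable lborel f"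
  shows "integrable lborel (\<lambda>x. exp (- \<i> * complex_of_real (x * \<xi>)) * f x)"
  by (rule Bochner_Integration.integrable_bound[OF assms])
    (use borel_measurable_integrable[OF assms] in \<open>simp_all add: norm_mult del: of_real_mult\<close>)

lemma fourier_diff:
  assumes "integrable lborel f" "integrable lborel g"
  shows "fourier (\<lambda>x. f x - g x) \<xi> = fourier f \<xi> - fourier g \<xi>"
  unfolding fourier_def right_diff_distrib
  by (subst Bochner_Integration.integral_diff) (simp_all only: fourier_integrand_integrable assms right_diff_distrib)

lemma fourier_norm_le:
  assumes "integrable lborel f"
  shows "norm (fourier f \<xi>) \<le> (1 / sqrt (2 * pi)) * (LINT x|lborel. norm (f x))"
proof -
  have "norm (LINT x|lborel. exp (- \<i> * complex_of_real (x * \<xi>)) * f x)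
      \<le> (LINT x|lborel. norm (exp (- \<i> * complex_of_real (x * \<xi>)) * f x))"
    by (rule integral_norm_bound)
  also have "\<dots> = (LINT x|lborel. norm (f x))" by (simp add: norm_mult del: of_real_mult)
  finally show ?thesis
    unfolding fourier_def norm_mult by (intro mult_mono) (auto simp: norm_divide)
qed

lemma fourier_measurable:
  assumes "integrable lborel f" shows "fourier f \<in> borel_measurable borel"
proof -
  note [measurable] = borel_measurable_integrable[OF assms]
  have [measurable]: "(\<lambda>p::real \<times> real. exp (- \<i> * complex_of_real (snd p * fst p))) \<in> borel_measurable (borel \<Otimes>\<^sub>M borel)"
    unfolding borel_prod by (intro borel_measurable_continuous_onI continuous_intros)
  have "(\<lambda>\<xi>. LINT x|lborel. exp (- \<i> * complex_of_real (x * \<xi>)) * f x) \<in> borel_measurable borel"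
  proof (rule lborel.borel_measurable_lebesgue_integral)
    have "(\<lambda>p::real \<times> real. exp (- \<i> * complex_of_real (snd p * fst p)) * f (snd p)) \<in> borel_measurable (borel \<Otimes>\<^sub>M lborel)"
      by measurable
    then show "(\<lambda>(\<xi>, x). exp (- \<i> * complex_of_real (x * \<xi>)) * f x) \<in> borel_measurable (borel \<Otimes>\<^sub>M lborel)"
      by (simp add: case_prod_beta')
  qed
  then show ?thesis unfolding fourier_def by measurable
qed

text \<open>Fubini. This identity is what lets the transform of an \<open>L\<^sup>1\<close> function be
  tested against Schwartz functions.\<close>

lemma fourier_multiplication:
  assumes f: "integrable lborel f" and g: "integrable lborel g"
  shows "(LINT x|lborel. f x * fourier g x) = (LINT x|lborel. fourier f x * g x)"
proof -
  note [measurable] = borel_measurable_integrable[OF f] borel_measurable_integrable[OF g]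
  let ?h = "\<lambda>x y. exp (- \<i> * complex_of_real (y * x)) * f x * g y"
  have e [measurable]: "(\<lambda>p::real \<times> real. exp (- \<i> * complex_of_real (snd p * fst p))) \<in> borel_measurable (borel \<Otimes>\<^sub>M borel)"
    unfolding borel_prod by (intro borel_measurable_continuous_onI continuous_intros)
  have "integrable (lborel \<Otimes>\<^sub>M lborel) (\<lambda>p. exp (- \<i> * complex_of_real (snd p * fst p)) * f (fst p) * g (snd p))"
    by (rule integrable_prod_bound[OF f g]) (measurable, simp add: norm_mult del: of_real_mult)
  then have "integrable (lborel \<Otimes>\<^sub>M lborel) (case_prod ?h)"
    by (simp add: case_prod_beta')
  from lborel_pair.Fubini_integral[OF this]
  have F: "(LINT y|lborel. LINT x|lborel. ?h x y) = (LINT x|lborel. LINT y|lborel. ?h x y)" .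
  let ?c = "complex_of_real (1 / sqrt (2 * pi))"
  have "(LINT x|lborel. f x * fourier g x) = ?c * (LINT x|lborel. LINT y|lborel. ?h x y)"
  proof -
    have "f x * fourier g x = ?c * (LINT y|lborel. ?h x y)" for x
    proof -
      have "(LINT y|lborel. ?h x y) = (LINT y|lborel. f x * (exp (- \<i> * complex_of_real (y * x)) * g y))"
        by (intro Bochner_Integration.integral_cong) (simp_all only: mult_ac)
      also have "\<dots> = f x * (LINT y|lborel. exp (- \<i> * complex_of_real (y * x)) * g y)"
        by (rule integral_mult_right_zero)
      finally show ?thesis unfolding fourier_def by (simp only: mult_ac)
    qed
    then show ?thesis by (simp only: integral_mult_right_zero)
  qed
  also have "\<dots> = ?c * (LINT y|lborel. LINT x|lborel. ?h x y)" by (simp only: F)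
  also have "\<dots> = (LINT y|lborel. fourier f y * g y)"
  proof -
    have "fourier f y * g y = ?c * (LINT x|lborel. ?h x y)" for y
    proof -
      have "(LINT x|lborel. ?h x y) = (LINT x|lborel. (exp (- \<i> * complex_of_real (x * y)) * f x) * g y)"
        by (intro Bochner_Integration.integral_cong) (simp_all only: mult_ac)
      also have "\<dots> = (LINT x|lborel. exp (- \<i> * complex_of_real (x * y)) * f x) * g y"
        by (rule integral_mult_left_zero)
      finally show ?thesis unfolding fourier_def by (simp only: mult_ac)
    qed
    then show ?thesis by (simp only: integral_mult_right_zero)
  qed
  finally show ?thesis .
qed

lemma integral_vderiv_schwartz:
  assumes "schwartz f" shows "(LINT x|lborel. vderiv f x) = 0"
proof -
  have "(\<lambda>n. LINT x|lborel. indicator {- real n..real n} x *\<^sub>R vderiv f x) \<longlonglongrightarrow> (LINT x|lborel. vderiv f x)"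
  proof (rule integral_dominated_convergence)
    show "integrable lborel (\<lambda>x. norm (vderiv f x))"
      using schwartz_integrable[OF schwartz_vderiv[OF assms]] by simp
    show "AE x in lborel. (\<lambda>n. indicator {- real n..real n} x *\<^sub>R vderiv f x) \<longlonglongrightarrow> vderiv f x"
    proof (intro AE_I2 tendsto_eventually)
      fix x :: real
      obtain N where "\<bar>x\<bar> \<le> real N" using real_arch_simple by blast
      then have "\<forall>n\<ge>N. x \<in> {- real n..real n}" by (auto simp: abs_le_iff)
      then show "eventually (\<lambda>n. indicator {- real n..real n} x *\<^sub>R vderiv f x = vderiv f x) sequentially"
        unfolding eventually_sequentially by (intro exI[of _ N]) auto
    qed
    show "AE x in lborel. norm (indicator {- real n..real n} x *\<^sub>R vderiv f x) \<le> norm (vderiv f x)" for n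
      by (auto simp: indicator_def)
  qed (use schwartz_measurable[OF schwartz_vderiv[OF assms]] in measurable)
  moreover have "(LINT x|lborel. indicator {- real n..real n} x *\<^sub>R vderiv f x) = f (real n) - f (- real n)" for n
    by (rule integral_FTC_Icc)
      (auto intro: has_vector_derivative_at_within schwartz_has_derivative[OF assms]
        continuous_on_subset[OF schwartz_continuous[OF schwartz_vderiv[OF assms]]])
  moreover have "(\<lambda>n. f (real n) - f (- real n)) \<longlonglongrightarrow> 0"
  proof -
    obtain B where B: "B \<ge> 0" "\<And>x. norm (f x) \<le> B / (1 + x\<^sup>2)" using schwartz_decay[OF assms] by auto
    have "norm (f (real n) - f (- real n)) \<le> 2 * B / (1 + (real n)\<^sup>2)" for n
      using norm_triangle_ineq4[of "f (real n)" "f (- real n)"] B(2)[of "real n"] B(2)[of "- real n"] by simp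
    moreover have "(\<lambda>n. 2 * B / (1 + (real n)\<^sup>2)) \<longlonglongrightarrow> 0" by real_asymp
    ultimately show ?thesis by (rule Lim_null_comparison[OF always_eventually[OF allI]])
  qed
  ultimately show ?thesis using LIMSEQ_unique by fastforce
qed

lemma schwartz_modulate:
  assumes "schwartz f" shows "schwartz (\<lambda>x. exp (- \<i> * complex_of_real (x * \<xi>)) * f x)"
  using schwartz_mult_quadratic_phase[OF assms, of 0 "- \<i> * of_real \<xi>"] by (simp add: mult_ac)

lemma modulate_derivative:
  assumes "schwartz f"
  shows "((\<lambda>x. exp (- \<i> * complex_of_real (x * \<xi>)) * f x) has_vector_derivative
    exp (- \<i> * complex_of_real (x * \<xi>)) * (vderiv f x - \<i> * of_real \<xi> * f x)) (at x)"
proof -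
  have "((\<lambda>x. exp (0 * complex_of_real x ^ 2 + (- \<i> * of_real \<xi>) * of_real x) * f x) has_vector_derivative
    exp (0 * of_real x ^ 2 + (- \<i> * of_real \<xi>) * of_real x) * vderiv f x +
    ((- \<i> * of_real \<xi>) + (2 * 0) * of_real x) * exp (0 * of_real x ^ 2 + (- \<i> * of_real \<xi>) * of_real x) * f x) (at x)"
    by (intro has_vector_derivative_mult exp_quadratic_derivative schwartz_has_derivative assms)
  then show ?thesis by (simp add: algebra_simps)
qed

lemma fourier_vderiv:
  assumes "schwartz f" shows "fourier (vderiv f) \<xi> = \<i> * of_real \<xi> * fourier f \<xi>"
proof -
  let ?e = "\<lambda>x. exp (- \<i> * complex_of_real (x * \<xi>))"
  have "0 = (LINT x|lborel. vderiv (\<lambda>x. ?e x * f x) x)"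
    by (rule integral_vderiv_schwartz[symmetric, OF schwartz_modulate[OF assms]])
  also have "\<dots> = (LINT x|lborel. ?e x * vderiv f x - \<i> * of_real \<xi> * (?e x * f x))"
    by (subst vderiv_eqI[OF modulate_derivative[OF assms]]) (simp add: algebra_simps)
  also have "\<dots> = (LINT x|lborel. ?e x * vderiv f x) - \<i> * of_real \<xi> * (LINT x|lborel. ?e x * f x)"
    using fourier_integrand_integrable[OF schwartz_integrable[OF assms], of \<xi>]
      fourier_integrand_integrable[OF schwartz_integrable[OF schwartz_vderiv[OF assms]], of \<xi>]
    by (subst Bochner_Integration.integral_diff) simp_all
  finally show ?thesis by (simp add: fourier_def)
qed

lemma fourier_has_derivative:
  assumes "schwartz f"
  shows "(fourier f has_vector_derivative fourier (\<lambda>x. - \<i> * (of_real x ^ 1 * f x)) \<xi>) (at \<xi>)"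
proof -
  let ?g = "\<lambda>x. - \<i> * (of_real x ^ 1 * f x)"
  have g: "schwartz ?g" by (intro schwartz_cmult schwartz_times_x assms)
  have "((\<lambda>\<xi>. LINT x|lborel. exp (- \<i> * complex_of_real (x * \<xi>)) * f x) has_vector_derivative
      (LINT x|lborel. exp (- \<i> * complex_of_real (x * \<xi>)) * ?g x)) (at \<xi>)"
  proof (rule integral_parameter_derivative)
    show "integrable lborel (\<lambda>x. exp (- \<i> * complex_of_real (x * \<xi>)) * f x)" for \<xi>
      by (rule fourier_integrand_integrable[OF schwartz_integrable[OF assms]])
    show "((\<lambda>\<xi>. exp (- \<i> * complex_of_real (x * \<xi>)) * f x) has_vector_derivative
        exp (- \<i> * complex_of_real (x * \<xi>)) * ?g x) (at \<xi>)" for \<xi> x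
    proof -
      have "((\<lambda>\<xi>. exp (0 * complex_of_real \<xi> ^ 2 + (- \<i> * of_real x) * of_real \<xi>)) has_vector_derivative
        ((- \<i> * of_real x) + (2 * 0) * of_real \<xi>) * exp (0 * of_real \<xi> ^ 2 + (- \<i> * of_real x) * of_real \<xi>)) (at \<xi>)"
        by (rule exp_quadratic_derivative)
      from has_vector_derivative_mult_left[OF this, of "f x"]
      show ?thesis by (simp add: mult_ac)
    qed
    show "norm (exp (- \<i> * complex_of_real (x * \<xi>)) * ?g x) \<le> norm (?g x)" for \<xi> x
      by (simp add: norm_mult del: of_real_mult)
    show "integrable lborel (\<lambda>x. norm (?g x))" using schwartz_integrable[OF g] by (rule integrable_norm)
    show "(\<lambda>x. exp (- \<i> * complex_of_real (x * \<xi>)) * ?g x) \<in> borel_measurable borel" for \<xi>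
      using schwartz_measurable[OF schwartz_modulate[OF g]] .
  qed
  from has_vector_derivative_mult_right[OF this] show ?thesis unfolding fourier_def .
qed

text \<open>Multiplication by \<open>x\<close> and differentiation exchange roles, so the transforms of
  Schwartz functions are closed under both, up to multiplication by powers of the variable.\<close>

lemma schwartz_fourier:
  assumes "schwartz f" shows "schwartz (fourier f)"
proof (rule schwartz_by_generators[of "{fourier f |f. schwartz f}"])
  fix g assume "g \<in> {fourier f |f. schwartz f}"
  then obtain f where f: "schwartz f" "g = fourier f" by blast
  show "\<exists>g'\<in>cspan {fourier f |f. schwartz f}. \<forall>x. (g has_vector_derivative g' x) (at x)"
  proof (intro bexI allI)
    show "(g has_vector_derivative fourier (\<lambda>x. - \<i> * (of_real x ^ 1 * f x)) x) (at x)" for x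
      unfolding f(2) by (rule fourier_has_derivative[OF f(1)])
    have "schwartz (\<lambda>x. - \<i> * (of_real x ^ 1 * f x))"
      by (intro schwartz_cmult schwartz_times_x f)
    then show "fourier (\<lambda>x. - \<i> * (of_real x ^ 1 * f x)) \<in> cspan {fourier f |f. schwartz f}"
      by (intro cspan_base) blast
  qed
  fix j
  have "\<exists>B. \<forall>x. \<bar>x\<bar> ^ j * norm (fourier f x) \<le> B" if "schwartz f" for f
    using that
  proof (induction j arbitrary: f)
    case 0
    then show ?case using fourier_norm_le[OF schwartz_integrable[OF 0]] by auto
  next
    case (Suc j)
    from Suc.IH[OF schwartz_vderiv[OF Suc.prems]]
    obtain B where "\<And>x. \<bar>x\<bar> ^ j * norm (fourier (vderiv f) x) \<le> B" by blast
    then have "\<bar>x\<bar> ^ Suc j * norm (fourier f x) \<le> B" for x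
      by (simp add: fourier_vderiv[OF Suc.prems] norm_mult mult_ac)
    then show ?case by blast
  qed
  then show "\<exists>B. \<forall>x. \<bar>x\<bar> ^ j * norm (g x) \<le> B" using f by blast
qed (rule cspan_base, use assms in blast)

lemma inv_fourier_eq: "inv_fourier f x = fourier f (- x)"
  unfolding inv_fourier_def fourier_def
  by (intro arg_cong2[where f="(*)"] Bochner_Integration.integral_cong refl) (simp add: mult.commute)

lemma inv_fourier_eq': "inv_fourier f = fourier (\<lambda>x. f (- x))"
proof
  fix x
  have "(LINT y|lborel. exp (\<i> * complex_of_real (x * y)) * f y)
     = (LINT y|lborel. exp (- \<i> * complex_of_real (y * x)) * f (- y))"
  proof -
    have "(LINT y|lborel. exp (\<i> * complex_of_real (x * y)) * f y)
      = \<bar>-1\<bar> *\<^sub>R (LINT y|lborel. exp (\<i> * complex_of_real (x * (0 + -1 * y))) * f (0 + -1 * y))"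
      by (rule lborel_integral_real_affine) simp
    also have "\<dots> = (LINT y|lborel. exp (\<i> * complex_of_real (x * (0 + -1 * y))) * f (0 + -1 * y))"
      by simp
    also have "\<dots> = (LINT y|lborel. exp (- \<i> * complex_of_real (y * x)) * f (- y))"
      by (intro Bochner_Integration.integral_cong refl) (simp add: mult.commute)
    finally show ?thesis .
  qed
  then show "inv_fourier f x = fourier (\<lambda>x. f (- x)) x"
    by (simp only: inv_fourier_def fourier_def)
qed

lemma schwartz_reflect: "schwartz f \<Longrightarrow> schwartz (\<lambda>x. f (- x))"
  using schwartz_affine[of f "-1" 0] by simp

lemma schwartz_inv_fourier: "schwartz f \<Longrightarrow> schwartz (inv_fourier f)"
  unfolding inv_fourier_eq' by (intro schwartz_fourier schwartz_reflect)

definition gauss :: "real \<Rightarrow> complex" where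
  "gauss x = exp (- (of_real x ^ 2) / 2)"

lemma schwartz_gauss': "schwartz gauss"
  using schwartz_gauss unfolding gauss_def[abs_def] .

lemma gauss_eq: "gauss x = of_real (sqrt (2 * pi) * std_normal_density x)"
  by (simp add: gauss_def std_normal_density_def flip: of_real_power exp_of_real)

text \<open>The characteristic function of the normal distribution.\<close>

lemma fourier_gauss: "fourier gauss \<xi> = gauss \<xi>"
proof -
  have "(LINT x|lborel. exp (- \<i> * complex_of_real (x * \<xi>)) * gauss x)
      = (LINT x|lborel. of_real (sqrt (2 * pi)) * (std_normal_density x *\<^sub>R iexp (- \<xi> * x)))"
    by (intro Bochner_Integration.integral_cong) (simp_all add: gauss_eq scaleR_conv_of_real mult_ac)
  also have "\<dots> = of_real (sqrt (2 * pi)) * (LINT x|lborel. std_normal_density x *\<^sub>R iexp (- \<xi> * x))"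
    by (rule integral_mult_right_zero)
  also have "(LINT x|lborel. std_normal_density x *\<^sub>R iexp (- \<xi> * x)) = char std_normal_distribution (- \<xi>)"
    unfolding char_def by (subst integral_density) (auto simp: normal_density_nonneg)
  also have "\<dots> = gauss \<xi>"
    by (simp add: char_std_normal_distribution gauss_def flip: of_real_power exp_of_real)
  finally have "fourier gauss \<xi> = of_real (1 / sqrt (2 * pi) * sqrt (2 * pi)) * gauss \<xi>"
    by (simp only: fourier_def of_real_mult mult.assoc)
  then show ?thesis by simp
qed

lemma integral_gauss: "(LINT x|lborel. gauss x) = of_real (sqrt (2 * pi))"
  using fourier_gauss[of 0] by (simp add: fourier_def gauss_def field_simps)

text \<open>Fourier inversion: insert a wide Gaussian into the inverse transform of \<open>fourier f\<close>, move
  the transform over to the Gaussian, and let the width tend to infinity.\<close>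

lemma fourier_inversion:
  assumes f: "schwartz f" shows "inv_fourier (fourier f) = f"
proof
  fix x :: real
  let ?e = "\<lambda>\<xi>. exp (\<i> * complex_of_real (x * \<xi>))"
  let ?G = "\<lambda>n \<xi>. ?e \<xi> * gauss (\<xi> / real (Suc n))"
  have Gs: "schwartz (\<lambda>\<xi>. gauss (\<xi> / real (Suc n)))" for n
    using schwartz_affine[OF schwartz_gauss', of "1 / real (Suc n)" 0] by simp
  have G: "schwartz (?G n)" for n
    using schwartz_modulate[OF Gs, of "- x" n] by (simp add: mult_ac)
  have FG: "fourier (?G n) y = of_real (real (Suc n)) * gauss (real (Suc n) * (y - x))" for n y
  proof -
    let ?N = "real (Suc n)"
    have "(LINT \<xi>|lborel. exp (- \<i> * complex_of_real (\<xi> * y)) * ?G n \<xi>)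
        = ?N *\<^sub>R (LINT \<xi>|lborel. exp (- \<i> * complex_of_real (\<xi> * (?N * (y - x)))) * gauss \<xi>)"
    proof -
      have "exp (- \<i> * complex_of_real ((0 + ?N * \<xi>) * y)) * ?G n (0 + ?N * \<xi>)
          = exp (- \<i> * complex_of_real (\<xi> * (?N * (y - x)))) * gauss \<xi>" for \<xi>
      proof -
        have "- \<i> * complex_of_real ((0 + ?N * \<xi>) * y) + \<i> * complex_of_real (x * (0 + ?N * \<xi>))
            = - \<i> * complex_of_real (\<xi> * (?N * (y - x)))"
          by (simp add: algebra_simps del: of_nat_Suc)
        then have "exp (- \<i> * complex_of_real ((0 + ?N * \<xi>) * y)) * exp (\<i> * complex_of_real (x * (0 + ?N * \<xi>)))
            = exp (- \<i> * complex_of_real (\<xi> * (?N * (y - x))))"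
          by (metis exp_add)
        moreover have "gauss ((0 + ?N * \<xi>) / ?N) = gauss \<xi>" by simp
        ultimately show ?thesis by (simp only: mult.assoc[symmetric])
      qed
      moreover have "(LINT \<xi>|lborel. exp (- \<i> * complex_of_real (\<xi> * y)) * ?G n \<xi>)
          = \<bar>?N\<bar> *\<^sub>R (LINT \<xi>|lborel. exp (- \<i> * complex_of_real ((0 + ?N * \<xi>) * y)) * ?G n (0 + ?N * \<xi>))"
        by (rule lborel_integral_real_affine) simp
      ultimately show ?thesis by (simp only: abs_of_nat)
    qed
    then have "fourier (?G n) y = of_real ?N * fourier gauss (?N * (y - x))"
      by (simp only: fourier_def scaleR_conv_of_real mult_ac)
    then show ?thesis by (simp only: fourier_gauss)
  qed
  have eq: "(LINT \<xi>|lborel. fourier f \<xi> * ?G n \<xi>) = (LINT z|lborel. f (x + z / real (Suc n)) * gauss z)" for n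
  proof -
    let ?N = "real (Suc n)"
    have "(LINT \<xi>|lborel. fourier f \<xi> * ?G n \<xi>) = (LINT y|lborel. f y * fourier (?G n) y)"
      by (rule fourier_multiplication[symmetric]) (intro schwartz_integrable f G)+
    also have "\<dots> = (LINT y|lborel. of_real ?N * (f y * gauss (?N * (y - x))))"
      by (intro Bochner_Integration.integral_cong refl, unfold FG, rule mult.left_commute)
    also have "\<dots> = of_real ?N * (LINT y|lborel. f y * gauss (?N * (y - x)))"
      by (rule integral_mult_right_zero)
    also have "(LINT y|lborel. f y * gauss (?N * (y - x))) = (1 / ?N) *\<^sub>R (LINT z|lborel. f (x + z / ?N) * gauss z)"
      by (subst lborel_integral_real_affine[where c="1 / ?N" and t=x]) (simp_all del: of_nat_Suc)
    finally show ?thesis by (simp add: scaleR_conv_of_real del: of_nat_Suc)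
  qed
  have lim: "(\<lambda>n. (c::real) + z / real (Suc n)) \<longlonglongrightarrow> c" for c z by real_asymp
  have lim1: "(\<lambda>n. LINT z|lborel. f (x + z / real (Suc n)) * gauss z) \<longlonglongrightarrow> (LINT z|lborel. f x * gauss z)"
  proof -
    obtain B where B: "B \<ge> 0" "\<And>x. norm (f x) \<le> B" using schwartz_bounded[OF f] by auto
    note [measurable] = schwartz_measurable[OF f] schwartz_measurable[OF schwartz_gauss']
    show ?thesis
    proof (rule integral_dominated_convergence)
      show "integrable lborel (\<lambda>z. B * norm (gauss z))" using schwartz_integrable[OF schwartz_gauss'] by simp
      show "AE z in lborel. (\<lambda>n. f (x + z / real (Suc n)) * gauss z) \<longlonglongrightarrow> f x * gauss z"
        using continuous_on_tendsto_compose[OF schwartz_continuous[OF f] lim]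
        by (intro AE_I2 tendsto_mult_right) simp
      show "AE z in lborel. norm (f (x + z / real (Suc n)) * gauss z) \<le> B * norm (gauss z)" for n
        using B by (intro AE_I2) (simp add: norm_mult mult_right_mono del: of_nat_Suc)
    qed measurable
  qed
  have lim2: "(\<lambda>n. LINT \<xi>|lborel. fourier f \<xi> * ?G n \<xi>) \<longlonglongrightarrow> (LINT \<xi>|lborel. fourier f \<xi> * (?e \<xi> * gauss 0))"
  proof -
    note [measurable] = schwartz_measurable[OF schwartz_fourier[OF f]] schwartz_measurable[OF G]
    have [measurable]: "?e \<in> borel_measurable borel"
      by (intro borel_measurable_continuous_onI continuous_intros)
    show ?thesis
    proof (rule integral_dominated_convergence)
      show "integrable lborel (\<lambda>\<xi>. norm (fourier f \<xi>))"
        using schwartz_integrable[OF schwartz_fourier[OF f]] by simp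
      have "(\<lambda>n. gauss (0 + \<xi> / real (Suc n))) \<longlonglongrightarrow> gauss 0" for \<xi>
        by (rule continuous_on_tendsto_compose[OF schwartz_continuous[OF schwartz_gauss'] lim]) simp_all
      then show "AE \<xi> in lborel. (\<lambda>n. fourier f \<xi> * ?G n \<xi>) \<longlonglongrightarrow> fourier f \<xi> * (?e \<xi> * gauss 0)"
        by (intro AE_I2 tendsto_mult_left) (simp del: of_nat_Suc)
      have "norm (gauss y) \<le> 1" for y
        by (simp add: gauss_def norm_exp_eq_Re flip: of_real_power)
      then show "AE \<xi> in lborel. norm (fourier f \<xi> * ?G n \<xi>) \<le> norm (fourier f \<xi>)" for n
        by (intro AE_I2) (simp add: norm_mult mult_left_le del: of_nat_Suc of_real_mult)
    qed (measurable)
  qed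
  have "(LINT \<xi>|lborel. fourier f \<xi> * (?e \<xi> * gauss 0)) = (LINT z|lborel. f x * gauss z)"
    by (rule LIMSEQ_unique[OF lim2]) (use lim1 in \<open>simp only: eq\<close>)
  also have "\<dots> = f x * of_real (sqrt (2 * pi))" by (simp add: integral_gauss)
  finally have "(LINT \<xi>|lborel. ?e \<xi> * fourier f \<xi>) = f x * of_real (sqrt (2 * pi))"
    by (simp add: gauss_def mult_ac)
  then show "inv_fourier (fourier f) x = f x"
    by (simp add: inv_fourier_def field_simps)
qed

lemma fourier_inversion':
  assumes f: "schwartz f" shows "fourier (inv_fourier f) = f"
proof
  fix x
  have "fourier (inv_fourier f) x = inv_fourier (fourier (\<lambda>x. f (- x))) (- x)"
    by (simp add: inv_fourier_eq' inv_fourier_eq flip: inv_fourier_eq')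
  also have "\<dots> = f x" by (simp add: fourier_inversion[OF schwartz_reflect[OF f]])
  finally show "fourier (inv_fourier f) x = f x" .
qed

lemma cnj_fourier: "cnj (fourier f \<xi>) = inv_fourier (\<lambda>x. cnj (f x)) \<xi>"
  by (simp add: fourier_def inv_fourier_def exp_cnj mult_ac flip: Bochner_Integration.integral_cnj)

lemma plancherel_schwartz:
  assumes f: "schwartz f" shows "l2 (fourier f) = l2 f"
proof -
  have sq: "of_real ((norm z)\<^sup>2) = z * cnj z" for z by (rule complex_norm_square)
  have "complex_of_real ((l2 (fourier f))\<^sup>2) = (LINT x|lborel. fourier f x * cnj (fourier f x))"
    by (simp only: l2_power2 sq flip: integral_complex_of_real)
  also have "\<dots> = (LINT x|lborel. f x * fourier (\<lambda>x. cnj (fourier f x)) x)"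
    by (intro fourier_multiplication[symmetric] schwartz_integrable f schwartz_fourier schwartz_cnj)
  also have "(\<lambda>x. fourier (\<lambda>x. cnj (fourier f x)) x) = (\<lambda>x. cnj (f x))"
  proof
    fix x
    have "cnj (fourier (\<lambda>x. cnj (fourier f x)) x) = inv_fourier (fourier f) x"
      using cnj_fourier[of "\<lambda>x. cnj (fourier f x)" x] by simp
    then show "fourier (\<lambda>x. cnj (fourier f x)) x = cnj (f x)"
      using fourier_inversion[OF f] by (metis complex_cnj_cnj)
  qed
  also have "(LINT x|lborel. f x * cnj (f x)) = complex_of_real ((l2 f)\<^sup>2)"
    by (simp only: l2_power2 sq flip: integral_complex_of_real)
  finally have "(l2 (fourier f))\<^sup>2 = (l2 f)\<^sup>2" by (simp only: of_real_eq_iff)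
  then show ?thesis by (simp add: power2_eq_iff_nonneg)
qed

lemma plancherel_inv: "schwartz f \<Longrightarrow> l2 (inv_fourier f) = l2 f"
  by (metis fourier_inversion' plancherel_schwartz schwartz_inv_fourier)

section \<open>Gaussian mollification and duality\<close>

lemma dominated_integral:
  fixes f :: "real \<Rightarrow> complex"
  assumes g: "integrable lborel g" and f: "f \<in> borel_measurable borel" and le: "\<And>x. norm (f x) \<le> g x"
  shows "integrable lborel f" "norm (LINT x|lborel. f x) \<le> (LINT x|lborel. g x)"
proof -
  show i: "integrable lborel f"
  proof (rule Bochner_Integration.integrable_bound[OF g])
    show "AE x in lborel. norm (f x) \<le> norm (g x)"
      using order_trans[OF le abs_ge_self] by (intro AE_I2) simp
  qed (use f in simp)
  have "norm (LINT x|lborel. f x) \<le> (LINT x|lborel. norm (f x))" by (rule integral_norm_bound)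
  also have "\<dots> \<le> (LINT x|lborel. g x)" using i g le by (intro integral_mono) auto
  finally show "norm (LINT x|lborel. f x) \<le> (LINT x|lborel. g x)" .
qed

lemma l2_fatou:
  assumes fn: "\<And>n. sqint (f n)" and A: "\<And>n. l2 (f n) \<le> A"
    and [measurable]: "g \<in> borel_measurable borel"
    and lim: "AE x in lborel. (\<lambda>n. f n x) \<longlonglongrightarrow> g x"
  shows "sqint g" "l2 g \<le> A"
proof -
  note [measurable] = sqint_measurable[OF fn]
  have A0: "0 \<le> A" using A[of 0] l2_nonneg order_trans by blast
  have "(\<integral>\<^sup>+x. ennreal ((norm (g x))\<^sup>2) \<partial>lborel) = (\<integral>\<^sup>+x. liminf (\<lambda>n. ennreal ((norm (f n x))\<^sup>2)) \<partial>lborel)"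
  proof (rule nn_integral_cong_AE)
    show "AE x in lborel. ennreal ((norm (g x))\<^sup>2) = liminf (\<lambda>n. ennreal ((norm (f n x))\<^sup>2))"
      using lim
    proof eventually_elim
      case (elim x)
      have "(\<lambda>n. ennreal ((norm (f n x))\<^sup>2)) \<longlonglongrightarrow> ennreal ((norm (g x))\<^sup>2)"
        by (intro tendsto_ennrealI tendsto_intros elim)
      then show ?case by (rule lim_imp_Liminf[OF sequentially_bot, symmetric])
    qed
  qed
  also have "\<dots> \<le> liminf (\<lambda>n. \<integral>\<^sup>+x. ennreal ((norm (f n x))\<^sup>2) \<partial>lborel)"
    by (rule nn_integral_liminf) measurable
  also have "\<dots> \<le> liminf (\<lambda>n::nat. ennreal (A\<^sup>2))"
  proof (rule Liminf_mono, intro always_eventually allI)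
    fix n
    have "(\<integral>\<^sup>+x. ennreal ((norm (f n x))\<^sup>2) \<partial>lborel) = ennreal ((l2 (f n))\<^sup>2)"
      using nn_integral_eq_integral[OF sqint_integrable[OF fn]] by (simp add: l2_power2)
    also have "\<dots> \<le> ennreal (A\<^sup>2)" using A by (intro ennreal_leI power_mono) auto
    finally show "(\<integral>\<^sup>+x. ennreal ((norm (f n x))\<^sup>2) \<partial>lborel) \<le> ennreal (A\<^sup>2)" .
  qed
  also have "\<dots> = ennreal (A\<^sup>2)" by (simp add: Liminf_const)
  finally have le: "(\<integral>\<^sup>+x. ennreal ((norm (g x))\<^sup>2) \<partial>lborel) \<le> ennreal (A\<^sup>2)" .
  have "integrable lborel (\<lambda>x. (norm (g x))\<^sup>2)"
    using le by (intro integrableI_nonneg) (auto intro: le_less_trans)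
  then show g: "sqint g" by (simp add: sqint_def)
  have "ennreal ((l2 g)\<^sup>2) \<le> ennreal (A\<^sup>2)"
    using nn_integral_eq_integral[OF sqint_integrable[OF g]] le by (simp add: l2_power2)
  then have "(l2 g)\<^sup>2 \<le> A\<^sup>2" by (simp add: ennreal_le_iff)
  then show "l2 g \<le> A" using A0 by (rule power2_le_imp_le)
qed

definition truncation :: "nat \<Rightarrow> (real \<Rightarrow> complex) \<Rightarrow> real \<Rightarrow> complex" where
  "truncation n f x = (if \<bar>x\<bar> \<le> real n \<and> norm (f x) \<le> real n then f x else 0)"

lemma truncation_measurable [measurable]:
  assumes [measurable]: "f \<in> borel_measurable borel"
  shows "truncation n f \<in> borel_measurable borel"
  unfolding truncation_def[abs_def] by measurable

lemma truncation_tendsto: "(\<lambda>n. truncation n f x) \<longlonglongrightarrow> f x"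
proof (rule tendsto_eventually)
  obtain N where "max \<bar>x\<bar> (norm (f x)) \<le> real N" using real_arch_simple by blast
  then show "eventually (\<lambda>n. truncation n f x = f x) sequentially"
    unfolding eventually_sequentially by (intro exI[of _ N]) (auto simp: truncation_def)
qed

lemma truncation_norm: "norm (truncation n f x) \<le> real n" "norm (truncation n f x) \<le> norm (f x)"
  "truncation n f x = 0 \<or> \<bar>x\<bar> \<le> real n"
  by (auto simp: truncation_def)

text \<open>A measurable function is an almost everywhere limit of continuous ones; the bound and the support
  of the approximants are kept under control so that dominated convergence applies to them.\<close>

lemma continuous_approximation:
  fixes k :: "real \<Rightarrow> complex"
  assumes k: "k \<in> borel_measurable borel" and B: "\<And>x. norm (k x) \<le> B" "0 < B"
    and R: "\<And>x. R < \<bar>x\<bar> \<Longrightarrow> k x = 0"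
  obtains g :: "nat \<Rightarrow> real \<Rightarrow> complex" where
    "\<And>n. continuous_on UNIV (g n)" "\<And>n x. norm (g n x) \<le> B" "\<And>n x. R + 1 < \<bar>x\<bar> \<Longrightarrow> g n x = 0"
    "AE x in lborel. (\<lambda>n. g n x) \<longlonglongrightarrow> k x"
proof -
  have "k \<in> borel_measurable lebesgue" using k by (intro measurable_completion) simp
  then have "k measurable_on UNIV" by (intro lebesgue_measurable_imp_measurable_on) auto
  then obtain N g where N: "negligible N" and g: "\<And>n. continuous_on UNIV (g n)"
    and lim: "\<And>x. x \<notin> N \<Longrightarrow> (\<lambda>n. g n x) \<longlonglongrightarrow> k x"
    unfolding measurable_on_def by auto
  define h where "h n x = (max 0 (min 1 (R + 1 - \<bar>x\<bar>)) * (B / max B (norm (g n x)))) *\<^sub>R g n x" for n x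
  show ?thesis
  proof
    show "continuous_on UNIV (h n)" for n
      unfolding h_def using B(2) by (intro continuous_intros g) (auto simp: max_def)
    show "norm (h n x) \<le> B" for n x
    proof -
      have "norm (h n x) = max 0 (min 1 (R + 1 - \<bar>x\<bar>)) * (B * norm (g n x) / max B (norm (g n x)))"
        using B(2) by (simp add: h_def abs_mult)
      also have "\<dots> \<le> 1 * B"
      proof (intro mult_mono)
        have "B * norm (g n x) \<le> B * max B (norm (g n x))" using B(2) by (intro mult_left_mono) auto
        then show "B * norm (g n x) / max B (norm (g n x)) \<le> B" using B(2) by (simp add: divide_le_eq max_def)
      qed (use B(2) in auto)
      finally show ?thesis by simp
    qed
    show "h n x = 0" if "R + 1 < \<bar>x\<bar>" for n x using that by (simp add: h_def)
    have "AE x in lborel. x \<notin> N"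
      using N by (metis AE_completion_iff AE_not_in negligible_iff_null_sets)
    then show "AE x in lborel. (\<lambda>n. h n x) \<longlonglongrightarrow> k x"
    proof eventually_elim
      case (elim x)
      have "(\<lambda>n. h n x) \<longlonglongrightarrow> (max 0 (min 1 (R + 1 - \<bar>x\<bar>)) * (B / max B (norm (k x)))) *\<^sub>R k x"
        unfolding h_def using B(2) by (intro tendsto_intros lim elim) (auto simp: max_def)
      moreover have "(max 0 (min 1 (R + 1 - \<bar>x\<bar>)) * (B / max B (norm (k x)))) *\<^sub>R k x = k x"
        using R[of x] B(1)[of x] B(2) by (cases "R < \<bar>x\<bar>") (auto simp: max_def min_def)
      ultimately show ?case by simp
    qed
  qed
qed

lemma integrable_indicator_sq:
  fixes a b B :: real
  shows "integrable lborel (\<lambda>x. (B * indicator {a..b} x)\<^sup>2 :: real)"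
proof -
  have "(\<lambda>x. (B * indicator {a..b} x)\<^sup>2) = (\<lambda>x. B\<^sup>2 * indicator {a..b} x :: real)"
    by (auto simp: indicator_def)
  moreover have "integrable lborel (\<lambda>x. B\<^sup>2 * indicator {a..b} x :: real)"
    by (intro integrable_mult_right integrable_real_indicator) (auto simp: emeasure_lborel_Icc_eq)
  ultimately show ?thesis by simp
qed

lemma cpt_bounded_sqint:
  assumes "g \<in> borel_measurable borel" "\<And>x. norm (g x) \<le> B" "\<And>x. R < \<bar>x\<bar> \<Longrightarrow> g x = 0"
  shows "sqint g"
proof (rule sqint_of_decay[of g "B * (1 + R\<^sup>2)"])
  fix x :: real
  have B: "0 \<le> B" using assms(2)[of x] norm_ge_zero order_trans by blast
  show "norm (g x) \<le> B * (1 + R\<^sup>2) / (1 + x\<^sup>2)"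
  proof (cases "R < \<bar>x\<bar>")
    case True then show ?thesis using assms(3) B by simp
  next
    case False
    then have "x\<^sup>2 \<le> R\<^sup>2" by (intro abs_le_square_iff[THEN iffD1]) auto
    then have "B * (1 + x\<^sup>2) \<le> B * (1 + R\<^sup>2)" using B by (intro mult_left_mono) auto
    then have "B \<le> B * (1 + R\<^sup>2) / (1 + x\<^sup>2)" by (simp add: field_simps add_pos_nonneg)
    then show ?thesis using assms(2)[of x] by linarith
  qed
qed (rule assms(1))

lemma cpt_bounded_integrable:
  assumes "f \<in> borel_measurable borel" "\<And>x. norm (f x) \<le> B" "\<And>x. R < \<bar>x\<bar> \<Longrightarrow> f x = 0"
  shows "integrable lborel (f :: real \<Rightarrow> complex)"
proof (rule Bochner_Integration.integrable_bound)
  show "integrable lborel (\<lambda>x. B * indicator {- R..R} x)"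
    by (intro integrable_mult_right integrable_real_indicator) (auto simp: emeasure_lborel_Icc_eq)
  have "0 \<le> B" using assms(2)[of 0] norm_ge_zero order_trans by blast
  then show "AE x in lborel. norm (f x) \<le> norm (B * indicator {- R..R} x)"
    using assms(2,3) by (intro AE_I2) (auto simp: indicator_def abs_le_iff not_le abs_less_iff)
qed (use assms in simp)

definition conv :: "(real \<Rightarrow> complex) \<Rightarrow> (real \<Rightarrow> complex) \<Rightarrow> real \<Rightarrow> complex" where
  "conv k f x = (LINT y|lborel. k y * f (x - y))"

text \<open>The derivative falls on the Schwartz factor, by differentiation under the integral sign.\<close>

lemma conv_has_derivative:
  assumes k: "integrable lborel k" and f: "schwartz f"
  shows "(conv k f has_vector_derivative conv k (vderiv f) x) (at x)"
proof -
  note [measurable] = borel_measurable_integrable[OF k] schwartz_measurable[OF f]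
    schwartz_measurable[OF schwartz_vderiv[OF f]]
  obtain B where B: "B \<ge> 0" "\<And>x. norm (f x) \<le> B" using schwartz_bounded[OF f] by auto
  obtain B' where B': "B' \<ge> 0" "\<And>x. norm (vderiv f x) \<le> B'"
    using schwartz_bounded[OF schwartz_vderiv[OF f]] by auto
  show ?thesis
    unfolding conv_def[abs_def]
  proof (rule integral_parameter_derivative)
  show "integrable lborel (\<lambda>y. k y * f (x - y))" for x
  proof (rule Bochner_Integration.integrable_bound)
    show "integrable lborel (\<lambda>y. B * k y)" using k by simp
    show "AE y in lborel. norm (k y * f (x - y)) \<le> norm (of_real B * k y)"
      using B by (intro AE_I2) (simp add: norm_mult mult.commute[of B] mult_left_mono)
  qed measurable
  show "((\<lambda>x. k y * f (x - y)) has_vector_derivative k y * vderiv f (x - y)) (at x)" for x y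
  proof -
    have "((\<lambda>x. x - y) has_vector_derivative 1) (at x)"
      unfolding has_real_derivative_iff_has_vector_derivative[symmetric] by (auto intro!: derivative_eq_intros)
    from vector_diff_chain_at[OF this schwartz_has_derivative[OF f]]
    show ?thesis by (intro has_vector_derivative_mult_right) (simp add: comp_def)
  qed
  show "norm (k y * vderiv f (x - y)) \<le> B' * norm (k y)" for x y
    using B' by (simp add: norm_mult mult.commute[of B'] mult_left_mono)
  show "integrable lborel (\<lambda>y. B' * norm (k y))" using k by simp
  qed measurable
qed

text \<open>Decay of the convolution comes from splitting the weight, \<open>1 + |x| \<le> (1 + |y|) (1 + |x
  - y|)\<close>.\<close>

lemma schwartz_conv:
  assumes k: "k \<in> borel_measurable borel" "\<And>j. integrable lborel (\<lambda>y. (1 + \<bar>y\<bar>) ^ j * norm (k y))"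
    and f: "schwartz f"
  shows "schwartz (conv k f)"
proof (rule schwartz_by_generators[of "{conv k f |f. schwartz f}"])
  have ik: "integrable lborel k"
    using k(2)[of 0] k(1) integrable_norm_iff[of k lborel] by simp
  fix g assume "g \<in> {conv k f |f. schwartz f}"
  then obtain f where f: "schwartz f" "g = conv k f" by blast
  show "\<exists>g'\<in>cspan {conv k f |f. schwartz f}. \<forall>x. (g has_vector_derivative g' x) (at x)"
  proof (intro bexI allI)
    show "(g has_vector_derivative conv k (vderiv f) x) (at x)" for x
      unfolding f(2) by (rule conv_has_derivative[OF ik f(1)])
    show "conv k (vderiv f) \<in> cspan {conv k f |f. schwartz f}"
      using schwartz_vderiv[OF f(1)] by (intro cspan_base) blast
  qed
  fix j
  obtain B where B: "0 \<le> B" "\<And>x. (1 + \<bar>x\<bar>) ^ j * norm (f x) \<le> B" using schwartz_weight_bound[OF f(1), of j] by auto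
  have "\<bar>x\<bar> ^ j * norm (g x) \<le> (LINT y|lborel. B * ((1 + \<bar>y\<bar>) ^ j * norm (k y)))" for x
  proof -
    have "\<bar>x\<bar> ^ j * norm (g x) = norm (LINT y|lborel. of_real (\<bar>x\<bar> ^ j) * (k y * f (x - y)))"
      unfolding f(2) conv_def by (simp add: norm_mult norm_power)
    also have "\<dots> \<le> (LINT y|lborel. B * ((1 + \<bar>y\<bar>) ^ j * norm (k y)))"
    proof (rule dominated_integral(2))
      show "integrable lborel (\<lambda>y. B * ((1 + \<bar>y\<bar>) ^ j * norm (k y)))" using k(2) by simp
      show "(\<lambda>y. of_real (\<bar>x\<bar> ^ j) * (k y * f (x - y))) \<in> borel_measurable borel"
        using k(1) schwartz_measurable[OF f(1)] by measurable
      show "norm (of_real (\<bar>x\<bar> ^ j) * (k y * f (x - y))) \<le> B * ((1 + \<bar>y\<bar>) ^ j * norm (k y))" for y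
      proof -
        have "\<bar>x\<bar> \<le> \<bar>y\<bar> + \<bar>x - y\<bar>" by linarith
        also have "\<dots> \<le> (1 + \<bar>y\<bar>) * (1 + \<bar>x - y\<bar>)" by (simp add: algebra_simps)
        finally have "\<bar>x\<bar> ^ j \<le> ((1 + \<bar>y\<bar>) * (1 + \<bar>x - y\<bar>)) ^ j" by (intro power_mono) auto
        then have "norm (of_real (\<bar>x\<bar> ^ j) * (k y * f (x - y)))
            \<le> ((1 + \<bar>y\<bar>) * (1 + \<bar>x - y\<bar>)) ^ j * (norm (k y) * norm (f (x - y)))"
          by (simp add: norm_mult norm_power mult_right_mono)
        also have "\<dots> = ((1 + \<bar>y\<bar>) ^ j * norm (k y)) * ((1 + \<bar>x - y\<bar>) ^ j * norm (f (x - y)))"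
          by (simp add: power_mult_distrib mult_ac)
        also have "\<dots> \<le> ((1 + \<bar>y\<bar>) ^ j * norm (k y)) * B"
          by (intro mult_left_mono B) auto
        finally show ?thesis by (simp add: mult.commute)
      qed
    qed
    finally show ?thesis .
  qed
  then show "\<exists>B. \<forall>x. \<bar>x\<bar> ^ j * norm (g x) \<le> B" by blast
qed (rule cspan_base, use f in blast)

text \<open>The Gaussian probability density of standard deviation \<open>1 / (n + 1)\<close>, an
  approximate identity consisting of Schwartz functions.\<close>

definition heat :: "nat \<Rightarrow> real \<Rightarrow> complex" where
  "heat n z = of_real (real (Suc n)) * (gauss (real (Suc n) * z) / of_real (sqrt (2 * pi)))"

abbreviation moll :: "nat \<Rightarrow> (real \<Rightarrow> complex) \<Rightarrow> real \<Rightarrow> complex" where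
  "moll n f \<equiv> conv f (heat n)"

lemma schwartz_heat: "schwartz (heat n)"
proof -
  have "schwartz (\<lambda>z. of_real (real (Suc n)) * (1 / of_real (sqrt (2 * pi))) * gauss (0 + real (Suc n) * z))"
    by (intro schwartz_cmult schwartz_affine schwartz_gauss') simp
  moreover have "(\<lambda>z. of_real (real (Suc n)) * (1 / of_real (sqrt (2 * pi))) * gauss (0 + real (Suc n) * z)) = heat n"
    by (rule ext) (simp add: heat_def)
  ultimately show ?thesis by simp
qed

definition rho :: "real \<Rightarrow> real" where "rho z = std_normal_density z"

lemma rho_facts: "rho z \<ge> 0" "integrable lborel rho" "(LINT z|lborel. rho z) = 1" "rho z \<le> 1"
  "rho \<in> borel_measurable borel" "gauss z / of_real (sqrt (2 * pi)) = of_real (rho z)"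
proof -
  show "rho z \<ge> 0" "integrable lborel rho" "(LINT z|lborel. rho z) = 1" "rho \<in> borel_measurable borel"
    using integrable_std_normal_moment[of 0] integral_std_normal_moment_even[of 0]
    by (simp_all add: rho_def[abs_def])
  have "1 \<le> sqrt (2 * pi)" using pi_gt3 by simp
  then have "1 / sqrt (2 * pi) \<le> 1" by (simp add: divide_le_eq)
  then have "1 / sqrt (2 * pi) * exp (- z\<^sup>2 / 2) \<le> 1 * 1" by (intro mult_mono) auto
  then show "rho z \<le> 1" by (simp add: rho_def std_normal_density_def)
  show "gauss z / of_real (sqrt (2 * pi)) = of_real (rho z)" by (simp add: rho_def gauss_eq)
qed

text \<open>After rescaling, mollification averages translates of \<open>f\<close> against one fixed
  probability density, which makes the dependence on \<open>n\<close> accessible to dominated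
  convergence and to Jensen-type estimates.\<close>

lemma moll_alt: "moll n f x = (LINT z|lborel. f (x - z / real (Suc n)) * of_real (rho z))"
proof -
  let ?N = "real (Suc n)"
  have "moll n f x = \<bar>- (1 / ?N)\<bar> *\<^sub>R (LINT z|lborel. f (x + - (1 / ?N) * z) * heat n (x - (x + - (1 / ?N) * z)))"
    unfolding conv_def by (rule lborel_integral_real_affine) simp
  also have "(\<lambda>z. f (x + - (1 / ?N) * z) * heat n (x - (x + - (1 / ?N) * z)))
      = (\<lambda>z. of_real ?N * (f (x - z / ?N) * of_real (rho z)))"
    by (rule ext) (simp add: heat_def rho_facts(6)[symmetric] del: of_nat_Suc)
  also have "\<bar>- (1 / ?N)\<bar> *\<^sub>R (LINT z|lborel. of_real ?N * (f (x - z / ?N) * of_real (rho z)))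
      = (LINT z|lborel. f (x - z / ?N) * of_real (rho z))"
    by (simp add: scaleR_conv_of_real del: of_nat_Suc)
  finally show ?thesis .
qed

lemma inv_Suc_lim: "(\<lambda>n. (c::real) - z / real (Suc n)) \<longlonglongrightarrow> c"
  by real_asymp

lemma moll_bounded_continuous:
  assumes f: "continuous_on UNIV f" and B: "\<And>x. norm (f x) \<le> B"
  shows "(\<lambda>n. moll n f x) \<longlonglongrightarrow> f x" "norm (moll n f x) \<le> B"
proof -
  note [measurable] = borel_measurable_continuous_onI[OF f] rho_facts(5)
  have B0: "0 \<le> B" using B[of 0] norm_ge_zero order_trans by blast
  have iB: "integrable lborel (\<lambda>z. B * rho z)" using rho_facts(2) by simp
  have bd: "norm (f (x - z / real (Suc n)) * of_real (rho z)) \<le> B * rho z" for n z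
    using B rho_facts(1) by (simp add: norm_mult mult_right_mono del: of_nat_Suc)
  have "(\<lambda>n. LINT z|lborel. f (x - z / real (Suc n)) * of_real (rho z)) \<longlonglongrightarrow> (LINT z|lborel. f x * of_real (rho z))"
  proof (rule integral_dominated_convergence[OF _ _ iB])
    show "AE z in lborel. (\<lambda>n. f (x - z / real (Suc n)) * of_real (rho z)) \<longlonglongrightarrow> f x * of_real (rho z)"
      using continuous_on_tendsto_compose[OF f inv_Suc_lim]
      by (intro AE_I2 tendsto_mult_right) (simp del: of_nat_Suc)
  qed (use bd in \<open>simp_all del: of_nat_Suc\<close>)
  also have "(LINT z|lborel. f x * of_real (rho z)) = f x"
    using rho_facts(3) by (simp add: integral_complex_of_real)
  finally show "(\<lambda>n. moll n f x) \<longlonglongrightarrow> f x" unfolding moll_alt .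
  have "norm (moll n f x) \<le> (LINT z|lborel. B * rho z)"
    unfolding moll_alt
  proof (rule dominated_integral(2)[OF iB])
    show "(\<lambda>z. f (x - z / real (Suc n)) * of_real (rho z)) \<in> borel_measurable borel" by measurable
  qed (use bd in simp)
  then show "norm (moll n f x) \<le> B" using rho_facts(3) by simp
qed

lemma schwartz_moll_cpt:
  assumes g: "continuous_on UNIV g" "\<And>x. norm (g x) \<le> B" "\<And>x. R < \<bar>x\<bar> \<Longrightarrow> g x = 0"
  shows "schwartz (moll n g)"
proof (rule schwartz_conv[OF _ _ schwartz_heat])
  show [measurable]: "g \<in> borel_measurable borel" by (rule borel_measurable_continuous_onI[OF g(1)])
  fix j
  have "integrable lborel (\<lambda>y. complex_of_real ((1 + \<bar>y\<bar>) ^ j * norm (g y)))"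
  proof (rule cpt_bounded_integrable)
    show "(\<lambda>y. complex_of_real ((1 + \<bar>y\<bar>) ^ j * norm (g y))) \<in> borel_measurable borel" by measurable
    show "norm (complex_of_real ((1 + \<bar>x\<bar>) ^ j * norm (g x))) \<le> (1 + \<bar>R\<bar>) ^ j * B" for x
    proof (cases "R < \<bar>x\<bar>")
      case True
      have "0 \<le> B" using g(2)[of 0] norm_ge_zero order_trans by blast
      then show ?thesis using g(3)[OF True] unfolding norm_of_real by simp
    next
      case False
      then have "(1 + \<bar>x\<bar>) ^ j * norm (g x) \<le> (1 + \<bar>R\<bar>) ^ j * B"
        using g(2) by (intro mult_mono power_mono) auto
      then show ?thesis unfolding norm_of_real by simp
    qed
    show "R < \<bar>x\<bar> \<Longrightarrow> complex_of_real ((1 + \<bar>x\<bar>) ^ j * norm (g x)) = 0" for x using g(3) by simp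
  qed
  then show "integrable lborel (\<lambda>y. (1 + \<bar>y\<bar>) ^ j * norm (g y))"
    by (subst (asm) complex_of_real_integrable_eq)
qed

text \<open>The Riesz representation of a functional, for a functional that is already given by a function.
  The bound is extended from Schwartz functions to continuous functions of compact support by
  mollification, then to bounded measurable functions of bounded support, and finally applied to
  the conjugate of a truncation of \<open>f\<close>, for which both sides are powers of one and
  the same norm.\<close>

lemma l2_by_duality:
  assumes f [measurable]: "f \<in> borel_measurable borel"
    and int: "\<And>\<psi>. schwartz \<psi> \<Longrightarrow> integrable lborel (\<lambda>x. f x * \<psi> x)"
    and A: "\<And>\<psi>. schwartz \<psi> \<Longrightarrow> norm (LINT x|lborel. f x * \<psi> x) \<le> A * l2 \<psi>"
    and A0: "0 \<le> A"
  shows "sqint f" "l2 f \<le> A"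
proof -
  have fg: "integrable lborel (\<lambda>x. f x * gauss x)" by (rule int[OF schwartz_gauss'])
  have gpos: "gauss x \<noteq> 0" "norm (gauss x) = exp (- x\<^sup>2 / 2)" for x
    by (simp_all add: gauss_def norm_exp_eq_Re flip: of_real_power)
  note [measurable] = schwartz_measurable[OF schwartz_gauss']
  have cpt: "norm (LINT x|lborel. f x * k x) \<le> A * l2 k"
    if k: "continuous_on UNIV k" "\<And>x. norm (k x) \<le> B" "\<And>x. R < \<bar>x\<bar> \<Longrightarrow> k x = 0" for k B R
  proof -
    \<comment> \<open>only the products of \<open>f\<close> with Schwartz functions are integrable; mollifying \<open>k / gauss\<close> and multiplying by \<open>gauss\<close> gives approximants dominated by a multiple of \<open>gauss\<close>\<close>
    define h where "h x = k x / gauss x" for x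
    have h: "continuous_on UNIV h" unfolding h_def[abs_def]
      by (intro continuous_intros k(1) schwartz_continuous[OF schwartz_gauss']) (simp add: gpos)
    have B0: "0 \<le> B" using k(2)[of 0] norm_ge_zero order_trans by blast
    have hB: "norm (h x) \<le> B * exp (R\<^sup>2 / 2)" for x
    proof (cases "R < \<bar>x\<bar>")
      case True then show ?thesis using k(3) B0 by (simp add: h_def)
    next
      case False
      then have "x\<^sup>2 \<le> R\<^sup>2" by (intro abs_le_square_iff[THEN iffD1]) auto
      have "norm (h x) = norm (k x) * exp (x\<^sup>2 / 2)" by (simp add: h_def norm_divide gpos exp_minus field_simps)
      also have "\<dots> \<le> B * exp (R\<^sup>2 / 2)" using k(2) B0 \<open>x\<^sup>2 \<le> R\<^sup>2\<close> by (intro mult_mono) auto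
      finally show ?thesis .
    qed
    have h0: "R < \<bar>x\<bar> \<Longrightarrow> h x = 0" for x using k(3) by (simp add: h_def)
    let ?B = "B * exp (R\<^sup>2 / 2)"
    let ?p = "\<lambda>n x. gauss x * moll n h x"
    have ps: "schwartz (?p n)" for n
    proof -
      have "schwartz (moll n h)" by (rule schwartz_moll_cpt[OF h hB]) (rule h0)
      then have "schwartz (\<lambda>x. exp ((-1/2) * of_real x ^ 2 + 0 * of_real x) * moll n h x)"
        by (rule schwartz_mult_quadratic_phase) simp_all
      then show ?thesis by (simp add: gauss_def)
    qed
    have plim: "(\<lambda>n. ?p n x) \<longlonglongrightarrow> k x" for x
    proof -
      have "(\<lambda>n. ?p n x) \<longlonglongrightarrow> gauss x * h x" by (intro tendsto_intros moll_bounded_continuous[OF h hB])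
      then show ?thesis by (simp add: h_def gpos)
    qed
    have pB: "norm (?p n x) \<le> ?B * norm (gauss x)" for n x
      using mult_left_mono[OF moll_bounded_continuous(2)[OF h hB, of n x], of "norm (gauss x)"]
      by (simp add: norm_mult mult.commute)
    have km [measurable]: "k \<in> borel_measurable borel" by (rule borel_measurable_continuous_onI[OF k(1)])
    note [measurable] = schwartz_measurable[OF ps]
    have 1: "(\<lambda>n. LINT x|lborel. f x * ?p n x) \<longlonglongrightarrow> (LINT x|lborel. f x * k x)"
    proof (rule integral_dominated_convergence)
      show "integrable lborel (\<lambda>x. ?B * norm (f x * gauss x))" using fg by simp
      show "AE x in lborel. norm (f x * ?p n x) \<le> ?B * norm (f x * gauss x)" for n
      proof (intro AE_I2)
        fix x
        have "norm (f x) * norm (?p n x) \<le> norm (f x) * (?B * norm (gauss x))"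
          by (intro mult_left_mono pB) simp
        then show "norm (f x * ?p n x) \<le> ?B * norm (f x * gauss x)"
          by (simp add: norm_mult mult_ac)
      qed
      show "AE x in lborel. (\<lambda>n. f x * ?p n x) \<longlonglongrightarrow> f x * k x"
        by (intro AE_I2 tendsto_mult_left plim)
    qed measurable
    have w: "integrable lborel (\<lambda>x. (?B * norm (gauss x))\<^sup>2)"
      using sqint_integrable[OF schwartz_sqint[OF schwartz_gauss']] by (simp add: power_mult_distrib)
    note dom = l2_dominated_tendsto[of ?p k "\<lambda>x. ?B * norm (gauss x)", OF schwartz_measurable[OF ps] km w AE_I2[OF plim] AE_I2[OF pB]]
    have 2: "(\<lambda>n. A * l2 (?p n)) \<longlonglongrightarrow> A * l2 k"
      by (intro tendsto_mult_left l2_tendsto dom(3) dom(1) dom(2))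
    show ?thesis
      by (rule LIMSEQ_le[OF tendsto_norm[OF 1] 2]) (use A[OF ps] in auto)
  qed
  have locint: "integrable lborel (\<lambda>x. indicator {- R..R} x *\<^sub>R f x)" for R
  proof (rule Bochner_Integration.integrable_bound)
    show "integrable lborel (\<lambda>x. exp (R\<^sup>2 / 2) * norm (f x * gauss x))" using fg by simp
    show "AE x in lborel. norm (indicator {- R..R} x *\<^sub>R f x) \<le> norm (exp (R\<^sup>2 / 2) * norm (f x * gauss x))"
    proof (intro AE_I2)
      fix x
      show "norm (indicator {- R..R} x *\<^sub>R f x) \<le> norm (exp (R\<^sup>2 / 2) * norm (f x * gauss x))"
      proof (cases "x \<in> {- R..R}")
        case True
        then have "x\<^sup>2 \<le> R\<^sup>2" by (intro abs_le_square_iff[THEN iffD1]) auto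
        then have "1 \<le> exp (R\<^sup>2 / 2) * exp (- x\<^sup>2 / 2)" by (simp flip: exp_add)
        then have "norm (f x) * 1 \<le> norm (f x) * (exp (R\<^sup>2 / 2) * exp (- x\<^sup>2 / 2))" by (intro mult_left_mono) auto
        then show ?thesis using True by (simp add: norm_mult gpos mult_ac)
      qed simp
    qed
  qed measurable
  have bdd: "norm (LINT x|lborel. f x * k x) \<le> A * l2 k"
    if k [measurable]: "k \<in> borel_measurable borel" and kB: "\<And>x. norm (k x) \<le> B" "0 < B" and kR: "\<And>x. R < \<bar>x\<bar> \<Longrightarrow> k x = 0" for k B R
  proof -
    obtain g where g: "\<And>n. continuous_on UNIV (g n)" "\<And>n x. norm (g n x) \<le> B" "\<And>n x. R + 1 < \<bar>x\<bar> \<Longrightarrow> g n x = 0"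
      "AE x in lborel. (\<lambda>n. g n x) \<longlonglongrightarrow> k x"
      by (rule continuous_approximation[of k B R, OF k kB]) (use kR in auto)
    have gm [measurable]: "g n \<in> borel_measurable borel" for n by (rule borel_measurable_continuous_onI[OF g(1)])
    have 1: "(\<lambda>n. LINT x|lborel. f x * g n x) \<longlonglongrightarrow> (LINT x|lborel. f x * k x)"
    proof (rule integral_dominated_convergence)
      show "integrable lborel (\<lambda>x. B * norm (indicator {- (R + 1)..R + 1} x *\<^sub>R f x))"
        by (intro integrable_mult_right integrable_norm locint)
      show "AE x in lborel. norm (f x * g n x) \<le> B * norm (indicator {- (R + 1)..R + 1} x *\<^sub>R f x)" for n
      proof (intro AE_I2)
        fix x
        show "norm (f x * g n x) \<le> B * norm (indicator {- (R + 1)..R + 1} x *\<^sub>R f x)"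
        proof (cases "R + 1 < \<bar>x\<bar>")
          case True then show ?thesis using g(3) kB(2) by simp
        next
          case False
          then have "x \<in> {- (R + 1)..R + 1}" by auto
          then show ?thesis using mult_left_mono[OF g(2)[of n x], of "norm (f x)"] by (simp add: norm_mult mult.commute)
        qed
      qed
      show "AE x in lborel. (\<lambda>n. f x * g n x) \<longlonglongrightarrow> f x * k x"
        using g(4) by eventually_elim (rule tendsto_mult_left)
    qed measurable
    have w: "integrable lborel (\<lambda>x. (B * indicator {- (R + 1)..R + 1} x)\<^sup>2)"
      by (rule integrable_indicator_sq)
    have gB: "AE x in lborel. norm (g n x) \<le> B * indicator {- (R + 1)..R + 1} x" for n
      using g(2)[of n] g(3)[of _ n] kB(2) by (intro AE_I2) (auto simp: indicator_def abs_less_iff not_le)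
    note dom = l2_dominated_tendsto[of g k "\<lambda>x. B * indicator {- (R + 1)..R + 1} x", OF gm k w g(4) gB]
    have 2: "(\<lambda>n. A * l2 (g n)) \<longlonglongrightarrow> A * l2 k"
      by (intro tendsto_mult_left l2_tendsto dom(3) dom(1) dom(2))
    show ?thesis
      by (rule LIMSEQ_le[OF tendsto_norm[OF 1] 2]) (use cpt[OF g(1,2,3)] in auto)
  qed
  have tr: "sqint (truncation n f)" "l2 (truncation n f) \<le> A" for n
  proof -
    let ?t = "truncation n f"
    show sq: "sqint ?t"
    proof (rule cpt_bounded_sqint[of _ "real n" "real n"])
      show "real n < \<bar>x\<bar> \<Longrightarrow> ?t x = 0" for x using truncation_norm(3)[of n f x] by auto
    qed (simp_all add: truncation_norm truncation_measurable)
    have "norm (LINT x|lborel. f x * cnj (?t x)) \<le> A * l2 (\<lambda>x. cnj (?t x))"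
    proof (rule bdd[of _ "real n + 1" "real n"])
      show "norm (cnj (?t x)) \<le> real n + 1" for x using truncation_norm(1)[of n f x] by simp
      show "real n < \<bar>x\<bar> \<Longrightarrow> cnj (?t x) = 0" for x using truncation_norm(3)[of n f x] by auto
    qed (auto intro: cnj_measurable truncation_measurable)
    moreover have "(LINT x|lborel. f x * cnj (?t x)) = of_real ((l2 ?t)\<^sup>2)"
    proof -
      have "f x * cnj (?t x) = of_real ((norm (?t x))\<^sup>2)" for x
        unfolding complex_norm_square by (simp add: truncation_def)
      then show ?thesis by (simp add: l2_power2 integral_complex_of_real del: of_real_power)
    qed
    ultimately have "(l2 ?t)\<^sup>2 \<le> A * l2 ?t" by (simp add: norm_power)
    then show "l2 ?t \<le> A" using A0 by (cases "l2 ?t = 0") (auto simp: power2_eq_square mult_le_cancel_right not_less order_antisym_conv)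
  qed
  show "sqint f" "l2 f \<le> A"
    by (rule l2_fatou[of "\<lambda>n. truncation n f", OF tr f AE_I2[OF truncation_tendsto]])+
qed

text \<open>The fundamental lemma of the calculus of variations, as the case \<open>A = 0\<close> of the duality bound.\<close>

lemma AE_zero_by_duality:
  assumes "f \<in> borel_measurable borel"
    and "\<And>\<psi>. schwartz \<psi> \<Longrightarrow> integrable lborel (\<lambda>x. f x * \<psi> x)"
    and "\<And>\<psi>. schwartz \<psi> \<Longrightarrow> (LINT x|lborel. f x * \<psi> x) = 0"
  shows "AE x in lborel. f x = 0"
proof -
  have "sqint f" "l2 f \<le> 0" using l2_by_duality[OF assms(1,2), of 0] assms(3) by auto
  then show ?thesis using l2_eq_0_AE[of f] l2_nonneg[of f] by (simp add: order_antisym)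
qed

lemma conv_measurable:
  assumes [measurable]: "f \<in> borel_measurable borel" "k \<in> borel_measurable borel"
  shows "conv f k \<in> borel_measurable borel"
proof -
  have "(\<lambda>(x, y). f y * k (x - y)) \<in> borel_measurable (borel \<Otimes>\<^sub>M lborel)" by measurable
  from lborel.borel_measurable_lebesgue_integral[OF this] show ?thesis unfolding conv_def .
qed

text \<open>Cauchy-Schwarz with respect to the probability density, then Fubini and translation invariance.\<close>

lemma moll_contraction:
  assumes f: "sqint f" shows "sqint (moll n f)" "l2 (moll n f) \<le> l2 f"
proof -
  note [measurable] = sqint_measurable[OF f] rho_facts(5) schwartz_measurable[OF schwartz_heat]
  have mm [measurable]: "moll n f \<in> borel_measurable borel" by (rule conv_measurable) measurable
  let ?N = "real (Suc n)"
  have b: "sqint (\<lambda>z. of_real (sqrt (rho z)))" "l2 (\<lambda>z. of_real (sqrt (rho z))) = 1"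
    using rho_facts(1,2,3) by (simp_all add: sqint_def l2_def)
  have pw: "ennreal ((norm (moll n f x))\<^sup>2) \<le> (\<integral>\<^sup>+z. ennreal ((norm (f (x - z / ?N)))\<^sup>2) * ennreal (rho z) \<partial>lborel)" for x
  proof -
    have fx: "sqint (\<lambda>z. f (x - z / ?N))"
      using l2_affine(1)[OF _ f, of "- 1 / ?N" x] by (simp del: of_nat_Suc)
    have "sqrt (rho z) \<le> 1" for z using rho_facts(4)[of z] by simp
    then have a: "sqint (\<lambda>z. of_real (sqrt (rho z)) * f (x - z / ?N))"
      using rho_facts(1) by (intro sqint_bounded_mult(1)[OF fx, of _ 1]) auto
    have "norm (LINT z|lborel. (of_real (sqrt (rho z)) * f (x - z / ?N)) * of_real (sqrt (rho z)))
       \<le> l2 (\<lambda>z. of_real (sqrt (rho z)) * f (x - z / ?N))"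
      using l2_CS[OF a b(1)] b(2) by simp
    moreover have "(\<lambda>z. (of_real (sqrt (rho z)) * f (x - z / ?N)) * of_real (sqrt (rho z))) = (\<lambda>z. f (x - z / ?N) * of_real (rho z))"
    proof
      fix z
      have "complex_of_real (sqrt (rho z)) * complex_of_real (sqrt (rho z)) = of_real (rho z)"
        using rho_facts(1)[of z] by (simp flip: of_real_mult)
      then show "(of_real (sqrt (rho z)) * f (x - z / ?N)) * of_real (sqrt (rho z)) = f (x - z / ?N) * of_real (rho z)"
        by (simp only: mult_ac) (simp only: mult.assoc[symmetric])
    qed
    ultimately have "norm (moll n f x) \<le> l2 (\<lambda>z. of_real (sqrt (rho z)) * f (x - z / ?N))"
      unfolding moll_alt by (simp only:)
    then have "ennreal ((norm (moll n f x))\<^sup>2) \<le> ennreal ((l2 (\<lambda>z. of_real (sqrt (rho z)) * f (x - z / ?N)))\<^sup>2)"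
      by (intro ennreal_leI power_mono) auto
    also have "\<dots> = (\<integral>\<^sup>+z. ennreal ((norm (of_real (sqrt (rho z)) * f (x - z / ?N)))\<^sup>2) \<partial>lborel)"
      unfolding l2_power2 using nn_integral_eq_integral[OF sqint_integrable[OF a]] by simp
    also have "\<dots> = (\<integral>\<^sup>+z. ennreal ((norm (f (x - z / ?N)))\<^sup>2) * ennreal (rho z) \<partial>lborel)"
      using rho_facts(1) by (simp add: norm_mult power_mult_distrib ennreal_mult[symmetric] mult.commute del: of_nat_Suc)
    finally show ?thesis .
  qed
  have "(\<integral>\<^sup>+x. ennreal ((norm (moll n f x))\<^sup>2) \<partial>lborel)
     \<le> (\<integral>\<^sup>+x. \<integral>\<^sup>+z. ennreal ((norm (f (x - z / ?N)))\<^sup>2) * ennreal (rho z) \<partial>lborel \<partial>lborel)"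
    by (intro nn_integral_mono pw)
  also have "\<dots> = (\<integral>\<^sup>+z. \<integral>\<^sup>+x. ennreal ((norm (f (x - z / ?N)))\<^sup>2) * ennreal (rho z) \<partial>lborel \<partial>lborel)"
    by (rule lborel_pair.Fubini') measurable
  also have "\<dots> = (\<integral>\<^sup>+z. ennreal ((l2 f)\<^sup>2) * ennreal (rho z) \<partial>lborel)"
  proof (rule nn_integral_cong)
    fix z
    have "(\<integral>\<^sup>+x. ennreal ((norm (f (x - z / ?N)))\<^sup>2) \<partial>lborel) = (\<integral>\<^sup>+x. ennreal ((norm (f x))\<^sup>2) \<partial>lborel)"
      using nn_integral_real_affine[of "\<lambda>x. ennreal ((norm (f x))\<^sup>2)" 1 "- z / ?N"] by (simp del: of_nat_Suc)
    also have "\<dots> = ennreal ((l2 f)\<^sup>2)"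
      unfolding l2_power2 using nn_integral_eq_integral[OF sqint_integrable[OF f]] by simp
    finally have h: "(\<integral>\<^sup>+x. ennreal ((norm (f (x - z / ?N)))\<^sup>2) \<partial>lborel) = ennreal ((l2 f)\<^sup>2)" .
    have "(\<integral>\<^sup>+x. ennreal ((norm (f (x - z / ?N)))\<^sup>2) * ennreal (rho z) \<partial>lborel)
      = (\<integral>\<^sup>+x. ennreal ((norm (f (x - z / ?N)))\<^sup>2) \<partial>lborel) * ennreal (rho z)"
      by (rule nn_integral_multc) measurable
    then show "(\<integral>\<^sup>+x. ennreal ((norm (f (x - z / ?N)))\<^sup>2) * ennreal (rho z) \<partial>lborel) = ennreal ((l2 f)\<^sup>2) * ennreal (rho z)"
      unfolding h .
  qed
  also have "\<dots> = ennreal ((l2 f)\<^sup>2)"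
    using nn_integral_eq_integral[OF rho_facts(2)] rho_facts(1,3) by (subst nn_integral_cmult) simp_all
  finally have le: "(\<integral>\<^sup>+x. ennreal ((norm (moll n f x))\<^sup>2) \<partial>lborel) \<le> ennreal ((l2 f)\<^sup>2)" .
  have "integrable lborel (\<lambda>x. (norm (moll n f x))\<^sup>2)"
    using le by (intro integrableI_nonneg) (auto intro: le_less_trans)
  then show m: "sqint (moll n f)" by (simp add: sqint_def)
  have "ennreal ((l2 (moll n f))\<^sup>2) \<le> ennreal ((l2 f)\<^sup>2)"
    using nn_integral_eq_integral[OF sqint_integrable[OF m]] le unfolding l2_power2 by simp
  then have "(l2 (moll n f))\<^sup>2 \<le> (l2 f)\<^sup>2" unfolding ennreal_le_iff[OF zero_le_power2] .
  then show "l2 (moll n f) \<le> l2 f" by (rule power2_le_imp_le) (rule l2_nonneg)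
qed

text \<open>A bound away from the origin that is uniform in the width; it dominates the tails of mollified
  functions of compact support.\<close>

lemma heat_decay: "\<exists>C\<ge>0. \<forall>n z. z\<^sup>2 * norm (heat n z) \<le> C"
proof -
  obtain C where C: "0 \<le> C" "\<And>z. \<bar>z\<bar> ^ 2 * norm (gauss z) \<le> C" using schwartz_moment_bound[OF schwartz_gauss', of 2] by auto
  have "z\<^sup>2 * norm (heat n z) \<le> C" for n z
  proof -
    let ?N = "real (Suc n)"
    have s: "1 \<le> sqrt (2 * pi)" using pi_gt3 by simp
    have "z\<^sup>2 * norm (heat n z) = (1 / (?N * sqrt (2 * pi))) * ((?N * z)\<^sup>2 * norm (gauss (?N * z)))"
      by (simp add: heat_def norm_mult norm_divide power2_eq_square field_simps del: of_nat_Suc)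
    also have "\<dots> \<le> 1 * C"
    proof (intro mult_mono)
      have "1 * 1 \<le> ?N * sqrt (2 * pi)" using s by (intro mult_mono) auto
      then show "1 / (?N * sqrt (2 * pi)) \<le> 1" by (simp add: divide_le_eq)
      show "(?N * z)\<^sup>2 * norm (gauss (?N * z)) \<le> C" using C(2)[of "?N * z"] by (simp only: power2_abs)
    qed (use C in auto)
    finally show ?thesis by simp
  qed
  then show ?thesis using C(1) by blast
qed

lemma moll_tendsto_cpt:
  assumes g: "continuous_on UNIV g" and gB: "\<And>x. norm (g x) \<le> B" and gR: "\<And>x. R < \<bar>x\<bar> \<Longrightarrow> g x = 0" and R: "1 \<le> R"
  shows "(\<lambda>n. l2 (\<lambda>x. moll n g x - g x)) \<longlonglongrightarrow> 0"
proof -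
  have gm [measurable]: "g \<in> borel_measurable borel" by (rule borel_measurable_continuous_onI[OF g])
  have B0: "0 \<le> B" using gB[of 0] norm_ge_zero order_trans by blast
  obtain C where C: "0 \<le> C" "\<And>n z. z\<^sup>2 * norm (heat n z) \<le> C" using heat_decay by blast
  have gi: "integrable lborel g" by (rule cpt_bounded_integrable[OF gm gB]) (rule gR)
  define I where "I = (LINT y|lborel. norm (g y))"
  have I0: "0 \<le> I" unfolding I_def by (rule Bochner_Integration.integral_nonneg) simp
  define D where "D = B * (1 + 4 * R\<^sup>2) + 8 * C * I"
  have bd: "norm (moll n g x) \<le> D / (1 + x\<^sup>2)" for n x
  proof (cases "\<bar>x\<bar> \<le> 2 * R")
    case True
    then have "x\<^sup>2 \<le> (2 * R)\<^sup>2" using R by (intro abs_le_square_iff[THEN iffD1]) auto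
    then have "B * (1 + x\<^sup>2) \<le> B * (1 + 4 * R\<^sup>2)" using B0 by (intro mult_left_mono) (auto simp: power_mult_distrib)
    also have "\<dots> \<le> D" using C I0 by (simp add: D_def)
    finally have "B \<le> D / (1 + x\<^sup>2)" by (simp add: field_simps add_pos_nonneg)
    then show ?thesis using moll_bounded_continuous(2)[OF g gB, of n x] by linarith
  next
    case False
    then have "1 \<le> \<bar>x\<bar>" using R by linarith
    from one_le_power[OF this, of 2] have x1: "1 \<le> x\<^sup>2" by simp
    from \<open>1 \<le> \<bar>x\<bar>\<close> have x0: "x \<noteq> 0" by auto
    have "norm (conv g (heat n) x) \<le> (LINT y|lborel. (4 * C / x\<^sup>2) * norm (g y))"
      unfolding conv_def
    proof (rule dominated_integral(2))
      show "integrable lborel (\<lambda>y. (4 * C / x\<^sup>2) * norm (g y))" using gi by simp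
      show "(\<lambda>y. g y * heat n (x - y)) \<in> borel_measurable borel"
        using schwartz_measurable[OF schwartz_heat] by measurable
      fix y
      show "norm (g y * heat n (x - y)) \<le> (4 * C / x\<^sup>2) * norm (g y)"
      proof (cases "R < \<bar>y\<bar>")
        case True then show ?thesis using gR by simp
      next
        case y: False
        then have "\<bar>x / 2\<bar> \<le> \<bar>x - y\<bar>" using False by linarith
        then have "(x / 2)\<^sup>2 \<le> (x - y)\<^sup>2" by (rule abs_le_square_iff[THEN iffD1])
        then have "(x / 2)\<^sup>2 * norm (heat n (x - y)) \<le> (x - y)\<^sup>2 * norm (heat n (x - y))" by (intro mult_right_mono) auto
        also have "\<dots> \<le> C" by (rule C)
        finally have "norm (heat n (x - y)) \<le> 4 * C / x\<^sup>2" using x0 by (simp add: power_divide field_simps)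
        from mult_left_mono[OF this, of "norm (g y)"] show ?thesis by (simp add: norm_mult mult.commute)
      qed
    qed
    also have "\<dots> = 4 * C * I / x\<^sup>2" by (simp add: I_def)
    also have "\<dots> \<le> 8 * C * I / (1 + x\<^sup>2)"
    proof -
      have "4 * C * I * (1 + x\<^sup>2) \<le> 4 * C * I * (2 * x\<^sup>2)" using C I0 x1 by (intro mult_left_mono) auto
      then show ?thesis using x0 by (simp add: divide_le_eq le_divide_eq field_simps add_pos_nonneg)
    qed
    also have "\<dots> \<le> D / (1 + x\<^sup>2)" using B0 by (intro divide_right_mono) (auto simp: D_def)
    finally show ?thesis .
  qed
  have w: "integrable lborel (\<lambda>x::real. (D / (1 + x\<^sup>2))\<^sup>2)"
  proof -
    have "sqint (\<lambda>x. of_real (D / (1 + x\<^sup>2)))"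
    proof (rule sqint_of_decay[of _ "\<bar>D\<bar>"])
      show "norm (complex_of_real (D / (1 + x\<^sup>2))) \<le> \<bar>D\<bar> / (1 + x\<^sup>2)" for x :: real
        unfolding norm_of_real by simp
    qed measurable
    from sqint_integrable[OF this] show ?thesis unfolding norm_of_real power2_abs .
  qed
  have mm: "moll n g \<in> borel_measurable borel" for n
    by (rule conv_measurable[OF gm schwartz_measurable[OF schwartz_heat]])
  show ?thesis
    by (rule l2_dominated_tendsto(2)[OF mm gm w AE_I2 AE_I2])
      (use moll_bounded_continuous(1)[OF g gB] bd in auto)
qed

lemma cpt_dense_l2:
  assumes f: "sqint f" and e: "0 < e"
  obtains g B R where "continuous_on UNIV g" "\<And>x. norm (g x) \<le> B" "\<And>x. R < \<bar>x\<bar> \<Longrightarrow> g x = 0" "1 \<le> R"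
    "sqint g" "l2 (\<lambda>x. g x - f x) < e"
proof -
  note fm [measurable] = sqint_measurable[OF f]
  have "(\<lambda>n. l2 (\<lambda>x. truncation n f x - f x)) \<longlonglongrightarrow> 0"
    by (rule l2_dominated_tendsto(2)[OF truncation_measurable[OF fm] fm _ AE_I2 AE_I2, of "\<lambda>x. norm (f x)"])
      (use f truncation_tendsto truncation_norm in \<open>auto simp: sqint_def\<close>)
  then have "eventually (\<lambda>n. l2 (\<lambda>x. truncation n f x - f x) < e / 2) sequentially"
    using e by (intro order_tendstoD) auto
  then obtain n where n: "l2 (\<lambda>x. truncation n f x - f x) < e / 2" by (auto simp: eventually_sequentially)
  let ?k = "truncation n f"
  have km: "?k \<in> borel_measurable borel" by measurable
  have kB: "norm (?k x) \<le> real n + 1" for x using truncation_norm(1)[of n f x] by simp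
  have kR: "real n < \<bar>x\<bar> \<Longrightarrow> ?k x = 0" for x using truncation_norm(3)[of n f x] by auto
  have ks: "sqint ?k" by (rule cpt_bounded_sqint[OF km kB]) (rule kR)
  obtain g where g: "\<And>j. continuous_on UNIV (g j)" "\<And>j x. norm (g j x) \<le> real n + 1" "\<And>j x. real n + 1 < \<bar>x\<bar> \<Longrightarrow> g j x = 0"
    "AE x in lborel. (\<lambda>j. g j x) \<longlonglongrightarrow> ?k x"
    by (rule continuous_approximation[of ?k "real n + 1" "real n", OF km kB]) (use kR in auto)
  have gm: "g j \<in> borel_measurable borel" for j by (rule borel_measurable_continuous_onI[OF g(1)])
  have gs: "sqint (g j)" for j by (rule cpt_bounded_sqint[OF gm g(2)]) (rule g(3))
  have "(\<lambda>j. l2 (\<lambda>x. g j x - ?k x)) \<longlonglongrightarrow> 0"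
  proof (rule l2_dominated_tendsto(2)[OF gm km _ g(4)])
    show "integrable lborel (\<lambda>x. ((real n + 1) * indicator {- (real n + 1)..real n + 1} x)\<^sup>2)"
      by (rule integrable_indicator_sq)
    show "AE x in lborel. norm (g j x) \<le> (real n + 1) * indicator {- (real n + 1)..real n + 1} x" for j
      using g(2)[of j] g(3)[of _ j] by (intro AE_I2) (auto simp: indicator_def abs_less_iff not_le)
  qed
  then have "eventually (\<lambda>j. l2 (\<lambda>x. g j x - ?k x) < e / 2) sequentially"
    using e by (intro order_tendstoD) auto
  then obtain j where j: "l2 (\<lambda>x. g j x - ?k x) < e / 2" by (auto simp: eventually_sequentially)
  show ?thesis
  proof (rule that[of "g j" "real n + 1" "real n + 1"])
    show "l2 (\<lambda>x. g j x - f x) < e"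
      using l2_triangle_diff[OF gs[of j] ks f] n j by linarith
  qed (use g gs in auto)
qed

lemma conv_diff:
  assumes "sqint f" "sqint g" "schwartz k"
  shows "conv (\<lambda>x. f x - g x) k x = conv f k x - conv g k x"
proof -
  have "sqint (\<lambda>y. k (x - y))"
    using l2_affine(1)[OF _ schwartz_sqint[OF assms(3)], of "-1" x] by simp
  then show ?thesis unfolding conv_def
    using sqint_prod_integrable[OF assms(1)] sqint_prod_integrable[OF assms(2)]
    by (simp add: left_diff_distrib)
qed

text \<open>By the contraction property it suffices to know convergence on a dense class, and for continuous
  functions of compact support it follows from dominated convergence.\<close>

lemma moll_tendsto_l2:
  assumes f: "sqint f" shows "(\<lambda>n. l2 (\<lambda>x. moll n f x - f x)) \<longlonglongrightarrow> 0"
proof (rule LIMSEQ_I)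
  fix e :: real assume e: "0 < e"
  obtain g B R where g: "continuous_on UNIV g" "\<And>x. norm (g x) \<le> B" "\<And>x. R < \<bar>x\<bar> \<Longrightarrow> g x = 0" "1 \<le> R"
    "sqint g" "l2 (\<lambda>x. g x - f x) < e / 3" by (rule cpt_dense_l2[OF f, of "e / 3"]) (use e in auto)
  have "(\<lambda>n. l2 (\<lambda>x. moll n g x - g x)) \<longlonglongrightarrow> 0"
    by (rule moll_tendsto_cpt[OF g(1,2) _ g(4)]) (rule g(3))
  from LIMSEQ_D[OF this, of "e / 3"] e obtain N where N: "\<And>n. n \<ge> N \<Longrightarrow> l2 (\<lambda>x. moll n g x - g x) < e / 3" by auto
  have "l2 (\<lambda>x. moll n f x - f x) < e" if "n \<ge> N" for n
  proof -
    have "l2 (\<lambda>x. moll n f x - f x) \<le> l2 (\<lambda>x. moll n f x - moll n g x) + l2 (\<lambda>x. moll n g x - f x)"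
      by (rule l2_triangle_diff) (use f g(5) moll_contraction(1) in auto)
    also have "l2 (\<lambda>x. moll n f x - moll n g x) = l2 (moll n (\<lambda>x. f x - g x))"
      using conv_diff[OF f g(5) schwartz_heat] by (intro arg_cong[where f=l2]) auto
    also have "\<dots> \<le> l2 (\<lambda>x. f x - g x)" by (rule moll_contraction[OF sqint_diff[OF f g(5)]])
    also have "\<dots> < e / 3" using g(6) by (simp add: l2_minus_commute[of f g])
    also have "l2 (\<lambda>x. moll n g x - f x) \<le> l2 (\<lambda>x. moll n g x - g x) + l2 (\<lambda>x. g x - f x)"
      by (rule l2_triangle_diff) (use f g(5) moll_contraction(1) in auto)
    finally show ?thesis using N[OF that] g(6) by linarith
  qed
  then show "\<exists>N. \<forall>n\<ge>N. norm (l2 (\<lambda>x. moll n f x - f x) - 0) < e" by auto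
qed

section \<open>Absolutely continuous functions and \<open>H\<^sup>1\<close>\<close>

text \<open>\<open>f\<close> is locally absolutely continuous with density \<open>f'\<close>. Carrying the
  density along as a second argument makes it an arbitrary representative of the derivative, so
  that the weak derivative of a solution can be used as it stands.\<close>

definition ac :: "(real \<Rightarrow> complex) \<Rightarrow> (real \<Rightarrow> complex) \<Rightarrow> bool" where
  "ac f f' \<longleftrightarrow> f' \<in> borel_measurable borel \<and>
     (\<forall>a b. integrable lborel (\<lambda>x. indicator {a..b} x *\<^sub>R f' x)) \<and>
     (\<forall>a b. a \<le> b \<longrightarrow> f b - f a = (LINT x|lborel. indicator {a..b} x *\<^sub>R f' x))"

lemma ac_measurable': "ac f f' \<Longrightarrow> f' \<in> borel_measurable borel"
  by (simp add: ac_def)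

lemma ac_locally_integrable: "ac f f' \<Longrightarrow> integrable lborel (\<lambda>x. indicator {a..b} x *\<^sub>R f' x)"
  by (simp add: ac_def)

lemma ac_FTC: "ac f f' \<Longrightarrow> a \<le> b \<Longrightarrow> f b - f a = (LINT x|lborel. indicator {a..b} x *\<^sub>R f' x)"
  by (simp add: ac_def)

lemma ac_continuous:
  assumes "ac f f'" shows "continuous_on UNIV f"
proof -
  have "continuous_on {a..b} f" if "a < b" for a b
  proof -
    have si: "set_integrable lborel {a..b} f'"
      using ac_locally_integrable[OF assms] by (simp add: set_integrable_def)
    have "f' integrable_on {a..b}" by (rule set_borel_integral_eq_integral(1)[OF si])
    then have "continuous_on {a..b} (\<lambda>x. f a + integral {a..x} f')"
      by (intro continuous_intros indefinite_integral_continuous_1)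
    moreover have "f a + integral {a..x} f' = f x" if "x \<in> {a..b}" for x
    proof -
      have si: "set_integrable lborel {a..x} f'"
        using ac_locally_integrable[OF assms] by (simp add: set_integrable_def)
      from set_borel_integral_eq_integral(2)[OF si]
      show ?thesis using ac_FTC[OF assms, of a x] that by (simp add: set_lebesgue_integral_def algebra_simps)
    qed
    ultimately show ?thesis by (rule continuous_on_eq)
  qed
  then have "isCont f x" for x
    by (rule continuous_on_interior[of "{x - 1..x + 1}"]) (auto simp: interior_atLeastAtMost_real)
  then show ?thesis by (simp add: continuous_at_imp_continuous_on)
qed

lemma ac_measurable: "ac f f' \<Longrightarrow> f \<in> borel_measurable borel"
  using ac_continuous borel_measurable_continuous_onI by blast

lemma ac_of_C1:
  assumes "\<And>x. (f has_vector_derivative f' x) (at x)" "continuous_on UNIV f'"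
  shows "ac f f'"
  unfolding ac_def
proof (intro conjI allI impI)
  show "f' \<in> borel_measurable borel" using assms(2) by (rule borel_measurable_continuous_onI)
  show "integrable lborel (\<lambda>x. indicator {a..b} x *\<^sub>R f' x)" for a b
    by (rule borel_integrable_compact) (auto intro: continuous_on_subset[OF assms(2)])
  show "f b - f a = (LINT x|lborel. indicator {a..b} x *\<^sub>R f' x)" if "a \<le> b" for a b
    by (rule integral_FTC_Icc[OF that, symmetric])
      (auto intro: has_vector_derivative_at_within assms(1) continuous_on_subset[OF assms(2)])
qed

lemma ac_schwartz: "schwartz f \<Longrightarrow> ac f (vderiv f)"
  by (intro ac_of_C1 schwartz_has_derivative schwartz_continuous schwartz_vderiv)

lemma ac_add:
  assumes "ac f f'" "ac g g'" shows "ac (\<lambda>x. f x + g x) (\<lambda>x. f' x + g' x)"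
  unfolding ac_def
proof (intro conjI allI impI)
  show "(\<lambda>x. f' x + g' x) \<in> borel_measurable borel"
    using ac_measurable'[OF assms(1)] ac_measurable'[OF assms(2)] by measurable
  show "integrable lborel (\<lambda>x. indicator {a..b} x *\<^sub>R (f' x + g' x))" for a b
    unfolding scaleR_add_right by (intro Bochner_Integration.integrable_add ac_locally_integrable[OF assms(1)] ac_locally_integrable[OF assms(2)])
  show "f b + g b - (f a + g a) = (LINT x|lborel. indicator {a..b} x *\<^sub>R (f' x + g' x))" if "a \<le> b" for a b
    using ac_FTC[OF assms(1) that] ac_FTC[OF assms(2) that]
    unfolding scaleR_add_right
    by (subst Bochner_Integration.integral_add[OF ac_locally_integrable[OF assms(1)] ac_locally_integrable[OF assms(2)]])
      (simp add: algebra_simps)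
qed

lemma ac_cmult:
  assumes "ac f f'" shows "ac (\<lambda>x. c * f x) (\<lambda>x. c * f' x)"
  unfolding ac_def
proof (intro conjI allI impI)
  show "(\<lambda>x. c * f' x) \<in> borel_measurable borel" using ac_measurable'[OF assms] by measurable
  have e: "indicator {a..b} x *\<^sub>R (c * f' x) = c * (indicator {a..b} x *\<^sub>R f' x)" for a b x by simp
  show "integrable lborel (\<lambda>x. indicator {a..b} x *\<^sub>R (c * f' x))" for a b
    unfolding e by (intro integrable_mult_right ac_locally_integrable[OF assms])
  show "c * f b - c * f a = (LINT x|lborel. indicator {a..b} x *\<^sub>R (c * f' x))" if "a \<le> b" for a b
    unfolding e integral_mult_right_zero ac_FTC[OF assms that, symmetric] by (rule right_diff_distrib[symmetric])
qed

lemma ac_cnj: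
  assumes "ac f f'" shows "ac (\<lambda>x. cnj (f x)) (\<lambda>x. cnj (f' x))"
  unfolding ac_def
proof (intro conjI allI impI)
  show "(\<lambda>x. cnj (f' x)) \<in> borel_measurable borel" using ac_measurable'[OF assms] by measurable
  have e: "indicator {a..b} x *\<^sub>R cnj (f' x) = cnj (indicator {a..b} x *\<^sub>R f' x)" for a b x by simp
  show "integrable lborel (\<lambda>x. indicator {a..b} x *\<^sub>R cnj (f' x))" for a b
    unfolding e by (intro integrable_cnj ac_locally_integrable[OF assms])
  show "cnj (f b) - cnj (f a) = (LINT x|lborel. indicator {a..b} x *\<^sub>R cnj (f' x))" if "a \<le> b" for a b
  proof -
    have "(LINT x|lborel. indicator {a..b} x *\<^sub>R cnj (f' x)) = cnj (LINT x|lborel. indicator {a..b} x *\<^sub>R f' x)"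
      unfolding e by (rule Bochner_Integration.integral_cnj)
    then show ?thesis using ac_FTC[OF assms that] by (simp only: complex_cnj_diff[symmetric])
  qed
qed

text \<open>The product rule: split the square \<open>[a,b]\<^sup>2\<close> along its diagonal and integrate \<open>f'(x) g'(y)\<close>
  over the two triangles.\<close>

lemma ac_mult:
  assumes f: "ac f f'" and g: "ac g g'"
  shows "ac (\<lambda>x. f x * g x) (\<lambda>x. f' x * g x + f x * g' x)"
proof -
  note [measurable] = ac_measurable[OF f] ac_measurable'[OF f] ac_measurable[OF g] ac_measurable'[OF g]
  have loc: "integrable lborel (\<lambda>x. h x * (indicator {a..b} x *\<^sub>R k x))"
    if h: "continuous_on UNIV h" and k: "integrable lborel (\<lambda>x. indicator {a..b} x *\<^sub>R k x)"
    for h k :: "real \<Rightarrow> complex" and a b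
  proof -
    have "compact (h ` {a..b})" by (intro compact_continuous_image continuous_on_subset[OF h]) auto
    then obtain M where M: "\<forall>y\<in>h ` {a..b}. norm y \<le> M"
      using compact_imp_bounded[of "h ` {a..b}"] unfolding bounded_iff by blast
    have hm: "h \<in> borel_measurable borel" by (rule borel_measurable_continuous_onI[OF h])
    have km: "(\<lambda>x. indicator {a..b} x *\<^sub>R k x) \<in> borel_measurable borel"
      using borel_measurable_integrable[OF k] by simp
    show ?thesis
    proof (rule dominated_integral(1))
      show "integrable lborel (\<lambda>x. M * norm (indicator {a..b} x *\<^sub>R k x))"
        by (intro integrable_mult_right integrable_norm k)
      show "norm (h x * (indicator {a..b} x *\<^sub>R k x)) \<le> M * norm (indicator {a..b} x *\<^sub>R k x)" for x
        using M by (cases "x \<in> {a..b}") (auto simp: norm_mult mult_right_mono)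
    qed (use hm km in measurable)
  qed
  have i1: "integrable lborel (\<lambda>x. g x * (indicator {a..b} x *\<^sub>R f' x))"
    and i2: "integrable lborel (\<lambda>x. f x * (indicator {a..b} x *\<^sub>R g' x))" for a b
    by (intro loc ac_continuous[OF f] ac_continuous[OF g] ac_locally_integrable[OF f] ac_locally_integrable[OF g])+
  have e: "indicator {a..b} x *\<^sub>R (f' x * g x + f x * g' x)
      = g x * (indicator {a..b} x *\<^sub>R f' x) + f x * (indicator {a..b} x *\<^sub>R g' x)" for a b x
    by (simp add: scaleR_add_right mult.commute)
  show ?thesis
    unfolding ac_def
  proof (intro conjI allI impI)
    show "(\<lambda>x. f' x * g x + f x * g' x) \<in> borel_measurable borel" by measurable
    show "integrable lborel (\<lambda>x. indicator {a..b} x *\<^sub>R (f' x * g x + f x * g' x))" for a b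
      unfolding e by (intro Bochner_Integration.integrable_add i1 i2)
    fix a b :: real assume ab: "a \<le> b"
    define F where "F x = indicator {a..b} x *\<^sub>R f' x" for x
    define G where "G x = indicator {a..b} x *\<^sub>R g' x" for x
    have [measurable]: "F \<in> borel_measurable borel" "G \<in> borel_measurable borel"
      unfolding F_def[abs_def] G_def[abs_def] by measurable
    have iF: "integrable lborel F" and iG: "integrable lborel G"
      unfolding F_def[abs_def] G_def[abs_def] by (intro ac_locally_integrable[OF f] ac_locally_integrable[OF g])+
    have FI: "(LINT x|lborel. indicator {..y} x *\<^sub>R F x) = f y - f a" if "y \<in> {a..b}" for y
    proof -
      have "(\<lambda>x. indicator {..y} x *\<^sub>R F x) = (\<lambda>x. indicator {a..y} x *\<^sub>R f' x)"
        using that by (auto simp: F_def indicator_def)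
      then show ?thesis using ac_FTC[OF f, of a y] that by simp
    qed
    have GI: "(LINT x|lborel. indicator {..y} x *\<^sub>R G x) = g y - g a" if "y \<in> {a..b}" for y
    proof -
      have "(\<lambda>x. indicator {..y} x *\<^sub>R G x) = (\<lambda>x. indicator {a..y} x *\<^sub>R g' x)"
        using that by (auto simp: G_def indicator_def)
      then show ?thesis using ac_FTC[OF g, of a y] that by simp
    qed
    have F1: "(LINT x|lborel. F x) = f b - f a" and G1: "(LINT x|lborel. G x) = g b - g a"
      using ac_FTC[OF f ab] ac_FTC[OF g ab] by (simp_all add: F_def[abs_def] G_def[abs_def])
    let ?A = "\<lambda>x y. F x * (indicator {..x} y *\<^sub>R G y)"
    let ?B = "\<lambda>x y. F x * (indicator {x..} y *\<^sub>R G y)"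
    have iB: "integrable (lborel \<Otimes>\<^sub>M lborel) (case_prod ?B)"
    proof (rule integrable_prod_bound[OF iF iG])
      have m: "(\<lambda>p. F (fst p) * ((if fst p \<le> snd p then 1 else 0) *\<^sub>R G (snd p))) \<in> borel_measurable (lborel \<Otimes>\<^sub>M lborel)"
        by measurable
      have eq: "(\<lambda>p. F (fst p) * ((if fst p \<le> snd p then 1 else 0) *\<^sub>R G (snd p))) = case_prod ?B"
        by (auto simp: indicator_def)
      show "case_prod ?B \<in> borel_measurable (lborel \<Otimes>\<^sub>M lborel)" using m unfolding eq .
      show "norm (case_prod ?B (x, y)) \<le> norm (F x) * norm (G y)" for x y
        by (auto simp: norm_mult indicator_def)
    qed
    have A: "(LINT y|lborel. ?A x y) = (g x - g a) * F x" for x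
    proof -
      have "(LINT y|lborel. ?A x y) = F x * (LINT y|lborel. indicator {..x} y *\<^sub>R G y)"
        by (rule integral_mult_right_zero)
      then show ?thesis using GI[of x] by (cases "x \<in> {a..b}") (simp_all add: F_def)
    qed
    have iGi: "integrable lborel (\<lambda>y. indicator S y *\<^sub>R G y)" if "S \<in> sets borel" for S
      using integrable_mult_indicator[OF _ iG] that by simp
    have B1: "(LINT y|lborel. ?B x y) = F x * ((g b - g a) - (g x - g a))" for x
    proof (cases "x \<in> {a..b}")
      case True
      have "AE y in lborel. indicator {x..} y *\<^sub>R G y = G y - indicator {..x} y *\<^sub>R G y"
        using AE_lborel_singleton[of x] by eventually_elim (auto simp: indicator_def)
      then have "(LINT y|lborel. indicator {x..} y *\<^sub>R G y) = (LINT y|lborel. G y - indicator {..x} y *\<^sub>R G y)"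
        by (intro integral_cong_AE) measurable
      also have "\<dots> = (g b - g a) - (g x - g a)"
        using iG iGi[of "{..x}"] GI[OF True] G1 by simp
      finally have "(LINT y|lborel. indicator {x..} y *\<^sub>R G y) = (g b - g a) - (g x - g a)" .
      moreover have "(LINT y|lborel. ?B x y) = F x * (LINT y|lborel. indicator {x..} y *\<^sub>R G y)"
        by (rule integral_mult_right_zero)
      ultimately show ?thesis by (simp only:)
    qed (simp add: F_def)
    have B2: "(LINT x|lborel. ?B x y) = (f y - f a) * G y" for y
    proof -
      have "(\<lambda>x. ?B x y) = (\<lambda>x. G y * (indicator {..y} x *\<^sub>R F x))"
        by (auto simp: indicator_def)
      then have "(LINT x|lborel. ?B x y) = G y * (LINT x|lborel. indicator {..y} x *\<^sub>R F x)"
        by (simp only: integral_mult_right_zero)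
      then show ?thesis using FI[of y] by (cases "y \<in> {a..b}") (simp_all add: G_def)
    qed
    have "(LINT x|lborel. F x * ((g b - g a) - (g x - g a))) = (LINT y|lborel. (f y - f a) * G y)"
      using lborel_pair.Fubini_integral[OF iB] by (simp only: B1 B2)
    moreover have "F x * ((g b - g a) - (g x - g a)) = g b * F x - g x * (indicator {a..b} x *\<^sub>R f' x)" for x
      by (simp add: F_def algebra_simps)
    moreover have "(f y - f a) * G y = f y * (indicator {a..b} y *\<^sub>R g' y) - f a * G y" for y
      by (simp add: G_def algebra_simps)
    ultimately have "g b * (f b - f a) - (LINT x|lborel. g x * (indicator {a..b} x *\<^sub>R f' x))
      = (LINT x|lborel. f x * (indicator {a..b} x *\<^sub>R g' x)) - f a * (g b - g a)"
      using iF iG i1[of a b] i2[of a b] F1 G1 by simp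
    then show "f b * g b - f a * g a = (LINT x|lborel. indicator {a..b} x *\<^sub>R (f' x * g x + f x * g' x))"
      unfolding e using i1[of a b] i2[of a b] by (simp add: algebra_simps)
  qed
qed

lemma ac_reflect:
  assumes "ac f f'" shows "ac (\<lambda>x. f (- x)) (\<lambda>x. - f' (- x))"
  unfolding ac_def
proof (intro conjI allI impI)
  show "(\<lambda>x. - f' (- x)) \<in> borel_measurable borel" using ac_measurable'[OF assms] by measurable
  have e: "indicator {a..b} x *\<^sub>R (- f' (- x)) = - (\<lambda>x. indicator {- b..- a} x *\<^sub>R f' x) (0 + -1 * x)" for a b x :: real
    by (auto simp: indicator_def)
  show "integrable lborel (\<lambda>x. indicator {a..b} x *\<^sub>R (- f' (- x)))" for a b
    unfolding e by (intro Bochner_Integration.integrable_minus lborel_integrable_real_affine ac_locally_integrable[OF assms]) simp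
  show "f (- b) - f (- a) = (LINT x|lborel. indicator {a..b} x *\<^sub>R (- f' (- x)))" if "a \<le> b" for a b
  proof -
    have "(LINT x|lborel. indicator {- b..- a} x *\<^sub>R f' x)
       = \<bar>-1\<bar> *\<^sub>R (LINT x|lborel. (\<lambda>x. indicator {- b..- a} x *\<^sub>R f' x) (0 + -1 * x))"
      by (rule lborel_integral_real_affine) simp
    then show ?thesis
      unfolding e Bochner_Integration.integral_minus using ac_FTC[OF assms, of "- b" "- a"] that by (simp add: algebra_simps)
  qed
qed

text \<open>An integrable function with integrable derivative vanishes at infinity: its limit exists, and
  translates of it converge to zero in the mean.\<close>

lemma ac_eq_integral_atMost:
  assumes f: "ac f f'" and i: "integrable lborel f" "integrable lborel f'"
  shows "f x = (LINT y|lborel. indicator {..x} y *\<^sub>R f' y)"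
proof -
  note [measurable] = ac_measurable[OF f] ac_measurable'[OF f]
  define L where "L = f x - (LINT y|lborel. indicator {..x} y *\<^sub>R f' y)"
  have lim: "(\<lambda>n. f (z - real n)) \<longlonglongrightarrow> f z - (LINT y|lborel. indicator {..z} y *\<^sub>R f' y)" for z
  proof -
    have "(\<lambda>n. LINT y|lborel. indicator {z - real n..z} y *\<^sub>R f' y) \<longlonglongrightarrow> (LINT y|lborel. indicator {..z} y *\<^sub>R f' y)"
    proof (rule integral_dominated_convergence)
      show "integrable lborel (\<lambda>y. norm (f' y))" using i by simp
      show "AE y in lborel. (\<lambda>n. indicator {z - real n..z} y *\<^sub>R f' y) \<longlonglongrightarrow> indicator {..z} y *\<^sub>R f' y"
      proof (intro AE_I2 tendsto_eventually)
        fix y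
        obtain N where "z - y \<le> real N" using real_arch_simple by blast
        then have "indicator {z - real n..z} y *\<^sub>R f' y = indicator {..z} y *\<^sub>R f' y" if "n \<ge> N" for n
          using that by (auto simp: indicator_def)
        then show "eventually (\<lambda>n. indicator {z - real n..z} y *\<^sub>R f' y = indicator {..z} y *\<^sub>R f' y) sequentially"
          unfolding eventually_sequentially by blast
      qed
      show "AE y in lborel. norm (indicator {z - real n..z} y *\<^sub>R f' y) \<le> norm (f' y)" for n
        by (auto simp: indicator_def)
    qed measurable
    then have "(\<lambda>n. f z - (LINT y|lborel. indicator {z - real n..z} y *\<^sub>R f' y)) \<longlonglongrightarrow> f z - (LINT y|lborel. indicator {..z} y *\<^sub>R f' y)"
      by (intro tendsto_intros)
    moreover have "f z - (LINT y|lborel. indicator {z - real n..z} y *\<^sub>R f' y) = f (z - real n)" for n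
      using ac_FTC[OF f, of "z - real n" z] by (simp add: algebra_simps)
    ultimately show ?thesis by simp
  qed
  have same: "f z - (LINT y|lborel. indicator {..z} y *\<^sub>R f' y) = L" for z
  proof -
    have "f z - (LINT y|lborel. indicator {..z} y *\<^sub>R f' y) = f w - (LINT y|lborel. indicator {..w} y *\<^sub>R f' y)" if "z \<le> w" for z w
    proof -
      have ii: "integrable lborel (\<lambda>y. indicator S y *\<^sub>R f' y)" if "S \<in> sets borel" for S
        using integrable_mult_indicator[OF _ i(2)] that by simp
      have "AE y in lborel. indicator {..w} y *\<^sub>R f' y = indicator {..z} y *\<^sub>R f' y + indicator {z..w} y *\<^sub>R f' y"
        using AE_lborel_singleton[of z] by eventually_elim (use that in \<open>auto simp: indicator_def\<close>)
      then have "(LINT y|lborel. indicator {..w} y *\<^sub>R f' y) = (LINT y|lborel. indicator {..z} y *\<^sub>R f' y + indicator {z..w} y *\<^sub>R f' y)"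
        by (intro integral_cong_AE) measurable
      also have "\<dots> = (LINT y|lborel. indicator {..z} y *\<^sub>R f' y) + (f w - f z)"
        using ii ac_FTC[OF f that] by simp
      finally show ?thesis by simp
    qed
    then show ?thesis unfolding L_def using le_cases by metis
  qed
  have bdd: "norm (f z) \<le> norm L + (LINT y|lborel. norm (f' y))" for z
  proof -
    have "f z = L + (LINT y|lborel. indicator {..z} y *\<^sub>R f' y)" using same[of z] by (simp add: algebra_simps)
    moreover have "norm (LINT y|lborel. indicator {..z} y *\<^sub>R f' y) \<le> (LINT y|lborel. norm (f' y))"
      by (rule dominated_integral(2)) (use i in \<open>auto simp: indicator_def\<close>)
    ultimately show ?thesis using norm_triangle_ineq[of L "LINT y|lborel. indicator {..z} y *\<^sub>R f' y"] by simp
  qed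
  have 1: "(\<lambda>n. LINT z|lborel. indicator {0..1} z *\<^sub>R norm (f (z - real n))) \<longlonglongrightarrow> (LINT z|lborel. indicator {0..1::real} z *\<^sub>R norm L)"
  proof (rule integral_dominated_convergence)
    show "integrable lborel (\<lambda>z. (norm L + (LINT y|lborel. norm (f' y))) * indicator {0..1::real} z)"
      by (intro integrable_mult_right integrable_real_indicator) auto
    show "AE z in lborel. (\<lambda>n. indicator {0..1} z *\<^sub>R norm (f (z - real n))) \<longlonglongrightarrow> indicator {0..1::real} z *\<^sub>R norm L"
      using lim unfolding same by (intro AE_I2 tendsto_intros)
    show "AE z in lborel. norm (indicator {0..1} z *\<^sub>R norm (f (z - real n))) \<le> (norm L + (LINT y|lborel. norm (f' y))) * indicator {0..1} z" for n
      using bdd by (intro AE_I2) (auto simp: indicator_def)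
  qed measurable
  have 2: "(\<lambda>n. LINT z|lborel. indicator {0..1} z *\<^sub>R norm (f (z - real n))) \<longlonglongrightarrow> 0"
  proof -
    have "(\<lambda>n. LINT z|lborel. indicator {- real n..1 - real n} z *\<^sub>R norm (f z)) \<longlonglongrightarrow> (LINT z|(lborel::real measure). (0::real))"
    proof (rule integral_dominated_convergence)
      show "integrable lborel (\<lambda>z. norm (f z))" using i by simp
      show "AE z in lborel. (\<lambda>n. indicator {- real n..1 - real n} z *\<^sub>R norm (f z)) \<longlonglongrightarrow> 0"
      proof (intro AE_I2 tendsto_eventually)
        fix z
        obtain N where "1 - z < real N" using reals_Archimedean2 by blast
        then have "indicator {- real n..1 - real n} z *\<^sub>R norm (f z) = 0" if "n \<ge> N" for n
          using that by (auto simp: indicator_def)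
        then show "eventually (\<lambda>n. indicator {- real n..1 - real n} z *\<^sub>R norm (f z) = 0) sequentially"
          unfolding eventually_sequentially by blast
      qed
      show "AE z in lborel. norm (indicator {- real n..1 - real n} z *\<^sub>R norm (f z)) \<le> norm (f z)" for n
        by (auto simp: indicator_def)
    qed measurable
    moreover have "(LINT z|lborel. indicator {- real n..1 - real n} z *\<^sub>R norm (f z)) = (LINT z|lborel. indicator {0..1} z *\<^sub>R norm (f (z - real n)))" for n
    proof -
      have "(LINT z|lborel. indicator {- real n..1 - real n} z *\<^sub>R norm (f z))
        = \<bar>1\<bar> *\<^sub>R (LINT z|lborel. indicator {- real n..1 - real n} (- real n + 1 * z) *\<^sub>R norm (f (- real n + 1 * z)))"
        by (rule lborel_integral_real_affine) simp
      also have "(\<lambda>z. indicator {- real n..1 - real n} (- real n + 1 * z) *\<^sub>R norm (f (- real n + 1 * z))) = (\<lambda>z. indicator {0..1} z *\<^sub>R norm (f (z - real n)))"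
        by (auto simp: indicator_def)
      finally show ?thesis by simp
    qed
    ultimately show ?thesis by simp
  qed
  have "(LINT z|lborel. indicator {0..1::real} z *\<^sub>R norm L) = 0" by (rule LIMSEQ_unique[OF 1 2])
  then have "L = 0" by simp
  then show ?thesis by (simp add: L_def)
qed

text \<open>Integration by parts on the line, when applied to a product.\<close>

lemma ac_integral_zero:
  assumes f: "ac f f'" and i: "integrable lborel f" "integrable lborel f'"
  shows "(LINT x|lborel. f' x) = 0"
proof -
  note [measurable] = ac_measurable[OF f] ac_measurable'[OF f]
  have r: "integrable lborel (\<lambda>x. f (- x))" "integrable lborel (\<lambda>x. - f' (- x))"
    using lborel_integrable_real_affine[OF i(1), of "-1" 0] lborel_integrable_real_affine[OF i(2), of "-1" 0] by simp_all
  have ii: "integrable lborel (\<lambda>y. indicator S y *\<^sub>R f' y)" if "S \<in> sets borel" for S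
    using integrable_mult_indicator[OF _ i(2)] that by simp
  have 1: "f 0 = (LINT y|lborel. indicator {..0} y *\<^sub>R f' y)" by (rule ac_eq_integral_atMost[OF f i])
  have "f (- 0) = (LINT y|lborel. indicator {..0} y *\<^sub>R (- f' (- y)))"
    by (rule ac_eq_integral_atMost[OF ac_reflect[OF f] r])
  also have "\<dots> = - (LINT y|lborel. indicator {..0} y *\<^sub>R f' (- y))" by simp
  also have "(LINT y|lborel. indicator {..0} y *\<^sub>R f' (- y)) = (LINT y|lborel. indicator {0..} y *\<^sub>R f' y)"
  proof -
    have "(LINT y|lborel. indicator {0..} y *\<^sub>R f' y) = \<bar>-1\<bar> *\<^sub>R (LINT y|lborel. indicator {0..} (0 + -1 * y) *\<^sub>R f' (0 + -1 * y))"
      by (rule lborel_integral_real_affine) simp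
    also have "(\<lambda>y. indicator {0..} (0 + -1 * y) *\<^sub>R f' (0 + -1 * y)) = (\<lambda>y. indicator {..0} y *\<^sub>R f' (- y))"
      by (auto simp: indicator_def)
    finally show ?thesis by simp
  qed
  finally have 2: "f 0 = - (LINT y|lborel. indicator {0..} y *\<^sub>R f' y)" by simp
  have "AE y in lborel. f' y = indicator {..0} y *\<^sub>R f' y + indicator {0..} y *\<^sub>R f' y"
    using AE_lborel_singleton[of 0] by eventually_elim (auto simp: indicator_def)
  then have "(LINT y|lborel. f' y) = (LINT y|lborel. indicator {..0} y *\<^sub>R f' y + indicator {0..} y *\<^sub>R f' y)"
    by (intro integral_cong_AE) measurable
  also have "\<dots> = 0" using ii 1 2 by (simp add: add_eq_0_iff2)
  finally show ?thesis .
qed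

definition h1 :: "(real \<Rightarrow> complex) \<Rightarrow> (real \<Rightarrow> complex) \<Rightarrow> bool" where
  "h1 f f' \<longleftrightarrow> ac f f' \<and> sqint f \<and> sqint f'"

text \<open>Write \<open>|f(x)|\<^sup>2\<close> as the integral of its derivative from
  \<open>-\<infinity>\<close> and apply Cauchy-Schwarz.\<close>

lemma h1_sup_bound:
  assumes "h1 f f'" shows "(norm (f x))\<^sup>2 \<le> 2 * l2 f * l2 f'"
proof -
  have f: "ac f f'" "sqint f" "sqint f'" using assms by (auto simp: h1_def)
  have m: "ac (\<lambda>x. f x * cnj (f x)) (\<lambda>x. f' x * cnj (f x) + f x * cnj (f' x))"
    by (intro ac_mult ac_cnj f)
  have i: "integrable lborel (\<lambda>x. f x * cnj (f x))" "integrable lborel (\<lambda>x. f' x * cnj (f x))" "integrable lborel (\<lambda>x. f x * cnj (f' x))"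
    using f by (auto intro!: sqint_prod_integrable)
  have i2: "integrable lborel (\<lambda>x. f' x * cnj (f x) + f x * cnj (f' x))" using i by simp
  have "of_real ((norm (f x))\<^sup>2) = (LINT y|lborel. indicator {..x} y *\<^sub>R (f' y * cnj (f y) + f y * cnj (f' y)))"
    using ac_eq_integral_atMost[OF m i(1) i2] by (simp add: complex_norm_square del: of_real_power)
  then have "(norm (f x))\<^sup>2 = norm (LINT y|lborel. indicator {..x} y *\<^sub>R (f' y * cnj (f y) + f y * cnj (f' y)))"
    by (metis abs_of_nonneg norm_of_real zero_le_power2)
  also have "\<dots> \<le> (LINT y|lborel. 2 * (norm (f y) * norm (f' y)))"
  proof (rule dominated_integral(2))
    show "integrable lborel (\<lambda>y. 2 * (norm (f y) * norm (f' y)))"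
      using integrable_norm[OF i(3)] by (simp add: norm_mult)
    show "(\<lambda>y. indicator {..x} y *\<^sub>R (f' y * cnj (f y) + f y * cnj (f' y))) \<in> borel_measurable borel"
      using borel_measurable_integrable[OF i2] by simp
    show "norm (indicator {..x} y *\<^sub>R (f' y * cnj (f y) + f y * cnj (f' y))) \<le> 2 * (norm (f y) * norm (f' y))" for y
      using norm_triangle_ineq[of "f' y * cnj (f y)" "f y * cnj (f' y)"]
      by (auto simp: indicator_def norm_mult mult.commute)
  qed
  also have "\<dots> \<le> 2 * (l2 f * l2 f')" using l2_CS_norm[OF f(2,3)] by simp
  finally show ?thesis by simp
qed

lemma heat_even: "heat n (- z) = heat n z"
  by (simp add: heat_def gauss_def)

text \<open>A square integrable function with a square integrable weak derivative has an absolutely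
  continuous representative. Testing with mollified indicators of \<open>[a,b]\<close> shows
  that the increments of the mollifications of \<open>u\<close> converge to the integral of
  \<open>v\<close> over \<open>[a,b]\<close>; along a subsequence the mollifications converge
  almost everywhere to \<open>u\<close>.\<close>

lemma weak_derivative_imp_h1:
  assumes u: "sqint u" and v: "sqint v"
    and weak: "\<And>\<psi>. schwartz \<psi> \<Longrightarrow> (LINT x|lborel. u x * vderiv \<psi> x) = - (LINT x|lborel. v x * \<psi> x)"
  obtains w where "h1 w v" "AE x in lborel. w x = u x"
proof -
  note [measurable] = sqint_measurable[OF u] sqint_measurable[OF v]
  have vloc: "integrable lborel (\<lambda>x. indicator {a..b} x *\<^sub>R v x)" for a b
  proof -
    have "sqint (\<lambda>x. complex_of_real (1 * indicator {a..b} x))"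
      unfolding sqint_def norm_of_real power2_abs using integrable_indicator_sq[of 1 a b] by simp
    from sqint_prod_integrable[OF this v] show ?thesis by (simp add: scaleR_conv_of_real)
  qed
  have key: "moll n u b - moll n u a = (LINT y|lborel. v y * moll n (\<lambda>x. of_real (indicator {a..b} x)) y)"
    if "a \<le> b" for n a b
  proof -
    let ?k = "\<lambda>x. complex_of_real (indicator {a..b} x)"
    have ks: "schwartz (moll n ?k)"
    proof (rule schwartz_conv[OF _ _ schwartz_heat])
      fix j
      have "integrable lborel (\<lambda>x. indicator {a..b} x *\<^sub>R (1 + \<bar>x\<bar>) ^ j)"
        by (intro borel_integrable_compact continuous_intros) auto
      then show "integrable lborel (\<lambda>y. (1 + \<bar>y\<bar>) ^ j * norm (?k y))" by (simp add: mult.commute)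
    qed measurable
    have ki: "integrable lborel ?k"
      by (intro integrable_of_real integrable_real_indicator) (auto simp: emeasure_lborel_Icc_eq)
    have d: "vderiv (moll n ?k) = conv ?k (vderiv (heat n))"
      by (intro vderiv_eqI conv_has_derivative ki schwartz_heat)
    have d2: "conv ?k (vderiv (heat n)) y = heat n (y - a) - heat n (y - b)" for y
    proof -
      have "((\<lambda>x. - heat n (y - x)) has_vector_derivative vderiv (heat n) (y - x)) (at x)" for x
      proof -
        have "((\<lambda>x. y - x) has_vector_derivative (- 1)) (at x)"
          unfolding has_real_derivative_iff_has_vector_derivative[symmetric] by (auto intro!: derivative_eq_intros)
        from has_vector_derivative_minus[OF vector_diff_chain_at[OF this schwartz_has_derivative[OF schwartz_heat, of n]]]
        show ?thesis by (simp add: comp_def)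
      qed
      then have "(LINT x|lborel. indicator {a..b} x *\<^sub>R vderiv (heat n) (y - x)) = - heat n (y - b) - - heat n (y - a)"
        by (intro integral_FTC_Icc that)
          (auto intro: has_vector_derivative_at_within
            intro!: continuous_on_compose2[OF schwartz_continuous[OF schwartz_vderiv[OF schwartz_heat]]] continuous_intros)
      then show ?thesis by (simp add: conv_def scaleR_conv_of_real)
    qed
    have su: "integrable lborel (\<lambda>y. u y * heat n (c - y))" for c
      using sqint_prod_integrable[OF u l2_affine(1)[OF _ schwartz_sqint[OF schwartz_heat[of n]], of "-1" c]] by simp
    have "(LINT y|lborel. u y * conv ?k (vderiv (heat n)) y) = (LINT y|lborel. u y * heat n (a - y) - u y * heat n (b - y))"
    proof (intro Bochner_Integration.integral_cong refl)
      fix y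
      show "u y * conv ?k (vderiv (heat n)) y = u y * heat n (a - y) - u y * heat n (b - y)"
        using heat_even[of n "a - y"] heat_even[of n "b - y"] unfolding d2 by (simp add: algebra_simps)
    qed
    also have "\<dots> = moll n u a - moll n u b" using su by (simp add: conv_def)
    finally show ?thesis using weak[OF ks] unfolding d by (simp add: minus_equation_iff algebra_simps)
  qed
  have klim: "(\<lambda>n. moll n u b - moll n u a) \<longlonglongrightarrow> (LINT x|lborel. indicator {a..b} x *\<^sub>R v x)" if "a \<le> b" for a b
  proof -
    let ?k = "\<lambda>x. complex_of_real (indicator {a..b} x)"
    have k: "sqint ?k"
      unfolding sqint_def norm_of_real power2_abs using integrable_indicator_sq[of 1 a b] by simp
    have "(\<lambda>n. LINT y|lborel. v y * moll n ?k y) \<longlonglongrightarrow> (LINT y|lborel. v y * ?k y)"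
      by (rule integral_mult_tendsto[OF moll_contraction(1)[OF k] k moll_tendsto_l2[OF k] v])
    then show ?thesis unfolding key[OF that] by (simp add: scaleR_conv_of_real mult.commute)
  qed
  have "(\<lambda>n. (l2 (\<lambda>x. moll n u x - u x))\<^sup>2) \<longlonglongrightarrow> 0\<^sup>2"
    by (intro tendsto_intros moll_tendsto_l2[OF u])
  then have "(\<lambda>n. LINT x|lborel. norm ((norm (moll n u x - u x))\<^sup>2)) \<longlonglongrightarrow> 0" by (simp add: l2_power2)
  from tendsto_L1_AE_subseq[OF _ this] obtain r where r: "strict_mono r"
    "AE x in lborel. (\<lambda>n. (norm (moll (r n) u x - u x))\<^sup>2) \<longlonglongrightarrow> 0"
    using sqint_integrable[OF sqint_diff[OF moll_contraction(1)[OF u] u]] by auto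
  have good: "AE x in lborel. (\<lambda>n. moll (r n) u x) \<longlonglongrightarrow> u x"
    using r(2)
  proof eventually_elim
    case (elim x)
    from tendsto_real_sqrt[OF elim] have "(\<lambda>n. norm (moll (r n) u x - u x)) \<longlonglongrightarrow> 0" by simp
    then show ?case using LIM_zero_iff tendsto_norm_zero_iff by blast
  qed
  then obtain c where c: "(\<lambda>n. moll (r n) u c) \<longlonglongrightarrow> u c"
    using eventually_happens'[OF _ good] by (auto simp: ae_filter_eq_bot_iff)
  define w where "w x = u c + (if c \<le> x then LINT y|lborel. indicator {c..x} y *\<^sub>R v y else - (LINT y|lborel. indicator {x..c} y *\<^sub>R v y))" for x
  have add: "(LINT y|lborel. indicator {p..q} y *\<^sub>R v y) + (LINT y|lborel. indicator {q..s} y *\<^sub>R v y) = (LINT y|lborel. indicator {p..s} y *\<^sub>R v y)"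
    if "p \<le> q" "q \<le> s" for p q s
  proof -
    have "AE y in lborel. indicator {p..s} y *\<^sub>R v y = indicator {p..q} y *\<^sub>R v y + indicator {q..s} y *\<^sub>R v y"
      using AE_lborel_singleton[of q] by eventually_elim (use that in \<open>auto simp: indicator_def\<close>)
    then have "(LINT y|lborel. indicator {p..s} y *\<^sub>R v y) = (LINT y|lborel. indicator {p..q} y *\<^sub>R v y + indicator {q..s} y *\<^sub>R v y)"
      by (intro integral_cong_AE) measurable
    then show ?thesis using vloc by simp
  qed
  have acw: "ac w v"
    unfolding ac_def
  proof (intro conjI allI impI vloc)
    fix a b :: real assume ab: "a \<le> b"
    consider "c \<le> a" | "a < c" "c \<le> b" | "b < c" by linarith
    then show "w b - w a = (LINT x|lborel. indicator {a..b} x *\<^sub>R v x)"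
    proof cases
      case 1 then show ?thesis using ab add[of c a b] by (simp add: w_def algebra_simps)
    next
      case 2 then show ?thesis using ab add[of a c b] by (simp add: w_def algebra_simps)
    next
      case 3 then show ?thesis using ab add[of a b c] by (simp add: w_def algebra_simps)
    qed
  qed measurable
  have eq: "AE x in lborel. w x = u x"
    using good
  proof eventually_elim
    case (elim x)
    have sub: "(\<lambda>n. moll (r n) u b - moll (r n) u a) \<longlonglongrightarrow> (LINT x|lborel. indicator {a..b} x *\<^sub>R v x)" if "a \<le> b" for a b
      using LIMSEQ_subseq_LIMSEQ[OF klim[OF that] r(1)] by (simp add: comp_def)
    show ?case
    proof (cases "c \<le> x")
      case True
      have "u x - u c = (LINT y|lborel. indicator {c..x} y *\<^sub>R v y)"
        by (rule LIMSEQ_unique[OF tendsto_diff[OF elim c] sub[OF True]])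
      then show ?thesis using True by (simp add: w_def algebra_simps)
    next
      case False
      have "u c - u x = (LINT y|lborel. indicator {x..c} y *\<^sub>R v y)"
        by (rule LIMSEQ_unique[OF tendsto_diff[OF c elim] sub]) (use False in simp)
      then show ?thesis using False by (simp add: w_def algebra_simps)
    qed
  qed
  have "sqint w"
    by (rule sqint_cong_AE[OF u ac_measurable[OF acw]]) (use eq in \<open>auto elim: eventually_mono\<close>)
  then show ?thesis using that[of w] acw eq v by (simp add: h1_def)
qed

lemma vderiv_affine:
  assumes "schwartz f"
  shows "((\<lambda>x. f (t + a * x)) has_vector_derivative of_real a * vderiv f (t + a * x)) (at x)"
proof -
  have "((\<lambda>x. t + a * x) has_vector_derivative a) (at x)"
    unfolding has_real_derivative_iff_has_vector_derivative[symmetric] by (auto intro!: derivative_eq_intros)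
  from vector_diff_chain_at[OF this schwartz_has_derivative[OF assms]]
  show ?thesis by (simp add: comp_def scaleR_conv_of_real)
qed

lemma gauss_norm_le: "norm (gauss x) \<le> 1"
  by (simp add: gauss_def norm_exp_eq_Re flip: of_real_power)

lemma sqint_norm_combination:
  assumes "sqint f" "sqint g"
  shows "integrable lborel (\<lambda>x. (B * norm (f x) + norm (g x))\<^sup>2)"
proof -
  have n: "sqint (\<lambda>x. complex_of_real (norm (h x)))" if "sqint h" for h
  proof -
    have m: "(\<lambda>x. complex_of_real (norm (h x))) \<in> borel_measurable borel" using sqint_measurable[OF that] by measurable
    show ?thesis
      by (rule sqint_bound[OF that m], rule AE_I2, unfold norm_of_real abs_norm_cancel, rule order_refl)
  qed
  have "sqint (\<lambda>x. of_real B * complex_of_real (norm (f x)) + complex_of_real (norm (g x)))"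
    by (intro sqint_add sqint_cmult n assms)
  moreover have "(\<lambda>x. of_real B * complex_of_real (norm (f x)) + complex_of_real (norm (g x))) = (\<lambda>x. of_real (B * norm (f x) + norm (g x)))"
    by simp
  ultimately have "sqint (\<lambda>x. complex_of_real (B * norm (f x) + norm (g x)))" by (simp only:)
  from sqint_integrable[OF this] show ?thesis unfolding norm_of_real power2_abs .
qed

text \<open>Cut off by wide Gaussians, which makes the function rapidly decreasing in the mean, then
  mollify. Mollification commutes with the derivative by integration by parts.\<close>

lemma schwartz_dense_h1:
  assumes h: "h1 h h'" and e: "0 < e"
  obtains \<psi> where "schwartz \<psi>" "l2 (\<lambda>x. \<psi> x - h x) < e" "l2 (\<lambda>x. vderiv \<psi> x - h' x) < e"
proof -
  have ac: "ac h h'" and sh: "sqint h" and sh': "sqint h'" using h by (auto simp: h1_def)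
  note [measurable] = sqint_measurable[OF sh] sqint_measurable[OF sh']
  define c where "c m = 1 / real (Suc m)" for m
  define g where "g m x = gauss (0 + c m * x)" for m x
  define g' where "g' m x = of_real (c m) * vderiv gauss (0 + c m * x)" for m x
  have c0: "c m \<noteq> 0" "\<bar>c m\<bar> \<le> 1" for m by (auto simp: c_def)
  have clim: "(\<lambda>m. 0 + c m * x) \<longlonglongrightarrow> 0" "(\<lambda>m. of_real (c m) :: complex) \<longlonglongrightarrow> 0" for x
  proof -
    have "c \<longlonglongrightarrow> 0" unfolding c_def by real_asymp
    then show "(\<lambda>m. 0 + c m * x) \<longlonglongrightarrow> 0" "(\<lambda>m. of_real (c m) :: complex) \<longlonglongrightarrow> 0"
      using tendsto_of_real[of c 0] by (auto intro!: tendsto_mult_left_zero simp: tendsto_mult_left_zero)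
  qed
  have gs: "schwartz (g m)" for m unfolding g_def by (rule schwartz_affine[OF schwartz_gauss' c0(1)])
  have g'eq: "vderiv (g m) = g' m" for m
    unfolding g_def g'_def by (rule vderiv_eqI) (rule vderiv_affine[OF schwartz_gauss'])
  note [measurable] = schwartz_measurable[OF gs] schwartz_measurable[OF schwartz_vderiv[OF gs], unfolded g'eq]
  obtain B where B: "0 \<le> B" "\<And>x. norm (vderiv gauss x) \<le> B" using schwartz_bounded[OF schwartz_vderiv[OF schwartz_gauss']] by auto
  have g'B: "norm (g' m x) \<le> B" for m x
  proof -
    have "norm (g' m x) = \<bar>c m\<bar> * norm (vderiv gauss (0 + c m * x))" by (simp add: g'_def norm_mult)
    also have "\<dots> \<le> 1 * B" using c0 B by (intro mult_mono) auto
    finally show ?thesis by simp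
  qed
  have g1: "norm (g m x) \<le> 1" for m x unfolding g_def by (rule gauss_norm_le)
  have glim: "(\<lambda>m. g m x) \<longlonglongrightarrow> 1" for x
  proof -
    have "(\<lambda>m. gauss (0 + c m * x)) \<longlonglongrightarrow> gauss 0"
      by (rule continuous_on_tendsto_compose[OF schwartz_continuous[OF schwartz_gauss'] clim(1)]) simp_all
    then show ?thesis by (simp add: g_def gauss_def)
  qed
  have g'lim: "(\<lambda>m. g' m x) \<longlonglongrightarrow> 0" for x
  proof -
    have "(\<lambda>m. vderiv gauss (0 + c m * x)) \<longlonglongrightarrow> vderiv gauss 0"
      by (rule continuous_on_tendsto_compose[OF schwartz_continuous[OF schwartz_vderiv[OF schwartz_gauss']] clim(1)]) simp_all
    from tendsto_mult[OF clim(2) this] show ?thesis by (simp add: g'_def)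
  qed
  define hm where "hm m x = g m x * h x" for m x
  define dm where "dm m x = g' m x * h x + g m x * h' x" for m x
  have [measurable]: "hm m \<in> borel_measurable borel" "dm m \<in> borel_measurable borel" for m
    unfolding hm_def[abs_def] dm_def[abs_def] by measurable
  have ach: "ac (hm m) (dm m)" for m
    unfolding hm_def[abs_def] dm_def[abs_def] using ac_mult[OF ac_schwartz[OF gs] ac] by (simp add: g'eq)
  have w1: "integrable lborel (\<lambda>x. (norm (h x))\<^sup>2)" by (rule sqint_integrable[OF sh])
  have b1: "norm (hm m x) \<le> norm (h x)" for m x
    using mult_right_mono[OF g1[of m x], of "norm (h x)"] by (simp add: hm_def norm_mult)
  have b2: "norm (dm m x) \<le> B * norm (h x) + norm (h' x)" for m x
  proof -
    have "norm (dm m x) \<le> norm (g' m x) * norm (h x) + norm (g m x) * norm (h' x)"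
      unfolding dm_def by (rule order_trans[OF norm_triangle_ineq]) (simp add: norm_mult)
    also have "\<dots> \<le> B * norm (h x) + 1 * norm (h' x)" by (intro add_mono mult_right_mono g'B g1) auto
    finally show ?thesis by simp
  qed
  have l1: "(\<lambda>m. hm m x) \<longlonglongrightarrow> h x" for x
    using tendsto_mult[OF glim[of x] tendsto_const[of "h x"]] by (simp add: hm_def)
  have l2': "(\<lambda>m. dm m x) \<longlonglongrightarrow> h' x" for x
    using tendsto_add[OF tendsto_mult[OF g'lim[of x] tendsto_const[of "h x"]] tendsto_mult[OF glim[of x] tendsto_const[of "h' x"]]]
    by (simp add: dm_def)
  have D1: "(\<lambda>m. l2 (\<lambda>x. hm m x - h x)) \<longlonglongrightarrow> 0" "\<And>m. sqint (hm m)"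
    by (rule l2_dominated_tendsto(2,3)[OF _ _ w1 AE_I2[OF l1] AE_I2[OF b1]]; measurable)+
  have D2: "(\<lambda>m. l2 (\<lambda>x. dm m x - h' x)) \<longlonglongrightarrow> 0" "\<And>m. sqint (dm m)"
    by (rule l2_dominated_tendsto(2,3)[OF _ _ sqint_norm_combination[OF sh sh'] AE_I2[OF l2'] AE_I2[OF b2]]; measurable)+
  have "eventually (\<lambda>m. l2 (\<lambda>x. hm m x - h x) < e / 2 \<and> l2 (\<lambda>x. dm m x - h' x) < e / 2) sequentially"
    using order_tendstoD(2)[OF D1(1), of "e / 2"] order_tendstoD(2)[OF D2(1), of "e / 2"] e by (auto intro: eventually_conj)
  then obtain m where m: "l2 (\<lambda>x. hm m x - h x) < e / 2" "l2 (\<lambda>x. dm m x - h' x) < e / 2"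
    by (auto simp: eventually_sequentially)
  have hms: "integrable lborel (\<lambda>y. (1 + \<bar>y\<bar>) ^ j * norm (hm m y))" for j
  proof -
    obtain C where C: "0 \<le> C" "\<And>x. (1 + \<bar>x\<bar>) ^ (j + 2) * norm (g m x) \<le> C" using schwartz_weight_bound[OF gs, of "j + 2" m] by auto
    have "sqint (\<lambda>y. of_real ((1 + \<bar>y\<bar>) ^ j) * g m y)"
    proof (rule sqint_of_decay[of _ C])
      fix y :: real
      have "1 + y\<^sup>2 \<le> (1 + \<bar>y\<bar>)\<^sup>2" unfolding power2_sum by simp
      then have "((1 + \<bar>y\<bar>) ^ j * norm (g m y)) * (1 + y\<^sup>2) \<le> ((1 + \<bar>y\<bar>) ^ j * norm (g m y)) * (1 + \<bar>y\<bar>)\<^sup>2"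
        by (intro mult_left_mono) auto
      also have "\<dots> \<le> C" using C(2)[of y] unfolding power_add by (simp only: mult_ac)
      finally have "(1 + \<bar>y\<bar>) ^ j * norm (g m y) \<le> C / (1 + y\<^sup>2)" by (simp add: field_simps add_pos_nonneg)
      then show "norm (of_real ((1 + \<bar>y\<bar>) ^ j) * g m y) \<le> C / (1 + y\<^sup>2)" unfolding norm_mult norm_of_real by simp
    qed measurable
    from integrable_norm[OF sqint_prod_integrable[OF this sh]]
    show ?thesis unfolding norm_mult norm_of_real by (simp add: hm_def norm_mult mult.assoc)
  qed
  have ms: "schwartz (moll n (hm m))" for n by (rule schwartz_conv[OF _ hms schwartz_heat]) measurable
  have him: "integrable lborel (hm m)" using hms[of 0] integrable_norm_iff[of "hm m" lborel] by simp
  have dmoll: "vderiv (moll n (hm m)) = moll n (dm m)" for n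
  proof -
    have "vderiv (moll n (hm m)) = conv (hm m) (vderiv (heat n))"
      by (intro vderiv_eqI conv_has_derivative him schwartz_heat)
    also have "\<dots> = moll n (dm m)"
    proof
      fix x
      have a: "ac (\<lambda>y. heat n (x + -1 * y)) (\<lambda>y. of_real (-1) * vderiv (heat n) (x + -1 * y))"
      proof (rule ac_of_C1[OF vderiv_affine[OF schwartz_heat]])
        show "continuous_on UNIV (\<lambda>y. of_real (-1) * vderiv (heat n) (x + -1 * y))"
          by (intro continuous_intros continuous_on_compose2[OF schwartz_continuous[OF schwartz_vderiv[OF schwartz_heat]]]) auto
      qed
      have s1: "sqint (\<lambda>y. heat n (x + -1 * y))" and s2: "sqint (\<lambda>y. vderiv (heat n) (x + -1 * y))"
        by (intro l2_affine(1) schwartz_sqint schwartz_vderiv schwartz_heat; simp)+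
      have s3: "sqint (\<lambda>y. of_real (-1) * vderiv (heat n) (x + -1 * y))" by (rule sqint_cmult[OF s2])
      have i: "integrable lborel (\<lambda>y. hm m y * heat n (x + -1 * y))"
        "integrable lborel (\<lambda>y. dm m y * heat n (x + -1 * y))"
        "integrable lborel (\<lambda>y. hm m y * (of_real (-1) * vderiv (heat n) (x + -1 * y)))"
        by (intro sqint_prod_integrable D1(2) D2(2) s1 s3)+
      have "(LINT y|lborel. dm m y * heat n (x + -1 * y) + hm m y * (of_real (-1) * vderiv (heat n) (x + -1 * y))) = 0"
        by (rule ac_integral_zero[OF ac_mult[OF ach a] i(1)]) (intro Bochner_Integration.integrable_add i)
      then have "(LINT y|lborel. dm m y * heat n (x + -1 * y)) + (LINT y|lborel. hm m y * (of_real (-1) * vderiv (heat n) (x + -1 * y))) = 0"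
        by (subst (asm) Bochner_Integration.integral_add[OF i(2,3)])
      then show "conv (hm m) (vderiv (heat n)) x = moll n (dm m) x"
        by (simp add: conv_def add_eq_0_iff2)
    qed
    finally show ?thesis .
  qed
  have "eventually (\<lambda>n. l2 (\<lambda>x. moll n (hm m) x - hm m x) < e / 2 \<and> l2 (\<lambda>x. moll n (dm m) x - dm m x) < e / 2) sequentially"
    using order_tendstoD(2)[OF moll_tendsto_l2[OF D1(2)[of m]], of "e / 2"] order_tendstoD(2)[OF moll_tendsto_l2[OF D2(2)[of m]], of "e / 2"] e
    by (auto intro: eventually_conj)
  then obtain n where n: "l2 (\<lambda>x. moll n (hm m) x - hm m x) < e / 2" "l2 (\<lambda>x. moll n (dm m) x - dm m x) < e / 2"
    by (auto simp: eventually_sequentially)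
  show ?thesis
  proof (rule that[OF ms[of n]])
    show "l2 (\<lambda>x. moll n (hm m) x - h x) < e"
      using l2_triangle_diff[OF moll_contraction(1)[OF D1(2)[of m], of n] D1(2)[of m] sh] n m by linarith
    show "l2 (\<lambda>x. vderiv (moll n (hm m)) x - h' x) < e"
      using l2_triangle_diff[OF moll_contraction(1)[OF D2(2)[of m], of n] D2(2)[of m] sh'] n m unfolding dmoll by linarith
  qed
qed

section \<open>The Sobolev spaces in terms of functions\<close>

lemma weight_0: "weight 0 x = 1"
  using add_pos_nonneg[of 1 "x\<^sup>2"] by (simp add: weight_def)

lemma weight_mult: "weight s x * weight t x = weight (s + t) x"
  by (simp add: weight_def add_divide_distrib powr_add)

lemma weight_m1_norm: "norm (weight (-1) x) \<le> 1" "norm (of_real x * weight (-1) x) \<le> 1"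
proof -
  have p: "1 + x\<^sup>2 > 0" by (simp add: add_pos_nonneg)
  have e: "norm (weight (-1) x) = 1 / sqrt (1 + x\<^sup>2)"
  proof -
    have "norm (weight (-1) x) = (1 + x\<^sup>2) powr (- (1 / 2))" unfolding weight_def norm_of_real power2_abs by simp
    also have "\<dots> = inverse ((1 + x\<^sup>2) powr (1 / 2))" by (rule powr_minus)
    also have "(1 + x\<^sup>2) powr (1 / 2) = sqrt (1 + x\<^sup>2)" by (rule powr_half_sqrt) (use p in linarith)
    finally show ?thesis by (simp only: inverse_eq_divide)
  qed
  have s: "1 \<le> sqrt (1 + x\<^sup>2)" by simp
  have "1 / sqrt (1 + x\<^sup>2) \<le> 1 / 1" by (rule frac_le) (use s in auto)
  then show "norm (weight (-1) x) \<le> 1" unfolding e by simp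
  have "\<bar>x\<bar> \<le> sqrt (1 + x\<^sup>2)" by (rule real_le_rsqrt) simp
  moreover have "0 < sqrt (1 + x\<^sup>2)" using s by linarith
  ultimately show "norm (of_real x * weight (-1) x) \<le> 1" unfolding norm_mult e norm_of_real
    using s by (simp only: times_divide_eq_right mult_1_right divide_le_eq_1_pos)
qed

lemma weight_measurable [measurable]: "weight s \<in> borel_measurable borel"
  unfolding weight_def[abs_def] by measurable

text \<open>The function \<open>g\<close> represents the distribution \<open>(1 -
  \<partial>\<^sub>x\<^sup>2)\<^bsup>1/2\<^esup> f\<close>.\<close>

definition H1_rep :: "(real \<Rightarrow> complex) \<Rightarrow> (real \<Rightarrow> complex) \<Rightarrow> bool" where
  "H1_rep f g \<longleftrightarrow> g \<in> Lq_space 2 \<and> distr_eq (distr_mult (weight 0) (bessel 1 (distr_of f))) (distr_of g)"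

text \<open>The inverse Bessel potential is moved onto the test function.\<close>

lemma H1_rep_pairing:
  assumes g: "H1_rep f g" and \<eta>: "schwartz \<eta>"
  shows "(LINT x|lborel. f x * \<eta> x) = (LINT x|lborel. g x * fourier (\<lambda>\<xi>. weight (-1) \<xi> * inv_fourier \<eta> \<xi>) x)"
proof -
  let ?\<psi> = "fourier (\<lambda>\<xi>. weight (-1) \<xi> * inv_fourier \<eta> \<xi>)"
  have w: "schwartz (\<lambda>\<xi>. weight (-1) \<xi> * inv_fourier \<eta> \<xi>)"
    by (intro schwartz_weight schwartz_inv_fourier \<eta>)
  have "distr_mult (weight 0) (bessel 1 (distr_of f)) ?\<psi> = distr_of g ?\<psi>"
    using g schwartz_fourier[OF w] by (simp add: H1_rep_def distr_eq_def)
  moreover have "distr_mult (weight 0) (bessel 1 (distr_of f)) ?\<psi> = distr_of f \<eta>"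
  proof -
    have "distr_mult (weight 0) (bessel 1 (distr_of f)) ?\<psi> = distr_of f (fourier (\<lambda>\<xi>. weight 1 \<xi> * inv_fourier ?\<psi> \<xi>))"
      by (simp add: distr_mult_def bessel_def distr_inv_fourier_def distr_fourier_def weight_0)
    also have "(\<lambda>\<xi>. weight 1 \<xi> * inv_fourier ?\<psi> \<xi>) = inv_fourier \<eta>"
      using fourier_inversion[OF w] by (simp add: weight_mult weight_0 flip: mult.assoc)
    finally show ?thesis by (simp add: fourier_inversion'[OF \<eta>])
  qed
  ultimately show ?thesis by (simp add: distr_of_def)
qed

lemma inv_fourier_vderiv: "schwartz f \<Longrightarrow> inv_fourier (vderiv f) \<xi> = - \<i> * of_real \<xi> * inv_fourier f \<xi>"
  by (simp add: inv_fourier_eq fourier_vderiv)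

text \<open>Both multipliers \<open>(1 + \<xi>\<^sup>2)\<^bsup>-1/2\<^esup>\<close> and \<open>\<xi> (1 +
  \<xi>\<^sup>2)\<^bsup>-1/2\<^esup>\<close> are bounded by one, so by Plancherel on Schwartz
  functions the pairings of \<open>f\<close> and of its derivative with a test function are
  bounded by \<open>l2 g\<close> times the norm of the test function; duality does the rest.
  This way the Fourier transform of a general square integrable function is never needed.\<close>

lemma H1_rep_bounds:
  assumes g: "H1_rep f g" and fm: "f \<in> borel_measurable borel"
    and fi: "\<And>\<psi>. schwartz \<psi> \<Longrightarrow> integrable lborel (\<lambda>x. f x * \<psi> x)"
  shows "sqint f" "l2 f \<le> l2 g"
    and "\<And>f'. f' \<in> borel_measurable borel \<Longrightarrow> (\<And>\<psi>. schwartz \<psi> \<Longrightarrow> integrable lborel (\<lambda>x. f' x * \<psi> x)) \<Longrightarrow>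
      (\<And>\<psi>. schwartz \<psi> \<Longrightarrow> (LINT x|lborel. f' x * \<psi> x) = - (LINT x|lborel. f x * vderiv \<psi> x)) \<Longrightarrow>
      sqint f' \<and> l2 f' \<le> l2 g"
proof -
  have gs: "sqint g" using g by (simp add: H1_rep_def Lq_space_2)
  have bd: "norm (LINT x|lborel. f x * \<eta> x) \<le> l2 g * l2 (\<lambda>\<xi>. weight (-1) \<xi> * inv_fourier \<eta> \<xi>)"
    if \<eta>: "schwartz \<eta>" for \<eta>
  proof -
    have w: "schwartz (\<lambda>\<xi>. weight (-1) \<xi> * inv_fourier \<eta> \<xi>)"
      by (intro schwartz_weight schwartz_inv_fourier \<eta>)
    show ?thesis unfolding H1_rep_pairing[OF g \<eta>]
      using l2_CS[OF gs schwartz_sqint[OF schwartz_fourier[OF w]]] by (simp add: plancherel_schwartz[OF w])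
  qed
  have "norm (LINT x|lborel. f x * \<eta> x) \<le> l2 g * l2 \<eta>" if \<eta>: "schwartz \<eta>" for \<eta>
  proof -
    have "l2 (\<lambda>\<xi>. weight (-1) \<xi> * inv_fourier \<eta> \<xi>) \<le> 1 * l2 (inv_fourier \<eta>)"
      by (intro sqint_bounded_mult schwartz_sqint schwartz_inv_fourier \<eta> weight_m1_norm weight_measurable)
    then have "l2 (\<lambda>\<xi>. weight (-1) \<xi> * inv_fourier \<eta> \<xi>) \<le> l2 \<eta>" by (simp add: plancherel_inv[OF \<eta>])
    from mult_left_mono[OF this, of "l2 g"] show ?thesis using bd[OF \<eta>] by simp
  qed
  then show "sqint f" "l2 f \<le> l2 g" using l2_by_duality[OF fm fi, of "l2 g"] by auto
  fix f' assume f': "f' \<in> borel_measurable borel" and f'i: "\<And>\<psi>. schwartz \<psi> \<Longrightarrow> integrable lborel (\<lambda>x. f' x * \<psi> x)"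
    and der: "\<And>\<psi>. schwartz \<psi> \<Longrightarrow> (LINT x|lborel. f' x * \<psi> x) = - (LINT x|lborel. f x * vderiv \<psi> x)"
  have "norm (LINT x|lborel. f' x * \<eta> x) \<le> l2 g * l2 \<eta>" if \<eta>: "schwartz \<eta>" for \<eta>
  proof -
    have "l2 (\<lambda>\<xi>. weight (-1) \<xi> * inv_fourier (vderiv \<eta>) \<xi>) = l2 (\<lambda>\<xi>. (- \<i> * (of_real \<xi> * weight (-1) \<xi>)) * inv_fourier \<eta> \<xi>)"
      by (simp add: inv_fourier_vderiv[OF \<eta>] mult_ac)
    also have "\<dots> \<le> 1 * l2 (inv_fourier \<eta>)"
    proof (intro sqint_bounded_mult schwartz_sqint schwartz_inv_fourier \<eta>)
      show "norm (- \<i> * (complex_of_real x * weight (- 1) x)) \<le> 1" for x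
        using weight_m1_norm(2)[of x] by (simp add: norm_mult)
    qed measurable
    also have "\<dots> = l2 \<eta>" by (simp add: plancherel_inv[OF \<eta>])
    finally have "l2 g * l2 (\<lambda>\<xi>. weight (-1) \<xi> * inv_fourier (vderiv \<eta>) \<xi>) \<le> l2 g * l2 \<eta>" by (rule mult_left_mono) simp
    then show ?thesis using bd[OF schwartz_vderiv[OF \<eta>]] der[OF \<eta>] by simp
  qed
  then show "sqint f' \<and> l2 f' \<le> l2 g" using l2_by_duality[OF f' f'i, of "l2 g"] by auto
qed

text \<open>The norm is defined through a chosen representative \<open>g\<close>.\<close>

lemma Hf_norm_1_0:
  assumes "H1_rep f g0" obtains g where "H1_rep f g" "Hf_norm 1 0 f = l2 g"
proof -
  let ?P = "\<lambda>g. g \<in> Lq_space 2 \<and> distr_eq (distr_mult (weight 0) (bessel 1 (distr_of f))) (distr_of g)"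
  have "?P (SOME g. ?P g)" by (rule someI[of ?P g0]) (use assms in \<open>simp add: H1_rep_def\<close>)
  then show ?thesis
    by (intro that[of "SOME g. ?P g"]) (simp_all add: H1_rep_def Hf_norm_def H_norm_def Lq_norm_2)
qed

text \<open>Continuity in \<open>H\<^sup>1\<close> is a statement about differences, so these need a
  representative as well.\<close>

lemma H1_rep_diff:
  assumes g: "H1_rep f g" and h: "H1_rep k h"
    and fi: "\<And>\<psi>. schwartz \<psi> \<Longrightarrow> integrable lborel (\<lambda>x. f x * \<psi> x)"
    and ki: "\<And>\<psi>. schwartz \<psi> \<Longrightarrow> integrable lborel (\<lambda>x. k x * \<psi> x)"
  shows "H1_rep (\<lambda>x. f x - k x) (\<lambda>x. g x - h x)"
proof -
  have s: "sqint g" "sqint h" using g h by (simp_all add: H1_rep_def Lq_space_2)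
  have op: "distr_mult (weight 0) (bessel 1 T) \<psi> = T (fourier (\<lambda>\<xi>. weight 1 \<xi> * inv_fourier (\<lambda>x. weight 0 x * \<psi> x) \<xi>))" for T \<psi>
    by (simp add: distr_mult_def bessel_def distr_inv_fourier_def distr_fourier_def)
  have "distr_eq (distr_mult (weight 0) (bessel 1 (distr_of (\<lambda>x. f x - k x)))) (distr_of (\<lambda>x. g x - h x))"
    unfolding distr_eq_def
  proof (intro allI impI)
    fix \<psi> assume \<psi>: "schwartz \<psi>"
    let ?\<eta> = "fourier (\<lambda>\<xi>. weight 1 \<xi> * inv_fourier (\<lambda>x. weight 0 x * \<psi> x) \<xi>)"
    have \<eta>: "schwartz ?\<eta>" by (intro schwartz_fourier schwartz_weight schwartz_inv_fourier \<psi>)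
    have "distr_of (\<lambda>x. f x - k x) ?\<eta> = distr_of f ?\<eta> - distr_of k ?\<eta>"
      using fi[OF \<eta>] ki[OF \<eta>] by (simp add: distr_of_def left_diff_distrib)
    also have "distr_of f ?\<eta> = distr_of g \<psi>" using g \<psi> by (simp add: H1_rep_def distr_eq_def op)
    also have "distr_of k ?\<eta> = distr_of h \<psi>" using h \<psi> by (simp add: H1_rep_def distr_eq_def op)
    also have "distr_of g \<psi> - distr_of h \<psi> = distr_of (\<lambda>x. g x - h x) \<psi>"
      using s schwartz_sqint[OF \<psi>] by (simp add: distr_of_def left_diff_distrib sqint_prod_integrable)
    finally show "distr_mult (weight 0) (bessel 1 (distr_of (\<lambda>x. f x - k x))) \<psi> = distr_of (\<lambda>x. g x - h x) \<psi>"
      by (simp only: op)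
  qed
  then show ?thesis using sqint_diff[OF s] by (simp add: H1_rep_def Lq_space_2)
qed

text \<open>By Cauchy-Schwarz against the square integrable weight \<open>(1 +
  x\<^sup>2)\<^bsup>-2\<^esup>\<close>.\<close>

lemma H_0_4_integrable:
  assumes "\<phi> \<in> H_fun 0 4"
  shows "integrable lborel \<phi>" "sqint \<phi>"
proof -
  have t: "tempered_fun \<phi>" using assms by (simp add: H_fun_def)
  then have fm [measurable]: "\<phi> \<in> borel_measurable borel" and fi: "\<And>\<psi>. schwartz \<psi> \<Longrightarrow> integrable lborel (\<lambda>x. \<phi> x * \<psi> x)"
    by (simp_all add: tempered_fun_def)
  obtain g where g: "sqint g" "distr_eq (distr_mult (weight 4) (bessel 0 (distr_of \<phi>))) (distr_of g)"
    using assms by (auto simp: H_fun_def H_space_def Lq_space_2)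
  note [measurable] = sqint_measurable[OF g(1)]
  have "AE x in lborel. weight 4 x * \<phi> x - g x = 0"
  proof (rule AE_zero_by_duality)
    fix \<psi> assume \<psi>: "schwartz \<psi>"
    have w: "schwartz (\<lambda>x. weight 4 x * \<psi> x)" by (rule schwartz_weight[OF \<psi>])
    have i1: "integrable lborel (\<lambda>x. weight 4 x * \<phi> x * \<psi> x)" using fi[OF w] by (simp add: mult_ac)
    have i2: "integrable lborel (\<lambda>x. g x * \<psi> x)" by (rule sqint_prod_integrable[OF g(1) schwartz_sqint[OF \<psi>]])
    show "integrable lborel (\<lambda>x. (weight 4 x * \<phi> x - g x) * \<psi> x)"
      using i1 i2 by (simp add: left_diff_distrib)
    have "(LINT x|lborel. g x * \<psi> x) = distr_mult (weight 4) (bessel 0 (distr_of \<phi>)) \<psi>"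
      using g(2) \<psi> by (simp add: distr_eq_def distr_of_def)
    also have "\<dots> = distr_of \<phi> (\<lambda>x. weight 4 x * \<psi> x)"
      using fourier_inversion'[OF w]
      by (simp add: distr_mult_def bessel_def distr_inv_fourier_def distr_fourier_def weight_0)
    also have "\<dots> = (LINT x|lborel. weight 4 x * \<phi> x * \<psi> x)" by (simp add: distr_of_def mult_ac)
    finally show "(LINT x|lborel. (weight 4 x * \<phi> x - g x) * \<psi> x) = 0"
      using i1 i2 by (simp add: left_diff_distrib)
  qed measurable
  then have eq: "AE x in lborel. weight (-4) x * g x = \<phi> x"
  proof eventually_elim
    case (elim x)
    then have "weight (-4) x * g x = (weight (-4) x * weight 4 x) * \<phi> x" by simp
    then show ?case by (simp add: weight_mult weight_0)
  qed
  have wn: "norm (weight (-4) x) \<le> 1 / (1 + x\<^sup>2)" "norm (weight (-4) x) \<le> 1" for x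
  proof -
    have p: "1 + x\<^sup>2 > 0" by (simp add: add_pos_nonneg)
    have q: "1 + x\<^sup>2 \<ge> 1" by simp
    have "norm (weight (-4) x) = (1 + x\<^sup>2) powr (-2)" unfolding weight_def norm_of_real by simp
    also have "\<dots> \<le> (1 + x\<^sup>2) powr (-1)" using q by (intro powr_mono) auto
    finally show 1: "norm (weight (-4) x) \<le> 1 / (1 + x\<^sup>2)" using p by (simp add: powr_minus divide_inverse)
    have "1 / (1 + x\<^sup>2) \<le> 1" using q p by (simp add: divide_le_eq)
    then show "norm (weight (-4) x) \<le> 1" using 1 by linarith
  qed
  have ws: "sqint (weight (-4))" by (rule sqint_of_decay[OF weight_measurable]) (rule wn(1))
  have "integrable lborel (\<lambda>x. weight (-4) x * g x)" by (rule sqint_prod_integrable[OF ws g(1)])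
  then show "integrable lborel \<phi>"
    by (rule integrable_cong_AE_imp) (use eq in \<open>auto elim: eventually_mono\<close>)
  have "sqint (\<lambda>x. weight (-4) x * g x)" by (rule sqint_bounded_mult(1)[OF g(1) weight_measurable wn(2)])
  then show "sqint \<phi>" by (rule sqint_cong_AE) (use eq in auto)
qed

text \<open>Plancherel's inequality on \<open>L\<^sup>1 \<inter> L\<^sup>2\<close>, by duality from the
  Schwartz class.\<close>

lemma fourier_sqint:
  assumes f: "integrable lborel f" "sqint f" shows "sqint (fourier f)"
proof (rule l2_by_duality[OF fourier_measurable[OF f(1)], of "l2 f"])
  fix \<psi> assume \<psi>: "schwartz \<psi>"
  show "integrable lborel (\<lambda>x. fourier f x * \<psi> x)"
  proof (rule dominated_integral(1))
    show "integrable lborel (\<lambda>x. (1 / sqrt (2 * pi)) * (LINT x|lborel. norm (f x)) * norm (\<psi> x))"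
      by (intro integrable_mult_right integrable_norm schwartz_integrable \<psi>)
    show "(\<lambda>x. fourier f x * \<psi> x) \<in> borel_measurable borel"
      using fourier_measurable[OF f(1)] schwartz_measurable[OF \<psi>] by measurable
    show "norm (fourier f x * \<psi> x) \<le> (1 / sqrt (2 * pi)) * (LINT x|lborel. norm (f x)) * norm (\<psi> x)" for x
      unfolding norm_mult by (intro mult_right_mono fourier_norm_le f) auto
  qed
  have "(LINT x|lborel. fourier f x * \<psi> x) = (LINT x|lborel. f x * fourier \<psi> x)"
    by (rule fourier_multiplication[OF f(1) schwartz_integrable[OF \<psi>], symmetric])
  then show "norm (LINT x|lborel. fourier f x * \<psi> x) \<le> l2 f * l2 \<psi>"
    using l2_CS[OF f(2) schwartz_sqint[OF schwartz_fourier[OF \<psi>]]] by (simp add: plancherel_schwartz[OF \<psi>])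
qed simp

lemma fourier_injective:
  assumes f: "integrable lborel f" and 0: "AE \<xi> in lborel. fourier f \<xi> = 0"
  shows "AE x in lborel. f x = 0"
proof (rule AE_zero_by_duality)
  show fm: "f \<in> borel_measurable borel" using borel_measurable_integrable[OF f] by simp
  fix \<psi> assume \<psi>: "schwartz \<psi>"
  obtain B where B: "\<And>x. norm (\<psi> x) \<le> B" using schwartz_bounded[OF \<psi>] by auto
  show "integrable lborel (\<lambda>x. f x * \<psi> x)"
  proof (rule dominated_integral(1))
    show "integrable lborel (\<lambda>x. B * norm (f x))" by (intro integrable_mult_right integrable_norm f)
    show "norm (f x * \<psi> x) \<le> B * norm (f x)" for x
      using mult_left_mono[OF B, of "norm (f x)" x] by (simp add: norm_mult mult.commute)
  qed (use fm schwartz_measurable[OF \<psi>] in measurable)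
  have "(LINT x|lborel. f x * fourier (inv_fourier \<psi>) x) = (LINT x|lborel. fourier f x * inv_fourier \<psi> x)"
    by (intro fourier_multiplication f schwartz_integrable schwartz_inv_fourier \<psi>)
  also have "\<dots> = (LINT x|(lborel::real measure). (0::complex))"
    using fourier_measurable[OF f] schwartz_measurable[OF schwartz_inv_fourier[OF \<psi>]] 0
    by (intro integral_cong_AE) (auto elim: eventually_mono)
  finally show "(LINT x|lborel. f x * \<psi> x) = 0" by (simp add: fourier_inversion'[OF \<psi>])
qed

lemma schwartz_dense_h1_seq:
  assumes "h1 h h'"
  obtains \<psi> :: "nat \<Rightarrow> real \<Rightarrow> complex" where "\<And>n. schwartz (\<psi> n)"
    "(\<lambda>n. l2 (\<lambda>x. \<psi> n x - h x)) \<longlonglongrightarrow> 0" "(\<lambda>n. l2 (\<lambda>x. vderiv (\<psi> n) x - h' x)) \<longlonglongrightarrow> 0"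
proof -
  have "\<exists>\<psi>. schwartz \<psi> \<and> l2 (\<lambda>x. \<psi> x - h x) < 1 / real (Suc n) \<and> l2 (\<lambda>x. vderiv \<psi> x - h' x) < 1 / real (Suc n)" for n
    by (rule schwartz_dense_h1[OF assms, of "1 / real (Suc n)"]) auto
  then obtain \<psi> where \<psi>: "\<And>n. schwartz (\<psi> n)" "\<And>n. l2 (\<lambda>x. \<psi> n x - h x) < 1 / real (Suc n)"
    "\<And>n. l2 (\<lambda>x. vderiv (\<psi> n) x - h' x) < 1 / real (Suc n)" by metis
  have lim: "(\<lambda>n. 1 / real (Suc n)) \<longlonglongrightarrow> 0" by real_asymp
  show ?thesis
  proof (rule that[OF \<psi>(1)])
    show "(\<lambda>n. l2 (\<lambda>x. \<psi> n x - h x)) \<longlonglongrightarrow> 0"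
      by (rule real_tendsto_sandwich[OF _ _ tendsto_const lim])
        (use less_imp_le[OF \<psi>(2)] in \<open>simp_all del: of_nat_Suc\<close>)
    show "(\<lambda>n. l2 (\<lambda>x. vderiv (\<psi> n) x - h' x)) \<longlonglongrightarrow> 0"
      by (rule real_tendsto_sandwich[OF _ _ tendsto_const lim])
        (use less_imp_le[OF \<psi>(3)] in \<open>simp_all del: of_nat_Suc\<close>)
  qed
qed

lemma h1_diff:
  assumes "h1 f f'" "h1 g g'" shows "h1 (\<lambda>x. f x - g x) (\<lambda>x. f' x - g' x)"
proof -
  have "ac (\<lambda>x. f x + -1 * g x) (\<lambda>x. f' x + -1 * g' x)"
    using assms by (intro ac_add ac_cmult) (simp_all add: h1_def)
  moreover have "sqint (\<lambda>x. f x - g x)" "sqint (\<lambda>x. f' x - g' x)"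
    using assms by (intro sqint_diff; simp add: h1_def)+
  ultimately show ?thesis by (simp add: h1_def)
qed

lemma h1_cnj: "h1 f f' \<Longrightarrow> h1 (\<lambda>x. cnj (f x)) (\<lambda>x. cnj (f' x))"
  unfolding h1_def by (elim conjE, intro conjI ac_cnj) simp_all

lemma h1_mult_bounded:
  assumes f: "h1 f f'" and K: "ac K K'" "\<And>x. norm (K x) \<le> B" "\<And>x. norm (K' x) \<le> B"
  shows "h1 (\<lambda>x. f x * K x) (\<lambda>x. f' x * K x + f x * K' x)"
proof -
  have m: "sqint (\<lambda>x. f x * K x)" "sqint (\<lambda>x. f' x * K x)" "sqint (\<lambda>x. f x * K' x)"
  proof -
    have s: "sqint f" "sqint f'" using f by (auto simp: h1_def)
    show "sqint (\<lambda>x. f x * K x)" "sqint (\<lambda>x. f' x * K x)"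
      using sqint_bounded_mult(1)[OF s(1) ac_measurable[OF K(1)] K(2)] sqint_bounded_mult(1)[OF s(2) ac_measurable[OF K(1)] K(2)]
      by (simp_all only: mult.commute)
    show "sqint (\<lambda>x. f x * K' x)"
      using sqint_bounded_mult(1)[OF s(1) ac_measurable'[OF K(1)] K(3)] by (simp only: mult.commute)
  qed
  have "ac f f'" using f by (simp add: h1_def)
  then show ?thesis unfolding h1_def by (intro conjI ac_mult K sqint_add m)
qed

definition nlin :: "real \<Rightarrow> real \<Rightarrow> (real \<Rightarrow> complex) \<Rightarrow> (real \<Rightarrow> complex) \<Rightarrow> real \<Rightarrow> complex" where
  "nlin p b f f' x = \<i> * of_real ((norm (f x))\<^sup>2) * f' x + of_real (b * norm (f x) powr p) * f x"

section \<open>The flow tested against \<open>H\<^sup>1\<close> functions\<close>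

text \<open>A solution given by its absolutely continuous representatives, bounded in
  \<open>H\<^sup>1\<close> and continuous in time with values in \<open>H\<^sup>1\<close>. In
  the equation one spatial derivative stays on \<open>u\<close>: in this form the right hand
  side makes sense for test functions in \<open>H\<^sup>1\<close>.\<close>

locale flow =
  fixes u ux :: "real \<Rightarrow> real \<Rightarrow> complex" and p b M :: real
  assumes p4: "4 \<le> p"
    and uh: "\<And>t. h1 (u t) (ux t)"
    and uM: "\<And>t. l2 (u t) \<le> M" and uxM: "\<And>t. l2 (ux t) \<le> M"
    and ucont: "\<And>t. ((\<lambda>k. l2 (\<lambda>x. u (t + k) x - u t x)) \<longlongrightarrow> 0) (at 0)"
    and uxcont: "\<And>t. ((\<lambda>k. l2 (\<lambda>x. ux (t + k) x - ux t x)) \<longlongrightarrow> 0) (at 0)"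
    and eq: "\<And>t \<psi>. schwartz \<psi> \<Longrightarrow> ((\<lambda>s. LINT x|lborel. u s x * \<psi> x) has_vector_derivative
      (- \<i> * (LINT x|lborel. ux t x * vderiv \<psi> x) + \<i> * (LINT x|lborel. nlin p b (u t) (ux t) x * \<psi> x))) (at t)"
begin

lemma M0: "0 \<le> M" by (rule order_trans[OF l2_nonneg uM[of 0]])

lemma u_ac: "ac (u t) (ux t)" and u_sq: "sqint (u t)" and ux_sq: "sqint (ux t)"
  using uh[of t] by (simp_all add: h1_def)

lemma u_meas [measurable]: "u t \<in> borel_measurable borel" "ux t \<in> borel_measurable borel"
  by (rule sqint_measurable[OF u_sq] sqint_measurable[OF ux_sq])+

lemma u_sup: "norm (u t x) \<le> 2 * M"
proof -
  have "(norm (u t x))\<^sup>2 \<le> 2 * l2 (u t) * l2 (ux t)" by (rule h1_sup_bound[OF uh])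
  also have "\<dots> \<le> 2 * M * M" using uM uxM M0 by (intro mult_mono) auto
  also have "\<dots> \<le> (2 * M)\<^sup>2" by (simp add: power2_eq_square)
  finally show ?thesis by (rule power2_le_imp_le) (simp add: M0)
qed

lemma u_sup2: "(norm (u t x))\<^sup>2 \<le> (2 * M)\<^sup>2"
  using u_sup by (intro power_mono) auto

abbreviation "N t \<equiv> nlin p b (u t) (ux t)"

definition "CN = (2 * M)\<^sup>2 * M + \<bar>b\<bar> * (2 * M) powr p * M"

lemma N_sq: "sqint (N t)" and N_l2: "l2 (N t) \<le> CN"
proof -
  let ?m1 = "\<lambda>x. \<i> * of_real ((norm (u t x))\<^sup>2)" and ?m2 = "\<lambda>x. complex_of_real (b * norm (u t x) powr p)"
  have 1: "norm (?m1 x) \<le> (2 * M)\<^sup>2" for x using u_sup2[of t x] unfolding norm_mult norm_of_real by simp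
  have 2: "norm (?m2 x) \<le> \<bar>b\<bar> * (2 * M) powr p" for x
    unfolding norm_of_real abs_mult using u_sup[of t x] p4 by (intro mult_left_mono) (auto intro: powr_mono2)
  have a: "sqint (\<lambda>x. ?m1 x * ux t x)" "l2 (\<lambda>x. ?m1 x * ux t x) \<le> (2 * M)\<^sup>2 * l2 (ux t)"
    by (rule sqint_bounded_mult[OF ux_sq _ 1]; measurable)+
  have c: "sqint (\<lambda>x. ?m2 x * u t x)" "l2 (\<lambda>x. ?m2 x * u t x) \<le> \<bar>b\<bar> * (2 * M) powr p * l2 (u t)"
    by (rule sqint_bounded_mult[OF u_sq _ 2]; measurable)+
  have e: "N t = (\<lambda>x. ?m1 x * ux t x + ?m2 x * u t x)" by (rule ext) (simp add: nlin_def)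
  show "sqint (N t)" unfolding e by (rule sqint_add[OF a(1) c(1)])
  have "l2 (N t) \<le> (2 * M)\<^sup>2 * l2 (ux t) + \<bar>b\<bar> * (2 * M) powr p * l2 (u t)"
    unfolding e using l2_triangle[OF a(1) c(1)] a(2) c(2) by linarith
  also have "\<dots> \<le> CN" unfolding CN_def using uM uxM by (intro add_mono mult_left_mono) auto
  finally show "l2 (N t) \<le> CN" .
qed

text \<open>The extension of the time derivative of \<open>u\<close> to test functions in
  \<open>H\<^sup>1\<close>, that is, \<open>\<partial>\<^sub>t u\<close> as an element of
  \<open>H\<^bsup>-1\<^esup>\<close>; \<open>h'\<close> is the derivative of the test function
  \<open>h\<close>.\<close>

definition A :: "real \<Rightarrow> (real \<Rightarrow> complex) \<Rightarrow> (real \<Rightarrow> complex) \<Rightarrow> complex" where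
  "A t h h' = - \<i> * (LINT x|lborel. ux t x * h' x) + \<i> * (LINT x|lborel. N t x * h x)"

definition "C1 = M + CN"

lemma C1_0: "0 \<le> C1" "M \<le> C1" "CN \<le> C1"
  unfolding C1_def CN_def using M0 by auto

lemma A_bound:
  assumes "sqint h" "sqint h'" shows "norm (A t h h') \<le> C1 * (l2 h + l2 h')"
proof -
  have "norm (A t h h') \<le> norm (LINT x|lborel. ux t x * h' x) + norm (LINT x|lborel. N t x * h x)"
    unfolding A_def by (rule order_trans[OF norm_triangle_ineq]) (simp add: norm_mult)
  also have "\<dots> \<le> l2 (ux t) * l2 h' + l2 (N t) * l2 h"
    by (intro add_mono l2_CS ux_sq N_sq assms)
  also have "\<dots> \<le> C1 * l2 h' + C1 * l2 h"
    using C1_0 uxM[of t] N_l2[of t] by (intro add_mono mult_right_mono) auto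
  finally show ?thesis by (simp add: algebra_simps)
qed

lemma A_diff:
  assumes "sqint h" "sqint h'" "sqint k" "sqint k'"
  shows "A t h h' - A t k k' = A t (\<lambda>x. h x - k x) (\<lambda>x. h' x - k' x)"
  unfolding A_def using assms
  by (simp add: right_diff_distrib sqint_prod_integrable ux_sq N_sq)

lemma du_sq: "sqint (\<lambda>x. u s x - u t x)" "sqint (\<lambda>x. ux s x - ux t x)"
  by (intro sqint_diff u_sq ux_sq)+

lemma du_schwartz:
  assumes "schwartz \<psi>"
  shows "norm (LINT x|lborel. (u s x - u t x) * \<psi> x) \<le> C1 * (l2 \<psi> + l2 (vderiv \<psi>)) * \<bar>s - t\<bar>"
proof -
  have "norm ((LINT x|lborel. u s x * \<psi> x) - (LINT x|lborel. u t x * \<psi> x)) \<le> C1 * (l2 \<psi> + l2 (vderiv \<psi>)) * \<bar>s - t\<bar>"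
  proof (rule vector_derivative_bound[of UNIV])
    show "((\<lambda>s. LINT x|lborel. u s x * \<psi> x) has_vector_derivative A r \<psi> (vderiv \<psi>)) (at r within UNIV)" for r
      using eq[OF assms, of r] by (simp add: A_def)
    show "norm (A r \<psi> (vderiv \<psi>)) \<le> C1 * (l2 \<psi> + l2 (vderiv \<psi>))" for r
      by (intro A_bound schwartz_sqint schwartz_vderiv assms)
  qed auto
  then show ?thesis
    by (simp add: left_diff_distrib sqint_prod_integrable u_sq schwartz_sqint[OF assms])
qed

text \<open>The flow is Lipschitz in time with values in \<open>H\<^bsup>-1\<^esup>\<close>; by density from
  Schwartz test functions, for which it is the mean value inequality.\<close>

lemma du_bound:
  assumes h: "h1 h h'"
  shows "norm (LINT x|lborel. (u s x - u t x) * h x) \<le> C1 * (l2 h + l2 h') * \<bar>s - t\<bar>"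
proof -
  have sq: "sqint h" "sqint h'" using h by (simp_all add: h1_def)
  obtain \<psi> where \<psi>: "\<And>n. schwartz (\<psi> n)" "(\<lambda>n. l2 (\<lambda>x. \<psi> n x - h x)) \<longlonglongrightarrow> 0"
    "(\<lambda>n. l2 (\<lambda>x. vderiv (\<psi> n) x - h' x)) \<longlonglongrightarrow> 0" by (rule schwartz_dense_h1_seq[OF h]) blast
  have s: "sqint (\<psi> n)" "sqint (vderiv (\<psi> n))" for n by (intro schwartz_sqint schwartz_vderiv \<psi>)+
  have 1: "(\<lambda>n. LINT x|lborel. (u s x - u t x) * \<psi> n x) \<longlonglongrightarrow> (LINT x|lborel. (u s x - u t x) * h x)"
    by (rule integral_mult_tendsto[OF s(1) sq(1) \<psi>(2) du_sq(1)])
  have 2: "(\<lambda>n. C1 * (l2 (\<psi> n) + l2 (vderiv (\<psi> n))) * \<bar>s - t\<bar>) \<longlonglongrightarrow> C1 * (l2 h + l2 h') * \<bar>s - t\<bar>"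
    by (intro tendsto_intros l2_tendsto s sq \<psi>)
  show ?thesis by (rule LIMSEQ_le[OF tendsto_norm[OF 1] 2]) (use du_schwartz[OF \<psi>(1)] in auto)
qed

text \<open>Testing the increment with its own conjugate: it is Lipschitz in
  \<open>H\<^bsup>-1\<^esup>\<close> and tends to zero in \<open>H\<^sup>1\<close>, so
  \<open>\<parallel>u(t+k) - u(t)\<parallel>\<^sup>2 = o(k)\<close>. Terms that are quadratic in
  the increment thus do not contribute to derivatives in time.\<close>

lemma du_l2_small: "((\<lambda>k. (l2 (\<lambda>x. u (t + k) x - u t x))\<^sup>2 / \<bar>k\<bar>) \<longlongrightarrow> 0) (at 0)"
proof (rule real_tendsto_sandwich[of "\<lambda>_. 0" _ _ "\<lambda>k. C1 * (l2 (\<lambda>x. u (t + k) x - u t x) + l2 (\<lambda>x. ux (t + k) x - ux t x))"])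
  have "((\<lambda>k. C1 * (l2 (\<lambda>x. u (t + k) x - u t x) + l2 (\<lambda>x. ux (t + k) x - ux t x))) \<longlongrightarrow> C1 * (0 + 0)) (at 0)"
    by (intro tendsto_intros ucont uxcont)
  then show "((\<lambda>k. C1 * (l2 (\<lambda>x. u (t + k) x - u t x) + l2 (\<lambda>x. ux (t + k) x - ux t x))) \<longlongrightarrow> 0) (at 0)" by simp
  show "\<forall>\<^sub>F k in at 0. (l2 (\<lambda>x. u (t + k) x - u t x))\<^sup>2 / \<bar>k\<bar>
      \<le> C1 * (l2 (\<lambda>x. u (t + k) x - u t x) + l2 (\<lambda>x. ux (t + k) x - ux t x))"
  proof (intro eventually_at_topological[THEN iffD2] exI[of _ UNIV] conjI ballI impI)
    fix k :: real assume k: "k \<noteq> 0"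
    let ?d = "\<lambda>x. u (t + k) x - u t x"
    have h: "h1 (\<lambda>x. cnj (?d x)) (\<lambda>x. cnj (ux (t + k) x - ux t x))" by (intro h1_cnj h1_diff uh)
    have "(LINT x|lborel. ?d x * cnj (?d x)) = of_real ((l2 ?d)\<^sup>2)"
      unfolding complex_norm_square[symmetric] l2_power2 by (rule integral_complex_of_real)
    then have "(l2 ?d)\<^sup>2 \<le> C1 * (l2 ?d + l2 (\<lambda>x. ux (t + k) x - ux t x)) * \<bar>k\<bar>"
      using du_bound[OF h, of "t + k" t] unfolding l2_cnj by (simp only: norm_of_real abs_power2 add_diff_cancel_left')
    then show "(l2 ?d)\<^sup>2 / \<bar>k\<bar> \<le> C1 * (l2 ?d + l2 (\<lambda>x. ux (t + k) x - ux t x))"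
      using k by (simp add: divide_le_eq)
  qed auto
qed auto

text \<open>The time derivative of \<open>u\<close> may be tested against an \<open>H\<^sup>1\<close>
  function that itself moves continuously: replace it by a fixed Schwartz function close to its
  limit, at a cost controlled by the Lipschitz bound uniformly in \<open>k\<close>.\<close>

lemma derivative_moving:
  assumes h: "\<And>k. h1 (h k) (h' k)" and g: "h1 g g'"
    and lim: "((\<lambda>k. l2 (\<lambda>x. h k x - g x)) \<longlongrightarrow> 0) (at 0)" "((\<lambda>k. l2 (\<lambda>x. h' k x - g' x)) \<longlongrightarrow> 0) (at 0)"
  shows "((\<lambda>k. (LINT x|lborel. (u (t + k) x - u t x) * h k x) /\<^sub>R k) \<longlongrightarrow> A t g g') (at 0)"
proof (rule tendstoI)
  fix e :: real assume e: "0 < e"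
  define \<eta> where "\<eta> = e / (8 * (C1 + 1))"
  have \<eta>: "0 < \<eta>" unfolding \<eta>_def using e C1_0 by simp
  have sg: "sqint g" "sqint g'" using g by (auto simp: h1_def)
  have sh: "sqint (h k)" "sqint (h' k)" for k using h by (auto simp: h1_def)
  obtain \<psi> where \<psi>: "schwartz \<psi>" "l2 (\<lambda>x. \<psi> x - g x) < \<eta>" "l2 (\<lambda>x. vderiv \<psi> x - g' x) < \<eta>"
    by (rule schwartz_dense_h1[OF g \<eta>])
  have s\<psi>: "sqint \<psi>" "sqint (vderiv \<psi>)" by (intro schwartz_sqint schwartz_vderiv \<psi>)+
  have h\<psi>: "h1 \<psi> (vderiv \<psi>)" using s\<psi> ac_schwartz[OF \<psi>(1)] by (simp add: h1_def)
  have "((\<lambda>k. ((LINT x|lborel. u (t + k) x * \<psi> x) - (LINT x|lborel. u t x * \<psi> x)) /\<^sub>R k) \<longlongrightarrow> A t \<psi> (vderiv \<psi>)) (at 0)"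
    using eq[OF \<psi>(1), of t] unfolding has_vector_derivative_limit A_def .
  from tendstoD[OF this \<eta>]
  have E1: "\<forall>\<^sub>F k in at 0. dist ((LINT x|lborel. (u (t + k) x - u t x) * \<psi> x) /\<^sub>R k) (A t \<psi> (vderiv \<psi>)) < \<eta>"
    by (simp add: left_diff_distrib sqint_prod_integrable u_sq s\<psi>)
  show "\<forall>\<^sub>F k in at 0. dist ((LINT x|lborel. (u (t + k) x - u t x) * h k x) /\<^sub>R k) (A t g g') < e"
    using E1 order_tendstoD(2)[OF lim(1) \<eta>] order_tendstoD(2)[OF lim(2) \<eta>] eventually_neq_at_within[of 0 0 UNIV]
  proof eventually_elim
    case (elim k)
    then have k: "k \<noteq> 0" by simp
    let ?D = "\<lambda>f. (LINT x|lborel. (u (t + k) x - u t x) * f x) /\<^sub>R k"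
    have hd: "h1 (\<lambda>x. h k x - \<psi> x) (\<lambda>x. h' k x - vderiv \<psi> x)" by (intro h1_diff h h\<psi>)
    have "?D (h k) - ?D \<psi> = ?D (\<lambda>x. h k x - \<psi> x)"
      by (simp add: right_diff_distrib sqint_prod_integrable du_sq sh s\<psi> scaleR_diff_right)
    moreover have "norm (?D (\<lambda>x. h k x - \<psi> x)) \<le> C1 * (l2 (\<lambda>x. h k x - \<psi> x) + l2 (\<lambda>x. h' k x - vderiv \<psi> x))"
      using du_bound[OF hd, of "t + k" t] k by (simp add: divide_le_eq divide_inverse[symmetric] mult.commute[of "inverse _"])
    moreover have "l2 (\<lambda>x. h k x - \<psi> x) \<le> l2 (\<lambda>x. h k x - g x) + l2 (\<lambda>x. g x - \<psi> x)"
      by (rule l2_triangle_diff[OF sh(1) sg(1) s\<psi>(1)])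
    moreover have "l2 (\<lambda>x. h' k x - vderiv \<psi> x) \<le> l2 (\<lambda>x. h' k x - g' x) + l2 (\<lambda>x. g' x - vderiv \<psi> x)"
      by (rule l2_triangle_diff[OF sh(2) sg(2) s\<psi>(2)])
    ultimately have 1: "norm (?D (h k) - ?D \<psi>) \<le> C1 * (4 * \<eta>)"
      using elim \<psi> C1_0 mult_left_mono[of "l2 (\<lambda>x. h k x - \<psi> x) + l2 (\<lambda>x. h' k x - vderiv \<psi> x)" "4 * \<eta>" C1]
      by (simp add: l2_minus_commute[of g] l2_minus_commute[of g'])
    have "norm (A t \<psi> (vderiv \<psi>) - A t g g') \<le> C1 * (l2 (\<lambda>x. \<psi> x - g x) + l2 (\<lambda>x. vderiv \<psi> x - g' x))"
      unfolding A_diff[OF s\<psi> sg] by (intro A_bound sqint_diff s\<psi> sg)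
    also have "\<dots> \<le> C1 * (2 * \<eta>)" using \<psi> C1_0 by (intro mult_left_mono) auto
    finally have 3: "norm (A t \<psi> (vderiv \<psi>) - A t g g') \<le> C1 * (2 * \<eta>)" .
    have "norm (?D (h k) - A t g g') \<le> norm (?D (h k) - ?D \<psi>) + norm (?D \<psi> - A t \<psi> (vderiv \<psi>)) + norm (A t \<psi> (vderiv \<psi>) - A t g g')"
      using norm_triangle_ineq[of "?D (h k) - ?D \<psi>" "(?D \<psi> - A t \<psi> (vderiv \<psi>)) + (A t \<psi> (vderiv \<psi>) - A t g g')"]
        norm_triangle_ineq[of "?D \<psi> - A t \<psi> (vderiv \<psi>)" "A t \<psi> (vderiv \<psi>) - A t g g'"] by simp
    also have "\<dots> < C1 * (4 * \<eta>) + \<eta> + C1 * (2 * \<eta>)" using 1 3 elim(1) unfolding dist_norm by linarith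
    also have "\<dots> \<le> 8 * (C1 + 1) * \<eta>" using C1_0 \<eta> by (simp add: algebra_simps)
    also have "\<dots> = e" unfolding \<eta>_def using C1_0 by simp
    finally show ?case by (simp add: dist_norm)
  qed
qed

lemma u4_int: "integrable lborel (\<lambda>x. (u t x * cnj (u t x)) * (u t x * cnj (u t x)))"
proof -
  have b: "norm (u t x) \<le> 2 * M" for x by (rule u_sup)
  have "sqint (\<lambda>x. u t x * cnj (u t x))" by (rule sqint_bounded_mult(1)[OF _ _ b]) (simp_all add: u_sq)
  from sqint_prod_integrable[OF this this] show ?thesis .
qed

lemma bounded_mult_integrable:
  fixes f m :: "real \<Rightarrow> complex"
  assumes "integrable lborel f" "m \<in> borel_measurable borel" "\<And>x. norm (m x) \<le> B"
  shows "integrable lborel (\<lambda>x. f x * m x)"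
proof (rule dominated_integral(1))
  show "integrable lborel (\<lambda>x. B * norm (f x))" using assms(1) by simp
  show "norm (f x * m x) \<le> B * norm (f x)" for x
    using mult_left_mono[OF assms(3)[of x], of "norm (f x)"] by (simp add: norm_mult mult.commute)
qed (use assms borel_measurable_integrable[OF assms(1)] in measurable)

text \<open>The local conservation law for the mass: the time derivative of \<open>|u|\<^sup>2\<close> is
  the derivative in \<open>x\<close> of a flux, here tested against a weight \<open>K\<close>.
  The increment of \<open>|u|\<^sup>2\<close> is linear in the increment of \<open>u\<close> up
  to a quadratic term.\<close>

lemma mass_density_derivative:
  assumes K: "ac K K'" "\<And>x. norm (K x) \<le> B" "\<And>x. norm (K' x) \<le> B"
  shows "((\<lambda>k. (LINT x|lborel. of_real ((norm (u (t + k) x))\<^sup>2 - (norm (u t x))\<^sup>2) * K x) /\<^sub>R k) \<longlongrightarrow>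
    (LINT x|lborel. (\<i> * (u t x * cnj (ux t x) - ux t x * cnj (u t x)) + 1 / 2 * ((u t x * cnj (u t x)) * (u t x * cnj (u t x)))) * K' x)) (at 0)"
proof -
  note [measurable] = ac_measurable[OF K(1)] ac_measurable'[OF K(1)]
  define h where "h x = cnj (u t x) * K x" for x
  define h' where "h' x = cnj (ux t x) * K x + cnj (u t x) * K' x" for x
  define g where "g x = cnj (u t x) * cnj (K x)" for x
  define g' where "g' x = cnj (ux t x) * cnj (K x) + cnj (u t x) * cnj (K' x)" for x
  have hh: "h1 h h'" unfolding h_def[abs_def] h'_def[abs_def] by (rule h1_mult_bounded[OF h1_cnj[OF uh] K])
  have hg: "h1 g g'" unfolding g_def[abs_def] g'_def[abs_def]
    by (rule h1_mult_bounded[OF h1_cnj[OF uh] ac_cnj[OF K(1)], where B=B]) (use K in simp_all)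
  have s: "sqint h" "sqint h'" "sqint g" "sqint g'" using hh hg by (auto simp: h1_def)
  have dsq: "integrable lborel (\<lambda>x. (u (t + k) x - u t x) * cnj (u (t + k) x - u t x))" for k
    by (intro sqint_prod_integrable) (simp_all add: du_sq del: complex_cnj_diff)
  have i: "integrable lborel (\<lambda>x. (u (t + k) x - u t x) * h x)" "integrable lborel (\<lambda>x. (u (t + k) x - u t x) * g x)"
    "integrable lborel (\<lambda>x. ((u (t + k) x - u t x) * cnj (u (t + k) x - u t x)) * K x)" for k
    by (intro sqint_prod_integrable du_sq s bounded_mult_integrable[OF dsq _ K(2)]; measurable)+
  have split: "(LINT x|lborel. of_real ((norm (u (t + k) x))\<^sup>2 - (norm (u t x))\<^sup>2) * K x)
     = (LINT x|lborel. (u (t + k) x - u t x) * h x) + cnj (LINT x|lborel. (u (t + k) x - u t x) * g x)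
       + (LINT x|lborel. ((u (t + k) x - u t x) * cnj (u (t + k) x - u t x)) * K x)" for k
  proof -
    have "of_real ((norm (u (t + k) x))\<^sup>2 - (norm (u t x))\<^sup>2) * K x
       = ((u (t + k) x - u t x) * h x + cnj ((u (t + k) x - u t x) * g x)) + ((u (t + k) x - u t x) * cnj (u (t + k) x - u t x)) * K x" for x
      unfolding of_real_diff complex_norm_square h_def g_def by (simp add: algebra_simps)
    then have "(LINT x|lborel. of_real ((norm (u (t + k) x))\<^sup>2 - (norm (u t x))\<^sup>2) * K x)
      = (LINT x|lborel. ((u (t + k) x - u t x) * h x + cnj ((u (t + k) x - u t x) * g x)) + ((u (t + k) x - u t x) * cnj (u (t + k) x - u t x)) * K x)"
      by (simp only:)
    also have "\<dots> = (LINT x|lborel. (u (t + k) x - u t x) * h x) + (LINT x|lborel. cnj ((u (t + k) x - u t x) * g x))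
       + (LINT x|lborel. ((u (t + k) x - u t x) * cnj (u (t + k) x - u t x)) * K x)"
      using i integrable_cnj[OF i(2)[of k]]
      by (subst Bochner_Integration.integral_add, simp only: Bochner_Integration.integrable_add, simp only:, subst Bochner_Integration.integral_add, simp only:, simp only:, simp only:)
    finally show ?thesis unfolding Bochner_Integration.integral_cnj .
  qed
  have l1: "((\<lambda>k. (LINT x|lborel. (u (t + k) x - u t x) * h x) /\<^sub>R k) \<longlongrightarrow> A t h h') (at 0)"
    by (rule derivative_moving[OF hh hh]) simp_all
  have l2: "((\<lambda>k. cnj ((LINT x|lborel. (u (t + k) x - u t x) * g x) /\<^sub>R k)) \<longlongrightarrow> cnj (A t g g')) (at 0)"
    by (intro tendsto_cnj derivative_moving[OF hg hg]) simp_all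
  have l3: "((\<lambda>k. (LINT x|lborel. ((u (t + k) x - u t x) * cnj (u (t + k) x - u t x)) * K x) /\<^sub>R k) \<longlongrightarrow> 0) (at 0)"
  proof (rule Lim_null_comparison)
    show "((\<lambda>k. B * ((l2 (\<lambda>x. u (t + k) x - u t x))\<^sup>2 / \<bar>k\<bar>)) \<longlongrightarrow> 0) (at 0)"
      using tendsto_mult_right_zero[OF du_l2_small] by simp
    have "norm (LINT x|lborel. ((u (t + k) x - u t x) * cnj (u (t + k) x - u t x)) * K x) \<le> B * (l2 (\<lambda>x. u (t + k) x - u t x))\<^sup>2" for k
    proof -
      have "norm (LINT x|lborel. ((u (t + k) x - u t x) * cnj (u (t + k) x - u t x)) * K x) \<le> (LINT x|lborel. B * (norm (u (t + k) x - u t x))\<^sup>2)"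
      proof (rule dominated_integral(2))
        show "integrable lborel (\<lambda>x. B * (norm (u (t + k) x - u t x))\<^sup>2)" using sqint_integrable[OF du_sq(1)] by simp
        show "norm ((u (t + k) x - u t x) * cnj (u (t + k) x - u t x) * K x) \<le> B * (norm (u (t + k) x - u t x))\<^sup>2" for x
          using mult_left_mono[OF K(2)[of x], of "(norm (u (t + k) x - u t x))\<^sup>2"]
          by (simp add: norm_mult power2_eq_square mult.commute del: complex_cnj_diff)
      qed measurable
      then show ?thesis by (simp add: l2_power2)
    qed
    then show "\<forall>\<^sub>F k in at 0. norm ((LINT x|lborel. ((u (t + k) x - u t x) * cnj (u (t + k) x - u t x)) * K x) /\<^sub>R k)
        \<le> B * ((l2 (\<lambda>x. u (t + k) x - u t x))\<^sup>2 / \<bar>k\<bar>)"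
      by (intro always_eventually allI) (simp add: divide_inverse mult.commute[of "inverse _"] mult_right_mono flip: mult.assoc del: complex_cnj_diff)
  qed
  have lim: "((\<lambda>k. (LINT x|lborel. of_real ((norm (u (t + k) x))\<^sup>2 - (norm (u t x))\<^sup>2) * K x) /\<^sub>R k) \<longlongrightarrow> A t h h' + cnj (A t g g') + 0) (at 0)"
    unfolding split scaleR_add_right using tendsto_add[OF tendsto_add[OF l1 l2] l3] by (simp del: complex_cnj_diff)
  have "A t h h' + cnj (A t g g') =
    (LINT x|lborel. (\<i> * (u t x * cnj (ux t x) - ux t x * cnj (u t x)) + 1 / 2 * ((u t x * cnj (u t x)) * (u t x * cnj (u t x)))) * K' x)"
  proof -
    \<comment> \<open>the derivative nonlinearity contributes half the derivative of \<open>|u|\<^sup>4\<close>, which is integrated by parts against \<open>K\<close>; the pure power contributes nothing because \<open>b\<close> is real\<close>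
    let ?q = "\<lambda>x. (u t x * cnj (u t x)) * (u t x * cnj (u t x))"
    let ?q' = "\<lambda>x. (ux t x * cnj (u t x) + u t x * cnj (ux t x)) * (u t x * cnj (u t x)) + (u t x * cnj (u t x)) * (ux t x * cnj (u t x) + u t x * cnj (ux t x))"
    have aq: "ac ?q ?q'" by (intro ac_mult ac_cnj u_ac)
    have aZ: "ac (\<lambda>x. ?q x * K x) (\<lambda>x. ?q' x * K x + ?q x * K' x)" by (rule ac_mult[OF aq K(1)])
    have uu: "norm (u t x * cnj (u t x)) \<le> (2 * M)\<^sup>2" for x
      using u_sup2[of t x] by (simp add: norm_mult power2_eq_square)
    have iq: "integrable lborel ?q'"
    proof -
      have "integrable lborel (\<lambda>x. (ux t x * cnj (u t x) + u t x * cnj (ux t x)) * (u t x * cnj (u t x)))"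
      proof (rule bounded_mult_integrable[OF _ _ uu])
        show "integrable lborel (\<lambda>x. ux t x * cnj (u t x) + u t x * cnj (ux t x))"
          by (intro Bochner_Integration.integrable_add sqint_prod_integrable) (simp_all add: u_sq ux_sq)
      qed measurable
      from Bochner_Integration.integrable_add[OF this this] show ?thesis by (simp add: mult.commute)
    qed
    have iK: "integrable lborel (\<lambda>x. ?q x * K x)" "integrable lborel (\<lambda>x. ?q' x * K x)" "integrable lborel (\<lambda>x. ?q x * K' x)"
      by (rule bounded_mult_integrable[OF u4_int _ K(2)] bounded_mult_integrable[OF iq _ K(2)] bounded_mult_integrable[OF u4_int _ K(3)]; measurable)+
    have Z: "(LINT x|lborel. ?q' x * K x + ?q x * K' x) = 0"
      by (rule ac_integral_zero[OF aZ iK(1)]) (rule Bochner_Integration.integrable_add[OF iK(2,3)])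
    have ia: "integrable lborel (\<lambda>x. ux t x * h' x)" "integrable lborel (\<lambda>x. N t x * h x)"
      "integrable lborel (\<lambda>x. cnj (ux t x * g' x))" "integrable lborel (\<lambda>x. cnj (N t x * g x))"
      by (intro integrable_cnj sqint_prod_integrable s ux_sq N_sq)+
    have iZ: "integrable lborel (\<lambda>x. ?q' x * K x + ?q x * K' x)" by (rule Bochner_Integration.integrable_add[OF iK(2,3)])
    have "A t h h' + cnj (A t g g') = A t h h' + cnj (A t g g') + 1 / 2 * (LINT x|lborel. ?q' x * K x + ?q x * K' x)"
      unfolding Z by simp
    also have "\<dots> = - \<i> * (LINT x|lborel. ux t x * h' x) + \<i> * (LINT x|lborel. N t x * h x)
        + (\<i> * (LINT x|lborel. cnj (ux t x * g' x)) + (- \<i>) * (LINT x|lborel. cnj (N t x * g x)))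
        + 1 / 2 * (LINT x|lborel. ?q' x * K x + ?q x * K' x)"
      unfolding A_def Bochner_Integration.integral_cnj by simp
    also have "\<dots> = (LINT x|lborel. (- \<i> * (ux t x * h' x) + \<i> * (N t x * h x) + (\<i> * cnj (ux t x * g' x) + (- \<i>) * cnj (N t x * g x)))
        + 1 / 2 * (?q' x * K x + ?q x * K' x))"
      unfolding integral_mult_right_zero[symmetric]
      by ((subst Bochner_Integration.integral_add[symmetric]; (intro Bochner_Integration.integrable_add integrable_mult_right ia iZ)?)+, rule refl)
    also have "\<dots> = (LINT x|lborel. (\<i> * (u t x * cnj (ux t x) - ux t x * cnj (u t x)) + 1 / 2 * ?q x) * K' x)"
    proof (intro Bochner_Integration.integral_cong refl)
      fix x
      have N: "N t x = \<i> * (u t x * cnj (u t x)) * ux t x + of_real (b * norm (u t x) powr p) * u t x"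
        unfolding nlin_def complex_norm_square ..
      show "(- \<i> * (ux t x * h' x) + \<i> * (N t x * h x) + (\<i> * cnj (ux t x * g' x) + (- \<i>) * cnj (N t x * g x)))
        + 1 / 2 * (?q' x * K x + ?q x * K' x) = (\<i> * (u t x * cnj (ux t x) - ux t x * cnj (u t x)) + 1 / 2 * ?q x) * K' x"
        unfolding N h_def h'_def g_def g'_def by (simp add: field_simps)
    qed
    finally show ?thesis .
  qed
  then show ?thesis using lim by simp
qed

text \<open>The weight \<open>K = 1\<close>.\<close>

lemma mass_conserved: "l2 (u s) = l2 (u t)"
proof -
  have d: "((\<lambda>t. (l2 (u t))\<^sup>2) has_vector_derivative 0) (at t)" for t
    unfolding has_vector_derivative_limit
  proof -
    have "((\<lambda>k. (LINT x|lborel. of_real ((norm (u (t + k) x))\<^sup>2 - (norm (u t x))\<^sup>2) * 1) /\<^sub>R k) \<longlongrightarrow>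
      (LINT x|lborel. (\<i> * (u t x * cnj (ux t x) - ux t x * cnj (u t x)) + 1 / 2 * ((u t x * cnj (u t x)) * (u t x * cnj (u t x)))) * 0)) (at 0)"
      by (rule mass_density_derivative[where B=1]) (auto intro: ac_of_C1)
    then have "((\<lambda>k. complex_of_real (((l2 (u (t + k)))\<^sup>2 - (l2 (u t))\<^sup>2) /\<^sub>R k)) \<longlongrightarrow> of_real 0) (at 0)"
      using sqint_integrable[OF u_sq] by (simp add: l2_power2 scaleR_conv_of_real integral_complex_of_real del: of_real_diff)
    then show "((\<lambda>k. ((l2 (u (t + k)))\<^sup>2 - (l2 (u t))\<^sup>2) /\<^sub>R k) \<longlongrightarrow> 0) (at 0)"
      unfolding tendsto_of_real_iff .
  qed
  have "norm ((l2 (u s))\<^sup>2 - (l2 (u t))\<^sup>2) \<le> 0 * \<bar>s - t\<bar>"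
    by (rule vector_derivative_bound[of UNIV _ "\<lambda>_. 0"]) (use d in auto)
  then show ?thesis by (simp add: power2_eq_iff_nonneg)
qed

end

section \<open>The gauge transform solves a derivative equation in divergence form\<close>

lemma ac_C1:
  assumes f: "ac f f'" and c: "continuous_on UNIV f'"
  shows "(f has_vector_derivative f' x) (at x)"
proof -
  let ?a = "x - 1" and ?b = "x + 1"
  have "((\<lambda>y. integral {?a..y} f') has_vector_derivative f' x) (at x within {?a..?b})"
    by (rule integral_has_vector_derivative[OF continuous_on_subset[OF c]]) auto
  then have "((\<lambda>y. f ?a + integral {?a..y} f') has_vector_derivative f' x) (at x within {?a..?b})"
    by (auto intro!: derivative_eq_intros)
  then have "(f has_vector_derivative f' x) (at x within {?a..?b})"
  proof (rule has_vector_derivative_transform[rotated 2])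
    fix y assume y: "y \<in> {?a..?b}"
    have si: "set_integrable lborel {?a..y} f'"
      using ac_locally_integrable[OF f] by (simp add: set_integrable_def)
    from set_borel_integral_eq_integral(2)[OF si]
    show "f y = f ?a + integral {?a..y} f'"
      using ac_FTC[OF f, of ?a y] y by (simp add: set_lebesgue_integral_def algebra_simps)
  qed simp
  then show ?thesis using at_within_interior[of x "{?a..?b}"] by (simp add: interior_atLeastAtMost_real)
qed

text \<open>Antiderivatives from the left are the gauge phase; those from the right appear as weights when
  the phase is tested and the order of integration is exchanged.\<close>

lemma ac_antiderivative:
  assumes q: "integrable lborel q"
  shows "ac (\<lambda>x. LINT y|lborel. indicator {..x} y *\<^sub>R q y) q"
    and "ac (\<lambda>x. LINT y|lborel. indicator {x..} y *\<^sub>R q y) (\<lambda>y. - q y)"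
proof -
  have qm [measurable]: "q \<in> borel_measurable borel" using borel_measurable_integrable[OF q] by simp
  have ii: "integrable lborel (\<lambda>y. indicator S y *\<^sub>R q y)" if "S \<in> sets borel" for S
    using integrable_mult_indicator[OF _ q] that by simp
  show "ac (\<lambda>x. LINT y|lborel. indicator {..x} y *\<^sub>R q y) q"
    unfolding ac_def
  proof (intro conjI allI impI qm ii)
    fix a b :: real assume ab: "a \<le> b"
    have "AE y in lborel. indicator {..b} y *\<^sub>R q y = indicator {..a} y *\<^sub>R q y + indicator {a..b} y *\<^sub>R q y"
      using AE_lborel_singleton[of a] by eventually_elim (use ab in \<open>auto simp: indicator_def\<close>)
    then have "(LINT y|lborel. indicator {..b} y *\<^sub>R q y) = (LINT y|lborel. indicator {..a} y *\<^sub>R q y + indicator {a..b} y *\<^sub>R q y)"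
      by (intro integral_cong_AE) measurable
    then show "(LINT y|lborel. indicator {..b} y *\<^sub>R q y) - (LINT y|lborel. indicator {..a} y *\<^sub>R q y) = (LINT y|lborel. indicator {a..b} y *\<^sub>R q y)"
      using ii by simp
  qed simp
  show "ac (\<lambda>x. LINT y|lborel. indicator {x..} y *\<^sub>R q y) (\<lambda>y. - q y)"
    unfolding ac_def scaleR_minus_right
  proof (intro conjI allI impI)
    show "integrable lborel (\<lambda>x. - (indicator {a..b} x *\<^sub>R q x))" for a b :: real using ii by simp
    fix a b :: real assume ab: "a \<le> b"
    have "AE y in lborel. indicator {a..} y *\<^sub>R q y = indicator {b..} y *\<^sub>R q y + indicator {a..b} y *\<^sub>R q y"
      using AE_lborel_singleton[of b] by eventually_elim (use ab in \<open>auto simp: indicator_def\<close>)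
    then have "(LINT y|lborel. indicator {a..} y *\<^sub>R q y) = (LINT y|lborel. indicator {b..} y *\<^sub>R q y + indicator {a..b} y *\<^sub>R q y)"
      by (intro integral_cong_AE) measurable
    then show "(LINT y|lborel. indicator {b..} y *\<^sub>R q y) - (LINT y|lborel. indicator {a..} y *\<^sub>R q y) = (LINT y|lborel. - (indicator {a..b} y *\<^sub>R q y))"
      using ii by simp
  qed measurable
qed

lemma iexp_first_order: "norm (exp (\<i> * of_real z) - 1) \<le> \<bar>z\<bar>" "norm (exp (\<i> * of_real z) - 1 - \<i> * of_real z) \<le> z\<^sup>2"
proof -
  show "norm (exp (\<i> * of_real z) - 1) \<le> \<bar>z\<bar>" using iexp_approx1[of z 0] by simp
  have "norm (exp (\<i> * of_real z) - (\<Sum>k\<le>1. (\<i> * of_real z) ^ k / fact k)) \<le> \<bar>z\<bar> ^ Suc 1 / fact (Suc 1)"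
    by (rule iexp_approx1)
  then have "norm (exp (\<i> * of_real z) - 1 - \<i> * of_real z) \<le> z\<^sup>2 / 2"
    by (simp add: power2_eq_square[symmetric] numeral_2_eq_2[symmetric] algebra_simps)
  then show "norm (exp (\<i> * of_real z) - 1 - \<i> * of_real z) \<le> z\<^sup>2"
    using zero_le_power2[of z] by linarith
qed

context flow
begin

definition mass_below :: "real \<Rightarrow> real \<Rightarrow> real" where
  "mass_below t x = (LINT y|lborel. indicator {..x} y *\<^sub>R (norm (u t y))\<^sup>2)"

definition G :: "real \<Rightarrow> real \<Rightarrow> complex" where
  "G t x = exp (- (\<i> / 2) * of_real (mass_below t x))"

abbreviation "q t x \<equiv> u t x * cnj (u t x)"

definition G' :: "real \<Rightarrow> real \<Rightarrow> complex" where
  "G' t x = - (\<i> / 2) * q t x * G t x"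

lemma q_int: "integrable lborel (q t)"
  by (intro sqint_prod_integrable) (simp_all add: u_sq)

lemma u_cont: "continuous_on UNIV (u t)" by (rule ac_continuous[OF u_ac])

lemma q_cont: "continuous_on UNIV (q t)" by (intro continuous_intros u_cont)

lemma q_norm: "norm (q t x) = (norm (u t x))\<^sup>2" by (simp add: norm_mult power2_eq_square)

lemma q_bound: "norm (q t x) \<le> (2 * M)\<^sup>2" unfolding q_norm by (rule u_sup2)

lemma mass_below_complex: "of_real (mass_below t x) = (LINT y|lborel. indicator {..x} y *\<^sub>R q t y)"
proof -
  have "of_real (mass_below t x) = (LINT y|lborel. complex_of_real (indicator {..x} y *\<^sub>R (norm (u t y))\<^sup>2))"
    unfolding mass_below_def by (rule integral_complex_of_real[symmetric])
  also have "\<dots> = (LINT y|lborel. indicator {..x} y *\<^sub>R q t y)"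
    unfolding complex_norm_square[symmetric] by (simp add: scaleR_conv_of_real)
  finally show ?thesis .
qed

lemma G_norm: "norm (G t x) = 1"
  by (simp add: G_def norm_exp_eq_Re)

lemma G_derivative: "(G t has_vector_derivative G' t x) (at x)"
proof -
  have "((\<lambda>x. of_real (mass_below t x)) has_vector_derivative q t x) (at x)"
    unfolding mass_below_complex by (rule ac_C1[OF ac_antiderivative(1)[OF q_int] q_cont])
  moreover have "((\<lambda>z. exp (- (\<i> / 2) * z)) has_field_derivative - (\<i> / 2) * exp (- (\<i> / 2) * z)) (at z)" for z
    by (auto intro!: derivative_eq_intros)
  ultimately have "((\<lambda>z. exp (- (\<i> / 2) * z)) \<circ> (\<lambda>x. of_real (mass_below t x)) has_vector_derivative
      q t x * (- (\<i> / 2) * exp (- (\<i> / 2) * of_real (mass_below t x)))) (at x)"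
    by (rule field_vector_diff_chain_at)
  then show ?thesis by (simp add: comp_def G_def[abs_def] G'_def mult_ac)
qed

lemma G_cont: "continuous_on UNIV (G t)"
  using has_vector_derivative_continuous[OF G_derivative] by (simp add: continuous_at_imp_continuous_on)

lemma G_ac: "ac (G t) (G' t)"
  by (rule ac_of_C1[OF G_derivative]) (unfold G'_def[abs_def], intro continuous_intros u_cont G_cont)

lemma G_meas [measurable]: "G t \<in> borel_measurable borel" "G' t \<in> borel_measurable borel"
  by (rule ac_measurable[OF G_ac] ac_measurable'[OF G_ac])+

lemma G'_bound: "norm (G' t x) \<le> (2 * M)\<^sup>2"
proof -
  have "norm (G' t x) = norm (q t x) / 2" by (simp add: G'_def norm_mult G_norm)
  also have "\<dots> \<le> norm (q t x)" by simp
  finally show ?thesis using q_bound[of t x] by linarith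
qed

definition d :: "real \<Rightarrow> real \<Rightarrow> real" where "d t k = l2 (\<lambda>x. u (t + k) x - u t x)"

lemma d_lim: "(d t \<longlongrightarrow> 0) (at 0)" unfolding d_def[abs_def] by (rule ucont)

lemma d_nonneg: "0 \<le> d t k" by (simp add: d_def)

lemma d_small: "((\<lambda>k. (d t k)\<^sup>2 / \<bar>k\<bar>) \<longlongrightarrow> 0) (at 0)" unfolding d_def by (rule du_l2_small)

lemma mass_int: "integrable lborel (\<lambda>y. (norm (u t y))\<^sup>2)" by (rule sqint_integrable[OF u_sq])

lemma mass_ind_int: "integrable lborel (\<lambda>y. indicator {..x} y *\<^sub>R (norm (u t y))\<^sup>2)"
  using integrable_mult_indicator[OF _ mass_int] by simp

text \<open>The phase is controlled in the supremum norm by the increment of \<open>u\<close> in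
  \<open>L\<^sup>2\<close>; the estimate is uniform in \<open>x\<close>.\<close>

lemma mass_below_diff: "\<bar>mass_below (t + k) x - mass_below t x\<bar> \<le> 2 * M * d t k"
proof -
  let ?D = "\<lambda>y. (norm (u (t + k) y))\<^sup>2 - (norm (u t y))\<^sup>2"
  have "mass_below (t + k) x - mass_below t x = (LINT y|lborel. indicator {..x} y *\<^sub>R ?D y)"
    unfolding mass_below_def scaleR_diff_right using mass_ind_int by simp
  then have "\<bar>mass_below (t + k) x - mass_below t x\<bar> = norm (LINT y|lborel. complex_of_real (indicator {..x} y *\<^sub>R ?D y))"
    by (simp only: integral_complex_of_real norm_of_real)
  also have "\<dots> \<le> (LINT y|lborel. norm (u (t + k) y) * norm (u (t + k) y - u t y) + norm (u t y) * norm (u (t + k) y - u t y))"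
  proof (rule dominated_integral(2))
    show "integrable lborel (\<lambda>y. norm (u (t + k) y) * norm (u (t + k) y - u t y) + norm (u t y) * norm (u (t + k) y - u t y))"
      unfolding norm_mult[symmetric]
      by (intro Bochner_Integration.integrable_add integrable_norm sqint_prod_integrable u_sq du_sq)
    show "(\<lambda>y. complex_of_real (indicator {..x} y *\<^sub>R ?D y)) \<in> borel_measurable borel" by measurable
    fix y
    have "\<bar>?D y\<bar> = (norm (u (t + k) y) + norm (u t y)) * \<bar>norm (u (t + k) y) - norm (u t y)\<bar>"
      unfolding power2_eq_square square_diff_square_factored abs_mult by simp
    also have "\<dots> \<le> (norm (u (t + k) y) + norm (u t y)) * norm (u (t + k) y - u t y)"
      by (intro mult_left_mono norm_triangle_ineq3) auto
    finally show "norm (complex_of_real (indicator {..x} y *\<^sub>R ?D y))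
        \<le> norm (u (t + k) y) * norm (u (t + k) y - u t y) + norm (u t y) * norm (u (t + k) y - u t y)"
      unfolding norm_of_real by (cases "y \<le> x") (simp_all add: distrib_right)
  qed
  also have "\<dots> = (LINT y|lborel. norm (u (t + k) y) * norm (u (t + k) y - u t y)) + (LINT y|lborel. norm (u t y) * norm (u (t + k) y - u t y))"
    by (rule Bochner_Integration.integral_add; unfold norm_mult[symmetric]; intro integrable_norm sqint_prod_integrable u_sq du_sq)
  also have "\<dots> \<le> l2 (u (t + k)) * d t k + l2 (u t) * d t k"
    unfolding d_def by (intro add_mono l2_CS_norm u_sq du_sq)
  also have "\<dots> \<le> M * d t k + M * d t k" by (intro add_mono mult_right_mono uM d_nonneg)
  finally show ?thesis by simp
qed

lemma G_diff_exact: "G (t + k) x - G t x = G t x * (exp (\<i> * of_real (- (mass_below (t + k) x - mass_below t x) / 2)) - 1)"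
proof -
  have "- (\<i> / 2) * complex_of_real (mass_below (t + k) x)
    = - (\<i> / 2) * of_real (mass_below t x) + \<i> * of_real (- (mass_below (t + k) x - mass_below t x) / 2)"
    by (simp add: field_simps)
  then have "G (t + k) x = G t x * exp (\<i> * of_real (- (mass_below (t + k) x - mass_below t x) / 2))"
    unfolding G_def by (metis exp_add)
  then show ?thesis by (simp add: right_diff_distrib)
qed

lemma G_diff: "norm (G (t + k) x - G t x) \<le> M * d t k"
proof -
  have "norm (G (t + k) x - G t x) \<le> \<bar>- (mass_below (t + k) x - mass_below t x) / 2\<bar>"
    unfolding G_diff_exact norm_mult G_norm mult_1 by (rule iexp_first_order)
  also have "\<dots> \<le> M * d t k" using mass_below_diff[of t k x] by (simp add: abs_minus_commute)
  finally show ?thesis .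
qed

text \<open>Moving the gauge factor onto the test function destroys smoothness, which is why the equation
  had to be extended to test functions in \<open>H\<^sup>1\<close>.\<close>

lemma tested_gauge_h1:
  assumes "schwartz \<psi>"
  shows "h1 (\<lambda>x. \<psi> x * G t x) (\<lambda>x. vderiv \<psi> x * G t x + \<psi> x * G' t x)"
proof (rule h1_mult_bounded[OF _ G_ac, where B="1 + (2 * M)\<^sup>2"])
  show "h1 \<psi> (vderiv \<psi>)" using assms by (simp add: h1_def ac_schwartz schwartz_sqint schwartz_vderiv)
  show "norm (G t x) \<le> 1 + (2 * M)\<^sup>2" for x unfolding G_norm by simp
  show "norm (G' t x) \<le> 1 + (2 * M)\<^sup>2" for x using G'_bound[of t x] by simp
qed

lemma tested_gauge_continuous:
  assumes \<psi>: "schwartz \<psi>"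
  shows "((\<lambda>k. l2 (\<lambda>x. \<psi> x * G (t + k) x - \<psi> x * G t x)) \<longlongrightarrow> 0) (at 0)"
    and "((\<lambda>k. l2 (\<lambda>x. (vderiv \<psi> x * G (t + k) x + \<psi> x * G' (t + k) x) - (vderiv \<psi> x * G t x + \<psi> x * G' t x))) \<longlongrightarrow> 0) (at 0)"
proof -
  have s: "sqint \<psi>" "sqint (vderiv \<psi>)" by (intro schwartz_sqint schwartz_vderiv \<psi>)+
  note [measurable] = schwartz_measurable[OF \<psi>] schwartz_measurable[OF schwartz_vderiv[OF \<psi>]]
  obtain B where B: "0 \<le> B" "\<And>x. norm (\<psi> x) \<le> B" using schwartz_bounded[OF \<psi>] by auto
  show "((\<lambda>k. l2 (\<lambda>x. \<psi> x * G (t + k) x - \<psi> x * G t x)) \<longlongrightarrow> 0) (at 0)"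
  proof (rule Lim_null_comparison[OF always_eventually[OF allI]])
    show "((\<lambda>k. (M * d t k) * l2 \<psi>) \<longlongrightarrow> 0) (at 0)" by (auto intro!: tendsto_eq_intros d_lim)
    fix k
    have "l2 (\<lambda>x. (G (t + k) x - G t x) * \<psi> x) \<le> (M * d t k) * l2 \<psi>"
      by (rule sqint_bounded_mult(2)[OF s(1) _ G_diff]) measurable
    then show "norm (l2 (\<lambda>x. \<psi> x * G (t + k) x - \<psi> x * G t x)) \<le> (M * d t k) * l2 \<psi>"
      by (simp add: algebra_simps)
  qed
  show "((\<lambda>k. l2 (\<lambda>x. (vderiv \<psi> x * G (t + k) x + \<psi> x * G' (t + k) x) - (vderiv \<psi> x * G t x + \<psi> x * G' t x))) \<longlongrightarrow> 0) (at 0)"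
  proof (rule Lim_null_comparison[OF always_eventually[OF allI]])
    let ?b = "\<lambda>k. (M * d t k) * l2 (vderiv \<psi>) + ((2 * M)\<^sup>2 * (M * d t k)) * l2 \<psi> + ((B * (2 * M)) * d t k + (B * (2 * M)) * d t k)"
    show "(?b \<longlongrightarrow> 0) (at 0)" by (auto intro!: tendsto_eq_intros d_lim)
    fix k
    let ?d = "\<lambda>x. u (t + k) x - u t x"
    let ?f1 = "\<lambda>x. (G (t + k) x - G t x) * vderiv \<psi> x"
    let ?f2 = "\<lambda>x. (- (\<i> / 2) * q t x * (G (t + k) x - G t x)) * \<psi> x"
    let ?f3 = "\<lambda>x. (\<psi> x * (- (\<i> / 2) * G (t + k) x) * cnj (u (t + k) x)) * ?d x"
    let ?f4 = "\<lambda>x. (\<psi> x * (- (\<i> / 2) * G (t + k) x) * u t x) * cnj (?d x)"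
    have dn: "0 \<le> M * d t k" using M0 d_nonneg by simp
    have f1: "sqint ?f1" "l2 ?f1 \<le> (M * d t k) * l2 (vderiv \<psi>)"
      by (rule sqint_bounded_mult[OF s(2) _ G_diff]; measurable)+
    have m2: "norm (- (\<i> / 2) * q t x * (G (t + k) x - G t x)) \<le> (2 * M)\<^sup>2 * (M * d t k)" for x
    proof -
      have "norm (- (\<i> / 2) * q t x * (G (t + k) x - G t x)) = (norm (q t x) / 2) * norm (G (t + k) x - G t x)"
        by (simp add: norm_mult)
      also have "\<dots> \<le> (2 * M)\<^sup>2 * (M * d t k)" using q_bound[of t x] norm_ge_zero[of "q t x"] dn by (intro mult_mono G_diff) (linarith | simp)+
      finally show ?thesis .
    qed
    have f2: "sqint ?f2" "l2 ?f2 \<le> ((2 * M)\<^sup>2 * (M * d t k)) * l2 \<psi>"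
      by (rule sqint_bounded_mult[OF s(1) _ m2]; measurable)+
    have m: "norm (\<psi> x * (- (\<i> / 2) * G (t + k) x) * z) \<le> B * (2 * M)" if "norm z \<le> 2 * M" for x z
    proof -
      have "norm (\<psi> x * (- (\<i> / 2) * G (t + k) x) * z) = (norm (\<psi> x) / 2) * norm z" by (simp add: norm_mult G_norm)
      also have "\<dots> \<le> B * (2 * M)" using B(1) B(2)[of x] norm_ge_zero[of "\<psi> x"] that by (intro mult_mono) (linarith | simp)+
      finally show ?thesis .
    qed
    have f3: "sqint ?f3" "l2 ?f3 \<le> (B * (2 * M)) * d t k"
      unfolding d_def by (rule sqint_bounded_mult[OF du_sq(1) _ m]; simp add: u_sup, measurable)+
    have f4: "sqint ?f4" "l2 ?f4 \<le> (B * (2 * M)) * l2 (\<lambda>x. cnj (?d x))"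
      by (rule sqint_bounded_mult[OF sqint_cnj[THEN iffD2, OF du_sq(1)] _ m]; simp add: u_sup, measurable)+
    have "(\<lambda>x. (vderiv \<psi> x * G (t + k) x + \<psi> x * G' (t + k) x) - (vderiv \<psi> x * G t x + \<psi> x * G' t x))
        = (\<lambda>x. (?f1 x + ?f2 x) + (?f3 x + ?f4 x))"
    proof
      fix x
      define H where "H = - (\<i> / 2)"
      show "(vderiv \<psi> x * G (t + k) x + \<psi> x * G' (t + k) x) - (vderiv \<psi> x * G t x + \<psi> x * G' t x)
        = (?f1 x + ?f2 x) + (?f3 x + ?f4 x)"
        unfolding G'_def H_def[symmetric] by (simp add: algebra_simps)
    qed
    then have "l2 (\<lambda>x. (vderiv \<psi> x * G (t + k) x + \<psi> x * G' (t + k) x) - (vderiv \<psi> x * G t x + \<psi> x * G' t x))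
        = l2 (\<lambda>x. (?f1 x + ?f2 x) + (?f3 x + ?f4 x))" by (rule arg_cong)
    also have "\<dots> \<le> ?b k"
      using l2_triangle[OF sqint_add[OF f1(1) f2(1)] sqint_add[OF f3(1) f4(1)]] l2_triangle[OF f1(1) f2(1)] l2_triangle[OF f3(1) f4(1)]
        f1(2) f2(2) f3(2) f4(2) unfolding l2_cnj d_def[symmetric] by linarith
    finally show "norm (l2 (\<lambda>x. (vderiv \<psi> x * G (t + k) x + \<psi> x * G' (t + k) x) - (vderiv \<psi> x * G t x + \<psi> x * G' t x))) \<le> ?b k"
      by simp
  qed
qed

text \<open>The phase is nonlocal in \<open>u\<close>, but tested against an integrable function
  \<open>k0\<close> its increment becomes, by Fubini, an increment of mass weighted with the
  antiderivative \<open>K\<close> of \<open>k0\<close>, to which the local conservation law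
  applies. The exponential is linearised with an error quadratic in the increment of
  \<open>u\<close>.\<close>

lemma phase_derivative:
  assumes k0: "integrable lborel k0" "\<And>x. norm (k0 x) \<le> B"
  shows "((\<lambda>k. (LINT x|lborel. k0 x * (exp (\<i> * of_real (- (mass_below (t + k) x - mass_below t x) / 2)) - 1)) /\<^sub>R k) \<longlongrightarrow>
    - (\<i> / 2) * (LINT x|lborel. (\<i> * (u t x * cnj (ux t x) - ux t x * cnj (u t x)) + 1 / 2 * (q t x * q t x)) * (- k0 x))) (at 0)"
proof -
  have km [measurable]: "k0 \<in> borel_measurable borel" using borel_measurable_integrable[OF k0(1)] by simp
  define K where "K y = (LINT x|lborel. indicator {y..} x *\<^sub>R k0 x)" for y
  have K: "ac K (\<lambda>x. - k0 x)" unfolding K_def[abs_def] by (rule ac_antiderivative(2)[OF k0(1)])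
  define I where "I = (LINT x|lborel. norm (k0 x))"
  have I0: "0 \<le> I" unfolding I_def by (rule Bochner_Integration.integral_nonneg) simp
  have Kb: "norm (K y) \<le> B + I" for y
  proof -
    have "norm (K y) \<le> I" unfolding K_def I_def
      by (rule dominated_integral(2)) (use k0(1) in \<open>auto simp: indicator_def\<close>)
    moreover have "0 \<le> B" using k0(2)[of 0] norm_ge_zero order_trans by blast
    ultimately show ?thesis by simp
  qed
  have kb: "norm (- k0 x) \<le> B + I" for x using k0(2)[of x] I0 by simp
  let ?m = "\<lambda>k x. mass_below (t + k) x - mass_below t x"
  let ?D = "\<lambda>k y. (norm (u (t + k) y))\<^sup>2 - (norm (u t y))\<^sup>2"
  have fub: "(LINT x|lborel. k0 x * of_real (?m k x)) = (LINT y|lborel. of_real (?D k y) * K y)" for k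
  proof -
    let ?h = "\<lambda>x y. k0 x * (indicator {..x} y *\<^sub>R complex_of_real (?D k y))"
    have Di: "integrable lborel (\<lambda>y. complex_of_real (?D k y))"
      by (intro integrable_of_real Bochner_Integration.integrable_diff mass_int)
    have i: "integrable (lborel \<Otimes>\<^sub>M lborel) (case_prod ?h)"
    proof (rule integrable_prod_bound[OF k0(1) Di])
      have m: "(\<lambda>p. k0 (fst p) * ((if snd p \<le> fst p then 1 else 0) *\<^sub>R complex_of_real (?D k (snd p)))) \<in> borel_measurable (lborel \<Otimes>\<^sub>M lborel)"
        by measurable
      have e: "(\<lambda>p. k0 (fst p) * ((if snd p \<le> fst p then 1 else 0) *\<^sub>R complex_of_real (?D k (snd p)))) = case_prod ?h"
        by (auto simp: indicator_def)
      show "case_prod ?h \<in> borel_measurable (lborel \<Otimes>\<^sub>M lborel)" using m unfolding e .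
      show "norm (case_prod ?h (x, y)) \<le> norm (k0 x) * norm (complex_of_real (?D k y))" for x y
        unfolding case_prod_conv norm_mult norm_scaleR by (intro mult_left_mono) (auto simp: indicator_def)
    qed
    have 1: "(LINT y|lborel. ?h x y) = k0 x * of_real (?m k x)" for x
    proof -
      have "(LINT y|lborel. ?h x y) = k0 x * (LINT y|lborel. indicator {..x} y *\<^sub>R complex_of_real (?D k y))"
        by (rule integral_mult_right_zero)
      moreover have "(\<lambda>y. indicator {..x} y *\<^sub>R complex_of_real (?D k y)) = (\<lambda>y. complex_of_real (indicator {..x} y *\<^sub>R (norm (u (t + k) y))\<^sup>2 - indicator {..x} y *\<^sub>R (norm (u t y))\<^sup>2))"
        by (rule ext) (simp add: scaleR_conv_of_real algebra_simps)
      moreover have "(LINT y|lborel. complex_of_real (indicator {..x} y *\<^sub>R (norm (u (t + k) y))\<^sup>2 - indicator {..x} y *\<^sub>R (norm (u t y))\<^sup>2)) = of_real (?m k x)"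
        unfolding integral_complex_of_real mass_below_def by (subst Bochner_Integration.integral_diff[OF mass_ind_int mass_ind_int]) simp
      ultimately show ?thesis by (simp only:)
    qed
    have 2: "(LINT x|lborel. ?h x y) = of_real (?D k y) * K y" for y
    proof -
      have "?h x y = of_real (?D k y) * (indicator {y..} x *\<^sub>R k0 x)" for x by (simp add: indicator_def)
      then have "(LINT x|lborel. ?h x y) = (LINT x|lborel. of_real (?D k y) * (indicator {y..} x *\<^sub>R k0 x))" by (simp only:)
      then show ?thesis unfolding K_def by (simp only: integral_mult_right_zero)
    qed
    show ?thesis using lborel_pair.Fubini_integral[OF i] unfolding 1 2 by simp
  qed
  have lin: "((\<lambda>k. - (\<i> / 2) * ((LINT x|lborel. k0 x * of_real (?m k x)) /\<^sub>R k)) \<longlongrightarrow>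
     - (\<i> / 2) * (LINT x|lborel. (\<i> * (u t x * cnj (ux t x) - ux t x * cnj (u t x)) + 1 / 2 * (q t x * q t x)) * (- k0 x))) (at 0)"
    unfolding fub by (intro tendsto_mult_left mass_density_derivative[OF K Kb kb])
  have mm [measurable]: "mass_below t \<in> borel_measurable borel" for t
  proof -
    have "(\<lambda>x. complex_of_real (mass_below t x)) \<in> borel_measurable borel"
      unfolding mass_below_complex by (rule ac_measurable[OF ac_antiderivative(1)[OF q_int]])
    from measurable_compose[OF this borel_measurable_Re] show ?thesis by simp
  qed
  let ?R = "\<lambda>k x. exp (\<i> * complex_of_real (- ?m k x / 2)) - 1 - \<i> * of_real (- ?m k x / 2)"
  have Rb: "norm (?R k x) \<le> (2 * M * d t k)\<^sup>2" for k x
  proof -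
    have "norm (?R k x) \<le> (- ?m k x / 2)\<^sup>2" by (rule iexp_first_order)
    also have "\<dots> = \<bar>?m k x / 2\<bar>\<^sup>2" by (simp add: power_divide power2_commute)
    also have "\<dots> \<le> (2 * M * d t k)\<^sup>2" using mass_below_diff[of t k x] by (intro power_mono) auto
    finally show ?thesis .
  qed
  have Rm [measurable]: "?R k \<in> borel_measurable borel" for k by measurable
  have iR: "integrable lborel (\<lambda>x. k0 x * ?R k x)" for k
    by (rule bounded_mult_integrable[OF k0(1) Rm Rb])
  have im: "integrable lborel (\<lambda>x. k0 x * of_real (?m k x))" for k
  proof (rule bounded_mult_integrable[OF k0(1)])
    show "norm (complex_of_real (?m k x)) \<le> 2 * M * d t k" for x unfolding norm_of_real by (rule mass_below_diff)
  qed measurable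
  have rem: "((\<lambda>k. (LINT x|lborel. k0 x * ?R k x) /\<^sub>R k) \<longlongrightarrow> 0) (at 0)"
  proof (rule Lim_null_comparison[OF always_eventually[OF allI]])
    show "((\<lambda>k. (4 * M\<^sup>2 * I) * ((d t k)\<^sup>2 / \<bar>k\<bar>)) \<longlongrightarrow> 0) (at 0)" by (rule tendsto_mult_right_zero[OF d_small])
    fix k
    have "norm (LINT x|lborel. k0 x * ?R k x) \<le> (LINT x|lborel. (2 * M * d t k)\<^sup>2 * norm (k0 x))"
    proof (rule dominated_integral(2))
      show "norm (k0 x * ?R k x) \<le> (2 * M * d t k)\<^sup>2 * norm (k0 x)" for x
        unfolding norm_mult mult.commute[of "(2 * M * d t k)\<^sup>2"] by (rule mult_left_mono[OF Rb norm_ge_zero])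
      show "integrable lborel (\<lambda>x. (2 * M * d t k)\<^sup>2 * norm (k0 x))" using k0(1) by simp
    qed measurable
    also have "\<dots> = (4 * M\<^sup>2 * I) * (d t k)\<^sup>2" by (simp add: I_def power_mult_distrib)
    finally have "norm (LINT x|lborel. k0 x * ?R k x) / \<bar>k\<bar> \<le> (4 * M\<^sup>2 * I) * (d t k)\<^sup>2 / \<bar>k\<bar>"
      by (intro divide_right_mono) auto
    then show "norm ((LINT x|lborel. k0 x * ?R k x) /\<^sub>R k) \<le> (4 * M\<^sup>2 * I) * ((d t k)\<^sup>2 / \<bar>k\<bar>)"
      unfolding norm_scaleR by (simp only: abs_inverse divide_inverse mult_ac)
  qed
  have "(LINT x|lborel. k0 x * (exp (\<i> * of_real (- ?m k x / 2)) - 1)) /\<^sub>R k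
      = - (\<i> / 2) * ((LINT x|lborel. k0 x * of_real (?m k x)) /\<^sub>R k) + (LINT x|lborel. k0 x * ?R k x) /\<^sub>R k" for k
  proof -
    have "k0 x * (exp (\<i> * of_real (- ?m k x / 2)) - 1) = (- (\<i> / 2)) * (k0 x * of_real (?m k x)) + k0 x * ?R k x" for x
    proof -
      define r where "r = complex_of_real (?m k x)"
      have e: "complex_of_real (- ?m k x / 2) = - (r / 2)"
        unfolding r_def of_real_divide of_real_minus of_real_numeral by (rule minus_divide_left[symmetric])
      show ?thesis unfolding e r_def[symmetric] by (simp add: field_simps)
    qed
    then have "(LINT x|lborel. k0 x * (exp (\<i> * of_real (- ?m k x / 2)) - 1)) = (LINT x|lborel. (- (\<i> / 2)) * (k0 x * of_real (?m k x)) + k0 x * ?R k x)"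
      by (simp only:)
    also have "\<dots> = (LINT x|lborel. (- (\<i> / 2)) * (k0 x * of_real (?m k x))) + (LINT x|lborel. k0 x * ?R k x)"
      by (rule Bochner_Integration.integral_add[OF integrable_mult_right[OF im] iR])
    also have "(LINT x|lborel. (- (\<i> / 2)) * (k0 x * of_real (?m k x))) = (- (\<i> / 2)) * (LINT x|lborel. k0 x * of_real (?m k x))"
      by (rule integral_mult_right_zero)
    finally show ?thesis by (simp only: scaleR_add_right mult_scaleR_right)
  qed
  then show ?thesis using tendsto_add[OF lin rem] by (simp only: add_0_right)
qed

text \<open>The function \<open>v = G u\<close> solves \<open>i v\<^sub>t + v\<^sub>x\<^sub>x + i
  (|v|\<^sup>2 v)\<^sub>x + b |v|\<^sup>p v = 0\<close> in the sense of distributions. The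
  derivative now stands outside the cubic term, so that the equation only involves
  \<open>v\<close> itself. The difference quotient is split into the increment of
  \<open>u\<close>, tested with the moving function \<open>\<psi> G\<close>, and the increment
  of the phase.\<close>

theorem gauge_equation:
  assumes \<psi>: "schwartz \<psi>"
  shows "((\<lambda>s. LINT x|lborel. (G s x * u s x) * \<psi> x) has_vector_derivative
    (LINT x|lborel. (G t x * u t x) * (\<i> * vderiv (vderiv \<psi>) x + q t x * vderiv \<psi> x + \<i> * of_real (b * norm (u t x) powr p) * \<psi> x))) (at t)"
  unfolding has_vector_derivative_limit
proof -
  have \<psi>': "schwartz (vderiv \<psi>)" and \<psi>'': "schwartz (vderiv (vderiv \<psi>))" using \<psi> by (simp_all add: schwartz_vderiv)
  note [measurable] = schwartz_measurable[OF \<psi>] schwartz_measurable[OF \<psi>'] schwartz_measurable[OF \<psi>'']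
  obtain B where B: "0 \<le> B" "\<And>x. norm (\<psi> x) \<le> B" using schwartz_bounded[OF \<psi>] by auto
  define E where "E k x = \<psi> x * G (t + k) x" for k x
  define E' where "E' k x = vderiv \<psi> x * G (t + k) x + \<psi> x * G' (t + k) x" for k x
  have hE: "h1 (E k) (E' k)" for k unfolding E_def[abs_def] E'_def[abs_def] by (rule tested_gauge_h1[OF \<psi>])
  have sE: "sqint (E k)" "sqint (E' k)" for k using hE[of k] by (simp_all add: h1_def)
  have l1: "((\<lambda>k. (LINT x|lborel. (u (t + k) x - u t x) * E k x) /\<^sub>R k) \<longlongrightarrow> A t (E 0) (E' 0)) (at 0)"
  proof (rule derivative_moving[OF hE hE])
    show "((\<lambda>k. l2 (\<lambda>x. E k x - E 0 x)) \<longlongrightarrow> 0) (at 0)"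
      unfolding E_def add_0_right by (rule tested_gauge_continuous(1)[OF \<psi>])
    show "((\<lambda>k. l2 (\<lambda>x. E' k x - E' 0 x)) \<longlongrightarrow> 0) (at 0)"
      unfolding E'_def add_0_right by (rule tested_gauge_continuous(2)[OF \<psi>])
  qed
  define k0 where "k0 x = u t x * E 0 x" for x
  have k0i: "integrable lborel k0" unfolding k0_def[abs_def] by (rule sqint_prod_integrable[OF u_sq sE(1)])
  have k0b: "norm (k0 x) \<le> (2 * M) * B" for x
    unfolding k0_def E_def norm_mult G_norm mult_1_right using M0 by (intro mult_mono u_sup B) auto
  let ?m = "\<lambda>k x. mass_below (t + k) x - mass_below t x"
  note l2 = phase_derivative[OF k0i k0b, of t]
  let ?V = "\<lambda>s. LINT x|lborel. (G s x * u s x) * \<psi> x"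
  let ?P = "LINT x|lborel. (\<i> * (u t x * cnj (ux t x) - ux t x * cnj (u t x)) + 1 / 2 * (q t x * q t x)) * (- k0 x)"
  have split: "?V (t + k) - ?V t = (LINT x|lborel. (u (t + k) x - u t x) * E k x)
      + (LINT x|lborel. k0 x * (exp (\<i> * of_real (- ?m k x / 2)) - 1))" for k
  proof -
    have e1: "(G (t + k) x * u (t + k) x) * \<psi> x = (u (t + k) x - u t x) * E k x + u t x * E k x" for x
      by (simp add: E_def algebra_simps)
    have "k0 x * (exp (\<i> * of_real (- ?m k x / 2)) - 1) = (u t x * \<psi> x) * (G t x * (exp (\<i> * of_real (- ?m k x / 2)) - 1))" for x
      by (simp only: k0_def E_def add_0_right mult_ac)
    then have e2: "k0 x * (exp (\<i> * of_real (- ?m k x / 2)) - 1) = u t x * E k x - u t x * E 0 x" for x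
      unfolding G_diff_exact[symmetric] by (simp add: E_def algebra_simps)
    have e3: "(G t x * u t x) * \<psi> x = u t x * E 0 x" for x by (simp add: E_def mult_ac)
    show ?thesis unfolding e1 e2 e3
      using sqint_prod_integrable[OF du_sq(1)[of "t + k" t] sE(1)[of k]] sqint_prod_integrable[OF u_sq[of t] sE(1)[of k]] sqint_prod_integrable[OF u_sq[of t] sE(1)[of 0]]
      by simp
  qed
  have lim: "((\<lambda>k. (?V (t + k) - ?V t) /\<^sub>R k) \<longlongrightarrow> A t (E 0) (E' 0) + - (\<i> / 2) * ?P) (at 0)"
    unfolding split scaleR_add_right by (rule tendsto_add[OF l1 l2])
  have "A t (E 0) (E' 0) + - (\<i> / 2) * ?P
    = (LINT x|lborel. (G t x * u t x) * (\<i> * vderiv (vderiv \<psi>) x + q t x * vderiv \<psi> x + \<i> * of_real (b * norm (u t x) powr p) * \<psi> x))"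
  proof -
    \<comment> \<open>both sides differ by the derivatives of \<open>u G \<psi>'\<close> and of \<open>|u|\<^sup>2 u G \<psi>\<close>, whose integrals vanish\<close>
    let ?z1 = "\<lambda>x. (ux t x * G t x + u t x * G' t x) * vderiv \<psi> x + (u t x * G t x) * vderiv (vderiv \<psi>) x"
    let ?uq' = "\<lambda>x. ux t x * q t x + u t x * (ux t x * cnj (u t x) + u t x * cnj (ux t x))"
    let ?z2 = "\<lambda>x. ?uq' x * E 0 x + (u t x * q t x) * E' 0 x"
    have sG: "sqint (\<lambda>x. f x * G t x)" "sqint (\<lambda>x. f x * G' t x)" if "sqint f" for f
      using sqint_bounded_mult(1)[OF that G_meas(1)[of t], of 1] sqint_bounded_mult(1)[OF that G_meas(2)[of t] G'_bound] G_norm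
      by (simp_all add: mult.commute)
    have sq: "sqint (\<lambda>x. f x * q t x)" if "sqint f" for f
      using sqint_bounded_mult(1)[OF that _ q_bound[of t]] by (simp add: mult.commute)
    have s\<psi>: "sqint \<psi>" "sqint (vderiv \<psi>)" "sqint (vderiv (vderiv \<psi>))" by (intro schwartz_sqint \<psi> \<psi>' \<psi>'')+
    have z1: "(LINT x|lborel. ?z1 x) = 0" and iz1: "integrable lborel ?z1"
    proof -
      have a: "ac (\<lambda>x. (u t x * G t x) * vderiv \<psi> x) ?z1" by (intro ac_mult u_ac G_ac ac_schwartz \<psi>')
      show i: "integrable lborel ?z1"
        by (intro Bochner_Integration.integrable_add sqint_prod_integrable sqint_add sG u_sq ux_sq s\<psi>)
      show "(LINT x|lborel. ?z1 x) = 0"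
        by (rule ac_integral_zero[OF a _ i]) (intro sqint_prod_integrable sG u_sq s\<psi>)
    qed
    have suq': "sqint ?uq'"
    proof -
      have b: "norm (u t x) \<le> 2 * M" for x by (rule u_sup)
      have "sqint (\<lambda>x. u t x * (ux t x * cnj (u t x) + u t x * cnj (ux t x)))"
      proof (rule sqint_bounded_mult(1)[OF _ _ b])
        have "sqint (\<lambda>x. cnj (u t x) * ux t x)" "sqint (\<lambda>x. u t x * cnj (ux t x))"
          by (rule sqint_bounded_mult(1)[of _ _ "2 * M"]; simp add: ux_sq u_sup, measurable)+
        then show "sqint (\<lambda>x. ux t x * cnj (u t x) + u t x * cnj (ux t x))"
          by (intro sqint_add) (simp_all only: mult.commute)
      qed measurable
      then show ?thesis by (intro sqint_add sq ux_sq)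
    qed
    have z2: "(LINT x|lborel. ?z2 x) = 0" and iz2: "integrable lborel ?z2"
    proof -
      have "ac (E 0) (E' 0)" using hE[of 0] by (simp add: h1_def)
      then have a: "ac (\<lambda>x. (u t x * q t x) * E 0 x) ?z2" by (intro ac_mult ac_cnj u_ac)
      show i: "integrable lborel ?z2"
        by (intro Bochner_Integration.integrable_add sqint_prod_integrable suq' sE sq u_sq)
      show "(LINT x|lborel. ?z2 x) = 0"
        by (rule ac_integral_zero[OF a _ i]) (intro sqint_prod_integrable sE sq u_sq)
    qed
    let ?w = "\<lambda>x. (\<i> * (u t x * cnj (ux t x) - ux t x * cnj (u t x)) + 1 / 2 * (q t x * q t x)) * (- k0 x)"
    have iw: "integrable lborel ?w"
    proof (rule bounded_mult_integrable)
      have "integrable lborel (\<lambda>x. u t x * cnj (ux t x))" "integrable lborel (\<lambda>x. ux t x * cnj (u t x))"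
        by (intro sqint_prod_integrable; simp add: u_sq ux_sq)+
      then show "integrable lborel (\<lambda>x. \<i> * (u t x * cnj (ux t x) - ux t x * cnj (u t x)) + 1 / 2 * (q t x * q t x))"
        by (intro Bochner_Integration.integrable_add integrable_mult_right Bochner_Integration.integrable_diff u4_int)
      show "norm (- k0 x) \<le> 2 * M * B" for x using k0b[of x] by simp
      show "(\<lambda>x. - k0 x) \<in> borel_measurable borel" using borel_measurable_integrable[OF k0i] by simp
    qed
    have ia: "integrable lborel (\<lambda>x. ux t x * E' 0 x)" "integrable lborel (\<lambda>x. N t x * E 0 x)"
      by (intro sqint_prod_integrable ux_sq N_sq sE)+
    have "A t (E 0) (E' 0) + - (\<i> / 2) * ?P = (- \<i> * (LINT x|lborel. ux t x * E' 0 x) + \<i> * (LINT x|lborel. N t x * E 0 x) + - (\<i> / 2) * ?P)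
       + (\<i> * (LINT x|lborel. ?z1 x) + 1 / 2 * (LINT x|lborel. ?z2 x))"
      unfolding z1 z2 A_def by simp
    also have "\<dots> = (LINT x|lborel. (- \<i> * (ux t x * E' 0 x) + \<i> * (N t x * E 0 x) + - (\<i> / 2) * ?w x) + (\<i> * ?z1 x + 1 / 2 * ?z2 x))"
      unfolding integral_mult_right_zero[symmetric]
      by ((subst Bochner_Integration.integral_add[symmetric]; (intro Bochner_Integration.integrable_add integrable_mult_right ia iw iz1 iz2)?)+, rule refl)
    also have "\<dots> = (LINT x|lborel. (G t x * u t x) * (\<i> * vderiv (vderiv \<psi>) x + q t x * vderiv \<psi> x + \<i> * of_real (b * norm (u t x) powr p) * \<psi> x))"
    proof (intro Bochner_Integration.integral_cong refl)
      fix x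
      have N: "N t x = \<i> * (u t x * cnj (u t x)) * ux t x + of_real (b * norm (u t x) powr p) * u t x"
        unfolding nlin_def complex_norm_square ..
      define B where "B = complex_of_real (b * norm (u t x) powr p)"
      define a where "a = u t x"
      define c where "c = cnj (u t x)"
      define a' where "a' = ux t x"
      define c' where "c' = cnj (ux t x)"
      have i2: "\<i> * \<i> = -1" "\<And>z. \<i> * (\<i> * z) = - z" by simp_all
      show "(- \<i> * (ux t x * E' 0 x) + \<i> * (N t x * E 0 x) + - (\<i> / 2) * ?w x) + (\<i> * ?z1 x + 1 / 2 * ?z2 x)
        = (G t x * u t x) * (\<i> * vderiv (vderiv \<psi>) x + q t x * vderiv \<psi> x + \<i> * of_real (b * norm (u t x) powr p) * \<psi> x)"
        unfolding N k0_def E_def E'_def G'_def add_0_right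
        unfolding B_def[symmetric] a_def[symmetric] c_def[symmetric] a'_def[symmetric] c'_def[symmetric]
        by (simp add: field_simps)
    qed
    finally show ?thesis .
  qed
  then show "((\<lambda>k. (?V (t + k) - ?V t) /\<^sub>R k) \<longlongrightarrow>
    (LINT x|lborel. (G t x * u t x) * (\<i> * vderiv (vderiv \<psi>) x + q t x * vderiv \<psi> x + \<i> * of_real (b * norm (u t x) powr p) * \<psi> x))) (at 0)"
    using lim by (simp only:)
qed

end

section \<open>Self-similar test functions\<close>

text \<open>Up to complex conjugation and constants this is the large time profile of a free solution whose
  Fourier transform is \<open>f\<close>: mass travels along \<open>x = 2 t \<xi>\<close> and is
  spread over a length proportional to \<open>t\<close>. Pairings are bilinear, hence the sign
  of the phase.\<close>

definition wave :: "real \<Rightarrow> (real \<Rightarrow> complex) \<Rightarrow> real \<Rightarrow> complex" where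
  "wave t f x = of_real (1 / sqrt t) * (exp (- \<i> * of_real (x\<^sup>2 / (4 * t))) * f (x / (2 * t)))"

lemma wave_phase: "exp (- \<i> * of_real (x\<^sup>2 / (4 * t))) = exp ((- \<i> / (4 * of_real t)) * of_real x ^ 2 + 0 * of_real x)"
  by simp

lemma wave_norm: "0 < t \<Longrightarrow> norm (wave t f x) = norm (f (x / (2 * t))) / sqrt t"
  unfolding wave_def norm_mult fourier_exp_norm norm_of_real by simp

lemma schwartz_wave:
  assumes f: "schwartz f" and t: "0 < t" shows "schwartz (wave t f)"
proof -
  have "schwartz (\<lambda>x. f (0 + (1 / (2 * t)) * x))" by (rule schwartz_affine[OF f]) (use t in simp)
  then have "schwartz (\<lambda>x. exp ((- \<i> / (4 * of_real t)) * of_real x ^ 2 + 0 * of_real x) * f (0 + (1 / (2 * t)) * x))"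
    by (rule schwartz_mult_quadratic_phase) simp_all
  then have "schwartz (\<lambda>x. of_real (1 / sqrt t) * (exp ((- \<i> / (4 * of_real t)) * of_real x ^ 2 + 0 * of_real x) * f (0 + (1 / (2 * t)) * x)))"
    by (rule schwartz_cmult)
  moreover have "(\<lambda>x. of_real (1 / sqrt t) * (exp ((- \<i> / (4 * of_real t)) * of_real x ^ 2 + 0 * of_real x) * f (0 + (1 / (2 * t)) * x))) = wave t f"
    unfolding wave_def wave_phase by (rule ext) simp
  ultimately show ?thesis by simp
qed

lemma wave_l2:
  assumes "sqint f" "0 < t" shows "sqint (wave t f)" "l2 (wave t f) = sqrt 2 * l2 f"
proof -
  have fs: "sqint (\<lambda>x. f (0 + (1 / (2 * t)) * x))" by (rule l2_affine(1)[OF _ assms(1)]) (use assms(2) in simp)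
  have [measurable]: "(\<lambda>x. exp (- \<i> * complex_of_real (x\<^sup>2 / (4 * t)))) \<in> borel_measurable borel"
    by measurable
  have "sqint (\<lambda>x. exp (- \<i> * complex_of_real (x\<^sup>2 / (4 * t))) * f (0 + (1 / (2 * t)) * x))"
    by (rule sqint_bounded_mult(1)[OF fs, of _ 1]) (simp_all only: fourier_exp_norm order_refl, measurable)
  from sqint_cmult[OF this, of "of_real (1 / sqrt t)"] show "sqint (wave t f)"
    by (simp add: wave_def[abs_def])
  have "l2 (wave t f) = norm (complex_of_real (1 / sqrt t)) * l2 (\<lambda>x. exp (- \<i> * complex_of_real (x\<^sup>2 / (4 * t))) * f (x / (2 * t)))"
    unfolding wave_def[abs_def] by (rule l2_cmult)
  also have "l2 (\<lambda>x. exp (- \<i> * complex_of_real (x\<^sup>2 / (4 * t))) * f (x / (2 * t))) = l2 (\<lambda>x. f (0 + (1 / (2 * t)) * x))"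
    unfolding l2_def norm_mult fourier_exp_norm by simp
  also have "\<dots> = l2 f / sqrt \<bar>1 / (2 * t)\<bar>" by (rule l2_affine(2)) (use assms(2) in simp)
  finally show "l2 (wave t f) = sqrt 2 * l2 f"
    unfolding norm_of_real using assms(2) by (simp add: real_sqrt_mult real_sqrt_divide)
qed

lemma wave_derivative:
  assumes f: "schwartz f" and t: "0 < t"
  shows "vderiv (wave t f) = wave t (\<lambda>\<xi>. - \<i> * (of_real \<xi> ^ 1 * f \<xi>) + of_real (1 / (2 * t)) * vderiv f \<xi>)"
proof (rule vderiv_eqI)
  fix x
  let ?c = "- \<i> / (4 * of_real t)"
  have "((\<lambda>x. of_real (1 / sqrt t) * (exp (?c * of_real x ^ 2 + 0 * of_real x) * f (0 + (1 / (2 * t)) * x))) has_vector_derivative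
     of_real (1 / sqrt t) * (exp (?c * of_real x ^ 2 + 0 * of_real x) * (of_real (1 / (2 * t)) * vderiv f (0 + (1 / (2 * t)) * x))
       + ((0 + (2 * ?c) * of_real x) * exp (?c * of_real x ^ 2 + 0 * of_real x)) * f (0 + (1 / (2 * t)) * x))) (at x)"
    by (intro has_vector_derivative_mult_right has_vector_derivative_mult exp_quadratic_derivative vderiv_affine f)
  moreover have "(\<lambda>x. of_real (1 / sqrt t) * (exp (?c * of_real x ^ 2 + 0 * of_real x) * f (0 + (1 / (2 * t)) * x))) = wave t f"
    unfolding wave_def wave_phase by (rule ext) simp
  moreover have "of_real (1 / sqrt t) * (exp (?c * of_real x ^ 2 + 0 * of_real x) * (of_real (1 / (2 * t)) * vderiv f (0 + (1 / (2 * t)) * x))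
       + ((0 + (2 * ?c) * of_real x) * exp (?c * of_real x ^ 2 + 0 * of_real x)) * f (0 + (1 / (2 * t)) * x))
    = wave t (\<lambda>\<xi>. - \<i> * (of_real \<xi> ^ 1 * f \<xi>) + of_real (1 / (2 * t)) * vderiv f \<xi>) x"
  proof -
    have "2 * ?c * of_real x = - \<i> * of_real (x / (2 * t))" using t by (simp add: field_simps)
    then show ?thesis unfolding wave_def wave_phase by (simp add: algebra_simps)
  qed
  ultimately show "(wave t f has_vector_derivative wave t (\<lambda>\<xi>. - \<i> * (of_real \<xi> ^ 1 * f \<xi>) + of_real (1 / (2 * t)) * vderiv f \<xi>) x) (at x)"
    by (simp only:)
qed

text \<open>The amplitude of the time derivative of \<open>wave t f\<close>, which is again of the form \<open>wave t\<close>.\<close>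

definition wave_dot :: "real \<Rightarrow> (real \<Rightarrow> complex) \<Rightarrow> real \<Rightarrow> complex" where
  "wave_dot t f \<xi> = of_real (- 1 / (2 * t)) * f \<xi> + (\<i> * (of_real \<xi> ^ 2 * f \<xi>) + of_real (- 1 / t) * (of_real \<xi> ^ 1 * vderiv f \<xi>))"

lemma schwartz_wave_dot: "schwartz f \<Longrightarrow> schwartz (wave_dot t f)"
  unfolding wave_dot_def[abs_def] by (intro schwartz_add schwartz_cmult schwartz_times_x schwartz_vderiv)

lemma wave_time_derivative:
  assumes f: "schwartz f" and t: "0 < t"
  shows "((\<lambda>t. wave t f x) has_vector_derivative wave t (wave_dot t f) x) (at t)"
proof -
  have 1: "((\<lambda>t. complex_of_real (1 / sqrt t)) has_vector_derivative of_real (- 1 / (2 * t) * (1 / sqrt t))) (at t)"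
  proof (rule has_vector_derivative_of_real)
    have "((\<lambda>t. 1 / sqrt t) has_real_derivative - (inverse (sqrt t) / 2) / (sqrt t * sqrt t)) (at t)"
      using t by (auto intro!: derivative_eq_intros)
    then show "((\<lambda>t. 1 / sqrt t) has_real_derivative - 1 / (2 * t) * (1 / sqrt t)) (at t)"
      using t by (simp add: field_simps)
  qed
  have 2: "((\<lambda>t. exp (- \<i> * complex_of_real (x\<^sup>2 / (4 * t)))) has_vector_derivative
      (\<i> * of_real ((x / (2 * t))\<^sup>2)) * exp (- \<i> * complex_of_real (x\<^sup>2 / (4 * t)))) (at t)"
  proof -
    have "((\<lambda>t. x\<^sup>2 / (4 * t)) has_real_derivative - ((x / (2 * t))\<^sup>2)) (at t)"
      using t by (auto intro!: derivative_eq_intros simp: power2_eq_square field_simps)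
    from has_vector_derivative_of_real[OF this]
    have a: "((\<lambda>t. complex_of_real (x\<^sup>2 / (4 * t))) has_vector_derivative of_real (- ((x / (2 * t))\<^sup>2))) (at t)" .
    have b: "((\<lambda>z. exp (- \<i> * z)) has_field_derivative - \<i> * exp (- \<i> * z)) (at z)" for z
      by (auto intro!: derivative_eq_intros)
    from field_vector_diff_chain_at[OF a b] show ?thesis by (simp add: comp_def mult_ac)
  qed
  have 3: "((\<lambda>t. f (x / (2 * t))) has_vector_derivative of_real (- 1 / t) * (of_real (x / (2 * t)) * vderiv f (x / (2 * t)))) (at t)"
  proof -
    have "((\<lambda>t. x / (2 * t)) has_real_derivative - 1 / t * (x / (2 * t))) (at t)"
      using t by (auto intro!: derivative_eq_intros simp: power2_eq_square field_simps)
    then have "((\<lambda>t. x / (2 * t)) has_vector_derivative - 1 / t * (x / (2 * t))) (at t)"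
      by (simp add: has_real_derivative_iff_has_vector_derivative)
    from vector_diff_chain_at[OF this schwartz_has_derivative[OF f]]
    show ?thesis by (simp add: comp_def scaleR_conv_of_real mult.assoc)
  qed
  have "((\<lambda>t. wave t f x) has_vector_derivative
     of_real (1 / sqrt t) * (exp (- \<i> * complex_of_real (x\<^sup>2 / (4 * t))) * (of_real (- 1 / t) * (of_real (x / (2 * t)) * vderiv f (x / (2 * t))))
       + (\<i> * of_real ((x / (2 * t))\<^sup>2)) * exp (- \<i> * complex_of_real (x\<^sup>2 / (4 * t))) * f (x / (2 * t)))
     + of_real (- 1 / (2 * t) * (1 / sqrt t)) * (exp (- \<i> * complex_of_real (x\<^sup>2 / (4 * t))) * f (x / (2 * t)))) (at t)"
    unfolding wave_def by (intro has_vector_derivative_mult 1 2 3)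
  moreover have "of_real (1 / sqrt t) * (exp (- \<i> * complex_of_real (x\<^sup>2 / (4 * t))) * (of_real (- 1 / t) * (of_real (x / (2 * t)) * vderiv f (x / (2 * t))))
       + (\<i> * of_real ((x / (2 * t))\<^sup>2)) * exp (- \<i> * complex_of_real (x\<^sup>2 / (4 * t))) * f (x / (2 * t)))
     + of_real (- 1 / (2 * t) * (1 / sqrt t)) * (exp (- \<i> * complex_of_real (x\<^sup>2 / (4 * t))) * f (x / (2 * t)))
     = wave t (wave_dot t f) x"
  proof -
    define E where "E = exp (- \<i> * complex_of_real (x\<^sup>2 / (4 * t)))"
    define y where "y = x / (2 * t)"
    define c where "c = complex_of_real (1 / sqrt t)"
    define h where "h = complex_of_real (- 1 / (2 * t))"
    define k where "k = complex_of_real (- 1 / t)"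
    have "complex_of_real (- 1 / (2 * t) * (1 / sqrt t)) = h * c" unfolding h_def c_def by (rule of_real_mult)
    then show ?thesis
      unfolding wave_def wave_dot_def E_def[symmetric] y_def[symmetric] c_def[symmetric] h_def[symmetric] k_def[symmetric]
      by (simp add: algebra_simps)
  qed
  ultimately show ?thesis by (simp only:)
qed

text \<open>The test functions solve the adjoint free equation up to an error of size
  \<open>t\<^bsup>-2\<^esup>\<close>, which is integrable in time; the terms of order
  \<open>1\<close> and \<open>t\<^bsup>-1\<^esup>\<close> cancel.\<close>

lemma wave_almost_free:
  assumes f: "schwartz f" and t: "0 < t"
  shows "\<i> * vderiv (vderiv (wave t f)) x + wave t (wave_dot t f) x = of_real (1 / (4 * t\<^sup>2)) * (\<i> * wave t (vderiv (vderiv f)) x)"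
proof -
  let ?f1 = "\<lambda>\<xi>. - \<i> * (of_real \<xi> ^ 1 * f \<xi>) + of_real (1 / (2 * t)) * vderiv f \<xi>"
  have f1: "schwartz ?f1" by (intro schwartz_add schwartz_cmult schwartz_times_x schwartz_vderiv f)
  have d: "vderiv ?f1 = (\<lambda>\<xi>. - \<i> * (of_real \<xi> ^ 1 * vderiv f \<xi> + of_nat 1 * of_real \<xi> ^ (1 - 1) * f \<xi>) + of_real (1 / (2 * t)) * vderiv (vderiv f) \<xi>)"
    by (intro vderiv_eqI has_vector_derivative_add has_vector_derivative_mult_right has_vector_derivative_mult
        of_real_power_has_vector_derivative schwartz_has_derivative schwartz_vderiv f)
  define E where "E = exp (- \<i> * complex_of_real (x\<^sup>2 / (4 * t)))"
  define y where "y = complex_of_real (x / (2 * t))"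
  define c where "c = complex_of_real (1 / sqrt t)"
  define h where "h = complex_of_real (1 / (2 * t))"
  have e: "complex_of_real (- 1 / (2 * t)) = - h" "complex_of_real (- 1 / t) = - (h + h)" "complex_of_real (1 / (4 * t\<^sup>2)) = h * h"
    using t by (simp_all add: h_def field_simps power2_eq_square)
  have ii: "\<i> * (\<i> * z) = - z" for z by simp
  show ?thesis
    unfolding wave_derivative[OF f t] wave_derivative[OF f1 t] d
    unfolding wave_def wave_dot_def e E_def[symmetric] c_def[symmetric] y_def[symmetric] h_def[symmetric]
    by (simp add: algebra_simps power2_eq_square)
qed

text \<open>Difference quotients converge in \<open>L\<^sup>2\<close> and not only pointwise, since they are
  paired with functions known only to be square integrable.\<close>

lemma wave_difference_quotient:
  assumes f: "schwartz f" and t: "0 < t"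
  shows "((\<lambda>k. l2 (\<lambda>x. (wave (t + k) f x - wave t f x) /\<^sub>R k - wave t (wave_dot t f) x)) \<longlongrightarrow> 0) (at 0)"
proof -
  let ?S = "{- t / 2<..<t / 2}"
  have at: "(at 0 :: real filter) = at 0 within ?S" by (rule at_within_open[symmetric]) (use t in auto)
  have "(\<lambda>n. l2 (\<lambda>x. (wave (t + k n) f x - wave t f x) /\<^sub>R k n - wave t (wave_dot t f) x)) \<longlonglongrightarrow> 0"
    if k: "\<And>n. k n \<in> ?S - {0}" "k \<longlonglongrightarrow> 0" for k
  proof -
    have pos: "0 < t + k n" for n using k(1)[of n] by auto
    obtain B0 where B0: "0 \<le> B0" "\<And>x. norm (f x) \<le> B0 / (1 + x\<^sup>2)" using schwartz_decay[OF f] by auto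
    obtain B1 where B1: "0 \<le> B1" "\<And>x. norm (of_real x ^ 2 * f x) \<le> B1 / (1 + x\<^sup>2)" using schwartz_decay[OF schwartz_times_x[OF f]] by auto
    obtain B2 where B2: "0 \<le> B2" "\<And>x. norm (of_real x ^ 1 * vderiv f x) \<le> B2 / (1 + x\<^sup>2)" using schwartz_decay[OF schwartz_times_x[OF schwartz_vderiv[OF f], of 1]] by blast
    define C where "C = (B0 / t + (B1 + 2 / t * B2)) / sqrt (t / 2) * (1 + 9 * t\<^sup>2)"
    have bd: "norm (wave s (wave_dot s f) x) \<le> C / (1 + x\<^sup>2)" if s: "t / 2 < s" "s < 3 * t / 2" for s x
    proof -
      have s0: "0 < s" using s t by linarith
      let ?y = "x / (2 * s)"
      have py: "0 < 1 + ?y\<^sup>2" by (simp add: add_pos_nonneg)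
      have "norm (wave_dot s f ?y) \<le> norm (of_real (- 1 / (2 * s)) * f ?y) + (norm (\<i> * (of_real ?y ^ 2 * f ?y)) + norm (of_real (- 1 / s) * (of_real ?y ^ 1 * vderiv f ?y)))"
        unfolding wave_dot_def by (intro order_trans[OF norm_triangle_ineq] add_left_mono norm_triangle_ineq)
      also have "\<dots> = 1 / (2 * s) * norm (f ?y) + (norm (of_real ?y ^ 2 * f ?y) + 1 / s * norm (of_real ?y ^ 1 * vderiv f ?y))"
        unfolding norm_mult[of "of_real (- 1 / (2 * s))"] norm_mult[of "of_real (- 1 / s)"] norm_mult[of \<i>] norm_of_real using s0 by simp
      also have "\<dots> \<le> 1 / t * (B0 / (1 + ?y\<^sup>2)) + (B1 / (1 + ?y\<^sup>2) + 2 / t * (B2 / (1 + ?y\<^sup>2)))"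
      proof -
        have "1 / (2 * s) \<le> 1 / t" "1 / s \<le> 2 / t" using s t s0 by (simp_all add: field_simps)
        then show ?thesis using t s0 by (intro add_mono mult_mono B0(2) B1(2) B2(2)) auto
      qed
      also have "\<dots> = (B0 / t + (B1 + 2 / t * B2)) / (1 + ?y\<^sup>2)" by (simp add: add_divide_distrib)
      finally have 1: "norm (wave_dot s f ?y) \<le> (B0 / t + (B1 + 2 / t * B2)) / (1 + ?y\<^sup>2)" .
      have 2: "1 / (1 + ?y\<^sup>2) \<le> (1 + 9 * t\<^sup>2) / (1 + x\<^sup>2)"
      proof -
        have "4 * s\<^sup>2 \<le> 9 * t\<^sup>2" using power_mono[of "2 * s" "3 * t" 2] s s0 by (simp add: power_mult_distrib)
        have "x\<^sup>2 = (4 * s\<^sup>2) * ?y\<^sup>2" using s0 by (simp add: power_divide power_mult_distrib)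
        also have "\<dots> \<le> 9 * t\<^sup>2 * ?y\<^sup>2" using \<open>4 * s\<^sup>2 \<le> 9 * t\<^sup>2\<close> by (intro mult_right_mono) auto
        finally have "x\<^sup>2 \<le> 9 * t\<^sup>2 * ?y\<^sup>2" .
        moreover have "(1 + 9 * t\<^sup>2) * (1 + ?y\<^sup>2) = 1 + 9 * t\<^sup>2 * ?y\<^sup>2 + (9 * t\<^sup>2 + ?y\<^sup>2)"
          by (simp only: distrib_left distrib_right mult_1 mult_1_right add_ac)
        ultimately have "1 + x\<^sup>2 \<le> (1 + 9 * t\<^sup>2) * (1 + ?y\<^sup>2)"
          using zero_le_power2[of ?y] zero_le_power2[of t] by linarith
        then show ?thesis using py by (simp add: divide_le_eq le_divide_eq add_pos_nonneg mult.commute)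
      qed
      have K0: "0 \<le> B0 / t + (B1 + 2 / t * B2)" using B0 B1 B2 t by simp
      have "norm (wave s (wave_dot s f) x) = norm (wave_dot s f ?y) / sqrt s" by (rule wave_norm[OF s0])
      also have "\<dots> \<le> ((B0 / t + (B1 + 2 / t * B2)) / (1 + ?y\<^sup>2)) / sqrt (t / 2)"
        using 1 s t K0 py by (intro frac_le) auto
      also have "\<dots> = ((B0 / t + (B1 + 2 / t * B2)) / sqrt (t / 2)) * (1 / (1 + ?y\<^sup>2))" by simp
      also have "\<dots> \<le> ((B0 / t + (B1 + 2 / t * B2)) / sqrt (t / 2)) * ((1 + 9 * t\<^sup>2) / (1 + x\<^sup>2))"
        using K0 t by (intro mult_left_mono 2) auto
      also have "\<dots> = C / (1 + x\<^sup>2)" by (simp add: C_def)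
      finally show ?thesis .
    qed
    have wm: "wave s f \<in> borel_measurable borel" if "0 < s" for s by (rule schwartz_measurable[OF schwartz_wave[OF f that]])
    note [measurable] = wm[OF t] wm[OF pos] schwartz_measurable[OF schwartz_wave[OF schwartz_wave_dot[OF f] t]]
    show ?thesis
    proof (rule l2_dominated_tendsto(2))
      show "integrable lborel (\<lambda>x::real. (C / (1 + x\<^sup>2))\<^sup>2)"
      proof -
        have "sqint (\<lambda>x. of_real (C / (1 + x\<^sup>2)))"
        proof (rule sqint_of_decay[of _ "\<bar>C\<bar>"])
          show "norm (complex_of_real (C / (1 + x\<^sup>2))) \<le> \<bar>C\<bar> / (1 + x\<^sup>2)" for x :: real
            unfolding norm_of_real by simp
        qed measurable
        from sqint_integrable[OF this] show ?thesis unfolding norm_of_real power2_abs .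
      qed
      show "AE x in lborel. (\<lambda>n. (wave (t + k n) f x - wave t f x) /\<^sub>R k n) \<longlonglongrightarrow> wave t (wave_dot t f) x"
      proof (intro AE_I2)
        fix x
        have "((\<lambda>h. (wave (t + h) f x - wave t f x) /\<^sub>R h) \<longlongrightarrow> wave t (wave_dot t f) x) (at 0)"
          using wave_time_derivative[OF f t, of x] unfolding has_vector_derivative_limit .
        then show "(\<lambda>n. (wave (t + k n) f x - wave t f x) /\<^sub>R k n) \<longlonglongrightarrow> wave t (wave_dot t f) x"
          unfolding tendsto_at_iff_sequentially comp_def using k by auto
      qed
      show "AE x in lborel. norm ((wave (t + k n) f x - wave t f x) /\<^sub>R k n) \<le> C / (1 + x\<^sup>2)" for n
      proof (intro AE_I2)
        fix x
        have "norm (wave (t + k n) f x - wave t f x) \<le> C / (1 + x\<^sup>2) * \<bar>(t + k n) - t\<bar>"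
        proof (rule vector_derivative_bound[of "{t / 2<..<3 * t / 2}" _ "\<lambda>s. wave s (wave_dot s f) x"])
          show "((\<lambda>s. wave s f x) has_vector_derivative wave s (wave_dot s f) x) (at s within {t / 2<..<3 * t / 2})" if "s \<in> {t / 2<..<3 * t / 2}" for s
            by (rule has_vector_derivative_at_within[OF wave_time_derivative[OF f]]) (use that t in auto)
        qed (use bd k(1)[of n] t in auto)
        then have "norm (wave (t + k n) f x - wave t f x) / \<bar>k n\<bar> \<le> C / (1 + x\<^sup>2)"
          using k(1)[of n] by (simp add: divide_le_eq)
        then show "norm ((wave (t + k n) f x - wave t f x) /\<^sub>R k n) \<le> C / (1 + x\<^sup>2)"
          unfolding norm_scaleR by (simp only: abs_inverse divide_inverse mult.commute)
      qed
    qed measurable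
  qed
  then show ?thesis unfolding at tendsto_at_iff_sequentially comp_def by blast
qed

text \<open>Otherwise the component of \<open>F\<close> in the direction of \<open>L\<close> would grow at least like a positive
  multiple of \<open>log t\<close>.\<close>

lemma no_logarithmic_growth:
  fixes F F' :: "real \<Rightarrow> complex"
  assumes der: "\<And>t. T \<le> t \<Longrightarrow> (F has_vector_derivative F' t) (at t)" and T: "0 < T"
    and bd: "\<And>t. T \<le> t \<Longrightarrow> norm (F t) \<le> C"
    and lim: "((\<lambda>t. of_real t * F' t) \<longlongrightarrow> L) at_top"
  shows "L = 0"
proof (rule ccontr)
  assume L: "L \<noteq> 0"
  define H where "H t = Re (cnj L * F t)" for t
  define r where "r = (norm L)\<^sup>2 / 2"
  have r: "0 < r" using L by (simp add: r_def)
  have "((\<lambda>t. Re (cnj L * (of_real t * F' t))) \<longlongrightarrow> Re (cnj L * L)) at_top" by (intro tendsto_intros lim)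
  moreover have "r < Re (cnj L * L)"
  proof -
    have "Re (cnj L * L) = (norm L)\<^sup>2" by (metis Re_complex_of_real complex_norm_square mult.commute)
    then show ?thesis using L by (simp add: r_def)
  qed
  ultimately have "eventually (\<lambda>t. r < Re (cnj L * (of_real t * F' t))) at_top" by (rule order_tendstoD(1))
  then obtain T1 where T1: "\<And>t. T1 \<le> t \<Longrightarrow> r < Re (cnj L * (of_real t * F' t))" by (auto simp: eventually_at_top_linorder)
  define a where "a = max T (max T1 1)"
  have mono: "H a - r * ln a \<le> H t - r * ln t" if "a \<le> t" for t
  proof (rule DERIV_nonneg_imp_nondecreasing[OF that])
    fix s assume s: "a \<le> s" "s \<le> t"
    then have s0: "0 < s" "T \<le> s" "T1 \<le> s" by (auto simp: a_def)
    have "(H has_vector_derivative Re (cnj L * F' s)) (at s)"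
      unfolding H_def[abs_def]
      by (intro bounded_linear.has_vector_derivative[OF bounded_linear_Re] has_vector_derivative_mult_right der s0)
    then have "((\<lambda>t. H t - r * ln t) has_real_derivative Re (cnj L * F' s) - r * (1 / s)) (at s)"
      unfolding has_real_derivative_iff_has_vector_derivative[symmetric] using s0 by (auto intro!: derivative_eq_intros)
    moreover have "0 \<le> Re (cnj L * F' s) - r * (1 / s)"
    proof -
      have "Re (cnj L * (of_real s * F' s)) = s * Re (cnj L * F' s)" by (simp add: algebra_simps)
      then have "r < s * Re (cnj L * F' s)" using T1[OF s0(3)] by simp
      then show ?thesis using s0(1) by (simp add: field_simps)
    qed
    ultimately show "\<exists>y. ((\<lambda>t. H t - r * ln t) has_real_derivative y) (at s) \<and> 0 \<le> y" by blast
  qed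
  have Hb: "\<bar>H t\<bar> \<le> norm L * C" if "a \<le> t" for t
  proof -
    have "\<bar>H t\<bar> \<le> norm (cnj L * F t)" unfolding H_def by (rule abs_Re_le_cmod)
    also have "\<dots> \<le> norm L * C" unfolding norm_mult complex_mod_cnj by (intro mult_left_mono bd) (use that in \<open>auto simp: a_def\<close>)
    finally show ?thesis .
  qed
  define t where "t = max a (exp ((2 * norm L * C + r * ln a + 1) / r))"
  have "a \<le> t" by (simp add: t_def)
  have "0 < a" by (simp add: a_def)
  have "(2 * norm L * C + r * ln a + 1) / r \<le> ln t"
    using \<open>0 < a\<close> by (subst ln_ge_iff) (auto simp: t_def)
  then have "2 * norm L * C + r * ln a + 1 \<le> r * ln t" using r by (simp add: divide_le_eq mult.commute)
  then show False using mono[OF \<open>a \<le> t\<close>] Hb[OF \<open>a \<le> t\<close>] Hb[of a] by (simp add: abs_le_iff)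
qed

section \<open>Absence of unmodified scattering\<close>

lemma cubic_difference:
  fixes a c :: complex
  shows "norm (of_real ((norm a)\<^sup>2) * a - of_real ((norm c)\<^sup>2) * c) \<le> 2 * ((norm a)\<^sup>2 + (norm c)\<^sup>2) * norm (a - c)"
proof -
  let ?a = "norm a" and ?c = "norm c" and ?d = "norm (a - c)"
  have "of_real (?a\<^sup>2) * a - of_real (?c\<^sup>2) * c = of_real (?a\<^sup>2) * (a - c) + of_real (?a\<^sup>2 - ?c\<^sup>2) * c"
    by (simp add: algebra_simps)
  then have "norm (of_real (?a\<^sup>2) * a - of_real (?c\<^sup>2) * c) \<le> norm (complex_of_real (?a\<^sup>2) * (a - c)) + norm (complex_of_real (?a\<^sup>2 - ?c\<^sup>2) * c)"
    by (metis norm_triangle_ineq)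
  also have "\<dots> = ?a\<^sup>2 * ?d + \<bar>?a\<^sup>2 - ?c\<^sup>2\<bar> * ?c" unfolding norm_mult norm_of_real by simp
  also have "\<bar>?a\<^sup>2 - ?c\<^sup>2\<bar> = \<bar>?a - ?c\<bar> * (?a + ?c)"
    unfolding power2_eq_square square_diff_square_factored abs_mult by simp
  also have "\<bar>?a - ?c\<bar> * (?a + ?c) * ?c \<le> ?d * (?a + ?c) * ?c"
    by (intro mult_right_mono norm_triangle_ineq3) auto
  also have "?a\<^sup>2 * ?d + ?d * (?a + ?c) * ?c \<le> 2 * (?a\<^sup>2 + ?c\<^sup>2) * ?d"
  proof -
    have "2 * (?a\<^sup>2 + ?c\<^sup>2) - (?a\<^sup>2 + (?a + ?c) * ?c) = ((?a - ?c)\<^sup>2 + (?a\<^sup>2 + ?c\<^sup>2)) / 2"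
      by (simp add: power2_eq_square field_simps)
    moreover have "0 \<le> ((?a - ?c)\<^sup>2 + (?a\<^sup>2 + ?c\<^sup>2)) / 2" by simp
    ultimately have "0 \<le> 2 * (?a\<^sup>2 + ?c\<^sup>2) - (?a\<^sup>2 + (?a + ?c) * ?c)" by (simp only:)
    then have "?a\<^sup>2 + (?a + ?c) * ?c \<le> 2 * (?a\<^sup>2 + ?c\<^sup>2)" by (simp only: diff_ge_0_iff_ge)
    from mult_right_mono[OF this, of ?d] show ?thesis by (simp add: algebra_simps)
  qed
  finally show ?thesis by simp
qed

definition scat_const :: complex where
  "scat_const = of_real (sqrt (2 * pi)) / csqrt (4 * complex_of_real pi * \<i>)"

lemma scat_const_nonzero: "scat_const \<noteq> 0"
  by (simp add: scat_const_def)

lemma csqrt_scale: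
  assumes "0 < t" shows "csqrt (z * of_real t) = csqrt z * of_real (sqrt t)"
proof -
  have "csqrt (z * of_real t) = csqrt z * csqrt (of_real t)"
    using assms mpi_less_Arg[of z] Arg_le_pi[of z] by (intro csqrt_mult) (simp add: Arg_of_real)
  then show ?thesis using assms by (simp add: csqrt_of_real)
qed

text \<open>Expanding \<open>(x - y)\<^sup>2\<close> factors the free propagator into two chirps, a dilation
  and the Fourier transform.\<close>

lemma free_propagator_eq:
  assumes t: "0 < t"
  shows "free_propagator t \<phi> x = scat_const * of_real (1 / sqrt t) * exp (\<i> * of_real (x\<^sup>2 / (4 * t))) *
    fourier (\<lambda>y. exp (\<i> * of_real (y\<^sup>2 / (4 * t))) * \<phi> y) (x / (2 * t))"
proof -
  have "(LINT y|lborel. exp (\<i> * complex_of_real ((x - y)\<^sup>2 / (4 * t))) * \<phi> y)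
     = (LINT y|lborel. exp (\<i> * of_real (x\<^sup>2 / (4 * t))) * (exp (- \<i> * complex_of_real (y * (x / (2 * t)))) * (exp (\<i> * of_real (y\<^sup>2 / (4 * t))) * \<phi> y)))"
  proof (intro Bochner_Integration.integral_cong refl)
    fix y
    have "(x - y)\<^sup>2 / (4 * t) = x\<^sup>2 / (4 * t) + (- (y * (x / (2 * t))) + y\<^sup>2 / (4 * t))"
      using t by (simp add: power2_eq_square field_simps)
    then have "\<i> * complex_of_real ((x - y)\<^sup>2 / (4 * t)) = \<i> * of_real (x\<^sup>2 / (4 * t)) + (- \<i> * of_real (y * (x / (2 * t))) + \<i> * of_real (y\<^sup>2 / (4 * t)))"
      by (simp only: of_real_add of_real_minus distrib_left mult_minus_left mult_minus_right)
    then show "exp (\<i> * complex_of_real ((x - y)\<^sup>2 / (4 * t))) * \<phi> y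
      = exp (\<i> * of_real (x\<^sup>2 / (4 * t))) * (exp (- \<i> * complex_of_real (y * (x / (2 * t)))) * (exp (\<i> * of_real (y\<^sup>2 / (4 * t))) * \<phi> y))"
      by (simp only: exp_add mult.assoc)
  qed
  also have "\<dots> = exp (\<i> * of_real (x\<^sup>2 / (4 * t))) * (LINT y|lborel. exp (- \<i> * complex_of_real (y * (x / (2 * t)))) * (exp (\<i> * of_real (y\<^sup>2 / (4 * t))) * \<phi> y))"
    by (rule integral_mult_right_zero)
  finally have 1: "(LINT y|lborel. exp (\<i> * complex_of_real ((x - y)\<^sup>2 / (4 * t))) * \<phi> y) = \<dots>" .
  have 2: "1 / csqrt (4 * complex_of_real pi * \<i> * complex_of_real t) = scat_const * of_real (1 / sqrt t) * complex_of_real (1 / sqrt (2 * pi))"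
    unfolding csqrt_scale[OF t] scat_const_def using t by (simp add: field_simps)
  show ?thesis unfolding free_propagator_def 1 2 fourier_def by (simp only: mult_ac)
qed

text \<open>The propagator without the inner chirp \<open>exp (i y\<^sup>2 / 4t)\<close>, which tends
  to one.\<close>

definition free_profile :: "real \<Rightarrow> (real \<Rightarrow> complex) \<Rightarrow> real \<Rightarrow> complex" where
  "free_profile t \<phi> x = scat_const * of_real (1 / sqrt t) * exp (\<i> * of_real (x\<^sup>2 / (4 * t))) * fourier \<phi> (x / (2 * t))"

text \<open>The \<open>L\<^sup>1\<close> distance by which the inner chirp moves \<open>\<phi>\<close>. It
  bounds the error of the profile in the supremum norm because the Fourier transform maps
  \<open>L\<^sup>1\<close> boundedly into bounded functions.\<close>

definition chirp_error :: "(real \<Rightarrow> complex) \<Rightarrow> real \<Rightarrow> real" where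
  "chirp_error \<phi> t = (1 / sqrt (2 * pi)) * (LINT y|lborel. norm (exp (\<i> * of_real (y\<^sup>2 / (4 * t))) * \<phi> y - \<phi> y))"

lemma chirp_measurable [measurable]: "(\<lambda>y. exp (\<i> * complex_of_real (y\<^sup>2 / (4 * t)))) \<in> borel_measurable borel"
  by measurable

lemma chirp_integrable:
  assumes "integrable lborel \<phi>" shows "integrable lborel (\<lambda>y. exp (\<i> * of_real (y\<^sup>2 / (4 * t))) * \<phi> y)"
proof (rule dominated_integral(1)[OF integrable_norm[OF assms]])
  show "(\<lambda>y. exp (\<i> * of_real (y\<^sup>2 / (4 * t))) * \<phi> y) \<in> borel_measurable borel"
    using borel_measurable_integrable[OF assms] by measurable
qed (unfold norm_mult fourier_exp_norm, simp)

lemma free_propagator_sqint: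
  assumes \<phi>: "integrable lborel \<phi>" "sqint \<phi>" and t: "0 < t"
  shows "sqint (free_propagator t \<phi>)"
proof -
  let ?f = "fourier (\<lambda>y. exp (\<i> * of_real (y\<^sup>2 / (4 * t))) * \<phi> y)"
  have "sqint (\<lambda>y. exp (\<i> * of_real (y\<^sup>2 / (4 * t))) * \<phi> y)"
    by (rule sqint_bounded_mult(1)[OF \<phi>(2) chirp_measurable, of _ 1]) (simp only: fourier_exp_norm order_refl)
  then have "sqint ?f" by (rule fourier_sqint[OF chirp_integrable[OF \<phi>(1)]])
  then have "sqint (\<lambda>x. ?f (0 + (1 / (2 * t)) * x))" by (rule l2_affine(1)[rotated]) (use t in simp)
  then have "sqint (\<lambda>x. exp (\<i> * of_real (x\<^sup>2 / (4 * t))) * ?f (0 + (1 / (2 * t)) * x))"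
    by (rule sqint_bounded_mult(1)[OF _ chirp_measurable, of _ _ 1]) (simp only: fourier_exp_norm order_refl)
  from sqint_cmult[OF this, of "scat_const * of_real (1 / sqrt t)"]
  show ?thesis by (simp add: free_propagator_eq[OF t, abs_def] mult.assoc)
qed

lemma free_propagator_asymptotics:
  assumes \<phi>: "integrable lborel \<phi>" and t: "0 < t"
  shows "norm (free_propagator t \<phi> x - free_profile t \<phi> x) \<le> norm scat_const * chirp_error \<phi> t / sqrt t"
proof -
  have eq1: "free_propagator t \<phi> x - free_profile t \<phi> x = scat_const * of_real (1 / sqrt t) * exp (\<i> * of_real (x\<^sup>2 / (4 * t))) *
     fourier (\<lambda>y. exp (\<i> * of_real (y\<^sup>2 / (4 * t))) * \<phi> y - \<phi> y) (x / (2 * t))"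
    unfolding free_propagator_eq[OF t] free_profile_def fourier_diff[OF chirp_integrable[OF \<phi>] \<phi>] right_diff_distrib ..
  have "norm (free_propagator t \<phi> x - free_profile t \<phi> x) = norm scat_const * (1 / sqrt t) *
     norm (fourier (\<lambda>y. exp (\<i> * of_real (y\<^sup>2 / (4 * t))) * \<phi> y - \<phi> y) (x / (2 * t)))"
    unfolding eq1 norm_mult fourier_exp_norm norm_of_real using t by simp
  also have "\<dots> \<le> norm scat_const * (1 / sqrt t) * chirp_error \<phi> t"
    unfolding chirp_error_def using t
    by (intro mult_left_mono fourier_norm_le Bochner_Integration.integrable_diff chirp_integrable \<phi>) auto
  finally show ?thesis by simp
qed

lemma chirp_error_tendsto:
  assumes \<phi>: "integrable lborel \<phi>" shows "(chirp_error \<phi> \<longlongrightarrow> 0) at_top"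
proof -
  note [measurable] = borel_measurable_integrable[OF \<phi>]
  have "((\<lambda>t. LINT y|lborel. norm (exp (\<i> * of_real (y\<^sup>2 / (4 * t))) * \<phi> y - \<phi> y)) \<longlongrightarrow> (LINT y|(lborel::real measure). (0::real))) at_top"
  proof (rule integral_dominated_convergence_at_top)
    show "integrable lborel (\<lambda>y. 2 * norm (\<phi> y))" using \<phi> by simp
    show "AE y in lborel. ((\<lambda>t. norm (exp (\<i> * of_real (y\<^sup>2 / (4 * t))) * \<phi> y - \<phi> y)) \<longlongrightarrow> 0) at_top"
    proof (intro AE_I2)
      fix y :: real
      have "((\<lambda>t. y\<^sup>2 / (4 * t)) \<longlongrightarrow> 0) at_top" by real_asymp
      then have "((\<lambda>t. norm (exp (\<i> * complex_of_real (y\<^sup>2 / (4 * t))) * \<phi> y - \<phi> y)) \<longlongrightarrow> norm (exp (\<i> * complex_of_real 0) * \<phi> y - \<phi> y)) at_top"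
        by (intro tendsto_intros)
      then show "((\<lambda>t. norm (exp (\<i> * of_real (y\<^sup>2 / (4 * t))) * \<phi> y - \<phi> y)) \<longlongrightarrow> 0) at_top" by simp
    qed
    show "\<forall>\<^sub>F t in at_top. AE y in lborel. norm (norm (exp (\<i> * of_real (y\<^sup>2 / (4 * t))) * \<phi> y - \<phi> y)) \<le> 2 * norm (\<phi> y)"
    proof (intro always_eventually allI AE_I2)
      fix t y
      have "norm (exp (\<i> * of_real (y\<^sup>2 / (4 * t))) * \<phi> y - \<phi> y) \<le> norm (exp (\<i> * of_real (y\<^sup>2 / (4 * t))) * \<phi> y) + norm (\<phi> y)"
        by (rule norm_triangle_ineq4)
      also have "\<dots> = 2 * norm (\<phi> y)" unfolding norm_mult fourier_exp_norm by simp
      finally show "norm (norm (exp (\<i> * of_real (y\<^sup>2 / (4 * t))) * \<phi> y - \<phi> y)) \<le> 2 * norm (\<phi> y)" by simp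
    qed
  qed measurable
  then have "((\<lambda>t. LINT y|lborel. norm (exp (\<i> * of_real (y\<^sup>2 / (4 * t))) * \<phi> y - \<phi> y)) \<longlongrightarrow> 0) at_top"
    by (simp only: Bochner_Integration.integral_zero)
  then show ?thesis unfolding chirp_error_def[abs_def] by (rule tendsto_mult_right_zero)
qed

text \<open>A flow that scatters in the gauge transformed sense and disperses in \<open>L\<^sup>4\<close>.\<close>

locale scattering = flow +
  fixes \<phi> :: "real \<Rightarrow> complex" and C4 T0 :: real
  assumes T0: "1 \<le> T0" and C4: "0 \<le> C4"
    and u4: "\<And>t. T0 \<le> t \<Longrightarrow> (LINT x|lborel. (norm (u t x)) ^ 4) \<le> C4 / t"
    and phi_int: "integrable lborel \<phi>" and phi_sq: "sqint \<phi>"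
    and scat: "((\<lambda>t. l2 (\<lambda>x. G t x * u t x - free_propagator t \<phi> x)) \<longlongrightarrow> 0) at_top"
begin

definition v :: "real \<Rightarrow> real \<Rightarrow> complex" where "v t x = G t x * u t x"

lemma v_norm: "norm (v t x) = norm (u t x)"
  by (simp add: v_def norm_mult G_norm)

lemma v_sq: "sqint (v t)" and v_l2: "l2 (v t) = l2 (u t)"
proof -
  show "sqint (v t)" unfolding v_def[abs_def] by (rule sqint_bounded_mult(1)[OF u_sq G_meas(1), of _ 1]) (simp add: G_norm)
  show "l2 (v t) = l2 (u t)" unfolding l2_def v_norm ..
qed

lemma v_meas [measurable]: "v t \<in> borel_measurable borel" by (rule sqint_measurable[OF v_sq])

lemma v_l2_le: "l2 (v t) \<le> M" unfolding v_l2 by (rule uM)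

definition \<delta> :: "real \<Rightarrow> real" where "\<delta> t = l2 (\<lambda>x. v t x - free_propagator t \<phi> x)"

lemma \<delta>_lim: "(\<delta> \<longlongrightarrow> 0) at_top" unfolding \<delta>_def[abs_def] v_def by (rule scat)

lemma v_derivative:
  assumes "schwartz \<psi>"
  shows "((\<lambda>s. LINT x|lborel. v s x * \<psi> x) has_vector_derivative
    (LINT x|lborel. v t x * (\<i> * vderiv (vderiv \<psi>) x + q t x * vderiv \<psi> x + \<i> * of_real (b * norm (u t x) powr p) * \<psi> x))) (at t)"
  unfolding v_def by (rule gauge_equation[OF assms])

lemma uvp_bound: "norm (\<i> * complex_of_real (b * norm (u t x) powr p)) \<le> \<bar>b\<bar> * (2 * M) powr p"
  unfolding norm_mult norm_of_real abs_mult using u_sup[of t x] p4 by (auto intro!: mult_left_mono powr_mono2)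

text \<open>Pair the gauge transformed solution with the moving profile. The dispersive term and the motion
  of the profile cancel up to the error of size \<open>t\<^bsup>-2\<^esup>\<close>; what remains
  comes from the nonlinearity.\<close>

lemma tested_wave_derivative:
  assumes g: "schwartz g" and t: "0 < t"
  shows "((\<lambda>s. LINT x|lborel. v s x * wave s g x) has_vector_derivative
    (LINT x|lborel. v t x * (of_real (1 / (4 * t\<^sup>2)) * (\<i> * wave t (vderiv (vderiv g)) x)))
    + ((LINT x|lborel. (q t x * v t x) * vderiv (wave t g) x)
    + (LINT x|lborel. v t x * (\<i> * of_real (b * norm (u t x) powr p) * wave t g x)))) (at t)"
  unfolding has_vector_derivative_limit
proof -
  let ?\<psi> = "wave t g" and ?\<psi>d = "wave t (wave_dot t g)"
  have \<psi>: "schwartz ?\<psi>" and \<psi>d: "schwartz ?\<psi>d" by (intro schwartz_wave schwartz_wave_dot g t)+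
  have \<psi>': "schwartz (vderiv ?\<psi>)" "schwartz (vderiv (vderiv ?\<psi>))" by (intro schwartz_vderiv \<psi>)+
  let ?F = "\<lambda>s. LINT x|lborel. v s x * wave s g x"
  let ?D1 = "LINT x|lborel. v t x * (\<i> * vderiv (vderiv ?\<psi>) x + q t x * vderiv ?\<psi> x + \<i> * of_real (b * norm (u t x) powr p) * ?\<psi> x)"
  let ?r = "\<lambda>k x. (wave (t + k) g x - wave t g x) /\<^sub>R k - ?\<psi>d x"
  have 1: "((\<lambda>k. ((LINT x|lborel. v (t + k) x * ?\<psi> x) - (LINT x|lborel. v t x * ?\<psi> x)) /\<^sub>R k) \<longlongrightarrow> ?D1) (at 0)"
    using v_derivative[OF \<psi>, of t] unfolding has_vector_derivative_limit .
  have 2: "((\<lambda>k. LINT x|lborel. v (t + k) x * ?\<psi>d x) \<longlongrightarrow> (LINT x|lborel. v t x * ?\<psi>d x)) (at 0)"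
  proof -
    have "isCont (\<lambda>s. LINT x|lborel. v s x * ?\<psi>d x) t" by (rule has_vector_derivative_continuous[OF v_derivative[OF \<psi>d]])
    then show ?thesis by (simp add: isCont_iff)
  qed
  have ev: "\<forall>\<^sub>F k in at 0. k \<noteq> 0 \<and> 0 < t + k"
  proof -
    have "\<forall>\<^sub>F k in at 0. k \<in> {- t<..<t}" by (rule eventually_at_in_open') (use t in auto)
    then show ?thesis using eventually_neq_at_within[of 0 0 UNIV] by eventually_elim auto
  qed
  have rs: "sqint (?r k)" if "0 < t + k" for k
    unfolding scaleR_conv_of_real by (intro sqint_diff sqint_cmult schwartz_sqint schwartz_wave schwartz_wave_dot g t that)
  have 3: "((\<lambda>k. LINT x|lborel. v (t + k) x * ?r k x) \<longlongrightarrow> 0) (at 0)"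
  proof (rule Lim_null_comparison)
    show "((\<lambda>k. M * l2 (?r k)) \<longlongrightarrow> 0) (at 0)" by (rule tendsto_mult_right_zero[OF wave_difference_quotient[OF g t]])
    show "\<forall>\<^sub>F k in at 0. norm (LINT x|lborel. v (t + k) x * ?r k x) \<le> M * l2 (?r k)"
      using ev
    proof eventually_elim
      case (elim k)
      have "norm (LINT x|lborel. v (t + k) x * ?r k x) \<le> l2 (v (t + k)) * l2 (?r k)"
        by (rule l2_CS[OF v_sq rs]) (use elim in simp)
      also have "\<dots> \<le> M * l2 (?r k)" by (intro mult_right_mono v_l2_le) simp
      finally show ?case .
    qed
  qed
  have "((\<lambda>k. ((LINT x|lborel. v (t + k) x * ?\<psi> x) - (LINT x|lborel. v t x * ?\<psi> x)) /\<^sub>R k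
      + ((LINT x|lborel. v (t + k) x * ?r k x) + (LINT x|lborel. v (t + k) x * ?\<psi>d x))) \<longlongrightarrow> ?D1 + (0 + (LINT x|lborel. v t x * ?\<psi>d x))) (at 0)"
    by (intro tendsto_add 1 2 3)
  moreover have "\<forall>\<^sub>F k in at 0. ((LINT x|lborel. v (t + k) x * ?\<psi> x) - (LINT x|lborel. v t x * ?\<psi> x)) /\<^sub>R k
      + ((LINT x|lborel. v (t + k) x * ?r k x) + (LINT x|lborel. v (t + k) x * ?\<psi>d x)) = (?F (t + k) - ?F t) /\<^sub>R k"
    using ev
  proof eventually_elim
    case (elim k)
    have w: "sqint (wave (t + k) g)" by (intro schwartz_sqint schwartz_wave g) (use elim in simp)
    have i: "integrable lborel (\<lambda>x. v (t + k) x * wave (t + k) g x)" "integrable lborel (\<lambda>x. v (t + k) x * ?\<psi> x)"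
      "integrable lborel (\<lambda>x. v (t + k) x * ?r k x)" "integrable lborel (\<lambda>x. v (t + k) x * ?\<psi>d x)"
      using elim
      by (auto intro!: sqint_prod_integrable[OF v_sq w] sqint_prod_integrable[OF v_sq schwartz_sqint[OF \<psi>]]
        sqint_prod_integrable[OF v_sq rs] sqint_prod_integrable[OF v_sq schwartz_sqint[OF \<psi>d]])
    have "(LINT x|lborel. v (t + k) x * ?r k x) + (LINT x|lborel. v (t + k) x * ?\<psi>d x) = (LINT x|lborel. v (t + k) x * ?r k x + v (t + k) x * ?\<psi>d x)"
      by (rule Bochner_Integration.integral_add[OF i(3,4), symmetric])
    also have "\<dots> = (LINT x|lborel. (v (t + k) x * wave (t + k) g x - v (t + k) x * ?\<psi> x) /\<^sub>R k)"
      by (intro Bochner_Integration.integral_cong refl) (simp add: scaleR_conv_of_real algebra_simps)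
    also have "\<dots> = ((LINT x|lborel. v (t + k) x * wave (t + k) g x) - (LINT x|lborel. v (t + k) x * ?\<psi> x)) /\<^sub>R k"
      using i by simp
    finally show ?case by (simp only: scaleR_diff_right) simp
  qed
  ultimately have lim: "((\<lambda>k. (?F (t + k) - ?F t) /\<^sub>R k) \<longlongrightarrow> ?D1 + (LINT x|lborel. v t x * ?\<psi>d x)) (at 0)"
    by (simp only: tendsto_cong add_0)
  have bm: "sqint (\<lambda>x. (\<i> * of_real (b * norm (u t x) powr p)) * ?\<psi> x)"
    by (rule sqint_bounded_mult(1)[OF schwartz_sqint[OF \<psi>] _ uvp_bound]) measurable
  have qv: "sqint (\<lambda>x. q t x * v t x)"
    by (rule sqint_bounded_mult(1)[OF v_sq _ q_bound]) measurable
  have i: "integrable lborel (\<lambda>x. v t x * (\<i> * vderiv (vderiv ?\<psi>) x))" "integrable lborel (\<lambda>x. (q t x * v t x) * vderiv ?\<psi> x)"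
    "integrable lborel (\<lambda>x. v t x * (\<i> * of_real (b * norm (u t x) powr p) * ?\<psi> x))" "integrable lborel (\<lambda>x. v t x * ?\<psi>d x)"
    by (intro sqint_prod_integrable v_sq sqint_cmult schwartz_sqint \<psi>' \<psi>d qv bm)+
  have "?D1 = (LINT x|lborel. v t x * (\<i> * vderiv (vderiv ?\<psi>) x) + ((q t x * v t x) * vderiv ?\<psi> x + v t x * (\<i> * of_real (b * norm (u t x) powr p) * ?\<psi> x)))"
    by (intro Bochner_Integration.integral_cong refl) (simp add: algebra_simps)
  also have "\<dots> = (LINT x|lborel. v t x * (\<i> * vderiv (vderiv ?\<psi>) x)) + ((LINT x|lborel. (q t x * v t x) * vderiv ?\<psi> x) + (LINT x|lborel. v t x * (\<i> * of_real (b * norm (u t x) powr p) * ?\<psi> x)))"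
    using i by (subst Bochner_Integration.integral_add[OF i(1) Bochner_Integration.integrable_add[OF i(2,3)]], subst Bochner_Integration.integral_add[OF i(2,3)]) (rule refl)
  finally have D1: "?D1 = \<dots>" .
  have "(LINT x|lborel. v t x * (\<i> * vderiv (vderiv ?\<psi>) x)) + (LINT x|lborel. v t x * ?\<psi>d x)
     = (LINT x|lborel. v t x * (\<i> * vderiv (vderiv ?\<psi>) x) + v t x * ?\<psi>d x)"
    by (rule Bochner_Integration.integral_add[OF i(1,4), symmetric])
  also have "\<dots> = (LINT x|lborel. v t x * (of_real (1 / (4 * t\<^sup>2)) * (\<i> * wave t (vderiv (vderiv g)) x)))"
    unfolding distrib_left[symmetric] wave_almost_free[OF g t] ..
  finally have h: "(LINT x|lborel. v t x * (\<i> * vderiv (vderiv ?\<psi>) x)) + (LINT x|lborel. v t x * ?\<psi>d x)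
    = (LINT x|lborel. v t x * (of_real (1 / (4 * t\<^sup>2)) * (\<i> * wave t (vderiv (vderiv g)) x)))" .
  have "?D1 + (LINT x|lborel. v t x * ?\<psi>d x) = (LINT x|lborel. v t x * (of_real (1 / (4 * t\<^sup>2)) * (\<i> * wave t (vderiv (vderiv g)) x)))
    + ((LINT x|lborel. (q t x * v t x) * vderiv ?\<psi> x) + (LINT x|lborel. v t x * (\<i> * of_real (b * norm (u t x) powr p) * ?\<psi> x)))"
    unfolding D1 h[symmetric] by (simp only: add_ac)
  then show "((\<lambda>k. (?F (t + k) - ?F t) /\<^sub>R k) \<longlongrightarrow> (LINT x|lborel. v t x * (of_real (1 / (4 * t\<^sup>2)) * (\<i> * wave t (vderiv (vderiv g)) x)))
    + ((LINT x|lborel. (q t x * v t x) * vderiv ?\<psi> x) + (LINT x|lborel. v t x * (\<i> * of_real (b * norm (u t x) powr p) * ?\<psi> x)))) (at 0)"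
    using lim by (simp only:)
qed

lemma u4_int_real: "integrable lborel (\<lambda>x. (norm (u t x)) ^ 4)"
proof -
  have "norm (q t x * q t x) = (norm (u t x)) ^ 4" for x by (simp add: norm_mult power4_eq_xxxx)
  then show ?thesis using integrable_norm[OF u4_int[of t]] by (simp only:)
qed

lemma sup_wave: "schwartz g \<Longrightarrow> \<exists>B\<ge>0. \<forall>t>0. \<forall>x. norm (wave t g x) \<le> B / sqrt t"
proof -
  assume "schwartz g"
  then obtain B where "0 \<le> B" "\<And>x. norm (g x) \<le> B" using schwartz_bounded by blast
  then show ?thesis by (intro exI[of _ B]) (auto simp: wave_norm intro: divide_right_mono)
qed

text \<open>The pairing is bounded, so the factor \<open>t\<^bsup>-2\<^esup>\<close> beats \<open>t\<close>.\<close>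

lemma remainder_free:
  assumes g: "schwartz g"
  shows "((\<lambda>t. of_real t * (LINT x|lborel. v t x * (of_real (1 / (4 * t\<^sup>2)) * (\<i> * wave t (vderiv (vderiv g)) x)))) \<longlongrightarrow> 0) at_top"
proof (rule Lim_null_comparison)
  have g2: "schwartz (vderiv (vderiv g))" by (intro schwartz_vderiv g)
  let ?K = "M * (sqrt 2 * l2 (vderiv (vderiv g)))"
  show "((\<lambda>t. ?K * (1 / (4 * t))) \<longlongrightarrow> 0) at_top" by (rule tendsto_mult_right_zero) real_asymp
  show "\<forall>\<^sub>F t in at_top. norm (of_real t * (LINT x|lborel. v t x * (of_real (1 / (4 * t\<^sup>2)) * (\<i> * wave t (vderiv (vderiv g)) x)))) \<le> ?K * (1 / (4 * t))"
    using eventually_gt_at_top[of 0]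
  proof eventually_elim
    case (elim t)
    have w: "sqint (wave t (vderiv (vderiv g)))" by (rule wave_l2(1)[OF schwartz_sqint[OF g2] elim])
    have "norm (LINT x|lborel. v t x * (of_real (1 / (4 * t\<^sup>2)) * (\<i> * wave t (vderiv (vderiv g)) x)))
      \<le> l2 (v t) * l2 (\<lambda>x. of_real (1 / (4 * t\<^sup>2)) * (\<i> * wave t (vderiv (vderiv g)) x))"
      by (intro l2_CS v_sq sqint_cmult w)
    also have "\<dots> = l2 (v t) * (1 / (4 * t\<^sup>2) * (sqrt 2 * l2 (vderiv (vderiv g))))"
      unfolding l2_cmult wave_l2(2)[OF schwartz_sqint[OF g2] elim] norm_of_real by simp
    also have "\<dots> \<le> M * (1 / (4 * t\<^sup>2) * (sqrt 2 * l2 (vderiv (vderiv g))))" by (intro mult_right_mono v_l2_le) auto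
    finally have "norm (LINT x|lborel. v t x * (of_real (1 / (4 * t\<^sup>2)) * (\<i> * wave t (vderiv (vderiv g)) x))) \<le> M * (1 / (4 * t\<^sup>2) * (sqrt 2 * l2 (vderiv (vderiv g))))" .
    from mult_left_mono[OF this, of t] elim show ?case
      unfolding norm_mult[of "of_real t"] norm_of_real by (simp add: power2_eq_square)
  qed
qed

text \<open>Here \<open>p \<ge> 4\<close> and the supremum bound reduce
  \<open>|v|\<^bsup>p+1\<^esup>\<close> to a multiple of \<open>|v|\<^sup>4\<close>, whose
  integral is \<open>O(1/t)\<close>; the test function adds a factor
  \<open>t\<^bsup>-1/2\<^esup>\<close>. The pure power is thus of short range.\<close>

lemma remainder_power:
  assumes g: "schwartz g"
  shows "((\<lambda>t. of_real t * (LINT x|lborel. v t x * (\<i> * of_real (b * norm (u t x) powr p) * wave t g x))) \<longlongrightarrow> 0) at_top"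
proof -
  obtain B where B: "0 \<le> B" "\<And>t x. 0 < t \<Longrightarrow> norm (wave t g x) \<le> B / sqrt t" using sup_wave[OF g] by blast
  let ?K = "\<bar>b\<bar> * (2 * M) powr (p - 3) * B * C4"
  show ?thesis
  proof (rule Lim_null_comparison)
    show "((\<lambda>t. ?K * (1 / sqrt t)) \<longlongrightarrow> 0) at_top" by (rule tendsto_mult_right_zero) real_asymp
    show "\<forall>\<^sub>F t in at_top. norm (of_real t * (LINT x|lborel. v t x * (\<i> * of_real (b * norm (u t x) powr p) * wave t g x))) \<le> ?K * (1 / sqrt t)"
      using eventually_ge_at_top[of T0]
    proof eventually_elim
      case (elim t)
      have t: "0 < t" using elim T0 by linarith
      let ?c = "\<bar>b\<bar> * (2 * M) powr (p - 3) * (B / sqrt t)"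
      have c0: "0 \<le> ?c" using B(1) t by simp
      have "norm (LINT x|lborel. v t x * (\<i> * of_real (b * norm (u t x) powr p) * wave t g x)) \<le> (LINT x|lborel. ?c * (norm (u t x)) ^ 4)"
      proof (rule dominated_integral(2))
        show "integrable lborel (\<lambda>x. ?c * (norm (u t x)) ^ 4)" using u4_int_real by simp
        show "(\<lambda>x. v t x * (\<i> * of_real (b * norm (u t x) powr p) * wave t g x)) \<in> borel_measurable borel"
          using schwartz_measurable[OF schwartz_wave[OF g t]] by measurable
        fix x
        have "norm (u t x) * norm (u t x) powr p \<le> (2 * M) powr (p - 3) * (norm (u t x)) ^ 4"
        proof (cases "norm (u t x) = 0")
          case False
          then have pos: "0 < norm (u t x)" by simp
          have "norm (u t x) powr p = norm (u t x) powr (p - 3) * norm (u t x) powr 3" by (simp only: powr_add[symmetric] diff_add_cancel)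
          also have "norm (u t x) powr 3 = (norm (u t x)) ^ 3" using pos powr_realpow[of "norm (u t x)" 3] by simp
          finally have "norm (u t x) * norm (u t x) powr p = norm (u t x) powr (p - 3) * (norm (u t x)) ^ 4"
            by (simp add: power3_eq_cube power4_eq_xxxx)
          also have "\<dots> \<le> (2 * M) powr (p - 3) * (norm (u t x)) ^ 4"
            using u_sup[of t x] p4 by (intro mult_right_mono powr_mono2) auto
          finally show ?thesis .
        qed simp
        then have "(\<bar>b\<bar> * (norm (u t x) * norm (u t x) powr p)) * norm (wave t g x) \<le> (\<bar>b\<bar> * ((2 * M) powr (p - 3) * (norm (u t x)) ^ 4)) * (B / sqrt t)"
          by (intro mult_mono[OF mult_left_mono B(2)[OF t]]) auto
        then show "norm (v t x * (\<i> * of_real (b * norm (u t x) powr p) * wave t g x)) \<le> ?c * (norm (u t x)) ^ 4"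
          unfolding norm_mult v_norm norm_of_real abs_mult by (simp add: mult_ac)
      qed
      also have "\<dots> = ?c * (LINT x|lborel. (norm (u t x)) ^ 4)" by simp
      also have "\<dots> \<le> ?c * (C4 / t)" by (intro mult_left_mono u4 elim c0)
      finally have "norm (LINT x|lborel. v t x * (\<i> * of_real (b * norm (u t x) powr p) * wave t g x)) \<le> ?c * (C4 / t)" .
      from mult_left_mono[OF this, of t] t show ?case
        unfolding norm_mult[of "of_real t"] norm_of_real by simp
    qed
  qed
qed

text \<open>When the derivative hits the amplitude of the profile and not its phase, it gains a factor
  \<open>1/t\<close>.\<close>

lemma remainder_derivative:
  assumes g: "schwartz g"
  shows "((\<lambda>t. of_real t * (LINT x|lborel. (q t x * v t x) * (of_real (1 / (2 * t)) * wave t g x))) \<longlongrightarrow> 0) at_top"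
proof -
  obtain B where B: "0 \<le> B" "\<And>t x. 0 < t \<Longrightarrow> norm (wave t g x) \<le> B / sqrt t" using sup_wave[OF g] by blast
  let ?K = "(2 * M) * B * M\<^sup>2 / 2"
  show ?thesis
  proof (rule Lim_null_comparison)
    show "((\<lambda>t. ?K * (1 / sqrt t)) \<longlongrightarrow> 0) at_top" by (rule tendsto_mult_right_zero) real_asymp
    show "\<forall>\<^sub>F t in at_top. norm (of_real t * (LINT x|lborel. (q t x * v t x) * (of_real (1 / (2 * t)) * wave t g x))) \<le> ?K * (1 / sqrt t)"
      using eventually_gt_at_top[of 0]
    proof eventually_elim
      case (elim t)
      let ?c = "(2 * M) * (1 / (2 * t) * (B / sqrt t))"
      have c0: "0 \<le> ?c" using M0 B(1) elim by simp
      have "norm (LINT x|lborel. (q t x * v t x) * (of_real (1 / (2 * t)) * wave t g x)) \<le> (LINT x|lborel. ?c * (norm (u t x))\<^sup>2)"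
      proof (rule dominated_integral(2))
        show "integrable lborel (\<lambda>x. ?c * (norm (u t x))\<^sup>2)" using mass_int by simp
        show "(\<lambda>x. (q t x * v t x) * (of_real (1 / (2 * t)) * wave t g x)) \<in> borel_measurable borel"
          using schwartz_measurable[OF schwartz_wave[OF g elim]] by measurable
        fix x
        have "norm ((q t x * v t x) * (of_real (1 / (2 * t)) * wave t g x)) = (norm (u t x))\<^sup>2 * (norm (u t x) * (1 / (2 * t) * norm (wave t g x)))"
          using elim unfolding norm_mult[of "q t x * v t x"] norm_mult[of "q t x"] q_norm v_norm norm_mult[of "of_real (1 / (2 * t))"] norm_of_real by simp
        also have "\<dots> \<le> (norm (u t x))\<^sup>2 * ?c"
          using elim M0 by (intro mult_left_mono mult_mono u_sup B elim) auto
        finally show "norm ((q t x * v t x) * (of_real (1 / (2 * t)) * wave t g x)) \<le> ?c * (norm (u t x))\<^sup>2"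
          by (simp only: mult.commute)
      qed
      also have "\<dots> = ?c * (l2 (u t))\<^sup>2" by (simp add: l2_power2)
      also have "\<dots> \<le> ?c * M\<^sup>2" by (intro mult_left_mono power_mono uM c0) simp
      finally have "norm (LINT x|lborel. (q t x * v t x) * (of_real (1 / (2 * t)) * wave t g x)) \<le> ?c * M\<^sup>2" .
      from mult_left_mono[OF this, of t] elim show ?case
        unfolding norm_mult[of "of_real t"] norm_of_real by (simp add: field_simps)
    qed
  qed
qed

definition cubic :: "complex \<Rightarrow> complex" where "cubic z = of_real ((norm z)\<^sup>2) * z"

lemma qv_cubic: "q t x * v t x = cubic (v t x)"
  unfolding cubic_def v_norm complex_norm_square ..

text \<open>The limit of \<open>t\<close> times the pairing of \<open>|v|\<^sup>2 v\<close> with the profile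
  of \<open>f\<close>. The factor \<open>2\<close> is the Jacobian of \<open>x = 2 t
  \<xi>\<close>.\<close>

definition leading :: "(real \<Rightarrow> complex) \<Rightarrow> complex" where
  "leading f = 2 * cubic scat_const * (LINT \<xi>|lborel. cubic (fourier \<phi> \<xi>) * f \<xi>)"

text \<open>On the exact profile the phases of the cubic term and of the test function cancel, and the
  scaling is such that the integral is exactly proportional to \<open>1/t\<close>.\<close>

lemma profile_cubic_integral:
  assumes t: "0 < t"
  shows "of_real t * (LINT x|lborel. cubic (free_profile t \<phi> x) * wave t f x) = leading f"
proof -
  have e: "exp (\<i> * complex_of_real r) * exp (- \<i> * complex_of_real r) = 1" for r
    by (simp flip: exp_add)
  have n: "norm (free_profile t \<phi> x) = norm scat_const * (1 / sqrt t) * norm (fourier \<phi> (x / (2 * t)))" for x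
    unfolding free_profile_def norm_mult fourier_exp_norm norm_of_real using t by simp
  have pw: "cubic (free_profile t \<phi> x) * wave t f x = of_real (1 / t\<^sup>2) * (cubic scat_const * (cubic (fourier \<phi> (0 + (1 / (2 * t)) * x)) * f (0 + (1 / (2 * t)) * x)))" for x
  proof -
    define E where "E = exp (\<i> * complex_of_real (x\<^sup>2 / (4 * t)))"
    define E' where "E' = exp (- \<i> * complex_of_real (x\<^sup>2 / (4 * t)))"
    define y where "y = x / (2 * t)"
    define s where "s = complex_of_real (1 / sqrt t)"
    define a where "a = complex_of_real ((norm scat_const)\<^sup>2)"
    define c where "c = complex_of_real ((norm (fourier \<phi> y))\<^sup>2)"
    have EE: "E * E' = 1" unfolding E_def E'_def by (rule e)
    have ss: "s * s * (s * s) = of_real (1 / t\<^sup>2)"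
    proof -
      have "s * s = of_real (1 / t)" using t by (simp add: s_def flip: of_real_mult)
      then show ?thesis by (simp add: power2_eq_square flip: of_real_mult)
    qed
    have nn: "complex_of_real ((norm (free_profile t \<phi> x))\<^sup>2) = a * (s * s) * c"
      unfolding n power_mult_distrib power2_eq_square[of "1 / sqrt t"] of_real_mult a_def c_def s_def y_def ..
    have "cubic (free_profile t \<phi> x) * wave t f x = (a * (s * s) * c) * (scat_const * s * E * fourier \<phi> y) * (s * (E' * f y))"
      unfolding cubic_def nn unfolding free_profile_def wave_def E_def E'_def y_def s_def ..
    also have "\<dots> = (s * s * (s * s)) * (E * E') * ((a * scat_const) * ((c * fourier \<phi> y) * f y))" by (simp only: mult_ac)
    also have "\<dots> = of_real (1 / t\<^sup>2) * ((a * scat_const) * ((c * fourier \<phi> y) * f y))" unfolding EE ss by simp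
    finally show ?thesis unfolding cubic_def a_def c_def y_def by simp
  qed
  have "(LINT \<xi>|lborel. cubic (fourier \<phi> \<xi>) * f \<xi>) = \<bar>1 / (2 * t)\<bar> *\<^sub>R (LINT x|lborel. cubic (fourier \<phi> (0 + (1 / (2 * t)) * x)) * f (0 + (1 / (2 * t)) * x))"
    by (rule lborel_integral_real_affine) (use t in simp)
  then have I: "(LINT x|lborel. cubic (fourier \<phi> (0 + (1 / (2 * t)) * x)) * f (0 + (1 / (2 * t)) * x)) = of_real (2 * t) * (LINT \<xi>|lborel. cubic (fourier \<phi> \<xi>) * f \<xi>)"
    using t by (simp add: scaleR_conv_of_real)
  show ?thesis
    unfolding pw integral_mult_right_zero I leading_def using t by (simp add: power2_eq_square)
qed

text \<open>Replace \<open>v\<close> by the profile of the scattering state, which costs \<open>(|v|\<^sup>2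
  + |z|\<^sup>2) |v - z|\<close>. Convergence in \<open>L\<^sup>2\<close> alone would not make
  \<open>|v|\<^sup>2 |v - z|\<close> small compared with \<open>t\<^bsup>-1/2\<^esup>\<close>:
  this is where the decay of the \<open>L\<^sup>4\<close> norm enters, because it bounds
  \<open>|v|\<^sup>2\<close> in \<open>L\<^sup>2\<close> by a multiple of
  \<open>t\<^bsup>-1/2\<^esup>\<close>.\<close>

lemma leading_term:
  assumes f: "schwartz f"
  shows "((\<lambda>t. of_real t * (LINT x|lborel. (q t x * v t x) * wave t f x)) \<longlongrightarrow> leading f) at_top"
proof -
  obtain B where B: "0 \<le> B" "\<And>t x. 0 < t \<Longrightarrow> norm (wave t f x) \<le> B / sqrt t" using sup_wave[OF f] by blast
  define \<Phi> where "\<Phi> = (1 / sqrt (2 * pi)) * (LINT x|lborel. norm (\<phi> x))"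
  define c where "c = norm scat_const"
  define Z where "Z = c * \<Phi>"
  define I where "I = (LINT x|lborel. norm (f x))"
  define K1 where "K1 = 2 * (B * sqrt C4 + Z\<^sup>2 * (sqrt 2 * l2 f))"
  define K2 where "K2 = 2 * (c * B * M\<^sup>2 + Z\<^sup>2 * c * (2 * I))"
  have fs: "sqint f" by (rule schwartz_sqint[OF f])
  have lim0: "((\<lambda>t. K1 * \<delta> t + K2 * chirp_error \<phi> t) \<longlongrightarrow> 0) at_top"
    using tendsto_add[OF tendsto_mult_right_zero[OF \<delta>_lim, of K1] tendsto_mult_right_zero[OF chirp_error_tendsto[OF phi_int], of K2]] by simp
  have main: "norm (of_real t * (LINT x|lborel. (q t x * v t x) * wave t f x) - leading f) \<le> K1 * \<delta> t + K2 * chirp_error \<phi> t" if t: "T0 \<le> t" for t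
  proof -
    have t0: "0 < t" using t T0 by linarith
    note [measurable] = schwartz_measurable[OF schwartz_wave[OF f t0]] fourier_measurable[OF phi_int]
    have [measurable]: "free_profile t \<phi> \<in> borel_measurable borel" unfolding free_profile_def[abs_def] by measurable
    let ?z = "free_profile t \<phi>" and ?w = "wave t f" and ?U = "free_propagator t \<phi>"
    have Us: "sqint ?U" by (rule free_propagator_sqint[OF phi_int phi_sq t0])
    note [measurable] = sqint_measurable[OF Us]
    have ds: "sqint (\<lambda>x. v t x - ?U x)" by (rule sqint_diff[OF v_sq Us])
    have ws: "sqint ?w" by (rule wave_l2(1)[OF fs t0])
    have wi: "integrable lborel ?w" by (rule schwartz_integrable[OF schwartz_wave[OF f t0]])
    have v2s: "sqint (\<lambda>x. of_real ((norm (v t x))\<^sup>2))" and v2l: "l2 (\<lambda>x. of_real ((norm (v t x))\<^sup>2)) \<le> sqrt (C4 / t)"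
    proof -
      have e: "(norm (complex_of_real ((norm (v t x))\<^sup>2)))\<^sup>2 = (norm (u t x)) ^ 4" for x
        unfolding norm_of_real v_norm by simp
      show "sqint (\<lambda>x. of_real ((norm (v t x))\<^sup>2))" unfolding sqint_def e by (intro conjI u4_int_real) measurable
      show "l2 (\<lambda>x. of_real ((norm (v t x))\<^sup>2)) \<le> sqrt (C4 / t)" unfolding l2_def e by (intro real_sqrt_le_mono u4 t)
    qed
    define \<eta> where "\<eta> = c * chirp_error \<phi> t / sqrt t"
    have \<eta>: "norm (?U x - ?z x) \<le> \<eta>" for x unfolding \<eta>_def c_def by (rule free_propagator_asymptotics[OF phi_int t0])
    have \<eta>0: "0 \<le> \<eta>" using \<eta>[of 0] norm_ge_zero order_trans by blast
    have z: "(norm (?z x))\<^sup>2 \<le> Z\<^sup>2 / t" for x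
    proof -
      have "norm (?z x) = c * norm (fourier \<phi> (x / (2 * t))) / sqrt t"
        unfolding free_profile_def norm_mult fourier_exp_norm norm_of_real c_def using t0 by simp
      also have "\<dots> \<le> Z / sqrt t" unfolding Z_def \<Phi>_def c_def
        by (intro divide_right_mono mult_left_mono fourier_norm_le phi_int) (use t0 in auto)
      finally have "(norm (?z x))\<^sup>2 \<le> (Z / sqrt t)\<^sup>2" by (intro power_mono) auto
      then show ?thesis using t0 by (simp add: power_divide)
    qed
    \<comment> \<open>first factor \<open>v\<close> or the profile, second factor the error in \<open>L\<^sup>2\<close> (from scattering) or in the supremum norm (from the chirp)\<close>
    let ?h1 = "\<lambda>x. (B / sqrt t) * (norm (complex_of_real ((norm (v t x))\<^sup>2)) * norm (v t x - ?U x))"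
    let ?h2 = "\<lambda>x. (Z\<^sup>2 / t) * (norm (v t x - ?U x) * norm (?w x))"
    let ?h3 = "\<lambda>x. (\<eta> * (B / sqrt t)) * (norm (v t x))\<^sup>2"
    let ?h4 = "\<lambda>x. ((Z\<^sup>2 / t) * \<eta>) * norm (?w x)"
    have ih: "integrable lborel ?h1" "integrable lborel ?h2" "integrable lborel ?h3" "integrable lborel ?h4"
    proof -
      show "integrable lborel ?h1" "integrable lborel ?h2"
        unfolding norm_mult[symmetric] by (intro integrable_mult_right integrable_norm sqint_prod_integrable v2s ds ws)+
      show "integrable lborel ?h3" by (intro integrable_mult_right sqint_integrable v_sq)
      show "integrable lborel ?h4" by (intro integrable_mult_right integrable_norm wi)
    qed
    have iz: "integrable lborel (\<lambda>x. cubic (?z x) * ?w x)"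
    proof -
      have "norm (cubic (?z x)) \<le> (Z\<^sup>2 / t) * (1 + Z\<^sup>2 / t)" for x
      proof -
        have "norm (?z x) \<le> 1 + (norm (?z x))\<^sup>2"
        proof -
          have "2 * norm (?z x) \<le> (norm (?z x))\<^sup>2 + 1" using sum_squares_bound[of "norm (?z x)" 1] by simp
          then show ?thesis using norm_ge_zero[of "?z x"] by linarith
        qed
        then have "norm (?z x) \<le> 1 + Z\<^sup>2 / t" using z[of x] by linarith
        then show ?thesis unfolding cubic_def norm_mult norm_of_real abs_power2 using t0 by (intro mult_mono z) auto
      qed
      moreover have "(\<lambda>x. cubic (?z x)) \<in> borel_measurable borel" unfolding cubic_def by measurable
      ultimately have "integrable lborel (\<lambda>x. ?w x * cubic (?z x))" by (intro bounded_mult_integrable[OF wi])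
      then show ?thesis by (simp only: mult.commute)
    qed
    have iv: "integrable lborel (\<lambda>x. cubic (v t x) * ?w x)"
      unfolding qv_cubic[symmetric] by (intro sqint_prod_integrable sqint_bounded_mult(1)[OF v_sq _ q_bound] ws) measurable
    have "norm (LINT x|lborel. cubic (v t x) * ?w x - cubic (?z x) * ?w x) \<le> (LINT x|lborel. 2 * ((?h1 x + ?h2 x) + (?h3 x + ?h4 x)))"
    proof (rule dominated_integral(2))
      show "integrable lborel (\<lambda>x. 2 * ((?h1 x + ?h2 x) + (?h3 x + ?h4 x)))"
        by (intro integrable_mult_right Bochner_Integration.integrable_add ih)
      show "(\<lambda>x. cubic (v t x) * ?w x - cubic (?z x) * ?w x) \<in> borel_measurable borel"
        using borel_measurable_integrable[OF Bochner_Integration.integrable_diff[OF iv iz]] by simp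
      fix x
      let ?V = "(norm (v t x))\<^sup>2" and ?Y = "(norm (?z x))\<^sup>2" and ?d = "norm (v t x - ?U x)" and ?W = "norm (?w x)"
      have wB: "?W \<le> B / sqrt t" by (rule B(2)[OF t0])
      have "norm (v t x - ?z x) \<le> ?d + \<eta>"
        using norm_triangle_ineq[of "v t x - ?U x" "?U x - ?z x"] \<eta>[of x] by simp
      have "norm (cubic (v t x) * ?w x - cubic (?z x) * ?w x) = norm (cubic (v t x) - cubic (?z x)) * ?W"
        by (simp only: left_diff_distrib[symmetric] norm_mult)
      also have "\<dots> \<le> (2 * (?V + ?Y) * norm (v t x - ?z x)) * ?W"
        unfolding cubic_def by (intro mult_right_mono cubic_difference) simp
      also have "\<dots> \<le> (2 * (?V + ?Y) * (?d + \<eta>)) * ?W"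
        by (intro mult_right_mono mult_left_mono \<open>norm (v t x - ?z x) \<le> ?d + \<eta>\<close>) auto
      also have "\<dots> = 2 * ((?V * ?d * ?W + ?Y * (?d * ?W)) + (?V * \<eta> * ?W + ?Y * \<eta> * ?W))" by (simp add: algebra_simps)
      also have "\<dots> \<le> 2 * ((?V * ?d * (B / sqrt t) + (Z\<^sup>2 / t) * (?d * ?W)) + (?V * \<eta> * (B / sqrt t) + (Z\<^sup>2 / t) * \<eta> * ?W))"
        using \<eta>0 by (intro mult_left_mono add_mono mult_right_mono wB z) auto
      also have "\<dots> = 2 * ((?h1 x + ?h2 x) + (?h3 x + ?h4 x))" unfolding norm_of_real abs_power2 by (simp add: mult_ac)
      finally show "norm (cubic (v t x) * ?w x - cubic (?z x) * ?w x) \<le> 2 * ((?h1 x + ?h2 x) + (?h3 x + ?h4 x))" .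
    qed
    also have "\<dots> = 2 * (((LINT x|lborel. ?h1 x) + (LINT x|lborel. ?h2 x)) + ((LINT x|lborel. ?h3 x) + (LINT x|lborel. ?h4 x)))"
      unfolding integral_mult_right_zero[of _ "2::real"]
        Bochner_Integration.integral_add[OF Bochner_Integration.integrable_add[OF ih(1,2)] Bochner_Integration.integrable_add[OF ih(3,4)]]
        Bochner_Integration.integral_add[OF ih(1,2)] Bochner_Integration.integral_add[OF ih(3,4)] ..
    also have "\<dots> \<le> 2 * (((B / sqrt t) * (sqrt (C4 / t) * \<delta> t) + (Z\<^sup>2 / t) * (\<delta> t * (sqrt 2 * l2 f))) + ((\<eta> * (B / sqrt t)) * M\<^sup>2 + ((Z\<^sup>2 / t) * \<eta>) * (2 * sqrt t * I)))"
    proof (intro mult_left_mono add_mono)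
      have "(LINT x|lborel. norm (complex_of_real ((norm (v t x))\<^sup>2)) * norm (v t x - ?U x)) \<le> l2 (\<lambda>x. of_real ((norm (v t x))\<^sup>2)) * \<delta> t"
        unfolding \<delta>_def by (rule l2_CS_norm[OF v2s ds])
      also have "\<dots> \<le> sqrt (C4 / t) * \<delta> t" by (intro mult_right_mono v2l) (simp add: \<delta>_def)
      finally show "(LINT x|lborel. ?h1 x) \<le> (B / sqrt t) * (sqrt (C4 / t) * \<delta> t)"
        unfolding integral_mult_right_zero using B(1) t0 by (intro mult_left_mono) auto
      have "(LINT x|lborel. norm (v t x - ?U x) * norm (?w x)) \<le> \<delta> t * (sqrt 2 * l2 f)"
        using l2_CS_norm[OF ds ws] unfolding \<delta>_def wave_l2(2)[OF fs t0] .
      then show "(LINT x|lborel. ?h2 x) \<le> (Z\<^sup>2 / t) * (\<delta> t * (sqrt 2 * l2 f))"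
        unfolding integral_mult_right_zero using t0 by (intro mult_left_mono) auto
      have "(LINT x|lborel. (norm (v t x))\<^sup>2) \<le> M\<^sup>2" unfolding l2_power2[symmetric] by (intro power_mono v_l2_le) simp
      then show "(LINT x|lborel. ?h3 x) \<le> (\<eta> * (B / sqrt t)) * M\<^sup>2"
        unfolding integral_mult_right_zero using B(1) t0 \<eta>0 by (intro mult_left_mono) auto
      have "(LINT x|lborel. norm (?w x)) = 2 * sqrt t * I"
      proof -
        have "I = \<bar>1 / (2 * t)\<bar> *\<^sub>R (LINT x|lborel. norm (f (0 + (1 / (2 * t)) * x)))"
          unfolding I_def by (rule lborel_integral_real_affine) (use t0 in simp)
        then have "(LINT x|lborel. norm (f (x / (2 * t)))) = 2 * t * I" using t0 by simp
        then have "(LINT x|lborel. norm (f (x / (2 * t))) / sqrt t) = 2 * t * I / sqrt t" by simp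
        also have "\<dots> = 2 * sqrt t * I" using t0 by (simp add: field_simps)
        finally show ?thesis unfolding wave_norm[OF t0] .
      qed
      then show "(LINT x|lborel. ?h4 x) \<le> ((Z\<^sup>2 / t) * \<eta>) * (2 * sqrt t * I)"
        unfolding integral_mult_right_zero by simp
    qed simp
    finally have bound: "norm ((LINT x|lborel. cubic (v t x) * ?w x) - (LINT x|lborel. cubic (?z x) * ?w x)) \<le> \<dots>"
      unfolding Bochner_Integration.integral_diff[OF iv iz] .
    have "of_real t * (LINT x|lborel. (q t x * v t x) * ?w x) - leading f = of_real t * ((LINT x|lborel. cubic (v t x) * ?w x) - (LINT x|lborel. cubic (?z x) * ?w x))"
      unfolding qv_cubic profile_cubic_integral[OF t0, of f, symmetric] by (simp only: right_diff_distrib)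
    then have "norm (of_real t * (LINT x|lborel. (q t x * v t x) * ?w x) - leading f) = t * norm ((LINT x|lborel. cubic (v t x) * ?w x) - (LINT x|lborel. cubic (?z x) * ?w x))"
      using t0 by (simp add: norm_mult)
    also have "\<dots> \<le> t * (2 * (((B / sqrt t) * (sqrt (C4 / t) * \<delta> t) + (Z\<^sup>2 / t) * (\<delta> t * (sqrt 2 * l2 f))) + ((\<eta> * (B / sqrt t)) * M\<^sup>2 + ((Z\<^sup>2 / t) * \<eta>) * (2 * sqrt t * I))))"
      by (intro mult_left_mono bound) (use t0 in simp)
    also have "\<dots> = K1 * \<delta> t + K2 * chirp_error \<phi> t"
    proof -
      define s where "s = sqrt t"
      have s: "t = s * s" "0 < s" using t0 by (simp_all add: s_def)
      have "sqrt (C4 / t) = sqrt C4 / s" by (simp add: s_def real_sqrt_divide)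
      then show ?thesis unfolding K1_def K2_def \<eta>_def s_def[symmetric] s(1) using s(2) by (simp add: field_simps)
    qed
    finally show ?thesis .
  qed
  have "((\<lambda>t. of_real t * (LINT x|lborel. (q t x * v t x) * wave t f x) - leading f) \<longlongrightarrow> 0) at_top"
    by (rule Lim_null_comparison[OF eventually_mono[OF eventually_ge_at_top[of T0] main] lim0])
  then show ?thesis by (simp only: LIM_zero_iff)
qed

text \<open>To leading order the derivative of \<open>wave t g\<close> multiplies the amplitude by \<open>-i\<xi>\<close>.  The
  pairing of \<open>v\<close> with \<open>wave t g\<close> stays bounded, while its derivative is asymptotic to the
  leading coefficient divided by \<open>t\<close>.\<close>

lemma leading_vanishes:
  assumes g: "schwartz g"
  shows "leading (\<lambda>\<xi>. - \<i> * (of_real \<xi> ^ 1 * g \<xi>)) = 0"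
proof -
  let ?f = "\<lambda>\<xi>. - \<i> * (of_real \<xi> ^ 1 * g \<xi>)"
  have f: "schwartz ?f" by (intro schwartz_cmult schwartz_times_x g)
  define F' where "F' t = (LINT x|lborel. v t x * (of_real (1 / (4 * t\<^sup>2)) * (\<i> * wave t (vderiv (vderiv g)) x)))
    + ((LINT x|lborel. (q t x * v t x) * vderiv (wave t g) x)
    + (LINT x|lborel. v t x * (\<i> * of_real (b * norm (u t x) powr p) * wave t g x)))" for t
  have lim: "((\<lambda>t. of_real t * F' t) \<longlongrightarrow> leading ?f) at_top"
  proof -
    have "((\<lambda>t. of_real t * (LINT x|lborel. v t x * (of_real (1 / (4 * t\<^sup>2)) * (\<i> * wave t (vderiv (vderiv g)) x)))
      + ((of_real t * (LINT x|lborel. (q t x * v t x) * wave t ?f x) + of_real t * (LINT x|lborel. (q t x * v t x) * (of_real (1 / (2 * t)) * wave t (vderiv g) x)))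
      + of_real t * (LINT x|lborel. v t x * (\<i> * of_real (b * norm (u t x) powr p) * wave t g x)))) \<longlongrightarrow> 0 + ((leading ?f + 0) + 0)) at_top"
      by (intro tendsto_add remainder_free[OF g] leading_term[OF f] remainder_derivative[OF schwartz_vderiv[OF g]] remainder_power[OF g])
    moreover have "\<forall>\<^sub>F t in at_top. of_real t * (LINT x|lborel. v t x * (of_real (1 / (4 * t\<^sup>2)) * (\<i> * wave t (vderiv (vderiv g)) x)))
      + ((of_real t * (LINT x|lborel. (q t x * v t x) * wave t ?f x) + of_real t * (LINT x|lborel. (q t x * v t x) * (of_real (1 / (2 * t)) * wave t (vderiv g) x)))
      + of_real t * (LINT x|lborel. v t x * (\<i> * of_real (b * norm (u t x) powr p) * wave t g x))) = of_real t * F' t"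
      using eventually_gt_at_top[of 0]
    proof eventually_elim
      case (elim t)
      have qv: "sqint (\<lambda>x. q t x * v t x)" by (rule sqint_bounded_mult(1)[OF v_sq _ q_bound]) measurable
      have i: "integrable lborel (\<lambda>x. (q t x * v t x) * wave t ?f x)" "integrable lborel (\<lambda>x. (q t x * v t x) * (of_real (1 / (2 * t)) * wave t (vderiv g) x))"
        by (intro sqint_prod_integrable qv sqint_cmult schwartz_sqint schwartz_wave f schwartz_vderiv g elim)+
      have "vderiv (wave t g) x = wave t ?f x + of_real (1 / (2 * t)) * wave t (vderiv g) x" for x
        unfolding wave_derivative[OF g elim] wave_def by (simp only: distrib_left mult_ac)
      then have "(LINT x|lborel. (q t x * v t x) * vderiv (wave t g) x) = (LINT x|lborel. (q t x * v t x) * wave t ?f x + (q t x * v t x) * (of_real (1 / (2 * t)) * wave t (vderiv g) x))"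
        by (simp only: distrib_left)
      also have "\<dots> = (LINT x|lborel. (q t x * v t x) * wave t ?f x) + (LINT x|lborel. (q t x * v t x) * (of_real (1 / (2 * t)) * wave t (vderiv g) x))"
        by (rule Bochner_Integration.integral_add[OF i])
      finally show ?case unfolding F'_def by (simp only: distrib_left)
    qed
    ultimately show ?thesis by (simp only: tendsto_cong add_0 add_0_right)
  qed
  show ?thesis
  proof (rule no_logarithmic_growth[OF _ _ _ lim])
    show "((\<lambda>s. LINT x|lborel. v s x * wave s g x) has_vector_derivative F' t) (at t)" if "1 \<le> t" for t
      unfolding F'_def by (rule tested_wave_derivative[OF g]) (use that in linarith)
    show "norm (LINT x|lborel. v t x * wave t g x) \<le> M * (sqrt 2 * l2 g)" if "1 \<le> t" for t
    proof -
      have t: "0 < t" using that by linarith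
      have "norm (LINT x|lborel. v t x * wave t g x) \<le> l2 (v t) * l2 (wave t g)"
        by (rule l2_CS[OF v_sq wave_l2(1)[OF schwartz_sqint[OF g] t]])
      also have "\<dots> \<le> M * (sqrt 2 * l2 g)" unfolding wave_l2(2)[OF schwartz_sqint[OF g] t] by (intro mult_right_mono v_l2_le) simp
      finally show ?thesis .
    qed
  qed simp
qed

text \<open>The leading coefficient is the integral of \<open>\<xi> |F|\<^sup>2 F\<close> against an
  arbitrary Schwartz function, where \<open>F\<close> is the transform of \<open>\<phi>\<close>;
  so \<open>F\<close> vanishes away from the origin.\<close>

lemma scattering_state_zero: "AE x in lborel. \<phi> x = 0"
proof (rule fourier_injective[OF phi_int])
  note [measurable] = fourier_measurable[OF phi_int]
  let ?h = "\<lambda>\<xi>. cubic (fourier \<phi> \<xi>) * of_real \<xi>"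
  have hm: "(\<lambda>\<xi>. cubic (fourier \<phi> \<xi>)) \<in> borel_measurable borel" unfolding cubic_def by measurable
  define \<Phi> where "\<Phi> = (1 / sqrt (2 * pi)) * (LINT x|lborel. norm (\<phi> x))"
  have \<Phi>: "norm (fourier \<phi> \<xi>) \<le> \<Phi>" for \<xi> unfolding \<Phi>_def by (rule fourier_norm_le[OF phi_int])
  have cb: "norm (cubic (fourier \<phi> \<xi>)) \<le> \<Phi>\<^sup>2 * \<Phi>" for \<xi>
    unfolding cubic_def norm_mult norm_of_real abs_power2 by (intro mult_mono power_mono \<Phi>) auto
  have "AE \<xi> in lborel. ?h \<xi> = 0"
  proof (rule AE_zero_by_duality)
    show "?h \<in> borel_measurable borel" using hm by measurable
    fix g assume g: "schwartz g"
    have xg: "schwartz (\<lambda>\<xi>. of_real \<xi> ^ 1 * g \<xi>)" by (rule schwartz_times_x[OF g])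
    have "integrable lborel (\<lambda>\<xi>. (of_real \<xi> ^ 1 * g \<xi>) * cubic (fourier \<phi> \<xi>))"
      by (rule bounded_mult_integrable[OF schwartz_integrable[OF xg] hm cb])
    then show "integrable lborel (\<lambda>\<xi>. ?h \<xi> * g \<xi>)" by (simp only: power_one_right mult_ac)
    have "(LINT \<xi>|lborel. cubic (fourier \<phi> \<xi>) * (- \<i> * (of_real \<xi> ^ 1 * g \<xi>))) = - \<i> * (LINT \<xi>|lborel. ?h \<xi> * g \<xi>)"
      unfolding integral_mult_right_zero[symmetric] by (intro Bochner_Integration.integral_cong refl) (simp add: mult_ac)
    moreover have "cubic scat_const \<noteq> 0" using scat_const_nonzero by (simp add: cubic_def)
    ultimately show "(LINT \<xi>|lborel. ?h \<xi> * g \<xi>) = 0" using leading_vanishes[OF g] unfolding leading_def by simp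
  qed
  then show "AE \<xi> in lborel. fourier \<phi> \<xi> = 0"
    using AE_lborel_singleton[of 0] by eventually_elim (simp add: cubic_def)
qed

text \<open>With a vanishing scattering state the mass tends to zero, but it is constant.\<close>

theorem flow_vanishes: "l2 (u t) = 0"
proof -
  have "free_propagator s \<phi> x = 0" for s x
  proof -
    have "(LINT y|lborel. exp (\<i> * complex_of_real ((x - y)\<^sup>2 / (4 * s))) * \<phi> y) = (LINT y|(lborel::real measure). (0::complex))"
      using borel_measurable_integrable[OF phi_int] scattering_state_zero
      by (intro integral_cong_AE) (auto elim: eventually_mono)
    then show ?thesis by (simp add: free_propagator_def)
  qed
  then have "\<delta> = (\<lambda>s. l2 (u t))"
    unfolding \<delta>_def using v_l2 mass_conserved[of _ t] by (intro ext) simp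
  then have "((\<lambda>s::real. l2 (u t)) \<longlongrightarrow> 0) at_top" using \<delta>_lim by simp
  then show ?thesis using tendsto_unique[OF _ tendsto_const] trivial_limit_at_top_linorder by blast
qed

end

lemma fourth_moment_of_Lq_norm:
  assumes "Lq_norm 4 f \<le> c * \<bar>t\<bar> powr (- 1 / 4)" "0 < t" "0 \<le> c"
  shows "(LINT x|lborel. (norm (f x)) ^ 4) \<le> c ^ 4 / t"
proof -
  let ?X = "LINT x|lborel. (norm (f x)) ^ 4"
  have X0: "0 \<le> ?X" by (rule Bochner_Integration.integral_nonneg) simp
  have "Lq_norm 4 f = ?X powr (1 / 4)" by (simp add: Lq_norm_def)
  then have "?X powr (1 / 4) \<le> c * t powr (- 1 / 4)" using assms by simp
  then have "(?X powr (1 / 4)) ^ 4 \<le> (c * t powr (- 1 / 4)) ^ 4" by (intro power_mono) auto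
  moreover have "(?X powr (1 / 4)) ^ 4 = ?X"
  proof (cases "?X = 0")
    case False
    then have "0 < ?X powr (1 / 4)" by simp
    then have "(?X powr (1 / 4)) ^ 4 = (?X powr (1 / 4)) powr real 4" by (rule powr_realpow[symmetric])
    also have "\<dots> = ?X" using X0 False by (simp add: powr_powr)
    finally show ?thesis .
  qed simp
  moreover have "(c * t powr (- 1 / 4)) ^ 4 = c ^ 4 / t"
  proof -
    have "(t powr (- 1 / 4)) ^ 4 = (t powr (- 1 / 4)) powr real 4" using assms(2) by (intro powr_realpow[symmetric]) simp
    also have "\<dots> = t powr - 1" unfolding powr_powr by simp
    also have "\<dots> = 1 / t" using assms(2) by (rule powr_neg_one)
    finally show ?thesis by (simp add: power_mult_distrib)
  qed
  ultimately show ?thesis by simp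
qed

theorem theorem1p7:
  fixes p b :: real
    and u :: "real \<Rightarrow> real \<Rightarrow> complex"
    and C :: "real \<Rightarrow> real"
    and \<phi>p :: "real \<Rightarrow> complex"
  assumes p: "p \<ge> 4"
    and b: "b \<ge> 0"
    and sol: "gdnls_solution p b u"
    and A1: "continuous_into_H 1 0 u"
    and A2_bound: "\<And>t. Hf_norm 1 0 (u t) \<le> C (Hf_norm 1 0 (u 0))"
    and A2_decay: "(\<lambda>t. Lq_norm 4 (u t)) \<in> O[at_top](\<lambda>t. \<bar>t\<bar> powr (- 1 / 4))"
    and phi: "\<phi>p \<in> H_fun 4 0 \<inter> H_fun 0 4"
    and A3: "((\<lambda>t. Lq_norm 2 (\<lambda>x. gauge_transform u t x - free_propagator t \<phi>p x)) \<longlongrightarrow> 0) at_top"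
  shows "\<forall>t. AE x in lborel. u t x = 0"
proof -
  obtain ux :: "real \<Rightarrow> real \<Rightarrow> complex" where S: "\<forall>t. (let N = (\<lambda>x. \<i> * complex_of_real ((norm (u t x))\<^sup>2) * ux t x
                      + complex_of_real (b * norm (u t x) powr p) * u t x)
         in tempered_fun (u t) \<and> tempered_fun (ux t) \<and> tempered_fun N \<and>
            distr_eq (distr_deriv (distr_of (u t))) (distr_of (ux t)) \<and>
            (\<forall>\<phi>. schwartz \<phi> \<longrightarrow>
               (\<lambda>s. distr_of (u s) \<phi>) differentiable (at t) \<and>
               \<i> * vector_derivative (\<lambda>s. distr_of (u s) \<phi>) (at t)
                 + distr_deriv (distr_deriv (distr_of (u t))) \<phi>
                 + distr_of N \<phi> = 0))"
    using sol unfolding gdnls_solution_def by blast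
  have tu: "tempered_fun (u t)" "tempered_fun (ux t)" for t using S by (simp_all add: Let_def)
  have um [measurable]: "u t \<in> borel_measurable borel" "ux t \<in> borel_measurable borel" for t
    using tu[of t] by (simp_all add: tempered_fun_def)
  have ui: "integrable lborel (\<lambda>x. u t x * \<psi> x)" "integrable lborel (\<lambda>x. ux t x * \<psi> x)" if "schwartz \<psi>" for t \<psi>
    using tu[of t] that by (simp_all add: tempered_fun_def)
  have weak: "(LINT x|lborel. ux t x * \<psi> x) = - (LINT x|lborel. u t x * vderiv \<psi> x)" if "schwartz \<psi>" for t \<psi>
  proof -
    have "distr_eq (distr_deriv (distr_of (u t))) (distr_of (ux t))" using S by (simp add: Let_def)
    then show ?thesis using that by (simp add: distr_eq_def distr_deriv_def distr_of_def)
  qed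
  \<comment> \<open>the norm of \<open>H\<^sup>1\<close> controls \<open>u\<close> and \<open>ux\<close>, and likewise their increments\<close>
  have "\<exists>g. H1_rep (u t) g" for t
    using A1 unfolding continuous_into_H_def H_fun_def H_space_def H1_rep_def by blast
  then obtain g0 where g0: "\<And>t. H1_rep (u t) (g0 t)" by metis
  have bound: "sqint (u t) \<and> sqint (ux t) \<and> l2 (u t) \<le> Hf_norm 1 0 (u t) \<and> l2 (ux t) \<le> Hf_norm 1 0 (u t)" for t
  proof -
    obtain g where g: "H1_rep (u t) g" "Hf_norm 1 0 (u t) = l2 g" by (rule Hf_norm_1_0[OF g0])
    from H1_rep_bounds(1,2)[OF g(1) um(1) ui(1)] H1_rep_bounds(3)[OF g(1) um(1) ui(1) um(2)[of t] ui(2) weak] g(2)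
    show ?thesis by simp
  qed
  then have su: "sqint (u t)" "sqint (ux t)" for t by auto
  have dbound: "l2 (\<lambda>x. u s x - u t x) \<le> Hf_norm 1 0 (\<lambda>x. u s x - u t x) \<and> l2 (\<lambda>x. ux s x - ux t x) \<le> Hf_norm 1 0 (\<lambda>x. u s x - u t x)" for s t
  proof -
    have r: "H1_rep (\<lambda>x. u s x - u t x) (\<lambda>x. g0 s x - g0 t x)" by (rule H1_rep_diff[OF g0 g0 ui(1) ui(1)])
    obtain g where g: "H1_rep (\<lambda>x. u s x - u t x) g" "Hf_norm 1 0 (\<lambda>x. u s x - u t x) = l2 g" by (rule Hf_norm_1_0[OF r])
    have di: "integrable lborel (\<lambda>x. (u s x - u t x) * \<psi> x)" "integrable lborel (\<lambda>x. (ux s x - ux t x) * \<psi> x)" if "schwartz \<psi>" for \<psi>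
      unfolding left_diff_distrib by (intro Bochner_Integration.integrable_diff ui that)+
    have dm: "(\<lambda>x. u s x - u t x) \<in> borel_measurable borel" "(\<lambda>x. ux s x - ux t x) \<in> borel_measurable borel" by measurable
    have dw: "(LINT x|lborel. (ux s x - ux t x) * \<psi> x) = - (LINT x|lborel. (u s x - u t x) * vderiv \<psi> x)" if "schwartz \<psi>" for \<psi>
      using weak[OF that] ui[OF that] ui[OF schwartz_vderiv[OF that]] by (simp add: left_diff_distrib)
    from H1_rep_bounds(2)[OF g(1) dm(1) di(1)] H1_rep_bounds(3)[OF g(1) dm(1) di(1) dm(2) di(2) dw] g(2)
    show ?thesis by simp
  qed
  have cont: "((\<lambda>k. Hf_norm 1 0 (\<lambda>x. u (t + k) x - u t x)) \<longlongrightarrow> 0) (at 0)" for t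
    using A1 unfolding continuous_into_H_def by (intro LIM_offset_zero) blast
  define M where "M = C (Hf_norm 1 0 (u 0))"
  have "\<exists>w. h1 w (ux t) \<and> (AE x in lborel. w x = u t x)" for t
  proof -
    have w: "(LINT x|lborel. u t x * vderiv \<psi> x) = - (LINT x|lborel. ux t x * \<psi> x)" if "schwartz \<psi>" for \<psi>
      using weak[OF that, of t] by simp
    show ?thesis by (rule weak_derivative_imp_h1[OF su(1)[of t] su(2)[of t] w]) blast+
  qed
  \<comment> \<open>from now on \<open>u t\<close> is replaced by its absolutely continuous representative \<open>U t\<close>\<close>
  then obtain U where U: "\<And>t. h1 (U t) (ux t)" and Ueq: "\<And>t. AE x in lborel. U t x = u t x" by metis
  have Us: "sqint (U t)" for t using U[of t] by (simp add: h1_def)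
  note [measurable] = sqint_measurable[OF Us]
  have l2U: "l2 (U t) = l2 (u t)" for t by (rule l2_cong_AE[OF _ _ Ueq]) measurable
  have l2dU: "l2 (\<lambda>x. U s x - U t x) = l2 (\<lambda>x. u s x - u t x)" for s t
  proof (rule l2_cong_AE)
    show "AE x in lborel. U s x - U t x = u s x - u t x" using Ueq[of s] Ueq[of t] by eventually_elim simp
  qed measurable
  have pair: "(LINT x|lborel. U t x * \<psi> x) = distr_of (u t) \<psi>" if "schwartz \<psi>" for t \<psi>
    unfolding distr_of_def
  proof (rule integral_cong_AE)
    show "AE x in lborel. U t x * \<psi> x = u t x * \<psi> x" using Ueq[of t] by eventually_elim simp
  qed (use schwartz_measurable[OF that] in measurable)
  interpret flow U ux p b M
  proof
    show "4 \<le> p" by (rule p)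
    show "h1 (U t) (ux t)" for t by (rule U)
    show "l2 (U t) \<le> M" "l2 (ux t) \<le> M" for t
      using bound[of t] A2_bound[of t] unfolding l2U M_def by linarith+
    show "((\<lambda>k. l2 (\<lambda>x. U (t + k) x - U t x)) \<longlongrightarrow> 0) (at 0)" for t
      unfolding l2dU using dbound by (intro Lim_null_comparison[OF always_eventually[OF allI] cont[of t]]) simp
    show "((\<lambda>k. l2 (\<lambda>x. ux (t + k) x - ux t x)) \<longlongrightarrow> 0) (at 0)" for t
      using dbound by (intro Lim_null_comparison[OF always_eventually[OF allI] cont[of t]]) simp
    fix t \<psi> assume \<psi>: "schwartz \<psi>"
    define N where "N = (\<lambda>x. \<i> * complex_of_real ((norm (u t x))\<^sup>2) * ux t x + complex_of_real (b * norm (u t x) powr p) * u t x)"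
    let ?D = "vector_derivative (\<lambda>s. distr_of (u s) \<psi>) (at t)"
    have "(\<lambda>s. distr_of (u s) \<psi>) differentiable (at t)" and
      e: "\<i> * ?D + distr_deriv (distr_deriv (distr_of (u t))) \<psi> + distr_of N \<psi> = 0"
      using S \<psi> unfolding Let_def N_def by blast+
    then have d: "((\<lambda>s. distr_of (u s) \<psi>) has_vector_derivative ?D) (at t)" by (simp add: vector_derivative_works)
    have N: "distr_of N \<psi> = (LINT x|lborel. nlin p b (U t) (ux t) x * \<psi> x)"
      unfolding distr_of_def
    proof (rule integral_cong_AE)
      show "AE x in lborel. N x * \<psi> x = nlin p b (U t) (ux t) x * \<psi> x"
        using Ueq[of t] by eventually_elim (simp add: N_def nlin_def)
      show "(\<lambda>x. N x * \<psi> x) \<in> borel_measurable lborel" "(\<lambda>x. nlin p b (U t) (ux t) x * \<psi> x) \<in> borel_measurable lborel"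
        unfolding N_def nlin_def using schwartz_measurable[OF \<psi>] by measurable
    qed
    \<comment> \<open>one of the two derivatives of the dispersive term is moved back onto \<open>u\<close>\<close>
    have uxx: "distr_deriv (distr_deriv (distr_of (u t))) \<psi> = - (LINT x|lborel. ux t x * vderiv \<psi> x)"
      using weak[OF schwartz_vderiv[OF \<psi>], of t] by (simp add: distr_deriv_def distr_of_def)
    have "?D = - \<i> * (\<i> * ?D)" by simp
    also have "\<i> * ?D = (LINT x|lborel. ux t x * vderiv \<psi> x) - (LINT x|lborel. nlin p b (U t) (ux t) x * \<psi> x)"
      using e unfolding uxx N by (simp add: algebra_simps add_eq_0_iff)
    finally have "?D = - \<i> * (LINT x|lborel. ux t x * vderiv \<psi> x) + \<i> * (LINT x|lborel. nlin p b (U t) (ux t) x * \<psi> x)"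
      by (simp add: algebra_simps)
    then show "((\<lambda>s. LINT x|lborel. U s x * \<psi> x) has_vector_derivative
      - \<i> * (LINT x|lborel. ux t x * vderiv \<psi> x) + \<i> * (LINT x|lborel. nlin p b (U t) (ux t) x * \<psi> x)) (at t)"
      using d unfolding pair[OF \<psi>] by simp
  qed
  have gauge: "AE x in lborel. gauge_transform u t x = G t x * U t x" for t
    using Ueq[of t]
  proof eventually_elim
    case (elim x)
    have "(LINT y:{..x}|lborel. (norm (u t y))\<^sup>2) = mass_below t x"
      unfolding set_lebesgue_integral_def mass_below_def
    proof (rule integral_cong_AE)
      show "AE y in lborel. indicator {..x} y *\<^sub>R (norm (u t y))\<^sup>2 = indicator {..x} y *\<^sub>R (norm (U t y))\<^sup>2"
        using Ueq[of t] by eventually_elim simp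
    qed measurable
    then show ?case using elim by (simp add: gauge_transform_def G_def)
  qed
  have phi_L: "integrable lborel \<phi>p" "sqint \<phi>p" using phi by (auto intro: H_0_4_integrable)
  have scat: "((\<lambda>t. l2 (\<lambda>x. G t x * U t x - free_propagator t \<phi>p x)) \<longlongrightarrow> 0) at_top"
  proof (rule Lim_transform_eventually[OF A3])
    show "\<forall>\<^sub>F t in at_top. Lq_norm 2 (\<lambda>x. gauge_transform u t x - free_propagator t \<phi>p x) = l2 (\<lambda>x. G t x * U t x - free_propagator t \<phi>p x)"
      using eventually_gt_at_top[of 0]
    proof eventually_elim
      case (elim t)
      note [measurable] = sqint_measurable[OF free_propagator_sqint[OF phi_L elim]]
      have m: "(\<lambda>x. G t x * U t x - free_propagator t \<phi>p x) \<in> borel_measurable borel" by measurable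
      have gm: "gauge_transform u t \<in> borel_measurable borel"
      proof -
        have "complex_of_real (LINT y:{..x}|lborel. (norm (u t y))\<^sup>2) = of_real (mass_below t x)" for x
          unfolding set_lebesgue_integral_def mass_below_def
          by (rule arg_cong[where f=of_real], rule integral_cong_AE) (use Ueq[of t] in \<open>auto elim: eventually_mono\<close>)
        then have "gauge_transform u t = (\<lambda>x. G t x * u t x)" by (simp add: gauge_transform_def[abs_def] G_def)
        then show ?thesis by simp
      qed
      show ?case unfolding Lq_norm_2
      proof (rule l2_cong_AE[OF _ m])
        show "AE x in lborel. gauge_transform u t x - free_propagator t \<phi>p x = G t x * U t x - free_propagator t \<phi>p x"
          using gauge[of t] by eventually_elim simp
      qed (use gm in measurable)
    qed
  qed
  obtain c where c: "0 < c" "\<forall>\<^sub>F t in at_top. norm (Lq_norm 4 (u t)) \<le> c * norm (\<bar>t\<bar> powr (- 1 / 4))"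
    by (rule landau_o.bigE[OF A2_decay])
  then obtain T where T: "\<And>t. T \<le> t \<Longrightarrow> Lq_norm 4 (u t) \<le> c * \<bar>t\<bar> powr (- 1 / 4)"
    by (auto simp: eventually_at_top_linorder abs_le_iff)
  interpret scattering U ux p b M \<phi>p "c ^ 4" "max T 1"
  proof
    show "(LINT x|lborel. (norm (U t x)) ^ 4) \<le> c ^ 4 / t" if t: "max T 1 \<le> t" for t
    proof -
      have "(LINT x|lborel. (norm (U t x)) ^ 4) = (LINT x|lborel. (norm (u t x)) ^ 4)"
      proof (rule integral_cong_AE)
        show "AE x in lborel. (norm (U t x)) ^ 4 = (norm (u t x)) ^ 4" using Ueq[of t] by eventually_elim simp
      qed measurable
      also have "\<dots> \<le> c ^ 4 / t"
        by (rule fourth_moment_of_Lq_norm[OF T]) (use t c(1) in auto)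
      finally show ?thesis .
    qed
  qed (use c(1) phi_L scat in auto)
  show ?thesis
  proof
    fix t
    have "AE x in lborel. U t x = 0" by (rule l2_eq_0_AE[OF Us flow_vanishes])
    then show "AE x in lborel. u t x = 0" using Ueq[of t] by eventually_elim simp
  qed
qed

end
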